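(* Let $X=\mathbb{C}^n$, $f=\prod_{i=1}^nx_i^{a_i}$ with $a_i\in\mathbb{Z}_{\ge0}$ not all zero, and $\alpha\in\mathbb{Q}$ with $\alpha>0$. Put $I:=\{i\in[n]:a_i\ne0\}$, $I_\alpha:=\{i\in I:\alpha a_i\in\mathbb{Z}\}$, $m_\alpha:=|I_\alpha|$. Then: (i) $W_{n+m_\alpha}\mathcal{M}(f^{-\alpha})=\mathcal{M}(f^{-\alpha})$. (ii) For every integer $l$ with $0\le l\le m_\alpha$, $$F^H_0W_{n+l}\mathcal{M}(f^{-\alpha})=\sum_{J\subseteq I_\alpha,\,|J|=l}\mathcal{O}_X\prod_{i\in I_\alpha\setminus J}x_i^{\lceil\alpha a_i\rceil}\prod_{i\in(I\setminus I_\alpha)\cup J}x_i^{\lceil\alpha a_i\rceil-1}f^{-\alpha},$$ and, for $k\in\mathbb{Z}_{\ge0}$, $F^H_kW_{n+l}\mathcal{M}(f^{-\alpha})=F_k\mathcal{D}_X\cdot F^H_0W_{n+l}\mathcal{M}(f^{-\alpha})$.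
   Context: Mixed Hodge module structure. Put $U:=X\setminus f^{-1}(0)$, $j:U\hookrightarrow X$. $\mathcal{M}(f^{-\alpha}):=\mathcal{O}_X( *f)f^{-\alpha}$, with $\mathcal{O}_X( *f)=\mathcal{O}_X[f^{-1}]$, is the left $\mathcal{D}_X$-module with action $\delta\cdot(uf^{-\alpha})=\delta(u)f^{-\alpha}-\alpha u\,\delta(f)f^{-\alpha-1}$ for vector fields $\delta$. The line bundle $\mathcal{O}_{\mathbb{C}^*}$ with connection $u\mapsto(\partial_tu-\alpha u/t)dt$ and trivial Hodge filtration (jumping only in degree $0$) is a polarisable variation of $\mathbb{C}$-Hodge structure of weight $0$; it defines a pure complex Hodge module of weight $1$ on $\mathbb{C}^*$, whose pullback along $f|_U$ is a pure complex Hodge module $\underline{\mathbb{C}}_{U,-\alpha f}[n]$ of weight $n$ on $U$, with underlying left $\mathcal{D}_U$-module $\mathcal{O}_Uf^{-\alpha}$ and $F_k=\mathcal{O}_Uf^{-\alpha}$ for $k\ge0$, $F_k=0$ for $k<0$. The complex mixed Hodge module $M(f^{-\alpha}):=j_*\underline{\mathbb{C}}_{U,-\alpha f}[n]$ has underlying $\mathcal{D}_X$-module $\mathcal{M}(f^{-\alpha})$, which thereby carries a Hodge filtration $F^H_\bullet$ (by $\mathcal{O}_X$-submodules) and a finite weight filtration $W_\bullet$ (by $\mathcal{D}_X$-submodules), with lowest nonzero step $W_n$. Each $W_{n+l}\mathcal{M}(f^{-\alpha})$ carries the induced filtration $F^H_\bullet$. $F_\bullet\mathcal{D}_X$ is the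 order filtration and $[n]=\{1,\dots,n\}$. *)

theory Defs
  imports "HOL-Analysis.Analysis" "HOL-Library.Function_Algebras"
begin

section \<open>Germs, stalks and sheaves on the complex manifold of n-tuples\<close>

text \<open>
  Throughout, X is the complex manifold \<^typ>\<open>complex ^ 'n\<close> with its sheaf of holomorphic functions,
  f is a holomorphic function on X that is not identically zero, D is its zero locus and
  U is the complement of D.
  A subsheaf of a sheaf A on X is the same as a family of subsets of the stalks of A that is
  open in the etale space of A; sheaves are encoded by such families S, where S p is the stalk at p.
  A germ at p is represented by a total function, of which only the values near p and off D matter
  (the identity principle makes this harmless); stalks are saturated for the
  relation \<open>germ_eq f p\<close>.
\<close>

definition holo_germ :: "complex ^ 'n::finite \<Rightarrow> (complex ^ 'n \<Rightarrow> complex) \<Rightarrow> bool" where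
  "holo_germ p h \<longleftrightarrow>
     (\<forall>\<^sub>F x in nhds p. \<exists>D. (h has_derivative D) (at x) \<and> (\<forall>c v. D (c *s v) = c * D v))"

definition partial :: "'n::finite \<Rightarrow> (complex ^ 'n \<Rightarrow> complex) \<Rightarrow> complex ^ 'n \<Rightarrow> complex" where
  "partial i u x = deriv (\<lambda>z. u (x + axis i z)) 0"

definition germ_eq ::
  "(complex ^ 'n::finite \<Rightarrow> complex) \<Rightarrow> complex ^ 'n \<Rightarrow> (complex ^ 'n \<Rightarrow> 'v) \<Rightarrow> (complex ^ 'n \<Rightarrow> 'v) \<Rightarrow> bool" where
  "germ_eq f p u v \<longleftrightarrow> (\<forall>\<^sub>F x in nhds p. f x \<noteq> 0 \<longrightarrow> u x = v x)"

definition zero_stalk ::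
  "(complex ^ 'n::finite \<Rightarrow> complex) \<Rightarrow> complex ^ 'n \<Rightarrow> (complex ^ 'n \<Rightarrow> 'v::zero) set" where
  "zero_stalk f p = {u. germ_eq f p u (\<lambda>_. 0)}"

text \<open>
  \<open>span_by E Ops G\<close>: all classes modulo E of finite sums of elements obtained from G by applying
  operators in Ops.  If Ops generates a ring of operators that contains the negatives,
  it is the submodule generated by G over that ring.
\<close>

inductive_set span_by ::
  "('a \<Rightarrow> 'a \<Rightarrow> bool) \<Rightarrow> ('a \<Rightarrow> 'a) set \<Rightarrow> 'a set \<Rightarrow> ('a::monoid_add) set"
  for E :: "'a \<Rightarrow> 'a \<Rightarrow> bool" and Ops :: "('a \<Rightarrow> 'a) set" and G :: "'a set" where
  zero: "0 \<in> span_by E Ops G"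
| base: "g \<in> G \<Longrightarrow> g \<in> span_by E Ops G"
| add: "u \<in> span_by E Ops G \<Longrightarrow> v \<in> span_by E Ops G \<Longrightarrow> u + v \<in> span_by E Ops G"
| act: "T \<in> Ops \<Longrightarrow> u \<in> span_by E Ops G \<Longrightarrow> T u \<in> span_by E Ops G"
| cong: "u \<in> span_by E Ops G \<Longrightarrow> E u v \<Longrightarrow> v \<in> span_by E Ops G"

text \<open>
  \<open>subsheaf_module f A Ops S\<close>: S is a subsheaf of A, stable under the sheaf of rings of operators
  whose stalk at p is generated by \<open>Ops p\<close>.
\<close>

definition subsheaf_module ::
  "(complex ^ 'n::finite \<Rightarrow> complex) \<Rightarrow> (complex ^ 'n \<Rightarrow> (complex ^ 'n \<Rightarrow> 'v::monoid_add) set) \<Rightarrow>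
   (complex ^ 'n \<Rightarrow> ((complex ^ 'n \<Rightarrow> 'v) \<Rightarrow> (complex ^ 'n \<Rightarrow> 'v)) set) \<Rightarrow>
   (complex ^ 'n \<Rightarrow> (complex ^ 'n \<Rightarrow> 'v) set) \<Rightarrow> bool" where
  "subsheaf_module f A Ops S \<longleftrightarrow>
     (\<forall>p. S p \<subseteq> A p \<and> span_by (germ_eq f p) (Ops p) (S p) \<subseteq> S p \<and>
          (\<forall>u\<in>S p. \<forall>\<^sub>F q in nhds p. u \<in> S q))"

definition locally_fin_gen ::
  "(complex ^ 'n::finite \<Rightarrow> complex) \<Rightarrow>
   (complex ^ 'n \<Rightarrow> ((complex ^ 'n \<Rightarrow> 'v::monoid_add) \<Rightarrow> (complex ^ 'n \<Rightarrow> 'v)) set) \<Rightarrow>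
   (complex ^ 'n \<Rightarrow> (complex ^ 'n \<Rightarrow> 'v) set) \<Rightarrow> bool" where
  "locally_fin_gen f Ops S \<longleftrightarrow>
     (\<forall>p. \<exists>G. finite G \<and> (\<forall>\<^sub>F q in nhds p. S q = span_by (germ_eq f q) (Ops q) G))"

section \<open>The D-module of meromorphic functions twisted by a power of f\<close>

text \<open>The section u f^(-alpha), with u meromorphic with poles along f, is represented by u.\<close>

definition mero_module ::
  "(complex ^ 'n::finite \<Rightarrow> complex) \<Rightarrow> complex ^ 'n \<Rightarrow> (complex ^ 'n \<Rightarrow> complex) set" where
  "mero_module f p = {u. \<exists>h N. holo_germ p h \<and> germ_eq f p u (\<lambda>x. h x / f x ^ N)}"

definition nabla ::
  "(complex ^ 'n::finite \<Rightarrow> complex) \<Rightarrow> rat \<Rightarrow> 'n \<Rightarrow> (complex ^ 'n \<Rightarrow> complex) \<Rightarrow> complex ^ 'n \<Rightarrow> complex" where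
  "nabla f \<alpha> i u x = partial i u x - of_rat \<alpha> * u x * partial i f x / f x"

definition O_ops :: "complex ^ 'n::finite \<Rightarrow> ((complex ^ 'n \<Rightarrow> complex) \<Rightarrow> complex ^ 'n \<Rightarrow> complex) set" where
  "O_ops p = {\<lambda>u x. h x * u x |h. holo_germ p h}"

definition D_ops ::
  "(complex ^ 'n::finite \<Rightarrow> complex) \<Rightarrow> rat \<Rightarrow> complex ^ 'n \<Rightarrow>
   ((complex ^ 'n \<Rightarrow> complex) \<Rightarrow> complex ^ 'n \<Rightarrow> complex) set" where
  "D_ops f \<alpha> p = O_ops p \<union> range (nabla f \<alpha>)"

text \<open>
  The product of the k-th step of the order filtration on differential operators with S: the
  operators of order at most k are the combinations, with holomorphic coefficients on the left, of
  the iterated partial derivatives of length at most k.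
\<close>

definition order_act ::
  "(complex ^ 'n::finite \<Rightarrow> complex) \<Rightarrow> rat \<Rightarrow> nat \<Rightarrow>
   (complex ^ 'n \<Rightarrow> (complex ^ 'n \<Rightarrow> complex) set) \<Rightarrow> complex ^ 'n \<Rightarrow> (complex ^ 'n \<Rightarrow> complex) set" where
  "order_act f \<alpha> k S p =
     span_by (germ_eq f p) (O_ops p) {foldr (nabla f \<alpha>) is u |is u. length is \<le> k \<and> u \<in> S p}"

section \<open>The graph embedding and the V-filtration\<close>

text \<open>
  The direct image of the D-module under the graph embedding x \<mapsto> (x, f x), regarded as a sheaf
  on X.  Its sections are locally finite sums of m_j (d/dt)^j delta with m_j in
  the D-module; such a section is represented by u with u x j = m_j x.
\<close>

type_synonym 'n graph_section = "complex ^ 'n \<Rightarrow> nat \<Rightarrow> complex"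

definition graph_module ::
  "(complex ^ 'n::finite \<Rightarrow> complex) \<Rightarrow> complex ^ 'n \<Rightarrow> 'n graph_section set" where
  "graph_module f p =
     {u. (\<forall>j. (\<lambda>x. u x j) \<in> mero_module f p) \<and>
         (\<exists>d. \<forall>\<^sub>F x in nhds p. f x \<noteq> 0 \<longrightarrow> (\<forall>j>d. u x j = 0))}"

definition graph_incl :: "(complex ^ 'n::finite \<Rightarrow> complex) \<Rightarrow> 'n graph_section" where
  "graph_incl m = (\<lambda>x j. if j = 0 then m x else 0)"

definition dt_act :: "'n::finite graph_section \<Rightarrow> 'n graph_section" where
  "dt_act u = (\<lambda>x j. if j = 0 then 0 else u x (j - 1))"

text \<open>From t delta = f delta and t (d/dt)^j = (d/dt)^j t - j (d/dt)^(j-1).\<close>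

definition t_act :: "(complex ^ 'n::finite \<Rightarrow> complex) \<Rightarrow> 'n graph_section \<Rightarrow> 'n graph_section" where
  "t_act f u = (\<lambda>x j. f x * u x j - of_nat (Suc j) * u x (Suc j))"

text \<open>From (d/dx_i) (m delta) = (d/dx_i m) delta - (d/dx_i f) m (d/dt) delta.\<close>

definition dx_act ::
  "(complex ^ 'n::finite \<Rightarrow> complex) \<Rightarrow> rat \<Rightarrow> 'n \<Rightarrow> 'n graph_section \<Rightarrow> 'n graph_section" where
  "dx_act f \<alpha> i u = (\<lambda>x j. nabla f \<alpha> i (\<lambda>y. u y j) x - partial i f x * dt_act u x j)"

definition dtt_minus :: "(complex ^ 'n::finite \<Rightarrow> complex) \<Rightarrow> rat \<Rightarrow> 'n graph_section \<Rightarrow> 'n graph_section" where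
  "dtt_minus f \<gamma> u = (\<lambda>x j. dt_act (t_act f u) x j - of_rat \<gamma> * u x j)"

text \<open>
  Generators of the zeroth step of the V-filtration, along t = 0, of the ring of differential
  operators on the product of X with the t-line.  Holomorphic functions of (x, t) need not be listed:
  t - f is locally nilpotent on the graph module, so they act through polynomials in t with
  coefficients holomorphic in x.
\<close>

definition V0_ops ::
  "(complex ^ 'n::finite \<Rightarrow> complex) \<Rightarrow> rat \<Rightarrow> complex ^ 'n \<Rightarrow> ('n graph_section \<Rightarrow> 'n graph_section) set" where
  "V0_ops f \<alpha> p =
     {\<lambda>u x j. h x * u x j |h. holo_germ p h} \<union> range (dx_act f \<alpha>) \<union> {t_act f, dt_act \<circ> t_act f}"

text \<open>
  The Kashiwara--Malgrange filtration along t = 0, decreasing and normalised (for left modules) so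
  that (d/dt) t - gamma is nilpotent on the gamma-th graded piece.
\<close>

definition is_V_filtration ::
  "(complex ^ 'n::finite \<Rightarrow> complex) \<Rightarrow> rat \<Rightarrow> (rat \<Rightarrow> complex ^ 'n \<Rightarrow> 'n graph_section set) \<Rightarrow> bool" where
  "is_V_filtration f \<alpha> V \<longleftrightarrow>
     (\<forall>\<gamma>. subsheaf_module f (graph_module f) (V0_ops f \<alpha>) (V \<gamma>) \<and>
          locally_fin_gen f (V0_ops f \<alpha>) (V \<gamma>)) \<and>
     (\<forall>\<gamma> \<delta> p. \<gamma> \<le> \<delta> \<longrightarrow> V \<delta> p \<subseteq> V \<gamma> p) \<and>
     (\<forall>p. (\<Union>\<gamma>. V \<gamma> p) = graph_module f p) \<and>
     (\<forall>p. \<exists>r::nat. r > 0 \<and>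
        (\<forall>\<^sub>F q in nhds p. \<forall>\<gamma>. V \<gamma> q = V (of_int \<lceil>of_nat r * \<gamma>\<rceil> / of_nat r) q)) \<and>
     (\<forall>\<gamma> p. t_act f ` V \<gamma> p \<subseteq> V (\<gamma> + 1) p \<and> dt_act ` V \<gamma> p \<subseteq> V (\<gamma> - 1) p) \<and>
     (\<forall>p. \<exists>c. \<forall>\<^sub>F q in nhds p. \<forall>\<gamma>\<ge>c. \<forall>u \<in> V (\<gamma> + 1) q. \<exists>v \<in> V \<gamma> q. germ_eq f q u (t_act f v)) \<and>
     (\<forall>\<gamma> p. \<exists>N. \<forall>u \<in> V \<gamma> p. (dtt_minus f \<gamma> ^^ N) u \<in> (\<Union>\<delta>\<in>{\<gamma><..}. V \<delta> p))"

text \<open>Such a filtration is unique if it exists.\<close>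

definition V_filtration ::
  "(complex ^ 'n::finite \<Rightarrow> complex) \<Rightarrow> rat \<Rightarrow> rat \<Rightarrow> complex ^ 'n \<Rightarrow> 'n graph_section set" where
  "V_filtration f \<alpha> = (THE V. is_V_filtration f \<alpha> V)"

definition V_above ::
  "(complex ^ 'n::finite \<Rightarrow> complex) \<Rightarrow> rat \<Rightarrow> rat \<Rightarrow> complex ^ 'n \<Rightarrow> 'n graph_section set" where
  "V_above f \<alpha> \<gamma> p = (\<Union>\<delta>\<in>{\<gamma><..}. V_filtration f \<alpha> \<delta> p)"

section \<open>The Hodge filtration of the open direct image\<close>

text \<open>
  The pure Hodge module on U: F_k is the structure sheaf times f^(-alpha) for k \<ge> 0, and zero for
  k < 0.  The filtration on the graph direct image is F_k = sum over j of F_(k-j) (d/dt)^j delta.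
\<close>

definition hodge_U ::
  "(complex ^ 'n::finite \<Rightarrow> complex) \<Rightarrow> int \<Rightarrow> complex ^ 'n \<Rightarrow> (complex ^ 'n \<Rightarrow> complex) set" where
  "hodge_U f k q = (if k \<ge> 0 then {u. holo_germ q u} else zero_stalk f q)"

definition hodge_U_graph ::
  "(complex ^ 'n::finite \<Rightarrow> complex) \<Rightarrow> int \<Rightarrow> complex ^ 'n \<Rightarrow> 'n graph_section set" where
  "hodge_U_graph f k q = {u. \<forall>j. (\<lambda>x. u x j) \<in> hodge_U f (k - int j) q}"

text \<open>
  Saito's definition of the Hodge filtration of the direct image under the inclusion j of U: on the
  graph module, F_k is the sum over i \<ge> 0 of (d/dt)^i (V^0 \<inter> j_* F_(k-i)).  Since
  F_k of the graph module is again the sum of the F_(k-j) (d/dt)^j delta, a section m of the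
  D-module lies in F_k iff m delta lies in F_k of the graph module.
\<close>

definition hodge_graph ::
  "(complex ^ 'n::finite \<Rightarrow> complex) \<Rightarrow> rat \<Rightarrow> int \<Rightarrow> complex ^ 'n \<Rightarrow> 'n graph_section set" where
  "hodge_graph f \<alpha> k p =
     span_by (germ_eq f p) {}
       (\<Union>i::nat. (dt_act ^^ i) ` {u \<in> V_filtration f \<alpha> 0 p.
           \<forall>\<^sub>F q in nhds p. f q \<noteq> 0 \<longrightarrow> u \<in> hodge_U_graph f (k - int i) q})"

definition hodge_filtration ::
  "(complex ^ 'n::finite \<Rightarrow> complex) \<Rightarrow> rat \<Rightarrow> int \<Rightarrow> complex ^ 'n \<Rightarrow> (complex ^ 'n \<Rightarrow> complex) set" where
  "hodge_filtration f \<alpha> k p = {m \<in> mero_module f p. graph_incl m \<in> hodge_graph f \<alpha> k p}"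

section \<open>The weight filtration of the open direct image\<close>

text \<open>
  R is the monodromy filtration of N on A/B relative to the filtration L (Deligne; Steenbrink and
  Zucker): N R_k \<subseteq> R_(k-2), and N^i induces isomorphisms from Gr^R_(k+i) Gr^L_k to
  Gr^R_(k-i) Gr^L_k.  Subgroups of A/B are represented by their preimages in A.  If L has its only
  jump at w, this is the monodromy filtration of N centred at w.
\<close>

definition relative_monodromy_filtration ::
  "('a::ab_group_add \<Rightarrow> 'a) \<Rightarrow> 'a set \<Rightarrow> 'a set \<Rightarrow> (int \<Rightarrow> 'a set) \<Rightarrow> (int \<Rightarrow> 'a set) \<Rightarrow> bool" where
  "relative_monodromy_filtration N A B L R \<longleftrightarrow>
     (let G = (\<lambda>m k. {u + v |u v. u \<in> R m \<inter> L k \<and> v \<in> L (k - 1)}) in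
       (\<forall>k. B \<subseteq> R k \<and> R k \<subseteq> A \<and> (\<forall>u\<in>R k. \<forall>v\<in>R k. u - v \<in> R k)) \<and>
       (\<forall>k l. k \<le> l \<longrightarrow> R k \<subseteq> R l) \<and>
       (\<exists>k l. R k = B \<and> R l = A) \<and>
       (\<forall>k. N ` R k \<subseteq> R (k - 2)) \<and>
       (\<forall>k (i::nat).
          (\<forall>u \<in> G (k + int i) k. (N ^^ i) u \<in> G (k - int i - 1) k \<longrightarrow> u \<in> G (k + int i - 1) k) \<and>
          (\<forall>v \<in> G (k - int i) k. \<exists>u \<in> G (k + int i) k. v - (N ^^ i) u \<in> G (k - int i - 1) k)))"

text \<open>The filtration induced by W on the gamma-th graded piece of V, as preimages in V^gamma.\<close>

definition W_graph ::
  "(complex ^ 'n::finite \<Rightarrow> complex) \<Rightarrow> (int \<Rightarrow> complex ^ 'n \<Rightarrow> (complex ^ 'n \<Rightarrow> complex) set) \<Rightarrow>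
   int \<Rightarrow> complex ^ 'n \<Rightarrow> 'n graph_section set" where
  "W_graph f W k p = {u \<in> graph_module f p. \<forall>j. (\<lambda>x. u x j) \<in> W k p}"

definition W_gr_V ::
  "(complex ^ 'n::finite \<Rightarrow> complex) \<Rightarrow> rat \<Rightarrow> (int \<Rightarrow> complex ^ 'n \<Rightarrow> (complex ^ 'n \<Rightarrow> complex) set) \<Rightarrow>
   complex ^ 'n \<Rightarrow> rat \<Rightarrow> int \<Rightarrow> 'n graph_section set" where
  "W_gr_V f \<alpha> W p \<gamma> k =
     {u + v |u v. u \<in> V_filtration f \<alpha> \<gamma> p \<inter> W_graph f W k p \<and> v \<in> V_above f \<alpha> \<gamma> p}"

text \<open>
  Saito's characterisation of the weight filtration W of the direct image under the inclusion of U
  of a pure Hodge module of weight n, as the W-filtered extension of the given module on U for which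
  var is an isomorphism.  W is a finite filtration by coherent D-submodules with the prescribed
  restriction to U.  The weight filtrations R gamma of the nearby cycles Gr_V^gamma
  (0 < gamma \<le> 1) and R 0 of the unipotent vanishing cycles Gr_V^0 are the monodromy
  filtrations of N = (d/dt) t - gamma relative to the filtrations induced by W, shifted by one
  in the case of the nearby cycles.  The map
  var: Gr_V^0 \<rightarrow> Gr_V^1(-1), which is multiplication by t, identifies the weight filtrations;
  the Tate twist (-1) raises weights by 2.
\<close>

definition is_weight_filtration ::
  "(complex ^ 'n::finite \<Rightarrow> complex) \<Rightarrow> rat \<Rightarrow> (int \<Rightarrow> complex ^ 'n \<Rightarrow> (complex ^ 'n \<Rightarrow> complex) set) \<Rightarrow> bool" where
  "is_weight_filtration f \<alpha> W \<longleftrightarrow>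
     (\<forall>k. subsheaf_module f (mero_module f) (D_ops f \<alpha>) (W k) \<and> locally_fin_gen f (D_ops f \<alpha>) (W k)) \<and>
     (\<forall>k l p. k \<le> l \<longrightarrow> W k p \<subseteq> W l p) \<and>
     (\<exists>k l. W k = zero_stalk f \<and> W l = mero_module f) \<and>
     (\<forall>k p. f p \<noteq> 0 \<longrightarrow>
        W k p = (if k \<ge> int CARD('n) then mero_module f p else zero_stalk f p)) \<and>
     (\<forall>p. \<exists>R.
        (\<forall>\<gamma>. 0 < \<gamma> \<and> \<gamma> \<le> 1 \<longrightarrow>
           relative_monodromy_filtration (dtt_minus f \<gamma>) (V_filtration f \<alpha> \<gamma> p) (V_above f \<alpha> \<gamma> p)
             (\<lambda>k. W_gr_V f \<alpha> W p \<gamma> (k + 1)) (R \<gamma>)) \<and>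
        relative_monodromy_filtration (dtt_minus f 0) (V_filtration f \<alpha> 0 p) (V_above f \<alpha> 0 p)
          (W_gr_V f \<alpha> W p 0) (R 0) \<and>
        (\<forall>k. \<forall>u \<in> V_filtration f \<alpha> 0 p. u \<in> R 0 k \<longleftrightarrow> t_act f u \<in> R 1 (k - 2)))"

text \<open>
  These conditions determine W uniquely: the two relative monodromy conditions and var determine the
  filtration on Gr_V^0, and W_k of the graph module is generated by its intersection with V^0.
\<close>

definition weight_filtration ::
  "(complex ^ 'n::finite \<Rightarrow> complex) \<Rightarrow> rat \<Rightarrow> int \<Rightarrow> complex ^ 'n \<Rightarrow> (complex ^ 'n \<Rightarrow> complex) set" where
  "weight_filtration f \<alpha> = (THE W. is_weight_filtration f \<alpha> W)"

text \<open>The filtration induced by the Hodge filtration on a weight step.\<close>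

definition hodge_weight ::
  "(complex ^ 'n::finite \<Rightarrow> complex) \<Rightarrow> rat \<Rightarrow> int \<Rightarrow> int \<Rightarrow> complex ^ 'n \<Rightarrow> (complex ^ 'n \<Rightarrow> complex) set" where
  "hodge_weight f \<alpha> k w p = hodge_filtration f \<alpha> k p \<inter> weight_filtration f \<alpha> w p"

end

theory Submission
  imports Defs "HOL-Complex_Analysis.Cauchy_Integral_Formula" "HOL-Computational_Algebra.Polynomial"
begin

text \<open>
  A section u of the graph module, with components u_k, is encoded by the polynomial
  P_u(s) = sum_k (u_k / f^k) (-s)(1 - s) ... (k - 1 - s) in s = -(d/dt) t.  On these polynomials t
  acts as P(s) \<mapsto> f P(s + 1), so that (d/dt) t - \<gamma> is, up to sign, the shift of the Taylor
  coefficients at s = -\<gamma>.  For a monomial f, let Wt \<beta> j be spanned by the Laurent monomials x^e with at most j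
  indices i such that \<beta> a_i is an integer greater than e_i.  The V-filtration consists of those u
  whose j-th Taylor coefficient at s = -\<delta> lies in Wt (\<delta> + \<alpha>) j for all \<delta> < \<gamma>; it is generated
  by a single monomial.

  The Taylor coefficients at s = -\<gamma> identify Gr_V^\<gamma> with the sum over j of the quotients of all
  meromorphic germs by Wt (\<gamma> + \<alpha>) j, so that the monodromy filtrations can be written down.  This shows
  that W_(n+l) = Wt \<alpha> l satisfies the conditions on the weight filtration, and also that every
  solution induces the same filtration on Gr_V^0, whence uniqueness.

  For the Hodge filtration, if a section of V^0 of degree at most k in d/dt has the monomial x^e in
  its polynomial, then the coefficient is a polynomial in s of degree at most k divisible by a product of
  sum_i max(0, \<lceil>\<alpha> a_i\<rceil> - 1 - e_i) linear factors.  So this sum is at most k; and by as many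
  derivatives x^e arises from a monomial with exponents at least \<lceil>\<alpha> a_i\<rceil> - 1, without changing the weight.
\<close>

section \<open>Holomorphic germs\<close>

text \<open>Both filtrations in the statement are definite descriptions, so each needs an explicit
  candidate and a uniqueness proof before anything can be computed. The count behind
  \<open>Wt\<close> has this origin. A graph section behaves like P(s) f^(s - alpha), so d/dx_i
  multiplies a term x^e by (a_i s + e_i - alpha a_i) / x_i. Descending from a monomial with large
  exponents, one picks up a root at s = -delta whenever the i-th exponent is lowered from the value
  (delta + alpha) a_i. Hence the coefficient of x^e vanishes at -delta at least to the order
  \<open>poles\<close> (delta + alpha) e. The obstacle is to read off this coefficient, because
  expansions in monomials with holomorphic coefficients are not unique. Normal forms with exponents
  clipped at a bound restore uniqueness, so that membership in a module of monomials can be tested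
  coefficient by coefficient. Uniqueness of W starts from the inclusion of V^gamma, gamma > 0, in
  the graph module of W_n: a D-submodule with a nonzero holomorphic section contains every monomial
  with exponents above alpha a_i - 1.\<close>

definition holo_at :: "(complex ^ 'n::finite \<Rightarrow> complex) \<Rightarrow> complex ^ 'n \<Rightarrow> bool" where
  "holo_at h x \<longleftrightarrow> (\<exists>D. (h has_derivative D) (at x) \<and> (\<forall>c v. D (c *s v) = c * D v))"

lemma holo_germ_iff: "holo_germ p h \<longleftrightarrow> (\<forall>\<^sub>F x in nhds p. holo_at h x)"
  by (simp add: holo_germ_def holo_at_def)

lemma holo_germ_iff_ball: "holo_germ p h \<longleftrightarrow> (\<exists>e>0. \<forall>x\<in>ball p e. holo_at h x)"
  unfolding holo_germ_iff eventually_nhds_metric by (auto simp: dist_commute)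

lemma norm_axis_complex: "norm (axis i z :: complex ^ 'n::finite) = norm z"
proof -
  have "(\<Sum>j\<in>UNIV. (norm ((axis i z :: complex ^ 'n) $ j))\<^sup>2) = (\<Sum>j\<in>UNIV. if j = i then (norm z)\<^sup>2 else 0)"
    by (rule sum.cong) (auto simp: axis_def)
  then show ?thesis
    by (simp add: norm_vec_def L2_set_def)
qed

lemma axis_smult: "axis i z = z *s (axis i 1 :: complex ^ 'n::finite)"
  by (simp add: vec_eq_iff axis_def)

lemma has_derivative_axis: "((\<lambda>z. x + axis i z :: complex ^ 'n::finite) has_derivative axis i) (at z within S)"
proof -
  have "bounded_linear (axis i :: complex \<Rightarrow> complex ^ 'n)"
  proof (rule bounded_linear_intro[where K=1])
    show "norm (axis i z :: complex ^ 'n) \<le> norm z * 1" for z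
      by (simp add: norm_axis_complex)
  qed (auto simp: vec_eq_iff axis_def)
  then show ?thesis
    by (auto intro!: derivative_eq_intros bounded_linear_imp_has_derivative)
qed

lemma axis_zero [simp]: "axis i 0 = (0 :: complex ^ 'n::finite)"
  by (simp add: axis_def vec_eq_iff)

lemma has_field_derivative_slice:
  fixes h :: "complex ^ 'n::finite \<Rightarrow> complex"
  assumes "(h has_derivative D) (at (x + axis i z))" and "\<And>c v. D (c *s v) = c * D v"
  shows "((\<lambda>z. h (x + axis i z)) has_field_derivative D (axis i 1)) (at z)"
proof -
  have "((\<lambda>z. h (x + axis i z)) has_derivative (\<lambda>v. D (axis i v))) (at z)"
    by (rule has_derivative_compose[where g=h and g'=D, OF has_derivative_axis assms(1)])
  moreover have "(\<lambda>v. D (axis i v)) = (*) (D (axis i 1))"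
  proof
    show "D (axis i v) = D (axis i 1) * v" for v
    unfolding axis_smult[of i v] assms(2) by (rule mult.commute)
  qed
  ultimately show ?thesis
    unfolding has_field_derivative_def by metis
qed

lemma vec_eq_sum_axis: "v = (\<Sum>i\<in>UNIV. (v $ i) *s axis i (1::complex))"
  by (simp add: vec_eq_iff axis_def if_distrib cong: if_cong)

lemma partial_eqI:
  assumes "(h has_derivative D) (at x)" and "\<And>c v. D (c *s v) = c * D v"
  shows "partial i h x = D (axis i 1)"
  unfolding partial_def
  by (rule DERIV_imp_deriv, rule has_field_derivative_slice[OF _ assms(2)]) (simp add: assms(1))

lemma holo_at_has_derivative:
  assumes "holo_at h x"
  shows "(h has_derivative (\<lambda>v. \<Sum>i\<in>UNIV. (v $ i) * partial i h x)) (at x)"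
proof -
  obtain D where D: "(h has_derivative D) (at x)" "\<And>c v. D (c *s v) = c * D v"
    using assms unfolding holo_at_def by blast
  have "D v = (\<Sum>i\<in>UNIV. (v $ i) * partial i h x)" for v
  proof -
    interpret bounded_linear D using D(1) by (rule has_derivative_bounded_linear)
    have "D v = D (\<Sum>i\<in>UNIV. (v $ i) *s axis i 1)" by (rule arg_cong[OF vec_eq_sum_axis])
    also have "\<dots> = (\<Sum>i\<in>UNIV. (v $ i) * partial i h x)"
      by (simp add: sum D partial_eqI[OF D])
    finally show ?thesis .
  qed
  then have "D = (\<lambda>v. \<Sum>i\<in>UNIV. (v $ i) * partial i h x)" ..
  with D(1) show ?thesis by simp
qed

lemma holo_at_slice:
  assumes "holo_at h (x + axis i z)"
  shows "((\<lambda>z. h (x + axis i z)) has_field_derivative partial i h (x + axis i z)) (at z)"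
proof -
  obtain D where D: "(h has_derivative D) (at (x + axis i z))" "\<And>c v. D (c *s v) = c * D v"
    using assms unfolding holo_at_def by blast
  show ?thesis
    unfolding partial_eqI[OF D] by (rule has_field_derivative_slice[OF D])
qed

lemma holo_atI:
  assumes "(h has_derivative (\<lambda>v. \<Sum>i\<in>UNIV. (v $ i) * d i)) (at x)"
  shows "holo_at h x" "partial i h x = d i"
proof -
  have *: "(\<Sum>i\<in>UNIV. ((c *s v) $ i) * d i) = c * (\<Sum>i\<in>UNIV. (v $ i) * d i)" for c v
    by (simp add: sum_distrib_left mult_ac)
  show "holo_at h x" using assms * unfolding holo_at_def by blast
  have "partial i h x = (\<Sum>k\<in>UNIV. ((axis i (1::complex)) $ k) * d k)"
    by (rule partial_eqI[OF assms *])
  also have "\<dots> = (\<Sum>k\<in>UNIV. if k = i then d k else 0)"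
    by (rule sum.cong) (auto simp: axis_def)
  finally show "partial i h x = d i" by simp
qed

lemma holo_at_continuous: "holo_at h x \<Longrightarrow> isCont h x"
  unfolding holo_at_def using has_derivative_continuous by blast

lemma holo_at_const [simp]: "holo_at (\<lambda>_. c) x" "partial i (\<lambda>_. c) x = 0"
  using holo_atI[of "\<lambda>_. c" "\<lambda>_. 0"] by simp_all

lemma holo_at_coord [simp]: "holo_at (\<lambda>x. x $ k) x" "partial i (\<lambda>x. x $ k) x = (if i = k then 1 else 0)"
proof -
  have "((\<lambda>x::complex ^ 'a. x $ k) has_derivative (\<lambda>v. v $ k)) (at x)"
    by (intro bounded_linear_imp_has_derivative bounded_linear_vec_nth)
  moreover have "(\<lambda>v::complex ^ 'a. v $ k) = (\<lambda>v. \<Sum>i\<in>UNIV. (v $ i) * (if i = k then 1 else 0))"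
    by (simp add: if_distrib cong: if_cong)
  ultimately have *: "((\<lambda>x::complex ^ 'a. x $ k) has_derivative (\<lambda>v. \<Sum>i\<in>UNIV. (v $ i) * (if i = k then 1 else 0))) (at x)" by (simp only:)
  show "holo_at (\<lambda>x. x $ k) x" by (rule holo_atI(1)[OF *])
  show "partial i (\<lambda>x. x $ k) x = (if i = k then 1 else 0)" by (rule holo_atI(2)[OF *])
qed

lemma holo_at_add:
  assumes "holo_at g x" "holo_at h x"
  shows "holo_at (\<lambda>x. g x + h x) x" "partial i (\<lambda>x. g x + h x) x = partial i g x + partial i h x"
proof -
  have *: "((\<lambda>x. g x + h x) has_derivative (\<lambda>v. \<Sum>i\<in>UNIV. (v $ i) * (partial i g x + partial i h x))) (at x)"
    using has_derivative_add[OF assms[THEN holo_at_has_derivative]]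
    by (simp add: sum.distrib algebra_simps)
  show "holo_at (\<lambda>x. g x + h x) x" by (rule holo_atI(1)[OF *])
  show "partial i (\<lambda>x. g x + h x) x = partial i g x + partial i h x" by (rule holo_atI(2)[OF *])
qed

lemma holo_at_mult:
  assumes "holo_at g x" "holo_at h x"
  shows "holo_at (\<lambda>x. g x * h x) x"
    and "partial i (\<lambda>x. g x * h x) x = partial i g x * h x + g x * partial i h x"
proof -
  have *: "((\<lambda>x. g x * h x) has_derivative
      (\<lambda>v. \<Sum>i\<in>UNIV. (v $ i) * (partial i g x * h x + g x * partial i h x))) (at x)"
    using has_derivative_mult[OF assms[THEN holo_at_has_derivative]]
    by (simp add: sum.distrib algebra_simps sum_distrib_left sum_distrib_right)
  show "holo_at (\<lambda>x. g x * h x) x" by (rule holo_atI(1)[OF *])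
  show "partial i (\<lambda>x. g x * h x) x = partial i g x * h x + g x * partial i h x"
    by (rule holo_atI(2)[OF *])
qed

lemma holo_at_inverse:
  assumes "holo_at g x" "g x \<noteq> 0"
  shows "holo_at (\<lambda>x. inverse (g x)) x"
    and "partial i (\<lambda>x. inverse (g x)) x = - partial i g x / (g x)\<^sup>2"
proof -
  have *: "((\<lambda>x. inverse (g x)) has_derivative
      (\<lambda>v. \<Sum>i\<in>UNIV. (v $ i) * (- partial i g x / (g x)\<^sup>2))) (at x)"
    using Deriv.has_derivative_inverse[OF assms(2) holo_at_has_derivative[OF assms(1)]]
    by (simp add: sum_distrib_left sum_distrib_right sum_negf power2_eq_square field_simps flip: sum_divide_distrib)
  show "holo_at (\<lambda>x. inverse (g x)) x" by (rule holo_atI(1)[OF *])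
  show "partial i (\<lambda>x. inverse (g x)) x = - partial i g x / (g x)\<^sup>2"
    by (rule holo_atI(2)[OF *])
qed

lemma holo_at_sum: "(\<And>k. k \<in> S \<Longrightarrow> holo_at (g k) x) \<Longrightarrow> holo_at (\<lambda>x. \<Sum>k\<in>S. g k x) x"
  by (induction S rule: infinite_finite_induct) (auto intro: holo_at_add)

lemma partial_sum:
  "(\<And>k. k \<in> S \<Longrightarrow> holo_at (g k) x) \<Longrightarrow> partial i (\<lambda>x. \<Sum>k\<in>S. g k x) x = (\<Sum>k\<in>S. partial i (g k) x)"
  by (induction S rule: infinite_finite_induct) (auto simp: holo_at_add holo_at_sum)

lemma filterlim_axis: "filterlim (\<lambda>z. x + axis i z) (nhds x) (nhds (0::complex))"
proof -
  have "((\<lambda>z. x + axis i z :: complex ^ 'a) \<longlongrightarrow> x + axis i 0) (at 0)"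
    using has_derivative_continuous[OF has_derivative_axis] unfolding continuous_within by blast
  then show ?thesis
    unfolding tendsto_at_iff_tendsto_nhds[where g="\<lambda>z. x + axis i z :: complex ^ 'a"] by simp
qed

lemma partial_cong_ev:
  assumes "\<forall>\<^sub>F y in nhds x. u y = v y"
  shows "partial i u x = partial i v x"
  unfolding partial_def
  by (rule deriv_cong_ev) (use assms filterlim_axis[of x i] in \<open>auto simp: filterlim_iff\<close>)

lemma holo_at_cong_ev:
  assumes "\<forall>\<^sub>F y in nhds x. u y = v y" "holo_at u x"
  shows "holo_at v x"
proof -
  obtain D where D: "(u has_derivative D) (at x)" "\<And>c v. D (c *s v) = c * D v"
    using assms(2) unfolding holo_at_def by blast
  have "(v has_derivative D) (at x)"
  proof (rule has_derivative_transform_eventually[OF D(1)])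
    show "\<forall>\<^sub>F y in at x. u y = v y"
      using assms(1) unfolding eventually_at_filter by (rule eventually_mono) simp
    show "u x = v x" using assms(1) by (rule eventually_nhds_x_imp_x)
  qed simp
  with D(2) show ?thesis unfolding holo_at_def by blast
qed

section \<open>Cauchy integrals and holomorphic dependence on parameters\<close>

lemma deriv_circle_integral:
  assumes "\<phi> holomorphic_on cball 0 r" "r > 0"
  shows "deriv \<phi> 0 = integral {0..1} (\<lambda>t. \<phi> (of_real r * exp (2 * of_real pi * \<i> * of_real t)) *
           inverse (of_real r * exp (2 * of_real pi * \<i> * of_real t)))"
proof -
  let ?c = "\<lambda>t::real. of_real r * exp (2 * of_real pi * \<i> * of_real t)"
  have "2 * of_real pi * \<i> * deriv \<phi> 0 = contour_integral (circlepath 0 r) (\<lambda>u. \<phi> u / (u - 0)\<^sup>2)"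
    using Cauchy_contour_integral_circlepath_2[of 0 r \<phi> 0] assms
    by (simp add: holomorphic_on_imp_continuous_on holomorphic_on_subset[OF _ ball_subset_cball])
  also have "\<dots> = integral {0..1} (\<lambda>t. \<phi> (?c t) / (?c t)\<^sup>2 * (2 * of_real pi * \<i> * ?c t))"
    unfolding contour_integral_integral vector_derivative_circlepath
    by (simp add: circlepath mult_ac)
  also have "\<dots> = integral {0..1} (\<lambda>t. (2 * of_real pi * \<i>) * (\<phi> (?c t) * inverse (?c t)))"
    using assms(2) by (intro integral_cong) (simp add: field_simps power2_eq_square)
  also have "\<dots> = 2 * of_real pi * \<i> * integral {0..1} (\<lambda>t. \<phi> (?c t) * inverse (?c t))"
    by simp
  finally show ?thesis by simp
qed

lemma holo_slice_holomorphic: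
  assumes "\<And>z. z \<in> S \<Longrightarrow> holo_at h (x + axis i z)"
  shows "(\<lambda>z. h (x + axis i z)) holomorphic_on S"
  using holo_at_slice[OF assms] unfolding holomorphic_on_def
  by (meson field_differentiable_at_within field_differentiable_def)

text \<open>One radius r serves all x in the ball, so Cauchy's formula becomes an integral over a
  fixed interval in which x is a parameter. Continuity and differentiability in x can then be passed
  through the integral.\<close>

lemma partial_circle_integral:
  assumes "\<And>y. y \<in> ball x0 (2 * r) \<Longrightarrow> holo_at h y" and "r > 0" and "x \<in> ball x0 r"
  shows "partial i h x = integral {0..1} (\<lambda>t. h (x + axis i (of_real r * exp (2 * of_real pi * \<i> * of_real t))) *
           inverse (of_real r * exp (2 * of_real pi * \<i> * of_real t)))"
  unfolding partial_def
proof (rule deriv_circle_integral[OF holo_slice_holomorphic])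
  fix z :: complex assume "z \<in> cball 0 r"
  then have "norm (axis i z :: complex ^ 'a) \<le> r" by (simp add: norm_axis_complex)
  then have "dist x0 (x + axis i z) < 2 * r"
    using assms(3) dist_triangle[of x0 "x + axis i z" x] by (simp add: dist_norm)
  then show "holo_at h (x + axis i z)" using assms(1) by simp
qed (use assms in auto)

lemma continuous_on_circle [continuous_intros]:
  "continuous_on S (\<lambda>t::real. of_real r * exp (2 * of_real pi * \<i> * of_real t))"
  by (intro continuous_intros)

lemma continuous_on_axis [continuous_intros]:
  fixes g :: "'b::topological_space \<Rightarrow> complex"
  assumes "continuous_on S g"
  shows "continuous_on S (\<lambda>t. axis i (g t) :: complex ^ 'n::finite)"
proof -
  have "(\<lambda>t. axis i (g t) :: complex ^ 'n) = (\<lambda>t. \<chi> j. if j = i then g t else 0)"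
    unfolding axis_def ..
  moreover have "continuous_on S (\<lambda>t. \<chi> j. if j = i then g t else 0 :: complex ^ 'n)"
  proof (rule continuous_on_vec_lambda)
    show "continuous_on S (\<lambda>t. if j = i then g t else 0)" for j
      using assms by (cases "j = i") auto
  qed
  ultimately show ?thesis by (simp only:)
qed

lemma holo_at_continuous_on: "(\<And>y. y \<in> S \<Longrightarrow> holo_at h y) \<Longrightarrow> continuous_on S h"
  by (simp add: continuous_at_imp_continuous_on holo_at_continuous)

text \<open>\<open>holo_at\<close> asserts only differentiability. Continuity of the partial
  derivatives must be known before the Leibniz rule in \<open>holo_at_integral\<close> applies, and
  the Cauchy integral gives it because its integrand is continuous.\<close>

lemma continuous_on_partial:
  assumes "\<And>y. y \<in> ball p e \<Longrightarrow> holo_at h y"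
  shows "continuous_on (ball p e) (partial i h)"
proof (rule continuous_at_imp_continuous_on, safe)
  fix x0 assume x0: "x0 \<in> ball p e"
  define r where "r = (e - dist p x0) / 2"
  have r: "r > 0" using x0 by (simp add: r_def)
  have sub: "ball x0 (2 * r) \<subseteq> ball p e"
    using x0 by (auto simp: r_def subset_iff dist_commute intro: le_less_trans[OF dist_triangle[of _ _ x0]])
  let ?c = "\<lambda>t::real. of_real r * exp (2 * of_real pi * \<i> * of_real t)"
  have "x + axis i (?c t) \<in> ball p e" if "x \<in> ball x0 r" for x t
  proof -
    have "norm (axis i (?c t) :: complex ^ 'a) = r"
      using r by (simp add: norm_axis_complex norm_mult)
    then have "dist x0 (x + axis i (?c t)) < 2 * r"
      using that dist_triangle[of x0 "x + axis i (?c t)" x] by (simp add: dist_norm)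
    then show ?thesis using sub by auto
  qed
  then have sub': "(\<lambda>z. fst z + axis i (?c (snd z))) ` (ball x0 r \<times> cbox 0 1) \<subseteq> ball p e"
    by auto
  have "continuous_on (ball x0 r \<times> cbox 0 1) (\<lambda>z. fst z + axis i (?c (snd z)) :: complex ^ 'a)"
    by (intro continuous_intros)
  from continuous_on_compose2[OF holo_at_continuous_on[OF assms] this sub']
  have "continuous_on (ball x0 r \<times> cbox 0 1) (\<lambda>z. h (fst z + axis i (?c (snd z))))" by blast
  moreover have "continuous_on (ball x0 r \<times> cbox 0 1) (\<lambda>z. inverse (?c (snd z)))"
    using r by (intro continuous_intros) auto
  ultimately have "continuous_on (ball x0 r \<times> cbox 0 1) (\<lambda>(x, t). h (x + axis i (?c t)) * inverse (?c t))"
    unfolding split_beta by (rule continuous_on_mult)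
  then have "continuous_on (ball x0 r) (\<lambda>x. integral (cbox 0 1) (\<lambda>t. h (x + axis i (?c t)) * inverse (?c t)))"
    by (rule integral_continuous_on_param)
  moreover have "integral (cbox 0 1) (\<lambda>t. h (x + axis i (?c t)) * inverse (?c t)) = partial i h x"
    if "x \<in> ball x0 r" for x
    unfolding cbox_interval
    by (rule partial_circle_integral[OF assms r that, symmetric]) (use sub in auto)
  ultimately have "continuous_on (ball x0 r) (partial i h)"
    by (simp cong: continuous_on_cong_simp)
  then show "isCont (partial i h) x0"
    using r by (simp add: continuous_on_eq_continuous_at)
qed

text \<open>The substitution scales and translates each coordinate separately. Three choices are
  used later: s = 1 with a circle as w in one coordinate for Cauchy's formula, s = 0 in one
  coordinate for restriction to a hyperplane, and s = t in one coordinate for the quotient in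
  Hadamard's lemma.\<close>

lemma holo_at_integral:
  fixes k :: "complex ^ 'n::finite \<Rightarrow> complex" and s w :: "'n \<Rightarrow> real \<Rightarrow> complex"
  assumes k: "\<And>y. y \<in> ball p e \<Longrightarrow> holo_at k y"
    and s: "\<And>j. continuous_on {0..1} (s j)" and w: "\<And>j. continuous_on {0..1} (w j)"
    and c: "continuous_on {0..1} c"
    and \<phi>: "\<And>x t. x \<in> ball q r \<Longrightarrow> t \<in> {0..1} \<Longrightarrow> (\<chi> j. s j t * x $ j + w j t) \<in> ball p e"
    and x0: "x0 \<in> ball q r"
  shows "holo_at (\<lambda>x. integral {0..1} (\<lambda>t. k (\<chi> j. s j t * x $ j + w j t) * c t)) x0"
proof -
  let ?\<phi> = "\<lambda>x t. \<chi> j. s j t * x $ j + w j t"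
  define P :: "'n \<Rightarrow> (complex ^ 'n) \<Rightarrow>\<^sub>L complex" where "P i = Blinfun (\<lambda>v. v $ i)" for i
  have P: "blinfun_apply (P i) v = v $ i" for i v
    unfolding P_def by (simp add: bounded_linear_Blinfun_apply bounded_linear_vec_nth)
  \<comment> \<open>The derivative of the integrand in x, packaged as a bounded linear map because
    the Leibniz rule asks for continuity in the operator norm.\<close>
  define fx where "fx x t = (\<Sum>i\<in>UNIV. blinfun_mult_right (c t * (s i t * partial i k (?\<phi> x t))) o\<^sub>L P i)" for x t
  have fx: "blinfun_apply (fx x t) v = (\<Sum>i\<in>UNIV. v $ i * (s i t * partial i k (?\<phi> x t))) * c t" for x t v
    by (simp add: fx_def blinfun.sum_left P sum_distrib_left sum_distrib_right mult_ac)
  have cont\<phi>: "continuous_on (ball q r \<times> {0..1}) (\<lambda>z. ?\<phi> (fst z) (snd z))"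
    by (intro continuous_intros continuous_on_compose2[OF s] continuous_on_compose2[OF w]) auto
  have \<phi>': "(\<lambda>z. ?\<phi> (fst z) (snd z)) ` (ball q r \<times> {0..1}) \<subseteq> ball p e"
    using \<phi> by auto
  have contk: "continuous_on (ball q r \<times> {0..1}) (\<lambda>z. k (?\<phi> (fst z) (snd z)))"
    by (rule continuous_on_compose2[OF holo_at_continuous_on[OF k] cont\<phi> \<phi>'])
  have contp: "continuous_on (ball q r \<times> {0..1}) (\<lambda>z. partial i k (?\<phi> (fst z) (snd z)))" for i
    by (rule continuous_on_compose2[OF continuous_on_partial[OF k] cont\<phi> \<phi>'])
  have *: "((\<lambda>x. integral (cbox 0 1) (\<lambda>t. k (?\<phi> x t) * c t)) has_derivative
           blinfun_apply (integral (cbox 0 1) (fx x0))) (at x0 within ball q r)"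
  proof (rule leibniz_rule[OF _ _ _ x0 convex_ball])
    fix x :: "complex ^ 'n" and t :: real assume x: "x \<in> ball q r" and t: "t \<in> cbox 0 1"
    then have t': "t \<in> {0..1}" by simp
    have "((\<lambda>x. ?\<phi> x t) has_derivative (\<lambda>v. \<chi> j. s j t * v $ j)) (at x)"
    proof -
      have "linear (\<lambda>v :: complex ^ 'n. \<chi> j. s j t * v $ j)"
        by (rule linearI) (simp_all add: vec_eq_iff algebra_simps)
      then have "((\<lambda>v. \<chi> j. s j t * v $ j) has_derivative (\<lambda>v. \<chi> j. s j t * v $ j)) (at x)"
        by (intro bounded_linear_imp_has_derivative) (simp add: linear_conv_bounded_linear)
      then have "((\<lambda>v. (\<chi> j. s j t * v $ j) + (\<chi> j. w j t)) has_derivative (\<lambda>v. \<chi> j. s j t * v $ j)) (at x)"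
        by (rule has_derivative_add_const)
      moreover have "(\<lambda>v. (\<chi> j. s j t * v $ j) + (\<chi> j. w j t)) = (\<lambda>x. ?\<phi> x t)"
        by (simp add: vec_eq_iff fun_eq_iff)
      ultimately show ?thesis by simp
    qed
    from has_derivative_compose[OF this holo_at_has_derivative[OF k[OF \<phi>[OF x t']]]]
    have "((\<lambda>x. k (?\<phi> x t)) has_derivative (\<lambda>v. \<Sum>i\<in>UNIV. s i t * v $ i * partial i k (?\<phi> x t))) (at x)"
      by simp
    then have "((\<lambda>x. k (?\<phi> x t) * c t) has_derivative
        (\<lambda>v. (\<Sum>i\<in>UNIV. s i t * v $ i * partial i k (?\<phi> x t)) * c t)) (at x)"
      by (rule has_derivative_mult_left)
    also have "(\<lambda>v. (\<Sum>i\<in>UNIV. s i t * v $ i * partial i k (?\<phi> x t)) * c t) = blinfun_apply (fx x t)"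
      by (simp add: fun_eq_iff fx mult_ac)
    finally show "((\<lambda>x. k (?\<phi> x t) * c t) has_derivative blinfun_apply (fx x t)) (at x within ball q r)"
      by (rule has_derivative_at_withinI)
  next
    fix x assume x: "x \<in> ball q r"
    have "continuous_on (cbox 0 1) (\<lambda>t. k (?\<phi> x t))"
      using continuous_on_compose2[OF contk, of "cbox 0 1" "\<lambda>t. (x, t)"] x
      by (force intro!: continuous_intros)
    then have "continuous_on (cbox 0 1) (\<lambda>t. k (?\<phi> x t) * c t)"
      using c by (intro continuous_intros) auto
    then show "(\<lambda>t. k (?\<phi> x t) * c t) integrable_on cbox 0 1"
      by (rule integrable_continuous)
  next
    show cfx: "continuous_on (ball q r \<times> cbox 0 1) (\<lambda>(x, t). fx x t)"
      using contp unfolding fx_def split_beta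
      by (intro continuous_intros continuous_on_compose2[OF s] continuous_on_compose2[OF c]) auto
  qed
  have cfx: "continuous_on (ball q r \<times> {0..1}) (\<lambda>z. fx (fst z) (snd z))"
    using contp unfolding fx_def
    by (intro continuous_intros continuous_on_compose2[OF s] continuous_on_compose2[OF c]) auto
  have ifx: "fx x0 integrable_on cbox 0 1"
    using continuous_on_compose2[OF cfx, of "cbox 0 1" "\<lambda>t. (x0, t)"] x0
    by (force intro!: continuous_intros integrable_continuous)
  have **: "blinfun_apply (integral (cbox 0 1) (fx x0)) v = integral (cbox 0 1) (\<lambda>t. blinfun_apply (fx x0 t) v)" for v
    using integral_linear[OF ifx, of "\<lambda>f. blinfun_apply f v"] by (simp add: o_def blinfun.bounded_linear_left)
  \<comment> \<open>The Leibniz rule yields a real derivative; complex homogeneity is inherited from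
    \<open>fx\<close>.\<close>
  have "blinfun_apply (integral (cbox 0 1) (fx x0)) (b *s v) = b * blinfun_apply (integral (cbox 0 1) (fx x0)) v" for b v
  proof -
    have "blinfun_apply (fx x0 t) (b *s v) = b * blinfun_apply (fx x0 t) v" for t
      by (simp add: fx sum_distrib_left sum_distrib_right mult_ac)
    then show ?thesis unfolding ** by simp
  qed
  with * x0 show ?thesis
    unfolding holo_at_def by (auto simp: at_within_open[OF x0 open_ball] cbox_interval)
qed

lemma holo_at_partial:
  assumes "\<And>y. y \<in> ball p e \<Longrightarrow> holo_at h y" and "x0 \<in> ball p e"
  shows "holo_at (partial i h) x0"
proof -
  define r where "r = (e - dist p x0) / 2"
  have r: "r > 0" using assms by (simp add: r_def)
  have sub: "ball x0 (2 * r) \<subseteq> ball p e"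
    using assms(2) by (auto simp: r_def subset_iff dist_commute intro: le_less_trans[OF dist_triangle[of _ _ x0]])
  let ?c = "\<lambda>t::real. of_real r * exp (2 * of_real pi * \<i> * of_real t)"
  have eq: "(\<chi> j. 1 * x $ j + (if j = i then ?c t else 0)) = x + axis i (?c t)" for x :: "complex ^ 'a" and t
    by (simp add: vec_eq_iff axis_def)
  have "holo_at (\<lambda>x. integral {0..1} (\<lambda>t. h (\<chi> j. 1 * x $ j + (if j = i then ?c t else 0)) * inverse (?c t))) x0"
  proof (rule holo_at_integral[OF assms(1)])
    show "continuous_on {0..1} (\<lambda>t. if j = i then ?c t else 0)" for j
      by (cases "j = i") (auto intro!: continuous_intros)
    show "continuous_on {0..1} (\<lambda>t. inverse (?c t))"
      using r by (intro continuous_intros) auto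
    show "x0 \<in> ball x0 r" using r by simp
    fix x and t :: real assume "x \<in> ball x0 r"
    moreover have "norm (axis i (?c t) :: complex ^ 'a) = r"
      using r by (simp add: norm_axis_complex norm_mult)
    ultimately have "dist x0 (x + axis i (?c t)) < 2 * r"
      using dist_triangle[of x0 "x + axis i (?c t)" x] by (simp add: dist_norm)
    then show "(\<chi> j. 1 * x $ j + (if j = i then ?c t else 0)) \<in> ball p e"
      unfolding eq using sub by auto
  qed auto
  moreover have "\<forall>\<^sub>F x in nhds x0. integral {0..1} (\<lambda>t. h (\<chi> j. 1 * x $ j + (if j = i then ?c t else 0)) * inverse (?c t))
      = partial i h x"
    unfolding eventually_nhds_metric
  proof (intro exI[of _ r] conjI allI impI r)
    fix x assume "dist x x0 < r"
    then show "integral {0..1} (\<lambda>t. h (\<chi> j. 1 * x $ j + (if j = i then ?c t else 0)) * inverse (?c t)) = partial i h x"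
      unfolding eq using sub
      by (intro partial_circle_integral[of x0 r h x i, symmetric] assms(1) r) (auto simp: dist_commute subset_iff)
  qed
  ultimately show ?thesis by (rule holo_at_cong_ev[rotated])
qed

section \<open>Operations on holomorphic germs\<close>

lemma holo_germ_partial: "holo_germ p h \<Longrightarrow> holo_germ p (partial i h)"
  unfolding holo_germ_iff_ball using holo_at_partial by blast

lemma holo_germ_const [simp]: "holo_germ p (\<lambda>_. c)"
  by (simp add: holo_germ_iff)

lemma holo_germ_coord [simp]: "holo_germ p (\<lambda>x. x $ k)"
  by (simp add: holo_germ_iff)

lemma holo_germ_add: "holo_germ p g \<Longrightarrow> holo_germ p h \<Longrightarrow> holo_germ p (\<lambda>x. g x + h x)"
  unfolding holo_germ_iff by (erule (1) eventually_elim2) (rule holo_at_add)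

lemma holo_germ_mult: "holo_germ p g \<Longrightarrow> holo_germ p h \<Longrightarrow> holo_germ p (\<lambda>x. g x * h x)"
  unfolding holo_germ_iff by (erule (1) eventually_elim2) (rule holo_at_mult)

lemma holo_germ_minus: "holo_germ p g \<Longrightarrow> holo_germ p (\<lambda>x. - g x)"
  using holo_germ_mult[of p "\<lambda>_. -1" g] by simp

lemma holo_germ_prod: "(\<And>k. k \<in> S \<Longrightarrow> holo_germ p (g k)) \<Longrightarrow> holo_germ p (\<lambda>x. \<Prod>k\<in>S. g k x)"
  by (induction S rule: infinite_finite_induct) (auto intro: holo_germ_mult)

lemma holo_germ_power: "holo_germ p g \<Longrightarrow> holo_germ p (\<lambda>x. g x ^ n)"
  by (induction n) (auto intro: holo_germ_mult)

lemma holo_germ_isCont: "holo_germ p g \<Longrightarrow> isCont g p"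
  unfolding holo_germ_iff using eventually_nhds_x_imp_x holo_at_continuous by blast

lemma holo_germ_eventually: "holo_germ p g \<Longrightarrow> \<forall>\<^sub>F q in nhds p. holo_germ q g"
  unfolding holo_germ_iff by (simp add: eventually_eventually)

lemma holo_germ_cong_ev: "\<forall>\<^sub>F x in nhds p. u x = v x \<Longrightarrow> holo_germ p u \<Longrightarrow> holo_germ p v"
  unfolding holo_germ_iff
  by (subst (asm) (1) eventually_eventually[symmetric], erule (1) eventually_elim2) (rule holo_at_cong_ev)

lemma isCont_eventually_nonzero:
  fixes g :: "'a::t2_space \<Rightarrow> complex"
  assumes "isCont g p" "g p \<noteq> 0"
  shows "\<forall>\<^sub>F x in nhds p. g x \<noteq> 0"
proof -
  have "(g \<longlongrightarrow> g p) (nhds p)"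
    using assms(1) by (simp add: isCont_def tendsto_at_iff_tendsto_nhds)
  then show ?thesis using assms(2) tendsto_imp_eventually_ne by blast
qed

lemma holo_germ_inverse: "holo_germ p g \<Longrightarrow> g p \<noteq> 0 \<Longrightarrow> holo_germ p (\<lambda>x. inverse (g x))"
proof -
  assume g: "holo_germ p g" "g p \<noteq> 0"
  have "\<forall>\<^sub>F x in nhds p. g x \<noteq> 0"
    by (rule isCont_eventually_nonzero[OF holo_germ_isCont[OF g(1)] g(2)])
  with g(1) show ?thesis
    unfolding holo_germ_iff by (rule eventually_elim2) (rule holo_at_inverse)
qed

section \<open>Division with remainder by a coordinate\<close>

definition upd :: "'n \<Rightarrow> complex \<Rightarrow> complex ^ 'n::finite \<Rightarrow> complex ^ 'n" where
  "upd i z x = (\<chi> j. if j = i then z else x $ j)"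

lemma upd_nth [simp]: "upd i z x $ j = (if j = i then z else x $ j)"
  by (simp add: upd_def)

lemma upd_upd [simp]: "upd i z (upd i w x) = upd i z x"
  by (simp add: vec_eq_iff)

lemma upd_same [simp]: "upd i (x $ i) x = x"
  by (simp add: vec_eq_iff)

lemma upd_commute: "i \<noteq> j \<Longrightarrow> upd i z (upd j w x) = upd j w (upd i z x)"
  by (simp add: vec_eq_iff)

lemma upd_plus_axis: "upd i z x = x + axis i (z - x $ i)"
  by (simp add: vec_eq_iff axis_def)

lemma norm_vec_mono:
  fixes x y :: "complex ^ 'n::finite"
  shows "(\<And>j. norm (x $ j) \<le> norm (y $ j)) \<Longrightarrow> norm x \<le> norm y"
  unfolding norm_vec_def by (rule L2_set_mono) auto

lemma upd_in_ball:
  assumes "x \<in> ball p e" "p $ i = 0" "norm z \<le> norm (x $ i)"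
  shows "upd i z x \<in> ball p e"
proof -
  have "norm (upd i z x - p) \<le> norm (x - p)"
    by (rule norm_vec_mono) (use assms in auto)
  then show ?thesis
    using assms(1) by (simp add: dist_norm norm_minus_commute)
qed

definition indep :: "'n \<Rightarrow> (complex ^ 'n::finite \<Rightarrow> complex) \<Rightarrow> bool" where
  "indep i h \<longleftrightarrow> (\<forall>x z. h (upd i z x) = h x)"

definition restr :: "'n \<Rightarrow> (complex ^ 'n::finite \<Rightarrow> complex) \<Rightarrow> complex ^ 'n \<Rightarrow> complex" where
  "restr i h x = h (upd i 0 x)"

text \<open>On the hyperplane x_i = 0 the value is the limit of the difference quotient, which makes
  the function holomorphic across the hyperplane.\<close>

definition quo :: "'n \<Rightarrow> (complex ^ 'n::finite \<Rightarrow> complex) \<Rightarrow> complex ^ 'n \<Rightarrow> complex" where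
  "quo i h x = (if x $ i = 0 then partial i h x else (h x - h (upd i 0 x)) / x $ i)"

lemma restr_quo: "h x = restr i h x + x $ i * quo i h x"
  by (auto simp: restr_def quo_def) (metis upd_same)

lemma indep_restr_self: "indep i (restr i h)"
  by (simp add: indep_def restr_def)

lemma indep_restr: "indep j h \<Longrightarrow> indep j (restr i h)"
  by (cases "i = j") (auto simp: indep_def restr_def upd_commute[of i j])

lemma holo_germ_restr:
  assumes "holo_germ p h" "p $ i = 0"
  shows "holo_germ p (restr i h)"
proof -
  obtain e where e: "e > 0" "\<And>y. y \<in> ball p e \<Longrightarrow> holo_at h y"
    using assms(1) unfolding holo_germ_iff_ball by blast
  \<comment> \<open>Restriction is written as an integral whose integrand does not depend on the
    parameter, so that \<open>holo_at_integral\<close> applies.\<close>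
  have eq: "(\<chi> j. (if j = i then 0 else 1) * x $ j + 0) = upd i 0 x" for x :: "complex ^ 'a"
    by (simp add: vec_eq_iff)
  have inb: "upd i 0 x \<in> ball p e" if "x \<in> ball p e" for x
    by (rule upd_in_ball) (use that assms(2) in auto)
  have "holo_at (\<lambda>x. integral {0..1} (\<lambda>t::real. h (\<chi> j. (if j = i then 0 else 1) * x $ j + 0) * 1)) y"
    if "y \<in> ball p e" for y
    by (rule holo_at_integral[where q=p and r=e and e=e and p=p], unfold eq)
       (use e that inb in auto)
  moreover have "(\<lambda>x. integral {0..1} (\<lambda>t::real. h (\<chi> j. (if j = i then 0 else 1) * x $ j + 0) * 1)) = restr i h"
    unfolding eq by (simp add: restr_def fun_eq_iff)
  ultimately show ?thesis
    unfolding holo_germ_iff_ball using e(1) by metis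
qed

text \<open>Hadamard's lemma: the quotient is the integral over t in [0, 1] of the i-th partial
  derivative at the point whose i-th coordinate is t x_i. Since p lies on the hyperplane, these
  points stay in the ball around p.\<close>

lemma holo_germ_quo:
  assumes "holo_germ p h" "p $ i = 0"
  shows "holo_germ p (quo i h)"
proof -
  obtain e where e: "e > 0" "\<And>y. y \<in> ball p e \<Longrightarrow> holo_at h y"
    using assms(1) unfolding holo_germ_iff_ball by blast
  have eq: "(\<chi> j. (if j = i then of_real t else 1) * x $ j + 0) = upd i (of_real t * x $ i) x"
    for x :: "complex ^ 'a" and t :: real
    by (simp add: vec_eq_iff)
  have inb: "upd i (of_real t * x $ i) x \<in> ball p e" if "x \<in> ball p e" "t \<in> {0..1}" for x t
    by (rule upd_in_ball) (use that assms(2) in \<open>auto simp: norm_mult intro!: mult_left_le_one_le\<close>)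
  have 1: "holo_at (\<lambda>x. integral {0..1} (\<lambda>t::real. partial i h (\<chi> j. (if j = i then of_real t else 1) * x $ j + 0) * 1)) y"
    if "y \<in> ball p e" for y
  proof (rule holo_at_integral[where q=p and r=e and e=e and p=p])
    show "continuous_on {0..1} (\<lambda>t. if j = i then complex_of_real t else 1)" for j
      by (cases "j = i") (auto intro!: continuous_intros)
    show "(\<chi> j. (if j = i then of_real t else 1) * x $ j + 0) \<in> ball p e"
      if "x \<in> ball p e" "t \<in> {0..1}" for x t
      unfolding eq using that by (rule inb)
  qed (use holo_at_partial[OF e(2)] that in auto)
  have 2: "integral {0..1} (\<lambda>t::real. partial i h (\<chi> j. (if j = i then of_real t else 1) * x $ j + 0) * 1) = quo i h x"
    if x: "x \<in> ball p e" for x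
  proof (cases "x $ i = 0")
    case True
    then have "upd i (of_real t * x $ i) x = x" for t
      using upd_same[of i x] by simp
    then show ?thesis unfolding eq using True by (simp add: quo_def)
  next
    case False
    have "((\<lambda>t. h (upd i (of_real t * x $ i) x)) has_vector_derivative
            x $ i * partial i h (upd i (of_real t * x $ i) x)) (at t within {0..1})"
      if "t \<in> {0..1}" for t
    proof -
      have "upd i 0 x + axis i (of_real t * x $ i) = upd i (of_real t * x $ i) x" for t
        by (simp add: vec_eq_iff axis_def)
      with holo_at_slice[of h "upd i 0 x" i "of_real t * x $ i"] e(2)[OF inb[OF x that]]
      have "((\<lambda>z. h (upd i 0 x + axis i z)) has_field_derivative partial i h (upd i (of_real t * x $ i) x))
          (at (of_real t * x $ i))" by simp
      moreover have "((\<lambda>t. of_real t * x $ i) has_vector_derivative x $ i) (at t within {0..1})"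
        by (auto intro!: derivative_eq_intros simp: has_vector_derivative_def scaleR_conv_of_real)
      ultimately have "((\<lambda>z. h (upd i 0 x + axis i z)) \<circ> (\<lambda>t. of_real t * x $ i) has_vector_derivative
          x $ i * partial i h (upd i (of_real t * x $ i) x)) (at t within {0..1})"
        by (intro field_vector_diff_chain_within) (auto intro: has_field_derivative_at_within)
      moreover have "((\<lambda>z. h (upd i 0 x + axis i z)) \<circ> (\<lambda>t. of_real t * x $ i)) = (\<lambda>t. h (upd i (of_real t * x $ i) x))"
        by (simp add: fun_eq_iff) (metis \<open>\<And>t. upd i 0 x + axis i (of_real t * x $ i) = upd i (of_real t * x $ i) x\<close>)
      ultimately show ?thesis by simp
    qed
    then have "((\<lambda>t. x $ i * partial i h (upd i (of_real t * x $ i) x)) has_integral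
        h (upd i (of_real 1 * x $ i) x) - h (upd i (of_real 0 * x $ i) x)) {0..1}"
      by (intro fundamental_theorem_of_calculus) auto
    from integral_unique[OF this]
    have "x $ i * integral {0..1} (\<lambda>t. partial i h (upd i (of_real t * x $ i) x)) = h x - h (upd i 0 x)"
      by simp
    then show ?thesis unfolding eq using False by (simp add: quo_def field_simps)
  qed
  have "holo_at (quo i h) y" if "y \<in> ball p e" for y
  proof (rule holo_at_cong_ev[OF _ 1[OF that]])
    show "\<forall>\<^sub>F y in nhds y. integral {0..1} (\<lambda>t::real. partial i h (\<chi> j. (if j = i then of_real t else 1) * y $ j + 0) * 1) = quo i h y"
      using eventually_nhds_in_open[OF open_ball that] by (rule eventually_mono) (rule 2)
  qed
  then show ?thesis unfolding holo_germ_iff_ball using e(1) by blast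
qed

section \<open>Identity theorem in several variables\<close>

lemma higher_deriv_sum:
  assumes "\<And>k. k \<in> K \<Longrightarrow> F k holomorphic_on S" "open S" "z \<in> S"
  shows "(deriv ^^ n) (\<lambda>w. \<Sum>k\<in>K. F k w) z = (\<Sum>k\<in>K. (deriv ^^ n) (F k) z)"
  using assms(1)
proof (induction K rule: infinite_finite_induct)
  case (insert k K)
  then show ?case
    using higher_deriv_add[of "F k" S "\<lambda>w. \<Sum>k\<in>K. F k w" z n] assms(2,3)
    by (simp add: holomorphic_on_sum)
qed (simp_all add: higher_deriv_const)

text \<open>On the complex line through p and x the derivatives at p are linear combinations of
  iterated partials of h, so the one-variable identity theorem makes h vanish on a disc of this line
  that contains x.\<close>

lemma holo_zero_if_partials_zero:
  assumes "\<And>y. y \<in> ball p e \<Longrightarrow> holo_at h y" "\<And>is. foldr partial is h p = 0" "x \<in> ball p e"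
  shows "h x = 0"
proof (cases "x = p")
  case True
  then show ?thesis using assms(2)[of "[]"] by simp
next
  case False
  define v where "v = x - p"
  \<comment> \<open>The parameters z with p + z v in the ball form the disc of radius r; as r
    exceeds 1, the value z = 1, which gives x, is covered.\<close>
  define r where "r = e / norm v"
  have v: "norm v > 0" using False by (simp add: v_def)
  then have r: "r > 1" using assms(3) by (simp add: r_def v_def dist_norm norm_minus_commute)
  have inb: "p + z *s v \<in> ball p e" if "z \<in> ball 0 r" for z
  proof -
    have "z *s v = (\<chi> j. z * v $ j)" by (simp add: vec_eq_iff)
    have "norm (z *s v) = norm (norm z *\<^sub>R v)"
      unfolding norm_vec_def by (rule L2_set_cong) (auto simp: norm_mult)
    then show ?thesis using that v by (simp add: r_def dist_norm field_simps)
  qed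
  have deriv: "((\<lambda>z. g (p + z *s v)) has_field_derivative (\<Sum>i\<in>UNIV. v $ i * partial i g (p + z *s v))) (at z)"
    if "\<And>y. y \<in> ball p e \<Longrightarrow> holo_at g y" "z \<in> ball 0 r" for g z
  proof -
    have "linear (\<lambda>z::complex. z *s v)"
      by (rule linearI) (simp_all add: vec_eq_iff algebra_simps)
    then have "((\<lambda>z. z *s v) has_derivative (\<lambda>z. z *s v)) (at z)"
      by (intro bounded_linear_imp_has_derivative) (simp add: linear_conv_bounded_linear)
    then have "((\<lambda>z. p + z *s v) has_derivative (\<lambda>z. z *s v)) (at z)"
      by (auto intro!: derivative_eq_intros)
    from has_derivative_compose[OF this holo_at_has_derivative[OF that(1)[OF inb[OF that(2)]]]]
    have "((\<lambda>x. g (p + x *s v)) has_derivative (\<lambda>x. \<Sum>i\<in>UNIV. (x *s v) $ i * partial i g (p + z *s v))) (at z)" .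
    moreover have "(\<lambda>x. \<Sum>i\<in>UNIV. (x *s v) $ i * partial i g (p + z *s v))
        = (*) (\<Sum>i\<in>UNIV. v $ i * partial i g (p + z *s v))"
      by (simp add: fun_eq_iff sum_distrib_left sum_distrib_right mult_ac)
    ultimately show ?thesis
      unfolding has_field_derivative_def by simp
  qed
  have hol: "(\<lambda>z. g (p + z *s v)) holomorphic_on ball 0 r"
    if "\<And>y. y \<in> ball p e \<Longrightarrow> holo_at g y" for g
    using deriv[OF that] by (auto simp: holomorphic_on_open intro!: exI)
  \<comment> \<open>Stated for every g, since the induction step passes from g to its partial
    derivatives.\<close>
  have "(deriv ^^ n) (\<lambda>z. g (p + z *s v)) 0 = 0"
    if "\<And>y. y \<in> ball p e \<Longrightarrow> holo_at g y" "\<And>is. foldr partial is g p = 0" for g n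
    using that
  proof (induction n arbitrary: g)
    case 0
    then show ?case using "0.prems"(2)[of "[]"] by simp
  next
    case (Suc n)
    have hp: "holo_at (partial i g) y" if "y \<in> ball p e" for i y
      using holo_at_partial[OF Suc.prems(1)] that by blast
    have "\<forall>\<^sub>F z in nhds 0. deriv (\<lambda>z. g (p + z *s v)) z = (\<Sum>i\<in>UNIV. v $ i * partial i g (p + z *s v))"
      using eventually_nhds_in_open[of "ball 0 r" 0] r
      by (auto elim!: eventually_mono intro!: DERIV_imp_deriv deriv[OF Suc.prems(1)])
    then have "(deriv ^^ Suc n) (\<lambda>z. g (p + z *s v)) 0
        = (deriv ^^ n) (\<lambda>z. \<Sum>i\<in>UNIV. v $ i * partial i g (p + z *s v)) 0"
      unfolding funpow_Suc_right o_apply by (rule higher_deriv_cong_ev) simp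
    also have "\<dots> = (\<Sum>i\<in>UNIV. (deriv ^^ n) (\<lambda>z. v $ i * partial i g (p + z *s v)) 0)"
      by (rule higher_deriv_sum[of _ _ "ball 0 r"]) (use r hol[OF hp] in \<open>auto intro!: holomorphic_intros\<close>)
    also have "\<dots> = (\<Sum>i\<in>UNIV. v $ i * (deriv ^^ n) (\<lambda>z. partial i g (p + z *s v)) 0)"
      by (intro sum.cong refl higher_deriv_cmult[of _ "ball 0 r"]) (use r hol[OF hp] in auto)
    also have "\<dots> = 0"
    proof (intro sum.neutral ballI)
      fix i
      have "foldr partial is (partial i g) p = 0" for "is"
        using Suc.prems(2)[of "is @ [i]"] by simp
      then show "v $ i * (deriv ^^ n) (\<lambda>z. partial i g (p + z *s v)) 0 = 0"
        using Suc.IH[OF hp] by simp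
    qed
    finally show ?case .
  qed
  from this[OF assms(1,2)] have "h (p + 1 *s v) = 0"
    using r by (intro holomorphic_fun_eq_0_on_ball[OF hol[OF assms(1)], of 1]) auto
  then show ?thesis by (simp add: v_def)
qed

section \<open>Laurent monomials off the normal crossing divisor\<close>

lemma germ_eq_refl [simp]: "germ_eq f p u u"
  by (simp add: germ_eq_def)

lemma germ_eq_sym: "germ_eq f p u v \<Longrightarrow> germ_eq f p v u"
  unfolding germ_eq_def by (erule eventually_mono) simp

lemma germ_eq_trans: "germ_eq f p u v \<Longrightarrow> germ_eq f p v w \<Longrightarrow> germ_eq f p u w"
  unfolding germ_eq_def by (erule (1) eventually_elim2) simp

lemma germ_eq_trans': "germ_eq f p u v \<Longrightarrow> germ_eq f p u w \<Longrightarrow> germ_eq f p v w"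
  by (rule germ_eq_trans[OF germ_eq_sym])

lemma germ_eq_eventually: "germ_eq f p u v \<Longrightarrow> \<forall>\<^sub>F q in nhds p. germ_eq f q u v"
  unfolding germ_eq_def by (simp add: eventually_eventually)

lemma germ_eqI: "(\<And>x. f x \<noteq> 0 \<Longrightarrow> u x = v x) \<Longrightarrow> germ_eq f p u v"
  unfolding germ_eq_def by (simp add: always_eventually)

lemma germ_eq_lift1:
  "germ_eq f p u v \<Longrightarrow> germ_eq f p (\<lambda>x. F x (u x)) (\<lambda>x. F x (v x))"
  unfolding germ_eq_def by (erule eventually_mono) simp

lemma germ_eq_lift2:
  "germ_eq f p u v \<Longrightarrow> germ_eq f p u' v' \<Longrightarrow> germ_eq f p (\<lambda>x. F x (u x) (u' x)) (\<lambda>x. F x (v x) (v' x))"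
  unfolding germ_eq_def by (erule (1) eventually_elim2) simp

locale normal_crossing =
  fixes a :: "'n::finite \<Rightarrow> nat" and \<alpha> :: rat
  assumes a_nonzero: "\<exists>i. a i \<noteq> 0" and \<alpha>_pos: "\<alpha> > 0"
begin

definition f :: "complex ^ 'n \<Rightarrow> complex" where
  "f x = (\<Prod>i\<in>UNIV. (x $ i) ^ a i)"

definition I :: "'n set" where "I = {i. a i \<noteq> 0}"

definition mon :: "('n \<Rightarrow> int) \<Rightarrow> complex ^ 'n \<Rightarrow> complex" where
  "mon e x = (\<Prod>i\<in>I. (x $ i) powi e i)"

lemma I_iff: "i \<in> I \<longleftrightarrow> 0 < a i"
  by (simp add: I_def)

lemma f_nonzero_iff: "f x \<noteq> 0 \<longleftrightarrow> (\<forall>i\<in>I. x $ i \<noteq> 0)"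
  by (auto simp: f_def I_def)

lemma f_eq_mon: "f x = mon (\<lambda>i. int (a i)) x"
  unfolding f_def mon_def by (rule prod.mono_neutral_cong_right) (auto simp: I_def)

lemma mon_nonzero: "f x \<noteq> 0 \<Longrightarrow> mon e x \<noteq> 0"
  by (simp add: f_nonzero_iff mon_def)

lemma mon_zero [simp]: "mon (\<lambda>_. 0) x = 1"
  by (simp add: mon_def)

lemma mon_add: "f x \<noteq> 0 \<Longrightarrow> mon (\<lambda>i. e i + e' i) x = mon e x * mon e' x"
  by (simp add: f_nonzero_iff mon_def power_int_add prod.distrib)

lemma mon_diff: "f x \<noteq> 0 \<Longrightarrow> mon (\<lambda>i. e i - e' i) x = mon e x / mon e' x"
  by (simp add: f_nonzero_iff mon_def power_int_diff prod_dividef)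

lemma f_power_eq_mon: "f x \<noteq> 0 \<Longrightarrow> f x ^ N = mon (\<lambda>i. int N * int (a i)) x"
  by (induction N) (simp_all add: f_eq_mon mon_add algebra_simps)

lemma mon_cong: "(\<And>i. i \<in> I \<Longrightarrow> e i = e' i) \<Longrightarrow> mon e x = mon e' x"
  by (simp add: mon_def)

lemma mon_lower: "i \<in> I \<Longrightarrow> x $ i \<noteq> 0 \<Longrightarrow> mon (e(i := e i - 1)) x = mon e x / x $ i"
proof -
  assume *: "i \<in> I" "x $ i \<noteq> 0"
  have "mon (e(i := e i - 1)) x = x $ i powi (e i - 1) * (\<Prod>j\<in>I - {i}. (x $ j) powi e j)"
    unfolding mon_def using * by (subst prod.remove[of _ i]) (auto intro!: prod.cong)
  also have "\<dots> = mon e x / x $ i"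
    unfolding mon_def using * by (subst (2) prod.remove[of _ i]) (auto simp: power_int_diff)
  finally show ?thesis .
qed

lemma holo_germ_powi: "0 \<le> k \<or> p $ i \<noteq> 0 \<Longrightarrow> holo_germ p (\<lambda>x. (x $ i) powi k)"
  unfolding power_int_def by (cases "0 \<le> k") (auto intro!: holo_germ_power holo_germ_inverse)

lemma holo_germ_mon: "(\<And>i. i \<in> I \<Longrightarrow> 0 \<le> e i \<or> p $ i \<noteq> 0) \<Longrightarrow> holo_germ p (mon e)"
  unfolding mon_def by (intro holo_germ_prod holo_germ_powi)

lemma holo_germ_f: "holo_germ p f"
  unfolding f_def by (intro holo_germ_prod holo_germ_power holo_germ_coord)

lemma eventually_f_nonzero: "f q \<noteq> 0 \<Longrightarrow> \<forall>\<^sub>F x in nhds q. f x \<noteq> 0"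
  by (rule isCont_eventually_nonzero[OF holo_germ_isCont[OF holo_germ_f]])

lemma germ_eq_off: "germ_eq f q u v \<Longrightarrow> f q \<noteq> 0 \<Longrightarrow> \<forall>\<^sub>F x in nhds q. u x = v x"
  unfolding germ_eq_def using eventually_f_nonzero[of q] by (auto elim: eventually_elim2)

lemma holo_at_mon: "f q \<noteq> 0 \<Longrightarrow> holo_at (mon e) q"
  using holo_germ_mon[of e q] unfolding holo_germ_iff f_nonzero_iff
  by (blast intro: eventually_nhds_x_imp_x)

lemma partial_mon:
  assumes "f q \<noteq> 0"
  shows "partial i (mon e) q = (if i \<in> I then of_int (e i) / q $ i * mon e q else 0)"
proof (cases "i \<in> I")
  case False
  then have "mon e (q + axis i z) = mon e q" for z
    unfolding mon_def by (intro prod.cong) (auto simp: axis_def)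
  then show ?thesis using False by (simp add: partial_def)
next
  case True
  then have nz: "q $ i \<noteq> 0" using assms by (simp add: f_nonzero_iff)
  have eq: "mon e (q + axis i z) = (q $ i + z) powi e i * (\<Prod>j\<in>I - {i}. (q $ j) powi e j)" for z
    unfolding mon_def using True by (subst prod.remove[of _ i]) (auto simp: axis_def intro!: prod.cong)
  have "((\<lambda>z. (q $ i + z) powi e i * (\<Prod>j\<in>I - {i}. (q $ j) powi e j)) has_field_derivative
      (of_int (e i) * (q $ i + 0) powi (e i - 1)) * (\<Prod>j\<in>I - {i}. (q $ j) powi e j)) (at 0)"
    using nz by (auto intro!: derivative_eq_intros)
  then have "partial i (mon e) q = (of_int (e i) * (q $ i + 0) powi (e i - 1)) * (\<Prod>j\<in>I - {i}. (q $ j) powi e j)"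
    unfolding partial_def eq by (rule DERIV_imp_deriv)
  also have "\<dots> = of_int (e i) / q $ i * mon e q"
    using nz eq[of 0] by (simp add: power_int_diff)
  finally show ?thesis using True by simp
qed

lemma partial_f: "f q \<noteq> 0 \<Longrightarrow> partial i f q = of_nat (a i) / q $ i * f q"
proof -
  assume "f q \<noteq> 0"
  moreover have "f = mon (\<lambda>i. int (a i))" by (rule ext) (rule f_eq_mon)
  ultimately show ?thesis using partial_mon[of q i "\<lambda>i. int (a i)"] by (auto simp: I_def)
qed

lemma germ_eq_partial:
  fixes u v :: "complex ^ 'n \<Rightarrow> complex"
  assumes "germ_eq f p u v"
  shows "germ_eq f p (partial i u) (partial i v)"
proof -
  have "\<forall>\<^sub>F q in nhds p. f q \<noteq> 0 \<longrightarrow> partial i u q = partial i v q"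
    using germ_eq_eventually[OF assms]
    by (rule eventually_mono) (blast intro: partial_cong_ev germ_eq_off)
  then show ?thesis unfolding germ_eq_def .
qed

text \<open>Density of the complement of the divisor: on the diagonal line through p each coordinate
  in I vanishes for only one parameter, so all small nonzero parameters avoid the divisor.\<close>

lemma exists_off:
  assumes "\<forall>\<^sub>F x in nhds p. P x"
  shows "\<exists>x. f x \<noteq> 0 \<and> P x"
proof -
  define g :: "complex \<Rightarrow> complex ^ 'n" where "g z = p + (\<chi> i. z)" for z
  have "isCont g 0" unfolding g_def isCont_def by (intro tendsto_intros)
  then have "(g \<longlongrightarrow> g 0) (at 0)" by (simp add: isCont_def)
  moreover have "g 0 = p" by (simp add: g_def vec_eq_iff)
  ultimately have "\<forall>\<^sub>F z in at 0. P (g z)"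
    using assms by (metis eventually_compose_filterlim)
  moreover have "\<forall>\<^sub>F z in at 0. \<forall>i\<in>I. z \<noteq> - (p $ i)"
  proof (rule eventually_ball_finite)
    show "\<forall>i\<in>I. \<forall>\<^sub>F z in at 0. z \<noteq> - (p $ i)"
    proof
      fix i
      have "\<forall>\<^sub>F z in at 0. z \<noteq> - (p $ i) \<or> z = 0"
        by (cases "p $ i = 0") (auto intro!: tendsto_imp_eventually_ne[OF tendsto_ident_at] elim: eventually_mono)
      moreover have "\<forall>\<^sub>F z in at 0. z \<noteq> (0::complex)"
        by (simp add: eventually_at_filter)
      ultimately show "\<forall>\<^sub>F z in at 0. z \<noteq> - (p $ i)"
        by (rule eventually_elim2) auto
    qed
  qed simp
  ultimately have "\<forall>\<^sub>F z in at 0. P (g z) \<and> (\<forall>i\<in>I. z \<noteq> - (p $ i))"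
    by (rule eventually_conj)
  then obtain z where "P (g z)" "\<forall>i\<in>I. z \<noteq> - (p $ i)"
    using eventually_happens[of _ "at (0::complex)"] by (auto simp: trivial_limit_at)
  then show ?thesis
    by (auto simp: f_nonzero_iff g_def add_eq_0_iff2 intro!: exI[of _ "g z"])
qed

section \<open>Modules spanned by Laurent monomials\<close>

text \<open>The stalk at p of the O-module generated by the monomials with exponents in E, as a set
  of representatives closed under \<open>germ_eq\<close>.\<close>

definition Msp :: "('n \<Rightarrow> int) set \<Rightarrow> complex ^ 'n \<Rightarrow> (complex ^ 'n \<Rightarrow> complex) set" where
  "Msp E p = {g. \<exists>S H. finite S \<and> S \<subseteq> E \<and> (\<forall>e\<in>S. holo_germ p (H e)) \<and>
                germ_eq f p g (\<lambda>x. \<Sum>e\<in>S. H e x * mon e x)}"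

lemma Msp_mon_mult: "e \<in> E \<Longrightarrow> holo_germ p h \<Longrightarrow> (\<lambda>x. h x * mon e x) \<in> Msp E p"
  unfolding Msp_def by (intro CollectI exI[of _ "{e}"] exI[of _ "\<lambda>_. h"]) simp

lemma Msp_mon: "e \<in> E \<Longrightarrow> mon e \<in> Msp E p"
  using Msp_mon_mult[of e E p "\<lambda>_. 1"] by simp

lemma Msp_cong: "g \<in> Msp E p \<Longrightarrow> germ_eq f p g g' \<Longrightarrow> g' \<in> Msp E p"
  unfolding Msp_def using germ_eq_trans'[of f p g g'] by blast

lemma Msp_zero: "(\<lambda>_. 0) \<in> Msp E p"
  unfolding Msp_def by (intro CollectI exI[of _ "{}"]) simp

lemma Msp_add:
  assumes "g \<in> Msp E p" "g' \<in> Msp E p"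
  shows "(\<lambda>x. g x + g' x) \<in> Msp E p"
proof -
  obtain S H where S: "finite S" "S \<subseteq> E" "\<And>e. e \<in> S \<Longrightarrow> holo_germ p (H e)"
      "germ_eq f p g (\<lambda>x. \<Sum>e\<in>S. H e x * mon e x)"
    using assms(1) unfolding Msp_def by blast
  obtain S' H' where S': "finite S'" "S' \<subseteq> E" "\<And>e. e \<in> S' \<Longrightarrow> holo_germ p (H' e)"
      "germ_eq f p g' (\<lambda>x. \<Sum>e\<in>S'. H' e x * mon e x)"
    using assms(2) unfolding Msp_def by blast
  define K where "K e x = (if e \<in> S then H e x else 0) + (if e \<in> S' then H' e x else 0)" for e x
  have "holo_germ p (K e)" for e
    unfolding K_def by (cases "e \<in> S"; cases "e \<in> S'") (auto intro!: holo_germ_add S(3) S'(3))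
  moreover have "(\<Sum>e\<in>S. H e x * mon e x) + (\<Sum>e\<in>S'. H' e x * mon e x) = (\<Sum>e\<in>S \<union> S'. K e x * mon e x)" for x
  proof -
    have "(\<Sum>e\<in>S. H e x * mon e x) = (\<Sum>e\<in>S \<union> S'. (if e \<in> S then H e x else 0) * mon e x)"
      by (rule sum.mono_neutral_cong_left) (use S S' in auto)
    moreover have "(\<Sum>e\<in>S'. H' e x * mon e x) = (\<Sum>e\<in>S \<union> S'. (if e \<in> S' then H' e x else 0) * mon e x)"
      by (rule sum.mono_neutral_cong_left) (use S S' in auto)
    ultimately show ?thesis by (simp only: K_def sum.distrib distrib_right)
  qed
  ultimately show ?thesis
    unfolding Msp_def using S S' germ_eq_lift2[OF S(4) S'(4), of "\<lambda>_. (+)"]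
    by (intro CollectI exI[of _ "S \<union> S'"] exI[of _ K]) auto
qed

lemma Msp_holo_mult:
  assumes "g \<in> Msp E p" "holo_germ p h"
  shows "(\<lambda>x. h x * g x) \<in> Msp E p"
proof -
  obtain S H where S: "finite S" "S \<subseteq> E" "\<And>e. e \<in> S \<Longrightarrow> holo_germ p (H e)"
      "germ_eq f p g (\<lambda>x. \<Sum>e\<in>S. H e x * mon e x)"
    using assms(1) unfolding Msp_def by blast
  have "germ_eq f p (\<lambda>x. h x * g x) (\<lambda>x. \<Sum>e\<in>S. (h x * H e x) * mon e x)"
    using germ_eq_lift1[OF S(4), of "\<lambda>x y. h x * y"] by (simp add: sum_distrib_left mult.assoc)
  then show ?thesis
    unfolding Msp_def using S assms(2)
    by (intro CollectI exI[of _ S] exI[of _ "\<lambda>e x. h x * H e x"]) (auto intro: holo_germ_mult)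
qed

lemma Msp_const_mult: "g \<in> Msp E p \<Longrightarrow> (\<lambda>x. c * g x) \<in> Msp E p"
  by (rule Msp_holo_mult) simp_all

lemma Msp_minus: "g \<in> Msp E p \<Longrightarrow> (\<lambda>x. - g x) \<in> Msp E p"
  using Msp_const_mult[of g E p "-1"] by simp

lemma Msp_diff: "g \<in> Msp E p \<Longrightarrow> g' \<in> Msp E p \<Longrightarrow> (\<lambda>x. g x - g' x) \<in> Msp E p"
  using Msp_add[OF _ Msp_minus] by fastforce

lemma Msp_sum: "(\<And>k. k \<in> K \<Longrightarrow> g k \<in> Msp E p) \<Longrightarrow> (\<lambda>x. \<Sum>k\<in>K. g k x) \<in> Msp E p"
  by (induction K rule: infinite_finite_induct) (auto intro: Msp_zero Msp_add)

lemma Msp_induct [consumes 1, case_names mon zero add cong]: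
  assumes "g \<in> Msp E p"
    and "\<And>e h. e \<in> E \<Longrightarrow> holo_germ p h \<Longrightarrow> P (\<lambda>x. h x * mon e x)"
    and "P (\<lambda>_. 0)"
    and "\<And>u v. P u \<Longrightarrow> P v \<Longrightarrow> P (\<lambda>x. u x + v x)"
    and "\<And>u v. P u \<Longrightarrow> germ_eq f p u v \<Longrightarrow> P v"
  shows "P g"
proof -
  obtain S H where S: "finite S" "S \<subseteq> E" "\<And>e. e \<in> S \<Longrightarrow> holo_germ p (H e)"
      "germ_eq f p g (\<lambda>x. \<Sum>e\<in>S. H e x * mon e x)"
    using assms(1) unfolding Msp_def by blast
  from S(1-3) have "P (\<lambda>x. \<Sum>e\<in>S. H e x * mon e x)"
    by (induction S) (use assms(2-4) in auto)
  then show ?thesis using assms(5) germ_eq_sym[OF S(4)] by blast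
qed

lemma Msp_mono: "E \<subseteq> E' \<Longrightarrow> Msp E p \<subseteq> Msp E' p"
  unfolding Msp_def by blast

lemma Msp_eventually: "g \<in> Msp E p \<Longrightarrow> \<forall>\<^sub>F q in nhds p. g \<in> Msp E q"
proof -
  assume "g \<in> Msp E p"
  then obtain S H where S: "finite S" "S \<subseteq> E" "\<And>e. e \<in> S \<Longrightarrow> holo_germ p (H e)"
      "germ_eq f p g (\<lambda>x. \<Sum>e\<in>S. H e x * mon e x)"
    unfolding Msp_def by blast
  have "\<forall>\<^sub>F q in nhds p. \<forall>e\<in>S. holo_germ q (H e)"
    using S(1,3) holo_germ_eventually by (intro eventually_ball_finite) auto
  then show ?thesis
    using germ_eq_eventually[OF S(4)]
  proof (rule eventually_elim2)
    fix q assume "\<forall>e\<in>S. holo_germ q (H e)" "germ_eq f q g (\<lambda>x. \<Sum>e\<in>S. H e x * mon e x)"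
    then show "g \<in> Msp E q" unfolding Msp_def using S(1,2) by blast
  qed
qed

lemma Msp_mon_shift:
  assumes "g \<in> Msp E p" "\<And>e. e \<in> E \<Longrightarrow> (\<lambda>i. c i + e i) \<in> E'"
  shows "(\<lambda>x. mon c x * g x) \<in> Msp E' p"
  using assms(1)
proof (induction g rule: Msp_induct)
  case (mon e h)
  have "germ_eq f p (\<lambda>x. h x * mon (\<lambda>i. c i + e i) x) (\<lambda>x. mon c x * (h x * mon e x))"
    by (rule germ_eqI) (simp add: mon_add)
  then show ?case using Msp_mon_mult[OF assms(2)[OF mon(1)] mon(2)] Msp_cong by blast
next
  case (add u v)
  then show ?case using Msp_add by (auto simp: distrib_left)
next
  case (cong u v)
  then show ?case using germ_eq_lift1[OF cong(2), of "\<lambda>x y. mon c x * y"] by (blast intro: Msp_cong)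
qed (simp add: Msp_zero)

text \<open>Coordinates that do not vanish at p are units there, so exponents need to be compared
  only at the coordinates that vanish at p.\<close>

lemma Msp_subset:
  assumes "g \<in> Msp E p" "\<And>e. e \<in> E \<Longrightarrow> \<exists>e'\<in>E'. \<forall>i\<in>I. p $ i = 0 \<longrightarrow> e' i \<le> e i"
  shows "g \<in> Msp E' p"
  using assms(1)
proof (induction rule: Msp_induct)
  case (mon e h)
  then obtain e' where e': "e' \<in> E'" "\<forall>i\<in>I. p $ i = 0 \<longrightarrow> e' i \<le> e i" using assms(2) by blast
  have "holo_germ p (\<lambda>x. h x * mon (\<lambda>i. e i - e' i) x)"
    by (intro holo_germ_mult mon(2) holo_germ_mon) (use e'(2) in force)
  from Msp_mon_mult[OF e'(1) this]
  show ?case by (rule Msp_cong) (auto intro!: germ_eqI simp: mon_diff mon_nonzero)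
next
  case (add u v)
  then show ?case by (rule Msp_add)
next
  case (cong u v)
  then show ?case by (rule Msp_cong)
qed (rule Msp_zero)

lemma Msp_UNIV: "Msp UNIV p = mero_module f p"
proof (intro equalityI subsetI)
  fix g assume "g \<in> Msp UNIV p"
  then show "g \<in> mero_module f p"
  proof (induction rule: Msp_induct)
    case (mon e h)
    \<comment> \<open>Any bound for the pole orders works: each a_i with i in I is at least 1, so
      f^N clears a pole of order up to N in every coordinate.\<close>
    define N where "N = nat (\<Sum>i\<in>UNIV. \<bar>e i\<bar>)"
    have "- e i \<le> int N * int (a i)" if "i \<in> I" for i
    proof -
      have "- e i \<le> \<bar>e i\<bar>" by simp
      also have "\<dots> \<le> (\<Sum>i\<in>UNIV. \<bar>e i\<bar>)" by (rule member_le_sum) auto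
      also have "\<dots> = int N" by (simp add: N_def sum_nonneg)
      also have "\<dots> \<le> int N * int (a i)" using that by (simp add: I_iff mult_le_cancel_left1)
      finally show ?thesis .
    qed
    then have "holo_germ p (mon (\<lambda>i. e i + int N * int (a i)))"
      by (intro holo_germ_mon) force
    then have "holo_germ p (\<lambda>x. h x * mon (\<lambda>i. e i + int N * int (a i)) x)"
      using mon(2) by (rule holo_germ_mult[rotated])
    moreover have "germ_eq f p (\<lambda>x. h x * mon e x) (\<lambda>x. h x * mon (\<lambda>i. e i + int N * int (a i)) x / f x ^ N)"
      by (rule germ_eqI) (simp add: f_power_eq_mon mon_add mon_nonzero)
    ultimately show ?case unfolding mero_module_def by blast
  next
    case zero
    show ?case unfolding mero_module_def by (intro CollectI exI[of _ "\<lambda>_. 0"]) simp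
  next
    case (add u v)
    then obtain h N h' N' where *: "holo_germ p h" "germ_eq f p u (\<lambda>x. h x / f x ^ N)"
      "holo_germ p h'" "germ_eq f p v (\<lambda>x. h' x / f x ^ N')" unfolding mero_module_def by blast
    have "holo_germ p (\<lambda>x. h x * f x ^ N' + h' x * f x ^ N)"
      by (intro holo_germ_add holo_germ_mult holo_germ_power holo_germ_f *)
    moreover have "germ_eq f p (\<lambda>x. h x / f x ^ N + h' x / f x ^ N') (\<lambda>x. (h x * f x ^ N' + h' x * f x ^ N) / f x ^ (N + N'))"
      by (rule germ_eqI) (simp add: power_add field_simps)
    then have "germ_eq f p (\<lambda>x. u x + v x) (\<lambda>x. (h x * f x ^ N' + h' x * f x ^ N) / f x ^ (N + N'))"
      using germ_eq_trans[OF germ_eq_lift2[OF *(2,4), of "\<lambda>_. (+)"]] by blast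
    ultimately show ?case unfolding mero_module_def
      by (intro CollectI exI[of _ "\<lambda>x. h x * f x ^ N' + h' x * f x ^ N"] exI[of _ "N + N'"]) simp
  next
    case (cong u v)
    then show ?case unfolding mero_module_def using germ_eq_trans'[OF cong(2)] by blast
  qed
next
  fix g assume "g \<in> mero_module f p"
  then obtain h N where h: "holo_germ p h" "germ_eq f p g (\<lambda>x. h x / f x ^ N)"
    unfolding mero_module_def by blast
  have "germ_eq f p (\<lambda>x. h x * mon (\<lambda>i. - (int N * int (a i))) x) (\<lambda>x. h x / f x ^ N)"
    using mon_diff[of _ "\<lambda>_. 0" "\<lambda>i. int N * int (a i)"] by (intro germ_eqI) (simp add: f_power_eq_mon)
  then show "g \<in> Msp UNIV p"
    by (intro Msp_cong[OF Msp_mon_mult[OF UNIV_I h(1)]] germ_eq_trans[OF _ germ_eq_sym[OF h(2)]])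
qed

lemma mero_eq: "mero_module f = Msp UNIV"
  by (rule ext) (simp add: Msp_UNIV)

lemma Msp_holo_at:
  assumes "g \<in> Msp E p"
  shows "\<forall>\<^sub>F q in nhds p. f q \<noteq> 0 \<longrightarrow> holo_germ q g"
  using assms
proof (induction rule: Msp_induct)
  case (mon e h)
  from holo_germ_eventually[OF mon(2)] show ?case
  proof (rule eventually_mono, intro impI holo_germ_mult)
    show "holo_germ q (mon e)" if "f q \<noteq> 0" for q
      by (rule holo_germ_mon) (use that in \<open>auto simp: f_nonzero_iff\<close>)
  qed
next
  case (add u v)
  then show ?case
    by (rule eventually_elim2) (simp add: holo_germ_add)
next
  case (cong u v)
  from cong(1) germ_eq_eventually[OF cong(2)] show ?case
  proof (rule eventually_elim2, intro impI)
    fix q assume "f q \<noteq> 0 \<longrightarrow> holo_germ q u" "germ_eq f q u v" "f q \<noteq> 0"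
    then show "holo_germ q v" using holo_germ_cong_ev[OF germ_eq_off] by simp
  qed
qed simp

lemma Msp_holo_at': "g \<in> Msp E p \<Longrightarrow> \<forall>\<^sub>F q in nhds p. f q \<noteq> 0 \<longrightarrow> holo_at g q"
  by (drule Msp_holo_at, erule eventually_mono) (auto simp: holo_germ_iff dest: eventually_nhds_x_imp_x)

lemma Msp_empty: "Msp {} p = zero_stalk f p"
  unfolding Msp_def zero_stalk_def by auto

section \<open>Twisted derivatives and the pole count\<close>

text \<open>The derivative on u f^(-beta), with the logarithmic derivative of the monomial f written
  out. The exponent beta varies because the Taylor coefficients of a graph section at s = -delta
  transform with beta = delta + alpha, see \<open>jet_dx_germ\<close>.\<close>

definition tw :: "rat \<Rightarrow> 'n \<Rightarrow> (complex ^ 'n \<Rightarrow> complex) \<Rightarrow> complex ^ 'n \<Rightarrow> complex" where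
  "tw \<beta> i g x = partial i g x - of_rat \<beta> * (of_nat (a i) / x $ i) * g x"

lemma germ_eq_tw: "germ_eq f p u v \<Longrightarrow> germ_eq f p (tw \<beta> i u) (tw \<beta> i v)"
  unfolding tw_def
  using germ_eq_lift2[OF germ_eq_partial, of p u v u v "\<lambda>x y z. y - of_rat \<beta> * (of_nat (a i) / x $ i) * z" i] by simp

lemma germ_eq_nabla_tw: "germ_eq f p (nabla f \<alpha> i u) (tw \<alpha> i u)"
  by (rule germ_eqI) (simp add: nabla_def tw_def partial_f)

lemma germ_eq_nabla: "germ_eq f p u v \<Longrightarrow> germ_eq f p (nabla f \<alpha> i u) (nabla f \<alpha> i v)"
  by (rule germ_eq_trans[OF germ_eq_nabla_tw germ_eq_trans[OF germ_eq_tw germ_eq_sym[OF germ_eq_nabla_tw]]])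

lemma tw_add:
  "holo_at u x \<Longrightarrow> holo_at v x \<Longrightarrow> tw \<beta> i (\<lambda>x. u x + v x) x = tw \<beta> i u x + tw \<beta> i v x"
  by (simp add: tw_def holo_at_add distrib_left)

lemma tw_holo_mon:
  assumes "holo_germ p h"
  shows "germ_eq f p (tw \<beta> i (\<lambda>x. h x * mon e x))
    (\<lambda>x. partial i h x * mon e x +
       (if i \<in> I then ((of_int (e i) - of_rat \<beta> * of_nat (a i)) * h x) * mon (e(i := e i - 1)) x else 0))"
proof -
  have "\<forall>\<^sub>F x in nhds p. holo_at h x" using assms by (simp add: holo_germ_iff)
  then show ?thesis
    unfolding germ_eq_def
  proof (rule eventually_mono, intro impI)
    fix x assume x: "holo_at h x" "f x \<noteq> 0"
    show "tw \<beta> i (\<lambda>x. h x * mon e x) x = partial i h x * mon e x +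
       (if i \<in> I then ((of_int (e i) - of_rat \<beta> * of_nat (a i)) * h x) * mon (e(i := e i - 1)) x else 0)"
    proof (cases "i \<in> I")
      case True
      then have "x $ i \<noteq> 0" using x(2) by (simp add: f_nonzero_iff)
      then show ?thesis using True x
        by (simp add: tw_def holo_at_mult holo_at_mon partial_mon mon_lower field_simps)
    next
      case False
      then have "a i = 0" by (simp add: I_def)
      then show ?thesis using False x
        by (simp add: tw_def holo_at_mult holo_at_mon partial_mon)
    qed
  qed
qed

lemma Msp_tw:
  assumes "g \<in> Msp E p" "E \<subseteq> E'"
    and "\<And>e. e \<in> E \<Longrightarrow> i \<in> I \<Longrightarrow> of_int (e i) \<noteq> \<beta> * of_nat (a i) \<Longrightarrow> e(i := e i - 1) \<in> E'"
  shows "tw \<beta> i g \<in> Msp E' p"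
proof -
  \<comment> \<open>Membership of g is carried through the induction: additivity of
    \<open>tw\<close> needs summands that are holomorphic off the divisor, and membership provides
    this.\<close>
  have "tw \<beta> i g \<in> Msp E' p \<and> g \<in> Msp E' p"
    using assms(1)
  proof (induction rule: Msp_induct)
    case (mon e h)
    have 1: "(\<lambda>x. partial i h x * mon e x) \<in> Msp E' p"
      using mon assms(2) by (intro Msp_mon_mult holo_germ_partial) auto
    have 2: "(\<lambda>x. if i \<in> I then ((of_int (e i) - of_rat \<beta> * of_nat (a i)) * h x) * mon (e(i := e i - 1)) x else 0) \<in> Msp E' p"
    proof (cases "i \<in> I")
      case True
      show ?thesis
      \<comment> \<open>When e_i = beta a_i the lowered monomial has coefficient zero, so the
        hypothesis on E' is not asked for it.\<close>
      proof (cases "of_int (e i) = \<beta> * of_nat (a i)")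
        case True
        then have "of_rat (of_int (e i)) = (of_rat (\<beta> * of_nat (a i)) :: complex)" by (rule arg_cong)
        then have "of_int (e i) - of_rat \<beta> * of_nat (a i) = (0::complex)" by (simp add: of_rat_mult)
        then show ?thesis by (simp only: mult_zero_left if_cancel) (rule Msp_zero)
      next
        case False
        then show ?thesis using mon \<open>i \<in> I\<close> assms(3)
          by (auto intro!: Msp_mon_mult holo_germ_mult)
      qed
    qed (simp add: Msp_zero)
    show ?case
      using Msp_cong[OF Msp_add[OF 1 2] germ_eq_sym[OF tw_holo_mon[OF mon(2)]]] mon assms(2)
      by (auto intro: Msp_mon_mult)
  next
    case zero
    have "tw \<beta> i (\<lambda>_. 0) = (\<lambda>_. 0)" by (simp add: tw_def fun_eq_iff)
    then show ?case by (simp add: Msp_zero)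
  next
    case (add u v)
    from add have uv: "u \<in> Msp E' p" "v \<in> Msp E' p" by auto
    have "\<forall>\<^sub>F q in nhds p. f q \<noteq> 0 \<longrightarrow> tw \<beta> i (\<lambda>x. u x + v x) q = tw \<beta> i u q + tw \<beta> i v q"
      using Msp_holo_at'[OF uv(1)] Msp_holo_at'[OF uv(2)] by (rule eventually_elim2) (auto simp: tw_add)
    then have "germ_eq f p (\<lambda>x. tw \<beta> i u x + tw \<beta> i v x) (tw \<beta> i (\<lambda>x. u x + v x))"
      by (subst germ_eq_def, elim eventually_mono) simp
    moreover have "(\<lambda>x. tw \<beta> i u x + tw \<beta> i v x) \<in> Msp E' p"
      using add by (intro Msp_add) auto
    ultimately have "tw \<beta> i (\<lambda>x. u x + v x) \<in> Msp E' p" by (rule Msp_cong[rotated])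
    then show ?case using Msp_add[OF uv] by simp
  next
    case (cong u v)
    then show ?case using Msp_cong[OF _ germ_eq_tw[OF cong(2)]] Msp_cong[OF _ cong(2)] by simp
  qed
  then show ?thesis ..
qed

definition poles :: "rat \<Rightarrow> ('n \<Rightarrow> int) \<Rightarrow> nat" where
  "poles \<beta> e = card {i \<in> I. \<beta> * of_nat (a i) \<in> \<int> \<and> of_int (e i) < \<beta> * of_nat (a i)}"

definition Wt :: "rat \<Rightarrow> int \<Rightarrow> complex ^ 'n \<Rightarrow> (complex ^ 'n \<Rightarrow> complex) set" where
  "Wt \<beta> j = Msp {e. int (poles \<beta> e) \<le> j}"

lemma poles_le_card: "poles \<beta> e \<le> CARD('n)"
  unfolding poles_def by (rule card_mono) auto

lemma Wt_mono: "j \<le> k \<Longrightarrow> Wt \<beta> j p \<subseteq> Wt \<beta> k p"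
  unfolding Wt_def by (rule Msp_mono) auto

lemma Wt_subset_mero: "Wt \<beta> j p \<subseteq> mero_module f p"
  unfolding Wt_def mero_eq by (rule Msp_mono) simp

lemma Wt_top: "j \<ge> int CARD('n) \<Longrightarrow> Wt \<beta> j = mero_module f"
proof -
  assume "j \<ge> int CARD('n)"
  then have "{e. int (poles \<beta> e) \<le> j} = UNIV"
    using poles_le_card[of \<beta>] by (auto intro: order_trans[of _ "int CARD('n)"])
  then show ?thesis by (simp add: Wt_def mero_eq)
qed

lemma Wt_neg: "j < 0 \<Longrightarrow> Wt \<beta> j = zero_stalk f"
  by (rule ext) (simp add: Wt_def Msp_empty)

lemma Wt_noncritical:
  assumes "\<And>i. i \<in> I \<Longrightarrow> \<beta> * of_nat (a i) \<notin> \<int>" "0 \<le> j"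
  shows "Wt \<beta> j = mero_module f"
proof -
  have "poles \<beta> e = 0" for e
  proof -
    have "{i \<in> I. \<beta> * of_nat (a i) \<in> \<int> \<and> of_int (e i) < \<beta> * of_nat (a i)} = {}" using assms(1) by auto
    then show ?thesis unfolding poles_def by simp
  qed
  then show ?thesis using assms(2) by (simp add: Wt_def mero_eq)
qed

text \<open>Lowering e_i can create a pole only when e_i = beta a_i, and exactly then the
  coefficient of the lowered monomial vanishes.\<close>

lemma Wt_tw: "g \<in> Wt \<beta> j p \<Longrightarrow> tw \<beta> i g \<in> Wt \<beta> j p"
  unfolding Wt_def
proof (erule Msp_tw)
  fix e assume e: "e \<in> {e. int (poles \<beta> e) \<le> j}" and ne: "of_int (e i) \<noteq> \<beta> * of_nat (a i)"
  have "of_int (e i - 1) < \<beta> * of_nat (a i) \<longleftrightarrow> of_int (e i) < \<beta> * of_nat (a i)"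
    if int: "\<beta> * of_nat (a i) \<in> \<int>"
  proof -
    obtain k where "\<beta> * of_nat (a i) = of_int k" using int unfolding Ints_def by blast
    with ne show ?thesis by (auto simp del: of_int_diff)
  qed
  then have "{k \<in> I. \<beta> * of_nat (a k) \<in> \<int> \<and> of_int ((e(i := e i - 1)) k) < \<beta> * of_nat (a k)}
      = {k \<in> I. \<beta> * of_nat (a k) \<in> \<int> \<and> of_int (e k) < \<beta> * of_nat (a k)}"
    by (auto split: if_splits simp del: of_int_diff)
  then have "poles \<beta> (e(i := e i - 1)) = poles \<beta> e" unfolding poles_def by simp
  then show "e(i := e i - 1) \<in> {e. int (poles \<beta> e) \<le> j}" using e by simp
qed simp

lemma poles_lower: "poles \<beta> (e(i := e i - 1)) \<le> Suc (poles \<beta> e)"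
proof -
  have "poles \<beta> (e(i := e i - 1)) \<le> card (insert i {k \<in> I. \<beta> * of_nat (a k) \<in> \<int> \<and> of_int (e k) < \<beta> * of_nat (a k)})"
    unfolding poles_def by (rule card_mono) (auto split: if_splits)
  also have "\<dots> \<le> Suc (poles \<beta> e)"
    unfolding poles_def by (rule card_insert_le_m1) simp_all
  finally show ?thesis .
qed

text \<open>Division by x_i creates at most one new pole. The factor a_i / x_i occurs in
  \<open>jet_dx_germ\<close> together with a Taylor coefficient of index one lower, which
  compensates for it.\<close>

lemma Wt_div_coord: "g \<in> Wt \<beta> (j - 1) p \<Longrightarrow> (\<lambda>x. of_nat (a i) / x $ i * g x) \<in> Wt \<beta> j p"
proof (cases "i \<in> I")
  case True
  assume g: "g \<in> Wt \<beta> (j - 1) p"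
  have "(\<lambda>x. mon (\<lambda>k. if k = i then -1 else 0) x * g x) \<in> Wt \<beta> j p"
    using g unfolding Wt_def
  proof (rule Msp_mon_shift)
    fix e assume e: "e \<in> {e. int (poles \<beta> e) \<le> j - 1}"
    have "(\<lambda>k. (if k = i then -1 else 0) + e k) = e(i := e i - 1)" by (auto simp: fun_eq_iff)
    then show "(\<lambda>k. (if k = i then -1 else 0) + e k) \<in> {e. int (poles \<beta> e) \<le> j}"
      using poles_lower[of \<beta> e i] e by simp
  qed
  from Msp_const_mult[OF this[unfolded Wt_def], of "of_nat (a i)"]
  show ?thesis unfolding Wt_def
  proof (rule Msp_cong, intro germ_eqI)
    fix x assume x: "f x \<noteq> 0"
    have "mon (\<lambda>k. if k = i then -1 else 0) x = 1 / x $ i"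
      using mon_lower[of i x "\<lambda>_. 0"] True x by (simp add: f_nonzero_iff fun_upd_def)
    then show "of_nat (a i) * (mon (\<lambda>k. if k = i then -1 else 0) x * g x) = of_nat (a i) / x $ i * g x"
      by simp
  qed
qed (simp add: I_def Wt_def Msp_zero)

text \<open>Multiplication by f^k raises both e_i and beta a_i by k a_i, so their comparison is
  unaffected.\<close>

lemma poles_shift: "poles (\<beta> + of_int k) (\<lambda>i. k * int (a i) + e i) = poles \<beta> e"
proof -
  have "(\<beta> + of_int k) * of_nat (a i) = \<beta> * of_nat (a i) + of_int (k * int (a i))" for i
    by (simp add: algebra_simps)
  moreover have "\<beta> * of_nat (a i) + of_int (k * int (a i)) \<in> \<int> \<longleftrightarrow> \<beta> * of_nat (a i) \<in> \<int>" for i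
    by (metis Ints_add Ints_diff Ints_of_int add_diff_cancel_right')
  ultimately show ?thesis unfolding poles_def by simp
qed

lemma Wt_mon_shift: "g \<in> Wt \<beta> j p \<Longrightarrow> (\<lambda>x. mon (\<lambda>i. k * int (a i)) x * g x) \<in> Wt (\<beta> + of_int k) j p"
  unfolding Wt_def by (erule Msp_mon_shift) (simp add: poles_shift)

lemma Wt_mult_f: "g \<in> Wt \<beta> j p \<Longrightarrow> (\<lambda>x. f x * g x) \<in> Wt (\<beta> + 1) j p"
  using Wt_mon_shift[of g \<beta> j p 1] f_eq_mon by simp

lemma Wt_div_f_power:
  assumes "g \<in> Wt \<beta> j p"
  shows "(\<lambda>x. g x / f x ^ k) \<in> Wt (\<beta> - of_nat k) j p"
proof -
  have "(\<lambda>x. mon (\<lambda>i. - int k * int (a i)) x * g x) \<in> Wt (\<beta> - of_nat k) j p"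
    using Wt_mon_shift[OF assms, of "- int k"] by simp
  then show ?thesis unfolding Wt_def
  proof (rule Msp_cong, intro germ_eqI)
    fix x assume "f x \<noteq> 0"
    then show "mon (\<lambda>i. - int k * int (a i)) x * g x = g x / f x ^ k"
      using mon_diff[of x "\<lambda>_. 0" "\<lambda>i. int k * int (a i)"] by (simp add: f_power_eq_mon)
  qed
qed

lemma Wt_mult_f_power:
  "g \<in> Wt \<beta> j p \<Longrightarrow> (\<lambda>x. f x ^ k * g x) \<in> Wt (\<beta> + of_nat k) j p"
proof (induction k)
  case (Suc k)
  then have "(\<lambda>x. f x * (f x ^ k * g x)) \<in> Wt (\<beta> + of_nat k + 1) j p" by (intro Wt_mult_f)
  then show ?case by (simp add: algebra_simps)
qed simp

text \<open>If beta a_i is an integer then so is (beta + k) a_i, and it is at least as large; every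
  pole for beta is therefore one for beta + k.\<close>

lemma Wt_subset_shift_down: "0 \<le> j \<Longrightarrow> Wt (\<beta> + of_nat k) j p \<subseteq> Wt \<beta> j p"
proof -
  have "poles \<beta> e \<le> poles (\<beta> + of_nat k) e" for e
    unfolding poles_def
  proof (rule card_mono)
    have "\<beta> * of_nat (a i) \<le> (\<beta> + of_nat k) * of_nat (a i)" for i
      by (intro mult_right_mono) auto
    moreover have "(\<beta> + of_nat k) * of_nat (a i) \<in> \<int>" if "\<beta> * of_nat (a i) \<in> \<int>" for i
      using that by (simp add: distrib_right)
    ultimately show "{i \<in> I. \<beta> * of_nat (a i) \<in> \<int> \<and> of_int (e i) < \<beta> * of_nat (a i)} \<subseteq>
      {i \<in> I. (\<beta> + of_nat k) * of_nat (a i) \<in> \<int> \<and> of_int (e i) < (\<beta> + of_nat k) * of_nat (a i)}"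
      by (auto intro: less_le_trans)
  qed simp
  then show ?thesis unfolding Wt_def by (intro Msp_mono) (auto intro: order_trans[rotated])
qed

text \<open>Only finitely many exponents occur in a germ. Once the critical values lie below all of
  them no index is a pole, uniformly in beta and j.\<close>

lemma mero_bounded:
  assumes "g \<in> mero_module f p"
  shows "\<exists>N::int. \<forall>\<beta> j. (\<forall>i\<in>I. \<beta> * of_nat (a i) \<in> \<int> \<longrightarrow> \<beta> * of_nat (a i) \<le> of_int N) \<longrightarrow> 0 \<le> j \<longrightarrow> g \<in> Wt \<beta> j p"
proof -
  obtain S H where S: "finite S" "\<And>e. e \<in> S \<Longrightarrow> holo_germ p (H e)"
      "germ_eq f p g (\<lambda>x. \<Sum>e\<in>S. H e x * mon e x)"
    using assms unfolding mero_eq Msp_def by blast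
  define N where "N = Min (insert 0 ((\<lambda>(e, i). e i) ` (S \<times> UNIV)))"
  have N: "N \<le> e i" if "e \<in> S" for e i
    unfolding N_def using S(1) that by (intro Min_le) force+
  have "g \<in> Wt \<beta> j p"
    if \<beta>: "\<forall>i\<in>I. \<beta> * of_nat (a i) \<in> \<int> \<longrightarrow> \<beta> * of_nat (a i) \<le> of_int N" and "0 \<le> j" for \<beta> j
  proof -
    have "poles \<beta> e = 0" if "e \<in> S" for e
    proof -
      have "\<beta> * of_nat (a i) \<le> of_int (e i)" if "i \<in> I" "\<beta> * of_nat (a i) \<in> \<int>" for i
        using \<beta> that N[OF \<open>e \<in> S\<close>, of i] by (meson of_int_le_iff order_trans)
      then have "{i \<in> I. \<beta> * of_nat (a i) \<in> \<int> \<and> of_int (e i) < \<beta> * of_nat (a i)} = {}"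
        by force
      then show ?thesis unfolding poles_def by simp
    qed
    then show ?thesis
      unfolding Wt_def Msp_def using S \<open>0 \<le> j\<close>
      by (intro CollectI exI[of _ S] exI[of _ H]) auto
  qed
  then show ?thesis by blast
qed

section \<open>Normal forms of meromorphic germs\<close>

text \<open>
  A germ is expanded in monomials with exponents at most B; the coefficient of x^e does not depend on
  those x_i for which e_i is less than B_i, which makes it unique.
\<close>

definition clipped :: "('n \<Rightarrow> int) \<Rightarrow> complex ^ 'n \<Rightarrow> ('n \<Rightarrow> int) set" where
  "clipped B p = {e. \<forall>i. e i \<le> B i \<and> (i \<in> I \<and> p $ i = 0 \<or> e i = B i)}"

definition coeffs_at :: "('n \<Rightarrow> int) \<Rightarrow> complex ^ 'n \<Rightarrow> ('n \<Rightarrow> int) \<Rightarrow> (complex ^ 'n \<Rightarrow> complex) set" where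
  "coeffs_at B p e = {h. holo_germ p h \<and> (\<forall>i. e i < B i \<longrightarrow> indep i h)}"

text \<open>Setting \<open>H\<close> to zero outside S allows S to be enlarged, so that several
  expansions can be compared over a common index set.\<close>

definition decomp ::
  "('n \<Rightarrow> int) \<Rightarrow> complex ^ 'n \<Rightarrow> ('n \<Rightarrow> int) set \<Rightarrow> (('n \<Rightarrow> int) \<Rightarrow> complex ^ 'n \<Rightarrow> complex) \<Rightarrow>
    (complex ^ 'n \<Rightarrow> complex) \<Rightarrow> bool" where
  "decomp B p S H g \<longleftrightarrow> finite S \<and> S \<subseteq> clipped B p \<and> (\<forall>e. H e \<in> coeffs_at B p e) \<and>
     (\<forall>e. e \<notin> S \<longrightarrow> H e = (\<lambda>_. 0)) \<and> germ_eq f p g (\<lambda>x. \<Sum>e\<in>S. H e x * mon e x)"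

lemma coeffs_at_zero: "(\<lambda>_. 0) \<in> coeffs_at B p e"
  by (simp add: coeffs_at_def indep_def)

lemma coeffs_at_add:
  "h \<in> coeffs_at B p e \<Longrightarrow> h' \<in> coeffs_at B p e \<Longrightarrow> (\<lambda>x. h x + h' x) \<in> coeffs_at B p e"
  by (auto simp: coeffs_at_def indep_def intro: holo_germ_add)

lemma coeffs_at_const_mult: "h \<in> coeffs_at B p e \<Longrightarrow> (\<lambda>x. c * h x) \<in> coeffs_at B p e"
  by (auto simp: coeffs_at_def indep_def intro: holo_germ_mult)

lemma coeffs_at_diff:
  "h \<in> coeffs_at B p e \<Longrightarrow> h' \<in> coeffs_at B p e \<Longrightarrow> (\<lambda>x. h x - h' x) \<in> coeffs_at B p e"
  using coeffs_at_add[OF _ coeffs_at_const_mult[of h' B p e "-1"]] by fastforce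

lemma decomp_mono:
  assumes "decomp B p S H g" "finite S'" "S \<subseteq> S'" "S' \<subseteq> clipped B p"
  shows "decomp B p S' H g"
proof -
  have "(\<Sum>e\<in>S. H e x * mon e x) = (\<Sum>e\<in>S'. H e x * mon e x)" for x
    using assms by (intro sum.mono_neutral_left) (auto simp: decomp_def)
  with assms show ?thesis by (auto simp: decomp_def)
qed

lemma decomp_lincomb:
  assumes "finite K" "\<And>k. k \<in> K \<Longrightarrow> decomp B p S (H k) (g k)" "finite S" "S \<subseteq> clipped B p"
  shows "decomp B p S (\<lambda>e x. \<Sum>k\<in>K. c k * H k e x) (\<lambda>x. \<Sum>k\<in>K. c k * g k x)"
  using assms(1,2)
proof (induction K)
  case empty
  show ?case using assms(3,4) by (simp add: decomp_def coeffs_at_zero)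
next
  case (insert k K)
  then have 1: "decomp B p S (H k) (g k)"
    and 2: "decomp B p S (\<lambda>e x. \<Sum>k\<in>K. c k * H k e x) (\<lambda>x. \<Sum>k\<in>K. c k * g k x)" by auto
  have "germ_eq f p (\<lambda>x. c k * g k x + (\<Sum>k\<in>K. c k * g k x))
     (\<lambda>x. c k * (\<Sum>e\<in>S. H k e x * mon e x) + (\<Sum>e\<in>S. (\<Sum>k\<in>K. c k * H k e x) * mon e x))"
    using 1 2 germ_eq_lift2[of f p "g k" _ _ _ "\<lambda>x y z. c k * y + z"] by (simp add: decomp_def)
  with 1 2 insert(1,2) show ?case
    by (simp add: decomp_def coeffs_at_add coeffs_at_const_mult sum_distrib_left distrib_right sum.distrib mult.assoc)
qed

lemma decomp_add:
  assumes "decomp B p S H g" "decomp B p S' H' g'"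
  shows "decomp B p (S \<union> S') (\<lambda>e x. H e x + H' e x) (\<lambda>x. g x + g' x)"
proof -
  have *: "finite (S \<union> S')" "S \<union> S' \<subseteq> clipped B p" using assms by (auto simp: decomp_def)
  have 1: "decomp B p (S \<union> S') H g" by (rule decomp_mono[OF assms(1)]) (use * in auto)
  have 2: "decomp B p (S \<union> S') H' g'" by (rule decomp_mono[OF assms(2)]) (use * in auto)
  show ?thesis
    using decomp_lincomb[of UNIV B p "S \<union> S'" "\<lambda>b. if b then H else H'" "\<lambda>b. if b then g else g'" "\<lambda>_. 1"] 1 2 *
    by (simp add: UNIV_bool add.commute)
qed

lemma decomp_cong: "decomp B p S H g \<Longrightarrow> germ_eq f p g g' \<Longrightarrow> decomp B p S H g'"
  using germ_eq_trans'[of f p g g'] by (auto simp: decomp_def)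

text \<open>If h depends on an x_i with e_i < B_i, write h as its restriction plus x_i times the
  quotient. The quotient comes with a raised e_i and decreases the distance d to B; the restriction
  keeps e and decreases the number c of offending variables. The lexicographic order on (d, c) thus
  terminates.\<close>

lemma decomp_mon_clipped:
  assumes "e \<in> clipped B p" "holo_germ p h"
  shows "\<exists>S H. decomp B p S H (\<lambda>x. h x * mon e x) \<and> (\<forall>e'\<in>S. e \<le> e')"
proof -
  define d where "d = (\<Sum>i\<in>UNIV. nat (B i - e i))"
  define c where "c = card {i. e i < B i \<and> \<not> indep i h}"
  from assms show ?thesis using d_def c_def
  proof (induction "(d, c)" arbitrary: d c e h rule: wf_induct_rule[OF wf_lex_prod[OF wf_less_than wf_less_than]])
    case (1 d c e h)
    show ?case
    proof (cases "h \<in> coeffs_at B p e")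
      case True
      then have "decomp B p {e} (\<lambda>e'. if e' = e then h else (\<lambda>_. 0)) (\<lambda>x. h x * mon e x)"
        using 1(2) by (auto simp: decomp_def coeffs_at_zero)
      then show ?thesis by blast
    next
      case False
      then obtain i where i: "e i < B i" "\<not> indep i h" using 1(3) by (auto simp: coeffs_at_def)
      then have pi: "i \<in> I" "p $ i = 0" using 1(2) by (force simp: clipped_def)+
      let ?e = "e(i := e i + 1)"
      have e': "?e \<in> clipped B p" using 1(2) i(1) pi by (auto simp: clipped_def)
      have "(\<Sum>j\<in>UNIV. nat (B j - ?e j)) < d"
        unfolding 1(4) using i(1) by (intro sum_strict_mono_ex1) auto
      then obtain S H where 2: "decomp B p S H (\<lambda>x. quo i h x * mon ?e x)" "\<forall>e'\<in>S. ?e \<le> e'"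
        using 1(1)[OF _ e' holo_germ_quo[OF 1(3) pi(2)] refl refl] by auto
      have "{j. e j < B j \<and> \<not> indep j (restr i h)} \<subset> {j. e j < B j \<and> \<not> indep j h}"
        using i indep_restr_self[of i h] indep_restr[of _ h i] by blast
      then have "card {j. e j < B j \<and> \<not> indep j (restr i h)} < c"
        unfolding 1(5) by (intro psubset_card_mono) auto
      then obtain S' H' where 3: "decomp B p S' H' (\<lambda>x. restr i h x * mon e x)" "\<forall>e'\<in>S'. e \<le> e'"
        using 1(1)[OF _ 1(2) holo_germ_restr[OF 1(3) pi(2)] 1(4) refl] by auto
      have "decomp B p (S' \<union> S) (\<lambda>e x. H' e x + H e x) (\<lambda>x. h x * mon e x)"
      proof (rule decomp_cong[OF decomp_add[OF 3(1) 2(1)]], rule germ_eqI)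
        fix x assume x: "f x \<noteq> 0"
        then have xi: "x $ i \<noteq> 0" using pi by (simp add: f_nonzero_iff)
        have "mon (?e(i := ?e i - 1)) x = mon ?e x / x $ i" by (rule mon_lower[OF pi(1) xi])
        then have "mon ?e x = x $ i * mon e x" using xi by (simp add: field_simps)
        then show "restr i h x * mon e x + quo i h x * mon ?e x = h x * mon e x"
          by (simp add: restr_quo[of h x i] algebra_simps)
      qed
      moreover have "e \<le> e'" if "e' \<in> S' \<union> S" for e'
      proof -
        have "e \<le> ?e" by (auto simp: le_fun_def)
        then show ?thesis using that 2(2) 3(2) order_trans by blast
      qed
      ultimately show ?thesis by blast
    qed
  qed
qed

text \<open>Exactly the stability that normal forms require: exponents are first cut off at B and
  afterwards only raised.\<close>

definition clip_closed :: "('n \<Rightarrow> int) \<Rightarrow> ('n \<Rightarrow> int) set \<Rightarrow> bool" where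
  "clip_closed B E \<longleftrightarrow> (\<forall>e\<in>E. \<forall>e'. (\<forall>i\<in>I. min (e i) (B i) \<le> e' i) \<longrightarrow> e' \<in> E)"

lemma decomp_exists:
  assumes "g \<in> Msp E p" "clip_closed B E"
  shows "\<exists>S H. decomp B p S H g \<and> S \<subseteq> E"
  using assms(1)
proof (induction rule: Msp_induct)
  case (mon e h)
  \<comment> \<open>The monomial with exponent e - e0 is holomorphic at p: its exponent is
    nonnegative where the coordinate vanishes, and elsewhere any power is a unit.\<close>
  define e0 where "e0 i = (if i \<in> I \<and> p $ i = 0 then min (e i) (B i) else B i)" for i
  have e0: "e0 \<in> clipped B p" by (auto simp: clipped_def e0_def)
  have "holo_germ p (\<lambda>x. h x * mon (\<lambda>i. e i - e0 i) x)"
    by (intro holo_germ_mult mon(2) holo_germ_mon) (auto simp: e0_def)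
  from decomp_mon_clipped[OF e0 this] obtain S H where
    *: "decomp B p S H (\<lambda>x. h x * mon (\<lambda>i. e i - e0 i) x * mon e0 x)" "\<forall>e'\<in>S. e0 \<le> e'" by blast
  have "decomp B p S H (\<lambda>x. h x * mon e x)"
    by (rule decomp_cong[OF *(1)], rule germ_eqI) (simp add: mon_diff mon_nonzero)
  moreover have "S \<subseteq> E"
  proof
    fix e' assume "e' \<in> S"
    then have e': "e0 i \<le> e' i" for i using *(2) by (auto simp: le_fun_def)
    have "min (e i) (B i) \<le> e0 i" for i by (auto simp: e0_def)
    then have "\<forall>i\<in>I. min (e i) (B i) \<le> e' i" using e' order_trans by blast
    then show "e' \<in> E" using assms(2) mon(1) unfolding clip_closed_def by blast
  qed
  ultimately show ?case by blast
next
  case zero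
  have "decomp B p {} (\<lambda>_ _. 0) (\<lambda>_. 0)" by (simp add: decomp_def coeffs_at_zero)
  then show ?case by blast
next
  case (add u v)
  then obtain S H S' H' where "decomp B p S H u" "S \<subseteq> E" "decomp B p S' H' v" "S' \<subseteq> E" by blast
  then show ?case using decomp_add[of B p S H u S' H' v] by (meson Un_least)
next
  case (cong u v)
  then obtain S H where "decomp B p S H u" "S \<subseteq> E" by blast
  then show ?case using decomp_cong[OF _ cong(2)] by blast
qed

lemma decomp_exists_mero:
  assumes "g \<in> mero_module f p"
  shows "\<exists>S H. decomp B p S H g"
  using decomp_exists[of g UNIV p B] assms by (auto simp: mero_eq clip_closed_def)

text \<open>A common index set is needed for the coefficients of a polynomial in s, so that the part
  belonging to one monomial x^e is again a polynomial in s.\<close>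

lemma decomp_exists_family:
  assumes "finite K" "\<And>k. k \<in> K \<Longrightarrow> g k \<in> mero_module f p"
  shows "\<exists>S H. finite S \<and> S \<subseteq> clipped B p \<and> (\<forall>k\<in>K. decomp B p S (H k) (g k))"
proof -
  have "\<forall>k\<in>K. \<exists>SH. decomp B p (fst SH) (snd SH) (g k)"
    using decomp_exists_mero assms(2) by fastforce
  then obtain SH where SH: "\<And>k. k \<in> K \<Longrightarrow> decomp B p (fst (SH k)) (snd (SH k)) (g k)"
    by (metis bchoice)
  define S where "S = (\<Union>k\<in>K. fst (SH k))"
  have "finite S" "S \<subseteq> clipped B p"
    using SH assms(1) by (auto simp: S_def decomp_def)
  moreover have "decomp B p S (snd (SH k)) (g k)" if "k \<in> K" for k
    by (rule decomp_mono[OF SH[OF that]]) (use that calculation in \<open>auto simp: S_def\<close>)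
  ultimately show ?thesis by (intro exI[of _ S] exI[of _ "\<lambda>k. snd (SH k)"]) auto
qed

lemma mon_upd:
  assumes "i \<in> I"
  shows "mon e (upd i z x) = z powi e i * mon (e(i := 0)) x"
proof -
  have "mon e (upd i z x) = z powi e i * (\<Prod>j\<in>I - {i}. (x $ j) powi e j)"
    unfolding mon_def using assms by (subst prod.remove[of _ i]) (auto intro!: prod.cong)
  also have "(\<Prod>j\<in>I - {i}. (x $ j) powi e j) = mon (e(i := 0)) x"
    unfolding mon_def using assms by (subst prod.remove[of _ i]) (auto intro!: prod.cong)
  finally show ?thesis .
qed

text \<open>Divide by x_i^m and let x_i tend to 0: only the terms with e_i = m survive, and their
  coefficients do not notice the limit because they are independent of x_i.\<close>

lemma lowest_part_zero:
  assumes S: "finite S" "\<And>e. e \<in> S \<Longrightarrow> holo_germ p (H e)"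
    and i: "i \<in> I" "p $ i = 0"
    and m: "\<And>e. e \<in> S \<Longrightarrow> m \<le> e i" "\<And>e. e \<in> S \<Longrightarrow> e i = m \<Longrightarrow> indep i (H e)"
    and eq: "germ_eq f p (\<lambda>x. \<Sum>e\<in>S. H e x * mon e x) (\<lambda>_. 0)"
  shows "germ_eq f p (\<lambda>x. \<Sum>e\<in>{e\<in>S. e i = m}. H e x * mon e x) (\<lambda>_. 0)"
proof -
  have "\<forall>\<^sub>F x in nhds p. \<forall>e\<in>S. holo_at (H e) x"
    using S by (intro eventually_ball_finite) (auto simp: holo_germ_iff)
  then have "\<forall>\<^sub>F x in nhds p. (\<forall>e\<in>S. holo_at (H e) x) \<and> (f x \<noteq> 0 \<longrightarrow> (\<Sum>e\<in>S. H e x * mon e x) = 0)"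
    using eq unfolding germ_eq_def by (rule eventually_conj)
  then obtain \<epsilon> where \<epsilon>: "\<epsilon> > 0" "\<And>x. x \<in> ball p \<epsilon> \<Longrightarrow> \<forall>e\<in>S. holo_at (H e) x"
      "\<And>x. x \<in> ball p \<epsilon> \<Longrightarrow> f x \<noteq> 0 \<Longrightarrow> (\<Sum>e\<in>S. H e x * mon e x) = 0"
    unfolding eventually_nhds_metric by (auto simp: dist_commute)
  have "(\<Sum>e\<in>{e\<in>S. e i = m}. H e x * mon e x) = 0" if x: "x \<in> ball p \<epsilon>" "f x \<noteq> 0" for x
  proof -
    have xi: "x $ i \<noteq> 0" using x(2) i by (simp add: f_nonzero_iff)
    let ?F = "\<lambda>z. \<Sum>e\<in>S. H e (upd i z x) * z ^ nat (e i - m) * mon (e(i := 0)) x"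
    have zero: "?F z = 0" if z: "z \<noteq> 0" "norm z < norm (x $ i)" for z
    proof -
      have xz: "upd i z x \<in> ball p \<epsilon>" by (rule upd_in_ball[OF x(1) i(2)]) (use z in simp)
      have "f (upd i z x) \<noteq> 0" using x(2) z(1) by (auto simp: f_nonzero_iff)
      from \<epsilon>(3)[OF xz this] have "0 = z powi (- m) * (\<Sum>e\<in>S. H e (upd i z x) * mon e (upd i z x))"
        by simp
      also have "\<dots> = ?F z"
        unfolding sum_distrib_left
      proof (rule sum.cong[OF refl])
        fix e assume "e \<in> S"
        then have "z powi (- m) * z powi e i = z ^ nat (e i - m)"
          using m(1) z(1) by (simp add: power_int_add[symmetric]) (simp add: power_int_def)
        then show "z powi (- m) * (H e (upd i z x) * mon e (upd i z x)) =
            H e (upd i z x) * z ^ nat (e i - m) * mon (e(i := 0)) x"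
          using i(1) by (simp add: mon_upd)
      qed
      finally show ?thesis by simp
    qed
    have x0: "upd i 0 x \<in> ball p \<epsilon>" by (rule upd_in_ball[OF x(1) i(2)]) simp
    have tends: "((\<lambda>z. H e (upd i z x)) \<longlongrightarrow> H e (upd i 0 x)) (at 0)" if "e \<in> S" for e
    proof -
      have "isCont (H e) (upd i 0 x)" using \<epsilon>(2)[OF x0] that holo_at_continuous by blast
      moreover have "((\<lambda>z. upd i z x) \<longlongrightarrow> upd i 0 x) (at 0)"
      proof -
        have "filterlim (\<lambda>z. upd i 0 x + axis i z) (nhds (upd i 0 x)) (at 0)"
          using filterlim_axis by (rule filterlim_mono) (auto simp: at_within_def)
        moreover have "upd i 0 x + axis i z = upd i z x" for z
          by (simp add: vec_eq_iff axis_def)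
        ultimately show ?thesis by simp
      qed
      ultimately show ?thesis by (rule isCont_tendsto_compose)
    qed
    have "(?F \<longlongrightarrow> (\<Sum>e\<in>S. H e (upd i 0 x) * 0 ^ nat (e i - m) * mon (e(i := 0)) x)) (at 0)"
      by (intro tendsto_intros tends)
    moreover have "\<forall>\<^sub>F z in at 0. ?F z = 0"
      unfolding eventually_at using zero xi by (intro exI[of _ "norm (x $ i)"]) auto
    then have "(?F \<longlongrightarrow> 0) (at 0)" by (rule tendsto_eventually)
    ultimately have "(\<Sum>e\<in>S. H e (upd i 0 x) * 0 ^ nat (e i - m) * mon (e(i := 0)) x) = 0"
      by (rule tendsto_unique[rotated]) simp
    also have "(\<Sum>e\<in>S. H e (upd i 0 x) * 0 ^ nat (e i - m) * mon (e(i := 0)) x)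
        = (\<Sum>e\<in>{e\<in>S. e i = m}. H e x * mon (e(i := 0)) x)"
    proof (rule sum.mono_neutral_cong_right)
      show "\<forall>e\<in>S - {e \<in> S. e i = m}. H e (upd i 0 x) * 0 ^ nat (e i - m) * mon (e(i := 0)) x = 0"
        using m(1) by force
    qed (use S m(2) in \<open>auto simp: indep_def\<close>)
    finally have "(\<Sum>e\<in>{e\<in>S. e i = m}. H e x * mon (e(i := 0)) x) = 0" .
    moreover have "mon e x = x $ i powi m * mon (e(i := 0)) x" if "e i = m" for e
      using mon_upd[OF i(1), of e "x $ i" x] that by simp
    ultimately have "x $ i powi m * (\<Sum>e\<in>{e\<in>S. e i = m}. H e x * mon (e(i := 0)) x) = 0" by simp
    also have "x $ i powi m * (\<Sum>e\<in>{e\<in>S. e i = m}. H e x * mon (e(i := 0)) x) = (\<Sum>e\<in>{e\<in>S. e i = m}. H e x * mon e x)"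
      unfolding sum_distrib_left using \<open>\<And>e. e i = m \<Longrightarrow> mon e x = x $ i powi m * mon (e(i := 0)) x\<close>
      by (intro sum.cong) auto
    finally show ?thesis .
  qed
  then show ?thesis
    unfolding germ_eq_def eventually_nhds_metric using \<epsilon>(1) by (auto simp: dist_commute)
qed

text \<open>Pick a coordinate in which two exponents differ and split off the terms of lowest
  exponent there. Both the split-off part and the rest vanish, and both are smaller.\<close>

lemma decomp_unique_zero:
  assumes "finite S" "S \<subseteq> clipped B p" "\<And>e. e \<in> S \<Longrightarrow> H e \<in> coeffs_at B p e"
    and "germ_eq f p (\<lambda>x. \<Sum>e\<in>S. H e x * mon e x) (\<lambda>_. 0)" and "e \<in> S"
  shows "germ_eq f p (H e) (\<lambda>_. 0)"
  using assms
proof (induction "card S" arbitrary: S e rule: less_induct)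
  case less
  show ?case
  proof (cases "\<exists>e'\<in>S. e' \<noteq> e")
    case False
    then have "S = {e}" using less(6) by blast
    then have "germ_eq f p (\<lambda>x. H e x * mon e x) (\<lambda>_. 0)" using less(5) by simp
    then show ?thesis unfolding germ_eq_def by (rule eventually_mono) (simp add: mon_nonzero)
  next
    case True
    then obtain e' where e': "e' \<in> S" "e' \<noteq> e" by blast
    then obtain i where i: "e' i \<noteq> e i" by blast
    \<comment> \<open>Otherwise \<open>clipped\<close> would force both exponents to equal
      B_i.\<close>
    have pi: "i \<in> I" "p $ i = 0"
    proof -
      have "i \<in> I \<and> p $ i = 0 \<or> e i = B i" "i \<in> I \<and> p $ i = 0 \<or> e' i = B i"
        using less(3,6) e'(1) unfolding clipped_def by blast+
      with i show "i \<in> I" "p $ i = 0" by auto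
    qed
    define m where "m = Min ((\<lambda>e. e i) ` S)"
    define S1 where "S1 = {e\<in>S. e i = m}"
    have m: "m \<le> e i" if "e \<in> S" for e
      unfolding m_def using less(2) that by (intro Min_le) auto
    have "m \<in> (\<lambda>e. e i) ` S"
      unfolding m_def using less(2,6) by (intro Min_in) auto
    then have S1: "S1 \<noteq> {}" by (auto simp: S1_def)
    have "e \<notin> S1 \<or> e' \<notin> S1" using i by (auto simp: S1_def)
    then have S1': "S1 \<subset> S" using e'(1) less(6) by (auto simp: S1_def)
    have "e i \<le> B i" "e' i \<le> B i" using less(3,6) e'(1) by (auto simp: clipped_def)
    \<comment> \<open>The strict inequality matters: it makes the coefficients of the lowest part
      independent of x_i.\<close>
    then have mB: "m < B i" using i m[OF less(6)] m[OF e'(1)] by linarith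
    have z1: "germ_eq f p (\<lambda>x. \<Sum>e\<in>S1. H e x * mon e x) (\<lambda>_. 0)"
      unfolding S1_def
      by (rule lowest_part_zero[where S=S and H=H and i=i, OF less(2) _ pi _ _ less(5)]) (use m less(4) mB in \<open>auto simp: coeffs_at_def\<close>)
    have "germ_eq f p (\<lambda>x. (\<Sum>e\<in>S. H e x * mon e x) - (\<Sum>e\<in>S1. H e x * mon e x)) (\<lambda>x. 0 - 0)"
      by (rule germ_eq_lift2[OF less(5) z1])
    then have z2: "germ_eq f p (\<lambda>x. \<Sum>e\<in>S - S1. H e x * mon e x) (\<lambda>_. 0)"
      using S1' less(2) by (simp add: sum_diff less_imp_le)
    have fin: "finite S1" "finite (S - S1)" using less(2) S1' finite_subset by auto
    have card: "card S1 < card S" "card (S - S1) < card S"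
      using S1 S1' less(2) by (auto intro!: psubset_card_mono)
    show ?thesis
    proof (cases "e \<in> S1")
      case True
      show ?thesis by (rule less(1)[OF card(1) fin(1) _ _ z1 True]) (use less(3,4) S1' in auto)
    next
      case False
      show ?thesis by (rule less(1)[OF card(2) fin(2) _ _ z2]) (use less(3,4,6) False in auto)
    qed
  qed
qed

text \<open>By uniqueness, any normal form of g agrees with the one whose exponents all lie in E.
  Membership in \<open>Msp E\<close> can therefore be read off from the coefficients.\<close>

lemma decomp_support:
  assumes "decomp B p S H g" "g \<in> Msp E p" "clip_closed B E" "e \<notin> E"
  shows "germ_eq f p (H e) (\<lambda>_. 0)"
proof (cases "e \<in> S")
  case False
  then show ?thesis using assms(1) by (simp add: decomp_def)
next
  case True
  obtain S' H' where D': "decomp B p S' H' g" "S' \<subseteq> E" using decomp_exists[OF assms(2,3)] by blast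
  define T where "T = S \<union> S'"
  have T: "finite T" "T \<subseteq> clipped B p" using assms(1) D'(1) by (auto simp: decomp_def T_def)
  have 1: "decomp B p T H g" by (rule decomp_mono[OF assms(1)]) (use T in \<open>auto simp: T_def\<close>)
  have 2: "decomp B p T H' g" by (rule decomp_mono[OF D'(1)]) (use T in \<open>auto simp: T_def\<close>)
  have "germ_eq f p (\<lambda>x. g x - g x) (\<lambda>x. (\<Sum>e\<in>T. H e x * mon e x) - (\<Sum>e\<in>T. H' e x * mon e x))"
    using 1 2 germ_eq_lift2[of f p g _ g _ "\<lambda>_. (-)"] by (simp add: decomp_def)
  then have "germ_eq f p (\<lambda>_. 0) (\<lambda>x. \<Sum>e\<in>T. (H e x - H' e x) * mon e x)"
    by (simp add: left_diff_distrib sum_subtractf)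
  from decomp_unique_zero[where H="\<lambda>e x. H e x - H' e x", OF T _ germ_eq_sym[OF this], of e]
  have "germ_eq f p (\<lambda>x. H e x - H' e x) (\<lambda>_. 0)"
    using 1 2 True by (simp add: T_def decomp_def coeffs_at_diff)
  moreover have "H' e = (\<lambda>_. 0)" using D' assms(4) by (auto simp: decomp_def)
  ultimately show ?thesis by simp
qed

text \<open>Cutting an exponent off at B creates no pole as long as no critical value lies above
  B.\<close>

lemma clip_closed_poles:
  assumes "\<And>i. i \<in> I \<Longrightarrow> \<beta> * of_nat (a i) \<in> \<int> \<Longrightarrow> \<beta> * of_nat (a i) \<le> of_int (B i)"
  shows "clip_closed B {e. int (poles \<beta> e) \<le> j}"
  unfolding clip_closed_def
proof (intro ballI allI impI)
  fix e e' :: "'n \<Rightarrow> int"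
  assume e: "e \<in> {e. int (poles \<beta> e) \<le> j}" and e': "\<forall>i\<in>I. min (e i) (B i) \<le> e' i"
  have "poles \<beta> e' \<le> poles \<beta> e"
    unfolding poles_def
  proof (rule card_mono, simp, safe)
    fix i assume i: "i \<in> I" "\<beta> * of_nat (a i) \<in> \<int>" "of_int (e' i) < \<beta> * of_nat (a i)"
    then have "of_int (e' i) < (of_int (B i) :: rat)" using assms by (meson less_le_trans)
    then have "e i \<le> e' i" using e' i(1) by (auto simp: min_def split: if_splits)
    then show "of_int (e i) < \<beta> * of_nat (a i)"
      using i(3) by (meson le_less_trans of_int_le_iff)
  qed
  then show "e' \<in> {e. int (poles \<beta> e) \<le> j}" using e by simp
qed

end

section \<open>The polynomial of a graph section\<close>

text \<open>The rising factorial of -s, as a polynomial in s.\<close>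

definition rising :: "nat \<Rightarrow> complex poly" where
  "rising k = (\<Prod>i<k. [:of_nat i, -1:])"

lemma smult_sum_right': "smult c (\<Sum>i\<in>A. p i) = (\<Sum>i\<in>A. smult c (p i))"
  by (induction A rule: infinite_finite_induct) (auto simp: smult_add_right)

lemma rising_0 [simp]: "rising 0 = 1"
  by (simp add: rising_def)

lemma rising_Suc: "rising (Suc k) = rising k * [:of_nat k, -1:]"
  by (simp add: rising_def)

lemma rising_Suc_shift: "rising (Suc k) = - [:0, 1:] * pcompose (rising k) [:-1, 1:]"
proof -
  have "rising (Suc k) = [:of_nat 0, -1:] * (\<Prod>i<k. [:of_nat (Suc i), -1:])"
    unfolding rising_def by (rule prod.lessThan_Suc_shift)
  also have "(\<Prod>i<k. [:of_nat (Suc i), -1:]) = pcompose (rising k) [:-1, 1:]"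
    by (simp add: rising_def pcompose_prod pcompose_pCons add.commute)
  finally show ?thesis by simp
qed

lemma pcompose_rising_Suc: "pcompose (rising (Suc k)) [:1, 1:] = [:-1, -1:] * rising k"
proof -
  have "pcompose (pcompose (rising k) [:-1, 1:]) [:1, 1:] = pcompose (rising k) (pcompose [:-1, 1:] [:1, 1:])"
    by (rule pcompose_assoc[symmetric])
  also have "pcompose [:-1, 1:] [:1, 1:] = ([:0, 1:] :: complex poly)"
    by (simp add: pcompose_pCons)
  finally show ?thesis
    by (simp add: rising_Suc_shift pcompose_mult pcompose_uminus pcompose_pCons pcompose_idR)
qed

text \<open>At s = d only the components up to d contribute, so the passage between the components
  u_k and the values at natural numbers is triangular, with the nonzero diagonal of
  \<open>poly_rising_nat_nonzero\<close>.\<close>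

lemma poly_rising_nat_zero: "d < k \<Longrightarrow> poly (rising k) (of_nat d) = 0"
  by (auto simp: rising_def poly_prod intro!: bexI[of _ d])

lemma poly_rising_nat_nonzero: "poly (rising d) (of_nat d) \<noteq> 0"
  by (auto simp: rising_def poly_prod)

text \<open>A pointwise predicate, since a graph section is controlled only near p and off the
  divisor.\<close>

definition supp_fin :: "'n::finite graph_section \<Rightarrow> complex ^ 'n \<Rightarrow> bool" where
  "supp_fin u x \<longleftrightarrow> finite {k. u x k \<noteq> 0}"

lemma supp_fin_bound: "supp_fin u x \<Longrightarrow> \<exists>d. \<forall>k>d. u x k = 0"
proof -
  assume "supp_fin u x"
  then have "finite {k. u x k \<noteq> 0}" by (simp add: supp_fin_def)
  then obtain d where "\<forall>k\<in>{k. u x k \<noteq> 0}. k \<le> d" using finite_nat_set_iff_bounded_le by blast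
  then show ?thesis by (metis mem_Collect_eq not_le)
qed

lemma supp_finI: "(\<And>k. k > d \<Longrightarrow> u x k = 0) \<Longrightarrow> supp_fin u x"
  unfolding supp_fin_def by (rule finite_subset[of _ "{..d}"]) (auto simp: not_less[symmetric])

lemma supp_fin_add: "supp_fin u x \<Longrightarrow> supp_fin v x \<Longrightarrow> supp_fin (\<lambda>x j. u x j + v x j) x"
  unfolding supp_fin_def by (rule finite_subset[of _ "{k. u x k \<noteq> 0} \<union> {k. v x k \<noteq> 0}"]) auto

lemma supp_fin_scale: "supp_fin u x \<Longrightarrow> supp_fin (\<lambda>x j. c x * u x j) x"
  unfolding supp_fin_def by (rule finite_subset[of _ "{k. u x k \<noteq> 0}"]) auto

lemma supp_fin_incl: "supp_fin (graph_incl m) x"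
  by (rule supp_finI[of 0]) (simp add: graph_incl_def)

lemma supp_fin_dt: "supp_fin u x \<Longrightarrow> supp_fin (dt_act u) x"
  by (drule supp_fin_bound, elim exE, rule_tac d="Suc d" in supp_finI) (auto simp: dt_act_def)

lemma supp_fin_t: "supp_fin u x \<Longrightarrow> supp_fin (t_act f u) x"
  by (drule supp_fin_bound, elim exE, rule_tac d=d in supp_finI) (auto simp: t_act_def)

context normal_crossing
begin

definition Pol :: "'n graph_section \<Rightarrow> complex ^ 'n \<Rightarrow> complex poly" where
  "Pol u x = (\<Sum>k\<in>{k. u x k \<noteq> 0}. smult (u x k / f x ^ k) (rising k))"

lemma Pol_bound: "(\<And>k. k > d \<Longrightarrow> u x k = 0) \<Longrightarrow> Pol u x = (\<Sum>k\<le>d. smult (u x k / f x ^ k) (rising k))"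
  unfolding Pol_def by (rule sum.mono_neutral_left) (auto simp: not_less[symmetric])

lemma Pol_add:
  assumes "supp_fin u x" "supp_fin v x"
  shows "Pol (\<lambda>x j. u x j + v x j) x = Pol u x + Pol v x"
proof -
  obtain d d' where d: "\<And>k. k > d \<Longrightarrow> u x k = 0" "\<And>k. k > d' \<Longrightarrow> v x k = 0"
    using assms supp_fin_bound by metis
  then show ?thesis
    using Pol_bound[of "max d d'" u x] Pol_bound[of "max d d'" v x] Pol_bound[of "max d d'" "\<lambda>x j. u x j + v x j" x]
    by (simp add: add_divide_distrib smult_add_left sum.distrib)
qed

lemma Pol_scale: "supp_fin u x \<Longrightarrow> Pol (\<lambda>x j. c x * u x j) x = smult (c x) (Pol u x)"
proof -
  assume "supp_fin u x"
  then obtain d where d: "\<And>k. k > d \<Longrightarrow> u x k = 0" using supp_fin_bound by metis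
  then show ?thesis
    using Pol_bound[of d u x] Pol_bound[of d "\<lambda>x j. c x * u x j" x] by (simp add: smult_sum_right')
qed

lemma Pol_incl: "Pol (graph_incl m) x = [:m x:]"
  using Pol_bound[of 0 "graph_incl m" x] by (simp add: graph_incl_def)

lemma Pol_dt:
  assumes "f x \<noteq> 0" "supp_fin u x"
  shows "Pol (dt_act u) x = smult (- 1 / f x) ([:0, 1:] * pcompose (Pol u x) [:-1, 1:])"
proof -
  obtain d where d: "\<And>k. k > d \<Longrightarrow> u x k = 0" using assms(2) supp_fin_bound by metis
  have "Pol (dt_act u) x = (\<Sum>k\<le>Suc d. smult (dt_act u x k / f x ^ k) (rising k))"
    by (rule Pol_bound) (use d in \<open>auto simp: dt_act_def\<close>)
  also have "\<dots> = (\<Sum>k\<le>d. smult (u x k / f x ^ Suc k) (rising (Suc k)))"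
    by (subst sum.atMost_Suc_shift) (simp add: dt_act_def)
  also have "\<dots> = (\<Sum>k\<le>d. smult (- 1 / f x) ([:0, 1:] * pcompose (smult (u x k / f x ^ k) (rising k)) [:-1, 1:]))"
    by (intro sum.cong) (simp_all add: rising_Suc_shift pcompose_smult field_simps)
  also have "\<dots> = smult (- 1 / f x) ([:0, 1:] * pcompose (Pol u x) [:-1, 1:])"
    by (simp only: smult_sum_right'[symmetric] sum_distrib_left[symmetric] pcompose_sum[symmetric] Pol_bound[where u=u and x=x, OF d, symmetric])
  finally show ?thesis .
qed

lemma Pol_t:
  assumes "f x \<noteq> 0" "supp_fin u x"
  shows "Pol (t_act f u) x = smult (f x) (pcompose (Pol u x) [:1, 1:])"
proof -
  obtain d where d: "\<And>k. k > d \<Longrightarrow> u x k = 0" using assms(2) supp_fin_bound by metis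
  have eq: "smult (f x) (pcompose (smult (u x k / f x ^ k) (rising k)) [:1, 1:]) =
      smult (f x * u x k / f x ^ k) (rising k) - (case k of 0 \<Rightarrow> 0 | Suc j \<Rightarrow> smult (of_nat (Suc j) * u x (Suc j) / f x ^ j) (rising j))" for k
  proof (cases k)
    case (Suc j)
    \<comment> \<open>This gives rising(k)(s + 1) = rising(k)(s) - k rising(k - 1)(s), whose two
      terms match those of \<open>t_act\<close>.\<close>
    have "[:-1, -1:] = [:of_nat j, -1:] - [:of_nat (Suc j) :: complex:]" by simp
    then have "pcompose (rising k) [:1, 1:] = rising k - smult (of_nat (Suc j)) (rising j)"
      unfolding Suc pcompose_rising_Suc by (simp only: rising_Suc left_diff_distrib) (simp add: mult.commute)
    then have "smult (f x) (pcompose (smult (u x k / f x ^ k) (rising k)) [:1, 1:]) =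
        smult (f x * u x k / f x ^ k) (rising k) - smult (f x * (u x k / f x ^ k * of_nat (Suc j))) (rising j)"
      by (simp only: pcompose_smult smult_diff_right smult_smult times_divide_eq_right)
    also have "f x * (u x k / f x ^ k * of_nat (Suc j)) = of_nat (Suc j) * u x (Suc j) / f x ^ j"
      using assms(1) Suc by simp
    finally show ?thesis using Suc by simp
  qed simp
  have "Pol (t_act f u) x = (\<Sum>k\<le>d. smult (t_act f u x k / f x ^ k) (rising k))"
    by (rule Pol_bound) (use d in \<open>auto simp: t_act_def\<close>)
  also have "\<dots> = (\<Sum>k\<le>d. smult (f x * u x k / f x ^ k) (rising k))
       - (\<Sum>k\<le>d. smult (of_nat (Suc k) * u x (Suc k) / f x ^ k) (rising k))"
    by (simp add: t_act_def diff_divide_distrib smult_diff_left sum_subtractf)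
  also have "(\<Sum>k\<le>d. smult (of_nat (Suc k) * u x (Suc k) / f x ^ k) (rising k)) =
      (\<Sum>k\<le>Suc d. case k of 0 \<Rightarrow> 0 | Suc j \<Rightarrow> smult (of_nat (Suc j) * u x (Suc j) / f x ^ j) (rising j))"
    by (subst sum.atMost_Suc_shift) simp
  also have "\<dots> = (\<Sum>k\<le>d. case k of 0 \<Rightarrow> 0 | Suc j \<Rightarrow> smult (of_nat (Suc j) * u x (Suc j) / f x ^ j) (rising j))"
    using d[of "Suc d"] by simp
  also have "(\<Sum>k\<le>d. smult (f x * u x k / f x ^ k) (rising k)) - \<dots>
      = (\<Sum>k\<le>d. smult (f x) (pcompose (smult (u x k / f x ^ k) (rising k)) [:1, 1:]))"
    unfolding eq by (simp add: sum_subtractf)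
  also have "\<dots> = smult (f x) (pcompose (Pol u x) [:1, 1:])"
    by (simp only: smult_sum_right'[symmetric] pcompose_sum[symmetric] Pol_bound[where u=u and x=x, OF d, symmetric])
  finally show ?thesis .
qed

lemma Pol_dt_t:
  assumes "f x \<noteq> 0" "supp_fin u x"
  shows "Pol (dt_act (t_act f u)) x = - [:0, 1:] * Pol u x"
proof -
  have "pcompose (pcompose (Pol u x) [:1, 1:]) [:-1, 1:] = pcompose (Pol u x) (pcompose [:1, 1:] [:-1, 1:])"
    by (rule pcompose_assoc[symmetric])
  also have "pcompose [:1, 1:] [:-1, 1:] = ([:0, 1:] :: complex poly)"
    by (simp add: pcompose_pCons)
  finally show ?thesis
    using assms by (simp add: Pol_dt Pol_t supp_fin_t pcompose_smult pcompose_idR)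
qed

lemma poly_Pol_nat:
  assumes "supp_fin u x"
  shows "poly (Pol u x) (of_nat d) = (\<Sum>k\<le>d. u x k / f x ^ k * poly (rising k) (of_nat d))"
proof -
  obtain d' where d': "\<And>k. k > d' \<Longrightarrow> u x k = 0" using assms supp_fin_bound by metis
  have "poly (Pol u x) (of_nat d) = (\<Sum>k\<le>max d d'. u x k / f x ^ k * poly (rising k) (of_nat d))"
    using Pol_bound[of "max d d'" u x] d' by (simp add: poly_sum)
  also have "\<dots> = (\<Sum>k\<le>d. u x k / f x ^ k * poly (rising k) (of_nat d))"
    by (rule sum.mono_neutral_right) (auto simp: poly_rising_nat_zero)
  finally show ?thesis .
qed

text \<open>Evaluation at s = d recovers the d-th component from the polynomial and the earlier
  components.\<close>

lemma Pol_inj: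
  assumes "f x \<noteq> 0" "supp_fin u x" "supp_fin v x" "Pol u x = Pol v x"
  shows "u x = v x"
proof
  fix d show "u x d = v x d"
  proof (induction d rule: less_induct)
    case (less d)
    have split: "(\<Sum>k\<le>d. F k) = (\<Sum>k<d. F k) + F d" for F :: "nat \<Rightarrow> complex"
      by (simp add: lessThan_Suc_atMost[symmetric])
    have "(\<Sum>k\<le>d. u x k / f x ^ k * poly (rising k) (of_nat d)) = (\<Sum>k\<le>d. v x k / f x ^ k * poly (rising k) (of_nat d))"
      using assms(4) poly_Pol_nat[OF assms(2), of d] poly_Pol_nat[OF assms(3), of d] by simp
    moreover have "(\<Sum>k<d. u x k / f x ^ k * poly (rising k) (of_nat d)) = (\<Sum>k<d. v x k / f x ^ k * poly (rising k) (of_nat d))"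
      using less by (intro sum.cong) auto
    ultimately have "u x d / f x ^ d * poly (rising d) (of_nat d) = v x d / f x ^ d * poly (rising d) (of_nat d)"
      unfolding split by simp
    then show ?case using assms(1) poly_rising_nat_nonzero[of d] by simp
  qed
qed

section \<open>Taylor coefficients at s = -delta and multiplication by polynomials in s\<close>

definition jet :: "rat \<Rightarrow> nat \<Rightarrow> 'n graph_section \<Rightarrow> complex ^ 'n \<Rightarrow> complex" where
  "jet \<delta> j u x = coeff (pcompose (Pol u x) [:- of_rat \<delta>, 1:]) j"

definition rjet :: "rat \<Rightarrow> nat \<Rightarrow> nat \<Rightarrow> complex" where
  "rjet \<delta> k j = coeff (pcompose (rising k) [:- of_rat \<delta>, 1:]) j"

lemma jet_bound: "(\<And>k. k > d \<Longrightarrow> u x k = 0) \<Longrightarrow> jet \<delta> j u x = (\<Sum>k\<le>d. rjet \<delta> k j * (u x k / f x ^ k))"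
  by (subst mult.commute) (simp add: jet_def Pol_bound[of d] pcompose_sum pcompose_smult coeff_sum rjet_def)

lemma rjet_Suc: "rjet \<delta> (Suc k) j = (of_nat k + of_rat \<delta>) * rjet \<delta> k j - (if j = 0 then 0 else rjet \<delta> k (j - 1))"
proof -
  have "pcompose (rising (Suc k)) [:- of_rat \<delta>, 1:] = pcompose (rising k) [:- of_rat \<delta>, 1:] * [:of_nat k + of_rat \<delta>, -1:]"
    unfolding rising_Suc pcompose_mult by (simp add: pcompose_pCons)
  then show ?thesis
    by (simp add: rjet_def coeff_pCons mult.commute[of _ "[:_, _:]"] split: nat.split)
qed

lemma degree_rising_le: "degree (rising k) \<le> k"
proof (induction k)
  case (Suc k)
  have "degree (rising (Suc k)) \<le> degree (rising k) + degree [:of_nat k :: complex, -1:]"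
    unfolding rising_Suc by (rule degree_mult_le)
  with Suc show ?case by simp
qed simp

lemma rjet_zero: "j > k \<Longrightarrow> rjet \<delta> k j = 0"
proof -
  assume "j > k"
  have "degree (pcompose (rising k) [:- of_rat \<delta>, 1:]) \<le> k"
    using degree_rising_le[of k] degree_pcompose_le[of "rising k" "[:- of_rat \<delta>, 1:]"] by simp
  then show ?thesis unfolding rjet_def using \<open>j > k\<close> by (intro coeff_eq_0) simp
qed

lemma jet_t: "f x \<noteq> 0 \<Longrightarrow> supp_fin u x \<Longrightarrow> jet \<delta> j (t_act f u) x = f x * jet (\<delta> - 1) j u x"
proof -
  assume *: "f x \<noteq> 0" "supp_fin u x"
  have "pcompose (pcompose (Pol u x) [:1, 1:]) [:- of_rat \<delta>, 1:] = pcompose (Pol u x) (pcompose [:1, 1:] [:- of_rat \<delta>, 1:])"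
    by (rule pcompose_assoc[symmetric])
  also have "pcompose [:1, 1:] [:- of_rat \<delta>, 1:] = ([:- of_rat (\<delta> - 1), 1:] :: complex poly)"
    by (simp add: pcompose_pCons of_rat_diff)
  finally show ?thesis using * by (simp add: jet_def Pol_t pcompose_smult)
qed

text \<open>On polynomials (d/dt) t - gamma is multiplication by -(s + gamma) = (delta - gamma) - (s
  + delta), and s + delta shifts the Taylor coefficients at -delta.\<close>

lemma jet_dtt_minus:
  assumes "f x \<noteq> 0" "supp_fin u x"
  shows "jet \<delta> j (dtt_minus f \<gamma> u) x = of_rat (\<delta> - \<gamma>) * jet \<delta> j u x - (if j = 0 then 0 else jet \<delta> (j - 1) u x)"
proof -
  have "dtt_minus f \<gamma> u = (\<lambda>x j. dt_act (t_act f u) x j + (- of_rat \<gamma>) * u x j)"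
    by (simp add: dtt_minus_def fun_eq_iff)
  then have "Pol (dtt_minus f \<gamma> u) x = - [:0, 1:] * Pol u x + smult (- of_rat \<gamma>) (Pol u x)"
    using assms(2) by (simp only: Pol_add Pol_scale Pol_dt_t[OF assms] supp_fin_dt supp_fin_t supp_fin_scale)
  also have "\<dots> = [:- of_rat \<gamma>, -1:] * Pol u x"
    by (simp add: algebra_simps)
  finally have "pcompose (Pol (dtt_minus f \<gamma> u) x) [:- of_rat \<delta>, 1:] =
      [:of_rat (\<delta> - \<gamma>), -1:] * pcompose (Pol u x) [:- of_rat \<delta>, 1:]"
    by (simp only: pcompose_mult) (simp add: pcompose_pCons of_rat_diff)
  then show ?thesis by (simp add: jet_def coeff_pCons split: nat.split)
qed

text \<open>The polynomial of (d/dt) u is divisible by s. In the Hodge filtration this removes all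
  terms with a positive power of d/dt.\<close>

lemma jet_dt_zero: "f x \<noteq> 0 \<Longrightarrow> supp_fin u x \<Longrightarrow> jet 0 0 (dt_act u) x = 0"
  by (simp add: jet_def Pol_dt pcompose_mult pcompose_smult pcompose_pCons coeff_mult_0)

lemma jet_add: "supp_fin u x \<Longrightarrow> supp_fin v x \<Longrightarrow> jet \<delta> j (\<lambda>x j. u x j + v x j) x = jet \<delta> j u x + jet \<delta> j v x"
  by (simp add: jet_def Pol_add pcompose_add)

lemma jet_scale: "supp_fin u x \<Longrightarrow> jet \<delta> j (\<lambda>x j. c x * u x j) x = c x * jet \<delta> j u x"
  by (simp add: jet_def Pol_scale pcompose_smult)

lemma jet_incl: "jet \<delta> j (graph_incl m) x = (if j = 0 then m x else 0)"
  by (simp add: jet_def Pol_incl pcompose_pCons coeff_pCons split: nat.split)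

lemma jet_0: "jet 0 j u x = coeff (Pol u x) j"
  by (simp add: jet_def pcompose_idR)

definition Sop :: "'n graph_section \<Rightarrow> 'n graph_section" where
  "Sop u = (\<lambda>x j. - 1 * dt_act (t_act f u) x j)"

text \<open>Multiplication of the polynomial of a section by q(s), built from \<open>Sop\<close>,
  which is multiplication by s.\<close>

definition sact :: "complex poly \<Rightarrow> 'n graph_section \<Rightarrow> 'n graph_section" where
  "sact q u = (\<lambda>x j. \<Sum>i\<le>degree q. coeff q i * (Sop ^^ i) u x j)"

lemma supp_fin_Sop: "supp_fin u x \<Longrightarrow> supp_fin (Sop u) x"
  unfolding Sop_def by (intro supp_fin_scale supp_fin_dt supp_fin_t)

lemma Pol_Sop: "f x \<noteq> 0 \<Longrightarrow> supp_fin u x \<Longrightarrow> Pol (Sop u) x = [:0, 1:] * Pol u x"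
  unfolding Sop_def by (subst Pol_scale) (simp_all add: supp_fin_dt supp_fin_t Pol_dt_t)

lemma Pol_Sop_power: "f x \<noteq> 0 \<Longrightarrow> supp_fin u x \<Longrightarrow>
    supp_fin ((Sop ^^ i) u) x \<and> Pol ((Sop ^^ i) u) x = [:0, 1:] ^ i * Pol u x"
  by (induction i) (auto simp: supp_fin_Sop Pol_Sop)

lemma Pol_sact:
  assumes "f x \<noteq> 0" "supp_fin u x"
  shows "supp_fin (sact q u) x \<and> Pol (sact q u) x = q * Pol u x"
proof -
  have "supp_fin (\<lambda>x j. \<Sum>i\<in>A. coeff q i * (Sop ^^ i) u x j) x \<and>
     Pol (\<lambda>x j. \<Sum>i\<in>A. coeff q i * (Sop ^^ i) u x j) x = (\<Sum>i\<in>A. smult (coeff q i) ([:0, 1:] ^ i)) * Pol u x"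
    if "finite A" for A
    using that
  proof (induction A)
    case empty
    show ?case by (simp add: Pol_def supp_fin_def)
  next
    case (insert i A)
    then show ?case using Pol_Sop_power[OF assms, of i]
      by (simp add: Pol_add Pol_scale supp_fin_add supp_fin_scale distrib_right)
  qed
  from this[of "{..degree q}"] have "supp_fin (sact q u) x \<and>
      Pol (sact q u) x = (\<Sum>i\<le>degree q. smult (coeff q i) ([:0, 1:] ^ i)) * Pol u x"
    unfolding sact_def by blast
  moreover have "(\<Sum>i\<le>degree q. smult (coeff q i) ([:0, 1:] ^ i)) = q"
    using poly_as_sum_of_monoms[of q] by (simp add: monom_altdef)
  ultimately show ?thesis by simp
qed

section \<open>Closure properties of the graph module\<close>

lemma mero_mult_holo: "g \<in> mero_module f p \<Longrightarrow> holo_germ p h \<Longrightarrow> (\<lambda>x. h x * g x) \<in> mero_module f p"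
  by (simp add: mero_eq Msp_holo_mult)

lemma mero_add: "g \<in> mero_module f p \<Longrightarrow> g' \<in> mero_module f p \<Longrightarrow> (\<lambda>x. g x + g' x) \<in> mero_module f p"
  by (simp add: mero_eq Msp_add)

lemma mero_cong: "g \<in> mero_module f p \<Longrightarrow> germ_eq f p g g' \<Longrightarrow> g' \<in> mero_module f p"
  unfolding mero_eq by (rule Msp_cong)

lemma mero_zero: "(\<lambda>_. 0) \<in> mero_module f p"
  by (simp add: mero_eq Msp_zero)

lemma mero_div_f_power: "g \<in> mero_module f p \<Longrightarrow> (\<lambda>x. g x / f x ^ k) \<in> mero_module f p"
  using Wt_div_f_power[of g 0 "int CARD('n)" p k] by (simp add: Wt_top)

lemma mero_nabla: "g \<in> mero_module f p \<Longrightarrow> nabla f \<alpha> i g \<in> mero_module f p"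
proof -
  assume "g \<in> mero_module f p"
  then have "tw \<alpha> i g \<in> mero_module f p" using Wt_tw[of g \<alpha> "int CARD('n)" p i] by (simp add: Wt_top)
  then show ?thesis by (rule mero_cong) (rule germ_eq_sym[OF germ_eq_nabla_tw])
qed

lemma graph_mero: "u \<in> graph_module f p \<Longrightarrow> (\<lambda>x. u x k) \<in> mero_module f p"
  by (simp add: graph_module_def)

lemma graph_bound: "u \<in> graph_module f p \<Longrightarrow> \<exists>d. \<forall>\<^sub>F x in nhds p. f x \<noteq> 0 \<longrightarrow> (\<forall>k>d. u x k = 0)"
  by (simp add: graph_module_def)

lemma graphI:
  "(\<And>k. (\<lambda>x. u x k) \<in> mero_module f p) \<Longrightarrow> \<forall>\<^sub>F x in nhds p. f x \<noteq> 0 \<longrightarrow> (\<forall>k>d. u x k = 0) \<Longrightarrow> u \<in> graph_module f p"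
  by (auto simp: graph_module_def)

lemma graph_supp_fin: "u \<in> graph_module f p \<Longrightarrow> \<forall>\<^sub>F x in nhds p. f x \<noteq> 0 \<longrightarrow> supp_fin u x"
  by (drule graph_bound, elim exE eventually_mono) (auto intro: supp_finI)

lemma germ_eq_comp: "germ_eq f p u v \<Longrightarrow> germ_eq f p (\<lambda>x. u x k) (\<lambda>x. v x k)"
  by (rule germ_eq_lift1[where F="\<lambda>_ y. y k"])

lemma graph_cong: "u \<in> graph_module f p \<Longrightarrow> germ_eq f p u v \<Longrightarrow> v \<in> graph_module f p"
proof -
  assume u: "u \<in> graph_module f p" and eq: "germ_eq f p u v"
  obtain d where "\<forall>\<^sub>F x in nhds p. f x \<noteq> 0 \<longrightarrow> (\<forall>k>d. u x k = 0)" using graph_bound[OF u] by blast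
  then have "\<forall>\<^sub>F x in nhds p. f x \<noteq> 0 \<longrightarrow> (\<forall>k>d. v x k = 0)"
    using eq unfolding germ_eq_def by (rule eventually_elim2) simp
  then show ?thesis
    using mero_cong[OF graph_mero[OF u] germ_eq_comp[OF eq]] by (rule graphI[rotated])
qed

lemma graph_zero: "(\<lambda>_ _. 0) \<in> graph_module f p"
  by (rule graphI) (auto simp: mero_zero)

lemma graph_add:
  assumes "u \<in> graph_module f p" "v \<in> graph_module f p"
  shows "(\<lambda>x j. u x j + v x j) \<in> graph_module f p"
proof -
  obtain d d' where "\<forall>\<^sub>F x in nhds p. f x \<noteq> 0 \<longrightarrow> (\<forall>k>d. u x k = 0)"
    "\<forall>\<^sub>F x in nhds p. f x \<noteq> 0 \<longrightarrow> (\<forall>k>d'. v x k = 0)"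
    using assms graph_bound by meson
  then have "\<forall>\<^sub>F x in nhds p. f x \<noteq> 0 \<longrightarrow> (\<forall>k>max d d'. u x k + v x k = 0)"
    by (rule eventually_elim2) simp
  then show ?thesis by (rule graphI[rotated]) (simp add: mero_add graph_mero assms)
qed

lemma graph_holo_mult:
  assumes "u \<in> graph_module f p" "holo_germ p h"
  shows "(\<lambda>x j. h x * u x j) \<in> graph_module f p"
proof -
  obtain d where "\<forall>\<^sub>F x in nhds p. f x \<noteq> 0 \<longrightarrow> (\<forall>k>d. u x k = 0)" using graph_bound[OF assms(1)] by blast
  then have "\<forall>\<^sub>F x in nhds p. f x \<noteq> 0 \<longrightarrow> (\<forall>k>d. h x * u x k = 0)"
    by (rule eventually_mono) simp
  then show ?thesis by (rule graphI[rotated]) (simp add: mero_mult_holo graph_mero assms)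
qed

lemma graph_scale: "u \<in> graph_module f p \<Longrightarrow> (\<lambda>x j. c * u x j) \<in> graph_module f p"
  by (rule graph_holo_mult) simp_all

lemma graph_incl_graph: "m \<in> mero_module f p \<Longrightarrow> graph_incl m \<in> graph_module f p"
proof (rule graphI)
  assume m: "m \<in> mero_module f p"
  show "(\<lambda>x. graph_incl m x k) \<in> mero_module f p" for k
    using m mero_zero by (cases "k = 0") (simp_all add: graph_incl_def)
  show "\<forall>\<^sub>F x in nhds p. f x \<noteq> 0 \<longrightarrow> (\<forall>k>0. graph_incl m x k = 0)"
    by (simp add: graph_incl_def)
qed

lemma graph_dt: "u \<in> graph_module f p \<Longrightarrow> dt_act u \<in> graph_module f p"
proof -
  assume u: "u \<in> graph_module f p"
  obtain d where "\<forall>\<^sub>F x in nhds p. f x \<noteq> 0 \<longrightarrow> (\<forall>k>d. u x k = 0)" using graph_bound[OF u] by blast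
  then have "\<forall>\<^sub>F x in nhds p. f x \<noteq> 0 \<longrightarrow> (\<forall>k>Suc d. dt_act u x k = 0)"
    by (rule eventually_mono) (auto simp: dt_act_def)
  moreover have "(\<lambda>x. dt_act u x k) \<in> mero_module f p" for k
    using graph_mero[OF u] mero_zero by (cases "k = 0") (simp_all add: dt_act_def)
  ultimately show ?thesis by (intro graphI)
qed

lemma graph_t: "u \<in> graph_module f p \<Longrightarrow> t_act f u \<in> graph_module f p"
proof -
  assume u: "u \<in> graph_module f p"
  obtain d where "\<forall>\<^sub>F x in nhds p. f x \<noteq> 0 \<longrightarrow> (\<forall>k>d. u x k = 0)" using graph_bound[OF u] by blast
  then have "\<forall>\<^sub>F x in nhds p. f x \<noteq> 0 \<longrightarrow> (\<forall>k>d. t_act f u x k = 0)"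
    by (rule eventually_mono) (auto simp: t_act_def)
  moreover have "(\<lambda>x. f x * u x k + (- of_nat (Suc k)) * u x (Suc k)) \<in> mero_module f p" for k
    by (intro mero_add mero_mult_holo graph_mero[OF u] holo_germ_f holo_germ_const)
  then have "(\<lambda>x. t_act f u x k) \<in> mero_module f p" for k
    by (simp only: t_act_def minus_mult_left[symmetric] diff_conv_add_uminus)
  ultimately show ?thesis by (intro graphI)
qed

lemma nabla_zero: "nabla f \<alpha> i (\<lambda>_. 0) x = 0"
  by (simp add: nabla_def)

lemma dx_act_eq: "dx_act f \<alpha> i u x k = nabla f \<alpha> i (\<lambda>y. u y k) x + (- partial i f x) * dt_act u x k"
  by (simp add: dx_act_def)

lemma graph_dx: "u \<in> graph_module f p \<Longrightarrow> dx_act f \<alpha> i u \<in> graph_module f p"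
proof -
  assume u: "u \<in> graph_module f p"
  obtain d where "\<forall>\<^sub>F x in nhds p. f x \<noteq> 0 \<longrightarrow> (\<forall>k>d. u x k = 0)" using graph_bound[OF u] by blast
  then have "\<forall>\<^sub>F y in nhds p. \<forall>\<^sub>F x in nhds y. f x \<noteq> 0 \<longrightarrow> (\<forall>k>d. u x k = 0)"
    by (simp add: eventually_eventually)
  then have "\<forall>\<^sub>F x in nhds p. f x \<noteq> 0 \<longrightarrow> (\<forall>k>Suc d. dx_act f \<alpha> i u x k = 0)"
  proof (rule eventually_mono, intro impI allI)
    fix y k assume *: "\<forall>\<^sub>F x in nhds y. f x \<noteq> 0 \<longrightarrow> (\<forall>k>d. u x k = 0)" "f y \<noteq> 0" "Suc d < k"
    have "\<forall>\<^sub>F x in nhds y. u x k = 0"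
      using *(1) eventually_f_nonzero[OF *(2)] by (rule eventually_elim2) (use *(3) in auto)
    then have "nabla f \<alpha> i (\<lambda>y. u y k) y = nabla f \<alpha> i (\<lambda>_. 0) y"
      unfolding nabla_def using partial_cong_ev eventually_nhds_x_imp_x by fastforce
    moreover have "dt_act u y k = 0"
      using *(2,3) eventually_nhds_x_imp_x[OF *(1)] by (auto simp: dt_act_def)
    ultimately show "dx_act f \<alpha> i u y k = 0" by (simp add: dx_act_def nabla_zero)
  qed
  moreover have "(\<lambda>x. dx_act f \<alpha> i u x k) \<in> mero_module f p" for k
    unfolding dx_act_eq
    by (intro mero_add mero_nabla mero_mult_holo graph_mero u graph_dt holo_germ_minus holo_germ_partial holo_germ_f)
  ultimately show ?thesis by (intro graphI)
qed

lemma jet_cong: "germ_eq f p u v \<Longrightarrow> germ_eq f p (jet \<delta> j u) (jet \<delta> j v)"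
  unfolding germ_eq_def by (erule eventually_mono) (simp add: jet_def Pol_def)

text \<open>One degree bound and one neighbourhood serve all delta and j at once, so the identity
  may be differentiated and used for infinitely many coefficients.\<close>

lemma graph_jet_expansion:
  assumes "u \<in> graph_module f p"
  shows "\<exists>d. \<forall>\<^sub>F x in nhds p. f x \<noteq> 0 \<longrightarrow> (\<forall>k>d. u x k = 0) \<and>
      (\<forall>\<delta> j. jet \<delta> j u x = (\<Sum>k\<le>d. rjet \<delta> k j * (u x k / f x ^ k)))"
proof -
  obtain d where "\<forall>\<^sub>F x in nhds p. f x \<noteq> 0 \<longrightarrow> (\<forall>k>d. u x k = 0)" using graph_bound[OF assms] by blast
  then have "\<forall>\<^sub>F x in nhds p. f x \<noteq> 0 \<longrightarrow> (\<forall>k>d. u x k = 0) \<and>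
      (\<forall>\<delta> j. jet \<delta> j u x = (\<Sum>k\<le>d. rjet \<delta> k j * (u x k / f x ^ k)))"
    by (rule eventually_mono, intro impI conjI allI jet_bound) auto
  then show ?thesis by blast
qed

lemma jet_mero: "u \<in> graph_module f p \<Longrightarrow> jet \<delta> j u \<in> mero_module f p"
proof -
  assume u: "u \<in> graph_module f p"
  obtain d where "\<forall>\<^sub>F x in nhds p. f x \<noteq> 0 \<longrightarrow> (\<forall>k>d. u x k = 0) \<and>
      (\<forall>\<delta> j. jet \<delta> j u x = (\<Sum>k\<le>d. rjet \<delta> k j * (u x k / f x ^ k)))"
    using graph_jet_expansion[OF u] by blast
  then have "germ_eq f p (\<lambda>x. \<Sum>k\<le>d. rjet \<delta> k j * (u x k / f x ^ k)) (jet \<delta> j u)"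
    unfolding germ_eq_def by (rule eventually_mono) simp
  moreover have "(\<lambda>x. \<Sum>k\<le>d. rjet \<delta> k j * (u x k / f x ^ k)) \<in> mero_module f p"
    using mero_div_f_power[OF graph_mero[OF u]] unfolding mero_eq
    by (intro Msp_sum Msp_const_mult) auto
  ultimately show ?thesis by (rule mero_cong[rotated])
qed

lemma jet_add_germ:
  assumes "u \<in> graph_module f p" "v \<in> graph_module f p"
  shows "germ_eq f p (jet \<delta> j (\<lambda>x j. u x j + v x j)) (\<lambda>x. jet \<delta> j u x + jet \<delta> j v x)"
  unfolding germ_eq_def using graph_supp_fin[OF assms(1)] graph_supp_fin[OF assms(2)]
  by (rule eventually_elim2) (simp add: jet_add)

lemma jet_scale_germ:
  "u \<in> graph_module f p \<Longrightarrow> germ_eq f p (jet \<delta> j (\<lambda>x j. c x * u x j)) (\<lambda>x. c x * jet \<delta> j u x)"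
  unfolding germ_eq_def by (drule graph_supp_fin, erule eventually_mono) (simp add: jet_scale)

lemma jet_t_germ:
  "u \<in> graph_module f p \<Longrightarrow> germ_eq f p (jet \<delta> j (t_act f u)) (\<lambda>x. f x * jet (\<delta> - 1) j u x)"
  unfolding germ_eq_def by (drule graph_supp_fin, erule eventually_mono) (simp add: jet_t)

lemma jet_dtt_minus_germ:
  "u \<in> graph_module f p \<Longrightarrow> germ_eq f p (jet \<delta> j (dtt_minus f \<gamma> u))
     (\<lambda>x. of_rat (\<delta> - \<gamma>) * jet \<delta> j u x - (if j = 0 then 0 else jet \<delta> (j - 1) u x))"
  unfolding germ_eq_def by (drule graph_supp_fin, erule eventually_mono) (simp add: jet_dtt_minus)

lemma graph_dtt_minus: "u \<in> graph_module f p \<Longrightarrow> dtt_minus f \<gamma> u \<in> graph_module f p"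
proof -
  assume u: "u \<in> graph_module f p"
  have "(\<lambda>x j. dt_act (t_act f u) x j + (- of_rat \<gamma>) * u x j) \<in> graph_module f p"
    by (intro graph_add graph_dt graph_t graph_scale u)
  then show ?thesis by (simp add: dtt_minus_def)
qed

lemma graph_Sop: "u \<in> graph_module f p \<Longrightarrow> Sop u \<in> graph_module f p"
  unfolding Sop_def by (intro graph_scale graph_dt graph_t)

lemma graph_sum: "(\<And>k. k \<in> K \<Longrightarrow> u k \<in> graph_module f p) \<Longrightarrow> (\<lambda>x j. \<Sum>k\<in>K. u k x j) \<in> graph_module f p"
  by (induction K rule: infinite_finite_induct) (auto simp: graph_zero graph_add)

lemma graph_sact: "u \<in> graph_module f p \<Longrightarrow> sact q u \<in> graph_module f p"
proof -
  assume u: "u \<in> graph_module f p"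
  have "(Sop ^^ i) u \<in> graph_module f p" for i by (induction i) (auto simp: u graph_Sop)
  then show ?thesis unfolding sact_def by (intro graph_sum graph_scale)
qed

lemma Pol_sact_germ: "u \<in> graph_module f p \<Longrightarrow> germ_eq f p (Pol (sact q u)) (\<lambda>x. q * Pol u x)"
  unfolding germ_eq_def by (drule graph_supp_fin, erule eventually_mono) (simp add: Pol_sact)

lemma graph_eqI:
  assumes "u \<in> graph_module f p" "v \<in> graph_module f p" "germ_eq f p (Pol u) (Pol v)"
  shows "germ_eq f p u v"
proof -
  have "\<forall>\<^sub>F x in nhds p. f x \<noteq> 0 \<longrightarrow> supp_fin u x \<and> supp_fin v x"
    using graph_supp_fin[OF assms(1)] graph_supp_fin[OF assms(2)] by (rule eventually_elim2) simp
  then show ?thesis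
    using assms(3) unfolding germ_eq_def by (rule eventually_elim2) (use Pol_inj in blast)
qed

text \<open>The degree bounds leave finitely many components, so the neighbourhoods on which they
  agree can be intersected.\<close>

lemma graph_eqI_comp:
  assumes "u \<in> graph_module f p" "v \<in> graph_module f p" "\<And>j. germ_eq f p (\<lambda>x. u x j) (\<lambda>x. v x j)"
  shows "germ_eq f p u v"
proof -
  obtain d d' where d: "\<forall>\<^sub>F x in nhds p. f x \<noteq> 0 \<longrightarrow> (\<forall>k>d. u x k = 0)"
    "\<forall>\<^sub>F x in nhds p. f x \<noteq> 0 \<longrightarrow> (\<forall>k>d'. v x k = 0)"
    using graph_bound[OF assms(1)] graph_bound[OF assms(2)] by blast
  have "\<forall>\<^sub>F x in nhds p. \<forall>j\<in>{..max d d'}. f x \<noteq> 0 \<longrightarrow> u x j = v x j"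
    using assms(3) by (intro eventually_ball_finite) (auto simp: germ_eq_def)
  then show ?thesis
    unfolding germ_eq_def using d
  proof (eventually_elim, intro impI ext)
    fix x j assume *: "\<forall>j\<in>{..max d d'}. f x \<noteq> 0 \<longrightarrow> u x j = v x j"
      "f x \<noteq> 0 \<longrightarrow> (\<forall>k>d. u x k = 0)" "f x \<noteq> 0 \<longrightarrow> (\<forall>k>d'. v x k = 0)" "f x \<noteq> 0"
    then show "u x j = v x j" by (cases "j \<le> max d d'") auto
  qed
qed

lemma graph_eqI_coeff:
  assumes "u \<in> graph_module f p" "v \<in> graph_module f p" "\<And>j. germ_eq f p (jet 0 j u) (jet 0 j v)"
  shows "germ_eq f p u v"
proof (rule graph_eqI[OF assms(1,2)])
  obtain d d' where d: "\<forall>\<^sub>F x in nhds p. f x \<noteq> 0 \<longrightarrow> (\<forall>k>d. u x k = 0)"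
    "\<forall>\<^sub>F x in nhds p. f x \<noteq> 0 \<longrightarrow> (\<forall>k>d'. v x k = 0)"
    using assms(1,2) graph_bound by meson
  have "\<forall>\<^sub>F x in nhds p. \<forall>j\<in>{..max d d'}. f x \<noteq> 0 \<longrightarrow> jet 0 j u x = jet 0 j v x"
    using assms(3) by (intro eventually_ball_finite) (auto simp: germ_eq_def)
  with d show "germ_eq f p (Pol u) (Pol v)"
    unfolding germ_eq_def
  proof eventually_elim
    case (elim x)
    show ?case
    proof (intro impI poly_eqI)
      fix j assume x: "f x \<noteq> 0"
      show "coeff (Pol u x) j = coeff (Pol v x) j"
      proof (cases "j \<le> max d d'")
        case True
        then show ?thesis using elim x by (simp add: jet_0)
      next
        case False
        then have "rjet 0 k j = 0" if "k \<le> max d d'" for k using that by (intro rjet_zero) simp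
        then show ?thesis
          using elim x jet_bound[of "max d d'" u x 0 j] jet_bound[of "max d d'" v x 0 j]
          by (simp add: jet_0 del: of_rat_0)
      qed
    qed
  qed
qed

text \<open>Think of u as P(s) f^(s - alpha). The derivative acts on P as d/dx_i + (s - alpha) a_i /
  x_i. Writing s = -delta + (s + delta), the constant part gives \<open>tw\<close> with beta = delta
  + alpha, and the factor s + delta gives the preceding Taylor coefficient times a_i / x_i.\<close>

lemma jet_dx_germ:
  assumes u: "u \<in> graph_module f p"
  shows "germ_eq f p (jet \<delta> j (dx_act f \<alpha> i u))
    (\<lambda>x. tw (\<delta> + \<alpha>) i (jet \<delta> j u) x + of_nat (a i) / x $ i * (if j = 0 then 0 else jet \<delta> (j - 1) u x))"
proof -
  obtain d where d: "\<forall>\<^sub>F x in nhds p. f x \<noteq> 0 \<longrightarrow> (\<forall>k>d. u x k = 0) \<and>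
      (\<forall>\<delta> j. jet \<delta> j u x = (\<Sum>k\<le>d. rjet \<delta> k j * (u x k / f x ^ k)))"
    using graph_jet_expansion[OF u] by blast
  have hol: "\<forall>\<^sub>F x in nhds p. \<forall>k\<in>{..Suc d}. f x \<noteq> 0 \<longrightarrow> holo_at (\<lambda>y. u y k) x"
    using Msp_holo_at'[OF graph_mero[OF u, unfolded mero_eq]] by (intro eventually_ball_finite) auto
  from d have "\<forall>\<^sub>F y in nhds p. \<forall>\<^sub>F x in nhds y. f x \<noteq> 0 \<longrightarrow> (\<forall>k>d. u x k = 0) \<and>
      (\<forall>\<delta> j. jet \<delta> j u x = (\<Sum>k\<le>d. rjet \<delta> k j * (u x k / f x ^ k)))"
    by (simp add: eventually_eventually)
  then show ?thesis
    unfolding germ_eq_def using hol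
  proof (eventually_elim, intro impI)
    fix y
    assume y: "\<forall>\<^sub>F x in nhds y. f x \<noteq> 0 \<longrightarrow> (\<forall>k>d. u x k = 0) \<and>
      (\<forall>\<delta> j. jet \<delta> j u x = (\<Sum>k\<le>d. rjet \<delta> k j * (u x k / f x ^ k)))"
      and hol: "\<forall>k\<in>{..Suc d}. f y \<noteq> 0 \<longrightarrow> holo_at (\<lambda>y. u y k) y" and fy: "f y \<noteq> 0"
    from y eventually_f_nonzero[OF fy] have ev: "\<forall>\<^sub>F x in nhds y. f x \<noteq> 0 \<and> (\<forall>k>d. u x k = 0) \<and>
      (\<forall>\<delta> j. jet \<delta> j u x = (\<Sum>k\<le>d. rjet \<delta> k j * (u x k / f x ^ k)))"
      by (rule eventually_elim2) blast
    let ?A = "of_nat (a i) / y $ i :: complex"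
    let ?\<rho> = "\<lambda>k. if j = 0 then 0 else rjet \<delta> k (j - 1)"
    let ?g = "\<lambda>k. u y k / f y ^ k"
    have holf: "holo_at f y" using holo_germ_f[of y] eventually_nhds_x_imp_x unfolding holo_germ_iff by blast
    have hk: "holo_at (\<lambda>y. u y k) y" if "k \<le> Suc d" for k using hol fy that by simp
    have hq: "holo_at (\<lambda>y. u y k / f y ^ k) y" "partial i (\<lambda>y. u y k / f y ^ k) y =
        partial i (\<lambda>y. u y k) y / f y ^ k - of_nat k * ?A * ?g k" if "k \<le> Suc d" for k
    proof -
      have e1: "\<forall>\<^sub>F x in nhds y. u x k * mon (\<lambda>i. - (int k * int (a i))) x = u x k / f x ^ k"
        using eventually_f_nonzero[OF fy]
      proof (rule eventually_mono)
        fix x assume x: "f x \<noteq> 0"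
        show "u x k * mon (\<lambda>i. - (int k * int (a i))) x = u x k / f x ^ k"
          using mon_diff[OF x, of "\<lambda>_. 0" "\<lambda>i. int k * int (a i)"] by (simp add: f_power_eq_mon[OF x])
      qed
      have hm: "holo_at (\<lambda>y. u y k * mon (\<lambda>i. - (int k * int (a i))) y) y"
        by (rule holo_at_mult(1)[OF hk[OF that] holo_at_mon[OF fy]])
      then show "holo_at (\<lambda>y. u y k / f y ^ k) y" by (rule holo_at_cong_ev[OF e1])
      have "partial i (\<lambda>y. u y k / f y ^ k) y = partial i (\<lambda>y. u y k * mon (\<lambda>i. - (int k * int (a i))) y) y"
        by (rule partial_cong_ev[OF e1, symmetric])
      also have "\<dots> = partial i (\<lambda>y. u y k) y / f y ^ k - of_nat k * ?A * ?g k"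
        using eventually_nhds_x_imp_x[OF e1] mon_diff[OF fy, of "\<lambda>_. 0" "\<lambda>i. int k * int (a i)"]
        by (simp add: holo_at_mult(2)[OF hk[OF that] holo_at_mon[OF fy]] partial_mon[OF fy] f_power_eq_mon[OF fy] I_def)
      finally show "partial i (\<lambda>y. u y k / f y ^ k) y =
        partial i (\<lambda>y. u y k) y / f y ^ k - of_nat k * ?A * ?g k" .
    qed
    have zero: "u y k = 0" "partial i (\<lambda>y. u y k) y = 0" if "k > d" for k
    proof -
      have "\<forall>\<^sub>F x in nhds y. u x k = 0" using ev by (rule eventually_mono) (use that in auto)
      then show "u y k = 0" "partial i (\<lambda>y. u y k) y = 0"
        using eventually_nhds_x_imp_x partial_cong_ev[of "\<lambda>y. u y k" "\<lambda>_. 0" y i] by auto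
    qed
    have J: "jet \<delta> j u y = (\<Sum>k\<le>d. rjet \<delta> k j * ?g k)" for j
      using eventually_nhds_x_imp_x[OF ev] by blast
    have "partial i (jet \<delta> j u) y = partial i (\<lambda>x. \<Sum>k\<le>d. rjet \<delta> k j * (u x k / f x ^ k)) y"
      by (rule partial_cong_ev, use ev in \<open>rule eventually_mono\<close>) blast
    also have "\<dots> = (\<Sum>k\<le>d. rjet \<delta> k j * (partial i (\<lambda>y. u y k) y / f y ^ k - of_nat k * ?A * ?g k))"
      using hq holo_at_mult[OF holo_at_const(1) hq(1)] by (subst partial_sum) auto
    finally have P: "partial i (jet \<delta> j u) y =
      (\<Sum>k\<le>d. rjet \<delta> k j * (partial i (\<lambda>y. u y k) y / f y ^ k - of_nat k * ?A * ?g k))" .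
    have "jet \<delta> j (dx_act f \<alpha> i u) y = (\<Sum>k\<le>Suc d. rjet \<delta> k j * (dx_act f \<alpha> i u y k / f y ^ k))"
      by (rule jet_bound) (use zero in \<open>auto simp: dx_act_def nabla_def dt_act_def\<close>)
    also have "\<dots> = (\<Sum>k\<le>Suc d. rjet \<delta> k j * ((partial i (\<lambda>y. u y k) y - of_rat \<alpha> * u y k * ?A) / f y ^ k))
        - (\<Sum>k\<le>Suc d. rjet \<delta> k j * (?A * f y * dt_act u y k / f y ^ k))"
      using fy by (simp add: dx_act_def nabla_def partial_f sum_subtractf[symmetric] right_diff_distrib diff_divide_distrib mult_ac)
    also have "(\<Sum>k\<le>Suc d. rjet \<delta> k j * ((partial i (\<lambda>y. u y k) y - of_rat \<alpha> * u y k * ?A) / f y ^ k)) =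
        (\<Sum>k\<le>d. rjet \<delta> k j * ((partial i (\<lambda>y. u y k) y - of_rat \<alpha> * u y k * ?A) / f y ^ k))"
      using zero[of "Suc d"] by simp
    also have "(\<Sum>k\<le>Suc d. rjet \<delta> k j * (?A * f y * dt_act u y k / f y ^ k)) =
        (\<Sum>k\<le>d. rjet \<delta> (Suc k) j * (?A * ?g k))"
      by (subst sum.atMost_Suc_shift) (use fy in \<open>simp add: dt_act_def\<close>)
    also have "(\<Sum>k\<le>d. rjet \<delta> (Suc k) j * (?A * ?g k)) =
        (\<Sum>k\<le>d. (of_nat k + of_rat \<delta>) * rjet \<delta> k j * (?A * ?g k)) - ?A * (\<Sum>k\<le>d. ?\<rho> k * ?g k)"
      by (simp only: rjet_Suc sum_distrib_left sum_subtractf[symmetric]) (rule sum.cong, simp_all add: left_diff_distrib right_diff_distrib diff_divide_distrib mult_ac)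
    finally have L: "jet \<delta> j (dx_act f \<alpha> i u) y =
        (\<Sum>k\<le>d. rjet \<delta> k j * ((partial i (\<lambda>y. u y k) y - of_rat \<alpha> * u y k * ?A) / f y ^ k)) -
        ((\<Sum>k\<le>d. (of_nat k + of_rat \<delta>) * rjet \<delta> k j * (?A * ?g k)) - ?A * (\<Sum>k\<le>d. ?\<rho> k * ?g k))" .
    have 1: "(if j = 0 then 0 else jet \<delta> (j - 1) u y) = (\<Sum>k\<le>d. ?\<rho> k * ?g k)"
      by (simp add: J)
    have 2: "(\<Sum>k\<le>d. rjet \<delta> k j * ((partial i (\<lambda>y. u y k) y - of_rat \<alpha> * u y k * ?A) / f y ^ k)) -
        (\<Sum>k\<le>d. (of_nat k + of_rat \<delta>) * rjet \<delta> k j * (?A * ?g k)) = tw (\<delta> + \<alpha>) i (jet \<delta> j u) y"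
      unfolding tw_def P J sum_distrib_left sum_subtractf[symmetric]
      by (rule sum.cong) (simp_all add: of_rat_add diff_divide_distrib add_divide_distrib algebra_simps)
    show "jet \<delta> j (dx_act f \<alpha> i u) y = tw (\<delta> + \<alpha>) i (jet \<delta> j u) y +
        ?A * (if j = 0 then 0 else jet \<delta> (j - 1) u y)"
      unfolding L 1 2[symmetric] by simp
  qed
qed

lemma Wt_cong: "g \<in> Wt \<beta> j p \<Longrightarrow> germ_eq f p g g' \<Longrightarrow> g' \<in> Wt \<beta> j p"
  unfolding Wt_def by (rule Msp_cong)

lemma Wt_zero: "(\<lambda>_. 0) \<in> Wt \<beta> j p"
  unfolding Wt_def by (rule Msp_zero)

lemma Wt_add: "g \<in> Wt \<beta> j p \<Longrightarrow> g' \<in> Wt \<beta> j p \<Longrightarrow> (\<lambda>x. g x + g' x) \<in> Wt \<beta> j p"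
  unfolding Wt_def by (rule Msp_add)

lemma Wt_diff: "g \<in> Wt \<beta> j p \<Longrightarrow> g' \<in> Wt \<beta> j p \<Longrightarrow> (\<lambda>x. g x - g' x) \<in> Wt \<beta> j p"
  unfolding Wt_def by (rule Msp_diff)

lemma Wt_holo_mult: "g \<in> Wt \<beta> j p \<Longrightarrow> holo_germ p h \<Longrightarrow> (\<lambda>x. h x * g x) \<in> Wt \<beta> j p"
  unfolding Wt_def by (rule Msp_holo_mult)

lemma Wt_const_mult: "g \<in> Wt \<beta> j p \<Longrightarrow> (\<lambda>x. c * g x) \<in> Wt \<beta> j p"
  unfolding Wt_def by (rule Msp_const_mult)

lemma Wt_of_zero_germ: "germ_eq f p g (\<lambda>_. 0) \<Longrightarrow> g \<in> Wt \<beta> j p"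
  by (rule Wt_cong[OF Wt_zero germ_eq_sym])

section \<open>The V-filtration of a monomial\<close>

definition Vf :: "rat \<Rightarrow> complex ^ 'n \<Rightarrow> 'n graph_section set" where
  "Vf \<gamma> p = {u \<in> graph_module f p. \<forall>\<delta><\<gamma>. \<forall>j. jet \<delta> j u \<in> Wt (\<delta> + \<alpha>) (int j) p}"

text \<open>The filtration step just above gamma: the union of the \<open>Vf\<close> with larger
  index, by \<open>Va_eq_Union\<close>.\<close>

definition Va :: "rat \<Rightarrow> complex ^ 'n \<Rightarrow> 'n graph_section set" where
  "Va \<gamma> p = {u \<in> graph_module f p. \<forall>\<delta>\<le>\<gamma>. \<forall>j. jet \<delta> j u \<in> Wt (\<delta> + \<alpha>) (int j) p}"

lemma Vf_graph: "u \<in> Vf \<gamma> p \<Longrightarrow> u \<in> graph_module f p"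
  by (simp add: Vf_def)

lemma Vf_jet: "u \<in> Vf \<gamma> p \<Longrightarrow> \<delta> < \<gamma> \<Longrightarrow> jet \<delta> j u \<in> Wt (\<delta> + \<alpha>) (int j) p"
  by (simp add: Vf_def)

lemma VfI: "u \<in> graph_module f p \<Longrightarrow> (\<And>\<delta> j. \<delta> < \<gamma> \<Longrightarrow> jet \<delta> j u \<in> Wt (\<delta> + \<alpha>) (int j) p) \<Longrightarrow> u \<in> Vf \<gamma> p"
  by (simp add: Vf_def)

lemma Vf_antimono: "\<gamma> \<le> \<gamma>' \<Longrightarrow> Vf \<gamma>' p \<subseteq> Vf \<gamma> p"
  by (auto simp: Vf_def)

lemma Va_iff: "u \<in> Va \<gamma> p \<longleftrightarrow> u \<in> Vf \<gamma> p \<and> (\<forall>j. jet \<gamma> j u \<in> Wt (\<gamma> + \<alpha>) (int j) p)"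
  by (auto simp: Va_def Vf_def le_less)

lemma Vf_cong: "u \<in> Vf \<gamma> p \<Longrightarrow> germ_eq f p u v \<Longrightarrow> v \<in> Vf \<gamma> p"
  by (intro VfI) (auto intro: graph_cong Vf_graph Wt_cong[OF Vf_jet jet_cong])

lemma Vf_zero: "(\<lambda>_ _. 0) \<in> Vf \<gamma> p"
proof (intro VfI graph_zero)
  have "jet \<delta> j (\<lambda>_ _. 0) = (\<lambda>_. 0)" for \<delta> j by (simp add: fun_eq_iff jet_def Pol_def)
  then show "jet \<delta> j (\<lambda>_ _. 0) \<in> Wt (\<delta> + \<alpha>) (int j) p" for \<delta> j by (simp only: Wt_zero)
qed

lemma Vf_add: "u \<in> Vf \<gamma> p \<Longrightarrow> v \<in> Vf \<gamma> p \<Longrightarrow> (\<lambda>x j. u x j + v x j) \<in> Vf \<gamma> p"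
proof (intro VfI)
  assume *: "u \<in> Vf \<gamma> p" "v \<in> Vf \<gamma> p"
  show "(\<lambda>x j. u x j + v x j) \<in> graph_module f p" using * by (intro graph_add Vf_graph)
  fix \<delta> j assume "\<delta> < \<gamma>"
  with * show "jet \<delta> j (\<lambda>x j. u x j + v x j) \<in> Wt (\<delta> + \<alpha>) (int j) p"
    by (intro Wt_cong[OF Wt_add germ_eq_sym[OF jet_add_germ]] Vf_jet Vf_graph)
qed

lemma Vf_holo_mult: "u \<in> Vf \<gamma> p \<Longrightarrow> holo_germ p h \<Longrightarrow> (\<lambda>x j. h x * u x j) \<in> Vf \<gamma> p"
proof (intro VfI)
  assume *: "u \<in> Vf \<gamma> p" "holo_germ p h"
  show "(\<lambda>x j. h x * u x j) \<in> graph_module f p" using * by (intro graph_holo_mult Vf_graph)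
  fix \<delta> j assume "\<delta> < \<gamma>"
  with * show "jet \<delta> j (\<lambda>x j. h x * u x j) \<in> Wt (\<delta> + \<alpha>) (int j) p"
    by (intro Wt_cong[OF Wt_holo_mult germ_eq_sym[OF jet_scale_germ]] Vf_jet Vf_graph)
qed

lemma Vf_scale: "u \<in> Vf \<gamma> p \<Longrightarrow> (\<lambda>x j. c * u x j) \<in> Vf \<gamma> p"
  by (rule Vf_holo_mult) simp_all

lemma Vf_diff: "u \<in> Vf \<gamma> p \<Longrightarrow> v \<in> Vf \<gamma> p \<Longrightarrow> (\<lambda>x j. u x j - v x j) \<in> Vf \<gamma> p"
  using Vf_add[OF _ Vf_scale[of v \<gamma> p "-1"], of u] by simp

lemma Vf_t: "u \<in> Vf \<gamma> p \<Longrightarrow> t_act f u \<in> Vf (\<gamma> + 1) p"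
proof (intro VfI)
  assume u: "u \<in> Vf \<gamma> p"
  show "t_act f u \<in> graph_module f p" by (intro graph_t Vf_graph[OF u])
  fix \<delta> j assume "\<delta> < \<gamma> + 1"
  then have "jet (\<delta> - 1) j u \<in> Wt (\<delta> - 1 + \<alpha>) (int j) p" by (intro Vf_jet[OF u]) simp
  from Wt_mult_f[OF this] have "(\<lambda>x. f x * jet (\<delta> - 1) j u x) \<in> Wt (\<delta> + \<alpha>) (int j) p"
    by (simp add: algebra_simps)
  then show "jet \<delta> j (t_act f u) \<in> Wt (\<delta> + \<alpha>) (int j) p"
    by (rule Wt_cong) (rule germ_eq_sym[OF jet_t_germ[OF Vf_graph[OF u]]])
qed

lemma graph_t_inverse:
  assumes "u \<in> graph_module f p"
  shows "\<exists>v \<in> graph_module f p. germ_eq f p u (t_act f v)"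
proof -
  obtain d where d: "\<forall>\<^sub>F x in nhds p. f x \<noteq> 0 \<longrightarrow> (\<forall>k>d. u x k = 0)" using graph_bound[OF assms] by blast
  \<comment> \<open>The equations f v_k - (k + 1) v_(k+1) = u_k, solved downwards from v_(d+1) =
    0.\<close>
  define v where "v x k = (\<Sum>m\<in>{k..d}. (fact m / fact k) * (u x m / f x ^ (Suc m - k)))" for x k
  have "(\<lambda>x. v x k) \<in> mero_module f p" for k
    unfolding v_def using mero_div_f_power[OF graph_mero[OF assms]] unfolding mero_eq
    by (intro Msp_sum Msp_const_mult) auto
  moreover have "\<forall>\<^sub>F x in nhds p. f x \<noteq> 0 \<longrightarrow> (\<forall>k>d. v x k = 0)"
    by (simp add: v_def)
  ultimately have v: "v \<in> graph_module f p" by (rule graphI)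
  have "u x k = t_act f v x k" if x: "f x \<noteq> 0" "\<forall>k>d. u x k = 0" for x k
  proof (cases "k \<le> d")
    case True
    have "f x * v x k = (\<Sum>m\<in>{k..d}. (fact m / fact k) * (u x m / f x ^ (m - k)))"
      unfolding v_def sum_distrib_left by (intro sum.cong) (use x in \<open>auto simp: Suc_diff_le\<close>)
    also have "\<dots> = u x k + (\<Sum>m\<in>{Suc k..d}. (fact m / fact k) * (u x m / f x ^ (m - k)))"
      using True by (subst sum.atLeast_Suc_atMost) auto
    also have "(\<Sum>m\<in>{Suc k..d}. (fact m / fact k) * (u x m / f x ^ (m - k))) = of_nat (Suc k) * v x (Suc k)"
      unfolding v_def sum_distrib_left by (intro sum.cong) (auto simp del: of_nat_Suc simp: fact_Suc field_simps)
    finally show ?thesis by (simp add: t_act_def)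
  next
    case False
    then show ?thesis using x by (simp add: t_act_def v_def)
  qed
  then have "germ_eq f p u (t_act f v)"
    unfolding germ_eq_def using d by (elim eventually_mono) (auto simp: fun_eq_iff)
  with v show ?thesis by blast
qed

lemma Vf_t_inverse:
  assumes "u \<in> Vf (\<gamma> + 1) p"
  shows "\<exists>v \<in> Vf \<gamma> p. germ_eq f p u (t_act f v)"
proof -
  obtain v where v: "v \<in> graph_module f p" "germ_eq f p u (t_act f v)"
    using graph_t_inverse[OF Vf_graph[OF assms]] by blast
  have "v \<in> Vf \<gamma> p"
  proof (rule VfI[OF v(1)])
    fix \<delta> j assume "\<delta> < \<gamma>"
    then have "jet (\<delta> + 1) j u \<in> Wt (\<delta> + 1 + \<alpha>) (int j) p" by (intro Vf_jet[OF assms]) simp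
    then have "jet (\<delta> + 1) j (t_act f v) \<in> Wt (\<delta> + 1 + \<alpha>) (int j) p"
      by (rule Wt_cong) (rule jet_cong[OF v(2)])
    then have "(\<lambda>x. f x * jet \<delta> j v x) \<in> Wt (\<delta> + 1 + \<alpha>) (int j) p"
      using Wt_cong[OF _ jet_t_germ[OF v(1), of "\<delta> + 1" j]] by simp
    from Wt_div_f_power[OF this, of 1] have "(\<lambda>x. f x * jet \<delta> j v x / f x ^ 1) \<in> Wt (\<delta> + \<alpha>) (int j) p"
      by (simp add: algebra_simps)
    then show "jet \<delta> j v \<in> Wt (\<delta> + \<alpha>) (int j) p" by (rule Wt_cong) (auto intro: germ_eqI)
  qed
  with v(2) show ?thesis by blast
qed

lemma Vf_dtt_minus: "u \<in> Vf \<gamma> p \<Longrightarrow> dtt_minus f \<gamma>' u \<in> Vf \<gamma> p"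
proof (intro VfI)
  assume u: "u \<in> Vf \<gamma> p"
  show "dtt_minus f \<gamma>' u \<in> graph_module f p" by (intro graph_dtt_minus Vf_graph[OF u])
  fix \<delta> j assume \<delta>: "\<delta> < \<gamma>"
  have "(\<lambda>x. if j = 0 then 0 else jet \<delta> (j - 1) u x) \<in> Wt (\<delta> + \<alpha>) (int j) p"
  proof (cases "j = 0")
    case False
    then show ?thesis using Vf_jet[OF u \<delta>, of "j - 1"] Wt_mono[of "int (j - 1)" "int j"] by auto
  qed (simp add: Wt_zero)
  then have "(\<lambda>x. of_rat (\<delta> - \<gamma>') * jet \<delta> j u x - (if j = 0 then 0 else jet \<delta> (j - 1) u x)) \<in> Wt (\<delta> + \<alpha>) (int j) p"
    by (intro Wt_diff Wt_const_mult Vf_jet[OF u \<delta>])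
  then show "jet \<delta> j (dtt_minus f \<gamma>' u) \<in> Wt (\<delta> + \<alpha>) (int j) p"
    by (rule Wt_cong) (rule germ_eq_sym[OF jet_dtt_minus_germ[OF Vf_graph[OF u]]])
qed

lemma dt_t_eq_dtt_minus: "dt_act (t_act f u) = dtt_minus f 0 u"
  by (simp add: dtt_minus_def)

lemma dt_cong: "germ_eq f p u v \<Longrightarrow> germ_eq f p (dt_act u) (dt_act v)"
  unfolding germ_eq_def by (erule eventually_mono) (auto simp: dt_act_def fun_eq_iff)

text \<open>Divide u by t, which lowers the index by one; then (d/dt) u is (d/dt) t applied to the
  quotient, and (d/dt) t preserves the filtration.\<close>

lemma Vf_dt: "u \<in> Vf \<gamma> p \<Longrightarrow> dt_act u \<in> Vf (\<gamma> - 1) p"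
proof -
  assume "u \<in> Vf \<gamma> p"
  then obtain v where v: "v \<in> Vf (\<gamma> - 1) p" "germ_eq f p u (t_act f v)"
    using Vf_t_inverse[of u "\<gamma> - 1" p] by auto
  have "dt_act (t_act f v) \<in> Vf (\<gamma> - 1) p"
    unfolding dt_t_eq_dtt_minus by (rule Vf_dtt_minus[OF v(1)])
  then show ?thesis by (rule Vf_cong) (rule germ_eq_sym[OF dt_cong[OF v(2)]])
qed

text \<open>Of the two terms in \<open>jet_dx_germ\<close>, the first keeps the pole count by
  \<open>Wt_tw\<close>; the second gains one pole, but comes from the Taylor coefficient of index j
  - 1, where one pole fewer is allowed.\<close>

lemma Vf_dx: "u \<in> Vf \<gamma> p \<Longrightarrow> dx_act f \<alpha> i u \<in> Vf \<gamma> p"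
proof (intro VfI)
  assume u: "u \<in> Vf \<gamma> p"
  show "dx_act f \<alpha> i u \<in> graph_module f p" by (intro graph_dx Vf_graph[OF u])
  fix \<delta> j assume \<delta>: "\<delta> < \<gamma>"
  have "(\<lambda>x. of_nat (a i) / x $ i * (if j = 0 then 0 else jet \<delta> (j - 1) u x)) \<in> Wt (\<delta> + \<alpha>) (int j) p"
  proof (cases "j = 0")
    case False
    then have "int (j - 1) = int j - 1" by simp
    then show ?thesis using Wt_div_coord[of "jet \<delta> (j - 1) u" "\<delta> + \<alpha>" "int j" p i] Vf_jet[OF u \<delta>, of "j - 1"] False
      by simp
  qed (simp add: Wt_zero)
  from Wt_add[OF Wt_tw[OF Vf_jet[OF u \<delta>]] this]
  show "jet \<delta> j (dx_act f \<alpha> i u) \<in> Wt (\<delta> + \<alpha>) (int j) p"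
    by (rule Wt_cong) (rule germ_eq_sym[OF jet_dx_germ[OF Vf_graph[OF u]]])
qed

section \<open>Jumps, nilpotence and exhaustiveness of the V-filtration\<close>

lemma jet_dtt_power:
  assumes "u \<in> graph_module f p"
  shows "(dtt_minus f \<gamma> ^^ i) u \<in> graph_module f p \<and>
    germ_eq f p (jet \<gamma> j ((dtt_minus f \<gamma> ^^ i) u)) (\<lambda>x. if j < i then 0 else (-1) ^ i * jet \<gamma> (j - i) u x)"
proof (induction i arbitrary: j)
  case 0
  then show ?case using assms by simp
next
  case (Suc i)
  have g: "(dtt_minus f \<gamma> ^^ i) u \<in> graph_module f p" using Suc by blast
  have "germ_eq f p (jet \<gamma> j (dtt_minus f \<gamma> ((dtt_minus f \<gamma> ^^ i) u)))
      (\<lambda>x. - (if j = 0 then 0 else jet \<gamma> (j - 1) ((dtt_minus f \<gamma> ^^ i) u) x))"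
    using jet_dtt_minus_germ[OF g, of \<gamma> j \<gamma>] by simp
  moreover have "germ_eq f p (\<lambda>x. - (if j = 0 then 0 else jet \<gamma> (j - 1) ((dtt_minus f \<gamma> ^^ i) u) x))
      (\<lambda>x. if j < Suc i then 0 else (-1) ^ Suc i * jet \<gamma> (j - Suc i) u x)"
  proof (cases "j = 0")
    case False
    have "germ_eq f p (\<lambda>x. - jet \<gamma> (j - 1) ((dtt_minus f \<gamma> ^^ i) u) x)
      (\<lambda>x. - (if j - 1 < i then 0 else (-1) ^ i * jet \<gamma> (j - 1 - i) u x))"
      using germ_eq_lift1[where F="\<lambda>_ y. - y", OF conjunct2[OF Suc[of "j - 1"]]] .
    moreover have "(j - 1 < i) = (j < Suc i)" using False by auto
    ultimately show ?thesis using False by (cases "j < Suc i") simp_all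
  qed simp
  ultimately have "germ_eq f p (jet \<gamma> j (dtt_minus f \<gamma> ((dtt_minus f \<gamma> ^^ i) u)))
      (\<lambda>x. if j < Suc i then 0 else (-1) ^ Suc i * jet \<gamma> (j - Suc i) u x)"
    by (rule germ_eq_trans)
  then show ?case using graph_dtt_minus[OF g] by simp
qed

text \<open>A critical delta has the form c / a_i - alpha with c an integer; the denominator of
  alpha times the product of the a_i clears all these denominators.\<close>

lemma grid_exists: "\<exists>r::nat. r > 0 \<and> (\<forall>\<delta>. \<forall>i\<in>I. (\<delta> + \<alpha>) * of_nat (a i) \<in> \<int> \<longrightarrow> of_nat r * \<delta> \<in> \<int>)"
proof -
  obtain m d where q: "quotient_of \<alpha> = (m, d)" by (cases "quotient_of \<alpha>")
  then have d: "d > 0" "\<alpha> = of_int m / of_int d"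
    by (auto simp: quotient_of_denom_pos quotient_of_div)
  let ?A = "\<Prod>i\<in>I. a i"
  have A: "?A > 0" by (auto simp: I_def)
  have "of_nat (nat d * ?A) * \<delta> \<in> \<int>" if "i \<in> I" "(\<delta> + \<alpha>) * of_nat (a i) \<in> \<int>" for \<delta> i
  proof -
    have "of_nat ?A = of_nat (a i) * (of_nat (\<Prod>j\<in>I - {i}. a j) :: rat)"
      using that(1) by (subst prod.remove[of _ i]) auto
    then have "of_nat (nat d * ?A) * (\<delta> + \<alpha>) = of_nat (nat d * (\<Prod>j\<in>I - {i}. a j)) * ((\<delta> + \<alpha>) * of_nat (a i))"
      by (simp only: of_nat_mult mult_ac)
    also have "\<dots> \<in> \<int>" by (rule Ints_mult[OF Ints_of_nat that(2)])
    finally have 1: "of_nat (nat d * ?A) * (\<delta> + \<alpha>) \<in> \<int>" .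
    have "of_nat (nat d) * \<alpha> = of_int m" using d by simp
    moreover have "of_nat (nat d * ?A) * \<alpha> = (of_nat (nat d) * \<alpha>) * of_nat ?A" by simp
    ultimately have "of_nat (nat d * ?A) * \<alpha> = of_int m * of_nat ?A" by metis
    also have "\<dots> \<in> \<int>" by (rule Ints_mult[OF Ints_of_int Ints_of_nat])
    finally have "of_nat (nat d * ?A) * (\<delta> + \<alpha>) - of_nat (nat d * ?A) * \<alpha> \<in> \<int>"
      using 1 by (intro Ints_diff)
    then show ?thesis by (simp add: distrib_left)
  qed
  moreover have "nat d * ?A > 0" using d(1) A by simp
  ultimately show ?thesis by blast
qed

definition grid :: nat where
  "grid = (SOME r. r > 0 \<and> (\<forall>\<delta>. \<forall>i\<in>I. (\<delta> + \<alpha>) * of_nat (a i) \<in> \<int> \<longrightarrow> of_nat r * \<delta> \<in> \<int>))"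

lemma grid_pos: "grid > 0"
  and grid_critical: "i \<in> I \<Longrightarrow> (\<delta> + \<alpha>) * of_nat (a i) \<in> \<int> \<Longrightarrow> of_nat grid * \<delta> \<in> \<int>"
  using someI_ex[OF grid_exists, folded grid_def] by blast+

lemma Wt_off_grid: "of_nat grid * \<delta> \<notin> \<int> \<Longrightarrow> Wt (\<delta> + \<alpha>) (int j) p = mero_module f p"
  using grid_critical by (subst Wt_noncritical) auto

text \<open>At points off the grid the condition on the Taylor coefficients is empty, so moving
  gamma up to the next grid point adds no constraint.\<close>

lemma Vf_round_up: "Vf \<gamma> p = Vf (of_int \<lceil>of_nat grid * \<gamma>\<rceil> / of_nat grid) p"
proof
  have g: "(0::rat) < of_nat grid" using grid_pos by simp
  have "\<gamma> \<le> of_int \<lceil>of_nat grid * \<gamma>\<rceil> / of_nat grid"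
    using g le_of_int_ceiling[of "of_nat grid * \<gamma>"] by (simp add: pos_le_divide_eq mult.commute)
  then show "Vf (of_int \<lceil>of_nat grid * \<gamma>\<rceil> / of_nat grid) p \<subseteq> Vf \<gamma> p" by (rule Vf_antimono)
  show "Vf \<gamma> p \<subseteq> Vf (of_int \<lceil>of_nat grid * \<gamma>\<rceil> / of_nat grid) p"
  proof
    fix u assume u: "u \<in> Vf \<gamma> p"
    show "u \<in> Vf (of_int \<lceil>of_nat grid * \<gamma>\<rceil> / of_nat grid) p"
    proof (rule VfI[OF Vf_graph[OF u]])
      fix \<delta> :: rat and j assume \<delta>: "\<delta> < of_int \<lceil>of_nat grid * \<gamma>\<rceil> / of_nat grid"
      show "jet \<delta> j u \<in> Wt (\<delta> + \<alpha>) (int j) p"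
      proof (cases "\<delta> < \<gamma>")
        case True
        then show ?thesis by (rule Vf_jet[OF u])
      next
        case False
        have "of_nat grid * \<delta> \<notin> \<int>"
        proof
          assume "of_nat grid * \<delta> \<in> \<int>"
          then obtain k where k: "of_nat grid * \<delta> = of_int k" by (elim Ints_cases)
          have "of_nat grid * \<gamma> \<le> of_int k" using False g by (simp flip: k)
          then have "\<lceil>of_nat grid * \<gamma>\<rceil> \<le> k" by (simp add: ceiling_le_iff)
          moreover have "of_int k < (of_int \<lceil>of_nat grid * \<gamma>\<rceil> :: rat)"
            using \<delta> g by (simp add: pos_less_divide_eq mult.commute flip: k)
          ultimately show False by simp
        qed
        then show ?thesis using Wt_off_grid jet_mero[OF Vf_graph[OF u]] by simp
      qed
    qed
  qed
qed

definition next_jump :: "rat \<Rightarrow> rat" where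
  "next_jump \<gamma> = (of_int \<lfloor>of_nat grid * \<gamma>\<rfloor> + 1) / of_nat grid"

lemma next_jump_greater: "\<gamma> < next_jump \<gamma>"
proof -
  have "of_nat grid * \<gamma> < of_int \<lfloor>of_nat grid * \<gamma>\<rfloor> + 1" by linarith
  then show ?thesis using grid_pos by (simp add: next_jump_def pos_less_divide_eq mult.commute)
qed

lemma Va_eq_Vf: "Va \<gamma> p = Vf (next_jump \<gamma>) p"
proof
  show "Vf (next_jump \<gamma>) p \<subseteq> Va \<gamma> p"
    using next_jump_greater[of \<gamma>] by (auto simp: Vf_def Va_def)
  have g: "(0::rat) < of_nat grid" using grid_pos by simp
  show "Va \<gamma> p \<subseteq> Vf (next_jump \<gamma>) p"
  proof
    fix u assume u: "u \<in> Va \<gamma> p"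
    then have gr: "u \<in> graph_module f p" by (simp add: Va_def)
    show "u \<in> Vf (next_jump \<gamma>) p"
    proof (rule VfI[OF gr])
      fix \<delta> j assume \<delta>: "\<delta> < next_jump \<gamma>"
      show "jet \<delta> j u \<in> Wt (\<delta> + \<alpha>) (int j) p"
      proof (cases "\<delta> \<le> \<gamma>")
        case True
        then show ?thesis using u by (simp add: Va_def)
      next
        case False
        have "of_nat grid * \<delta> \<notin> \<int>"
        proof
          assume "of_nat grid * \<delta> \<in> \<int>"
          then obtain k where k: "of_nat grid * \<delta> = of_int k" by (elim Ints_cases)
          have "of_nat grid * \<gamma> < of_int k" using False g by (simp flip: k)
          then have "\<lfloor>of_nat grid * \<gamma>\<rfloor> < k" by (simp add: floor_less_iff)
          moreover have "of_int k < (of_int (\<lfloor>of_nat grid * \<gamma>\<rfloor> + 1) :: rat)"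
            using \<delta> g by (simp add: next_jump_def pos_less_divide_eq mult.commute flip: k)
          ultimately show False by (simp only: of_int_less_iff)
        qed
        then show ?thesis using Wt_off_grid jet_mero[OF gr] by simp
      qed
    qed
  qed
qed

lemma Va_eq_Union: "Va \<gamma> p = (\<Union>\<delta>\<in>{\<gamma><..}. Vf \<delta> p)"
proof
  show "Va \<gamma> p \<subseteq> (\<Union>\<delta>\<in>{\<gamma><..}. Vf \<delta> p)"
    using next_jump_greater[of \<gamma>] by (auto simp: Va_eq_Vf)
  show "(\<Union>\<delta>\<in>{\<gamma><..}. Vf \<delta> p) \<subseteq> Va \<gamma> p"
    by (auto simp: Vf_def Va_def)
qed

text \<open>The power shifts the Taylor coefficients at -gamma past the index CARD('n); those below
  vanish, and those from there on are unconstrained, since there are never more poles than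
  coordinates.\<close>

lemma Vf_nilpotent: "u \<in> Vf \<gamma> p \<Longrightarrow> (dtt_minus f \<gamma> ^^ CARD('n)) u \<in> Va \<gamma> p"
proof -
  assume u: "u \<in> Vf \<gamma> p"
  have 1: "(dtt_minus f \<gamma> ^^ i) u \<in> Vf \<gamma> p" for i
    by (induction i) (auto simp: u Vf_dtt_minus)
  have "jet \<gamma> j ((dtt_minus f \<gamma> ^^ CARD('n)) u) \<in> Wt (\<gamma> + \<alpha>) (int j) p" for j
  proof (cases "j < CARD('n)")
    case True
    have "germ_eq f p (jet \<gamma> j ((dtt_minus f \<gamma> ^^ CARD('n)) u)) (\<lambda>_. 0)"
      using jet_dtt_power[OF Vf_graph[OF u], where \<gamma>=\<gamma> and i="CARD('n)" and j=j] True by simp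
    then show ?thesis by (rule Wt_of_zero_germ)
  next
    case False
    then show ?thesis using jet_mero[OF Vf_graph[OF 1]] by (simp add: Wt_top)
  qed
  with 1 show ?thesis by (simp add: Va_iff)
qed

lemma graph_in_Vf: "u \<in> graph_module f p \<Longrightarrow> \<exists>\<gamma>. u \<in> Vf \<gamma> p"
proof -
  assume u: "u \<in> graph_module f p"
  obtain d where d: "\<forall>\<^sub>F x in nhds p. f x \<noteq> 0 \<longrightarrow> (\<forall>k>d. u x k = 0) \<and>
      (\<forall>\<delta> j. jet \<delta> j u x = (\<Sum>k\<le>d. rjet \<delta> k j * (u x k / f x ^ k)))"
    using graph_jet_expansion[OF u] by blast
  have "\<forall>k. \<exists>N::int. \<forall>\<beta> j. (\<forall>i\<in>I. \<beta> * of_nat (a i) \<in> \<int> \<longrightarrow> \<beta> * of_nat (a i) \<le> of_int N) \<longrightarrow> 0 \<le> j \<longrightarrow>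
      (\<lambda>x. u x k / f x ^ k) \<in> Wt \<beta> j p"
    using mero_bounded[OF mero_div_f_power[OF graph_mero[OF u]]] by blast
  then obtain N :: "nat \<Rightarrow> int" where N: "\<And>k \<beta> j. \<forall>i\<in>I. \<beta> * of_nat (a i) \<in> \<int> \<longrightarrow> \<beta> * of_nat (a i) \<le> of_int (N k) \<Longrightarrow>
      0 \<le> j \<Longrightarrow> (\<lambda>x. u x k / f x ^ k) \<in> Wt \<beta> j p"
    by metis
  \<comment> \<open>Including 0 makes M nonpositive, so that M a_i <= M because a_i >= 1.\<close>
  define M where "M = Min (insert 0 (N ` {..d}))"
  have M: "M \<le> 0" "\<And>k. k \<le> d \<Longrightarrow> M \<le> N k" unfolding M_def by (intro Min_le; auto)+
  have "u \<in> Vf (of_int M - \<alpha>) p"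
  proof (rule VfI[OF u])
    fix \<delta> j assume \<delta>: "\<delta> < of_int M - \<alpha>"
    have "(\<delta> + \<alpha>) * of_nat (a i) \<le> of_int (N k)" if "i \<in> I" "k \<le> d" for i k
    proof -
      have "(\<delta> + \<alpha>) * of_nat (a i) \<le> of_int M * of_nat (a i)"
        using \<delta> by (intro mult_right_mono) auto
      also have "\<dots> \<le> of_int M * 1"
        using M(1) that(1) by (intro mult_left_mono_neg) (auto simp: I_iff Suc_le_eq)
      also have "\<dots> \<le> of_int (N k)" using M(2)[OF that(2)] by simp
      finally show ?thesis .
    qed
    then have "(\<lambda>x. rjet \<delta> k j * (u x k / f x ^ k)) \<in> Wt (\<delta> + \<alpha>) (int j) p" if "k \<le> d" for k
      using that by (intro Wt_const_mult N) auto
    then have "(\<lambda>x. \<Sum>k\<le>d. rjet \<delta> k j * (u x k / f x ^ k)) \<in> Wt (\<delta> + \<alpha>) (int j) p"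
      unfolding Wt_def by (intro Msp_sum) auto
    then show "jet \<delta> j u \<in> Wt (\<delta> + \<alpha>) (int j) p"
    proof (rule Wt_cong)
      show "germ_eq f p (\<lambda>x. \<Sum>k\<le>d. rjet \<delta> k j * (u x k / f x ^ k)) (jet \<delta> j u)"
        unfolding germ_eq_def using d by (rule eventually_mono) simp
    qed
  qed
  then show ?thesis by blast
qed

end

text \<open>A derivation in the span has finitely many steps, each valid on a neighbourhood of
  p.\<close>

lemma span_by_eventually:
  assumes "u \<in> span_by (germ_eq f p) (Ops p) G" "\<And>T. T \<in> Ops p \<Longrightarrow> \<forall>\<^sub>F q in nhds p. T \<in> Ops q"
  shows "\<forall>\<^sub>F q in nhds p. u \<in> span_by (germ_eq f q) (Ops q) G"
  using assms(1)
proof induction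
  case zero
  show ?case by (intro always_eventually allI span_by.zero)
next
  case (base g)
  then show ?case by (intro always_eventually allI span_by.base)
next
  case (add u v)
  from add(3,4) show ?case by (rule eventually_elim2) (rule span_by.add)
next
  case (act T u)
  from assms(2)[OF act(1)] act(3) show ?case by (rule eventually_elim2) (rule span_by.act)
next
  case (cong u v)
  from cong(3) germ_eq_eventually[OF cong(2)] show ?case by (rule eventually_elim2) (rule span_by.cong)
qed

lemma span_by_least:
  assumes "u \<in> span_by E Ops G" "G \<subseteq> S" "0 \<in> S"
    and "\<And>u v. u \<in> S \<Longrightarrow> v \<in> S \<Longrightarrow> u + v \<in> S"
    and "\<And>T u. T \<in> Ops \<Longrightarrow> u \<in> S \<Longrightarrow> T u \<in> S"
    and "\<And>u v. u \<in> S \<Longrightarrow> E u v \<Longrightarrow> v \<in> S"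
  shows "u \<in> S"
  using assms(1) by induction (use assms(2-) in blast)+

section \<open>Divisibility by products of linear factors\<close>

lemma linear_power_dvd:
  fixes q :: "complex poly"
  assumes "\<And>j. j < R \<Longrightarrow> coeff (pcompose q [:- c, 1:]) j = 0"
  shows "[:c, 1:] ^ R dvd q"
proof -
  have "monom 1 R dvd pcompose q [:- c, 1:]"
    using assms by (simp add: monom_1_dvd_iff')
  then obtain r where r: "pcompose q [:- c, 1:] = monom 1 R * r" by (elim dvdE)
  have "pcompose (pcompose q [:- c, 1:]) [:c, 1:] = pcompose q (pcompose [:- c, 1:] [:c, 1:])"
    by (rule pcompose_assoc[symmetric])
  also have "pcompose [:- c, 1:] [:c, 1:] = [:0, 1:]" by (simp add: pcompose_pCons)
  finally have "q = pcompose (monom 1 R) [:c, 1:] * pcompose r [:c, 1:]"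
    by (simp add: r pcompose_mult pcompose_idR)
  also have "pcompose (monom 1 R) [:c, 1:] = [:c, 1:] ^ R"
    by (induction R) (simp_all add: monom_Suc pcompose_mult pcompose_pCons pcompose_1 flip: one_pCons monom_0)
  finally show ?thesis by simp
qed

lemma prod_linear_powers_dvd:
  fixes q :: "complex poly"
  assumes "finite A" "inj_on c A" "\<And>d. d \<in> A \<Longrightarrow> [:c d, 1:] ^ n d dvd q"
  shows "(\<Prod>d\<in>A. [:c d, 1:] ^ n d) dvd q"
  using assms
proof (induction A)
  case (insert d A)
  then obtain r where r: "q = (\<Prod>d\<in>A. [:c d, 1:] ^ n d) * r" by (auto elim!: dvdE)
  show ?case
  proof (cases "q = 0")
    case False
    let ?P = "\<Prod>d\<in>A. [:c d, 1:] ^ n d"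
    have nz: "?P \<noteq> 0" "r \<noteq> 0" using False r by auto
    have "poly ?P (- c d) \<noteq> 0"
      using insert(1,2,4) by (auto simp: poly_prod inj_on_def)
    then have "order (- c d) ?P = 0" by (rule order_0I)
    then have "order (- c d) q = order (- c d) r" using nz r by (simp add: order_mult)
    moreover have "n d \<le> order (- c d) q"
      using insert(5)[of d] False order_divides[of "- c d" "n d" q] by simp
    ultimately have "[:c d, 1:] ^ n d dvd r"
      using order_divides[of "- c d" "n d" r] by simp
    then show ?thesis using insert(1,2) r by (simp add: mult.commute[of "[:c d, 1:] ^ n d"] mult_dvd_mono)
  qed simp
qed simp

lemma div_sum_smult:
  fixes D :: "complex poly"
  shows "(\<Sum>k\<in>K. smult (c k) (P k)) div D = (\<Sum>k\<in>K. smult (c k) (P k div D))"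
  by (induction K rule: infinite_finite_induct) (auto simp: poly_div_add_left div_smult_left)

context normal_crossing
begin

section \<open>Sections generated by a single monomial\<close>

lemma V0_ops_eventually: "T \<in> V0_ops f \<alpha> p \<Longrightarrow> \<forall>\<^sub>F q in nhds p. T \<in> V0_ops f \<alpha> q"
proof -
  assume T: "T \<in> V0_ops f \<alpha> p"
  show ?thesis
  proof (cases "\<exists>h. holo_germ p h \<and> T = (\<lambda>u x j. h x * u x j)")
    case True
    then obtain h where h: "holo_germ p h" "T = (\<lambda>u x j. h x * u x j)" by blast
    from holo_germ_eventually[OF h(1)] show ?thesis
      by (rule eventually_mono) (use h(2) in \<open>unfold V0_ops_def, blast\<close>)
  next
    case False
    then have "T \<in> range (dx_act f \<alpha>) \<union> {t_act f, dt_act \<circ> t_act f}" using T unfolding V0_ops_def by blast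
    then show ?thesis unfolding V0_ops_def by (intro always_eventually) blast
  qed
qed

lemma Vf_V0_ops: "T \<in> V0_ops f \<alpha> p \<Longrightarrow> u \<in> Vf \<gamma> p \<Longrightarrow> T u \<in> Vf \<gamma> p"
  using Vf_t[of u \<gamma> p] Vf_antimono[of \<gamma> "\<gamma> + 1" p] Vf_dtt_minus[of u \<gamma> p 0]
  unfolding V0_ops_def by (auto simp: Vf_holo_mult Vf_dx dt_t_eq_dtt_minus)

lemma Vf_span: "G \<subseteq> Vf \<gamma> p \<Longrightarrow> span_by (germ_eq f p) (V0_ops f \<alpha> p) G \<subseteq> Vf \<gamma> p"
proof
  fix u assume G: "G \<subseteq> Vf \<gamma> p" and u: "u \<in> span_by (germ_eq f p) (V0_ops f \<alpha> p) G"
  from u G show "u \<in> Vf \<gamma> p"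
  proof (rule span_by_least)
    show "0 \<in> Vf \<gamma> p" using Vf_zero by (simp add: zero_fun_def)
    show "u + v \<in> Vf \<gamma> p" if "u \<in> Vf \<gamma> p" "v \<in> Vf \<gamma> p" for u v
      using Vf_add[OF that] by (simp add: plus_fun_def)
  qed (fact Vf_V0_ops, fact Vf_cong)
qed

text \<open>The largest integer strictly below (gamma + alpha) a_i: the least exponents for which no
  index is a pole at any delta < gamma.\<close>

definition bexp :: "rat \<Rightarrow> 'n \<Rightarrow> int" where
  "bexp \<gamma> i = \<lceil>(\<gamma> + \<alpha>) * of_nat (a i)\<rceil> - 1"

lemma below_bexp:
  assumes "\<delta> < \<gamma>" "i \<in> I" "(\<delta> + \<alpha>) * of_nat (a i) \<in> \<int>"
  shows "(\<delta> + \<alpha>) * of_nat (a i) \<le> of_int (bexp \<gamma> i)"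
proof -
  obtain k where k: "(\<delta> + \<alpha>) * of_nat (a i) = of_int k" using assms(3) by (elim Ints_cases)
  have "of_int k < (\<gamma> + \<alpha>) * of_nat (a i)"
    unfolding k[symmetric] using assms(1,2) by (intro mult_strict_right_mono) (auto simp: I_iff)
  then have "k < \<lceil>(\<gamma> + \<alpha>) * of_nat (a i)\<rceil>" by (simp add: less_ceiling_iff)
  then show ?thesis unfolding k bexp_def by simp
qed

lemma bexp_less: "of_int (bexp \<gamma> i) < (\<gamma> + \<alpha>) * of_nat (a i)"
proof -
  have "of_int \<lceil>(\<gamma> + \<alpha>) * of_nat (a i)\<rceil> - 1 < (\<gamma> + \<alpha>) * of_nat (a i)" by linarith
  then show ?thesis by (simp add: bexp_def)
qed

lemma poles_zeroI:
  assumes "\<And>i. i \<in> I \<Longrightarrow> \<beta> * of_nat (a i) \<in> \<int> \<Longrightarrow> \<beta> * of_nat (a i) \<le> of_int (e i)"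
  shows "poles \<beta> e = 0"
proof -
  have "{i \<in> I. \<beta> * of_nat (a i) \<in> \<int> \<and> of_int (e i) < \<beta> * of_nat (a i)} = {}"
    using assms by force
  then show ?thesis unfolding poles_def by simp
qed

lemma incl_mon_Vf:
  assumes "\<And>i. i \<in> I \<Longrightarrow> bexp \<gamma> i \<le> e i"
  shows "graph_incl (mon e) \<in> Vf \<gamma> p"
proof (rule VfI)
  show "graph_incl (mon e) \<in> graph_module f p"
    by (rule graph_incl_graph) (simp add: mero_eq Msp_mon)
  fix \<delta> j assume \<delta>: "\<delta> < \<gamma>"
  have "poles (\<delta> + \<alpha>) e = 0"
    by (rule poles_zeroI) (use below_bexp[OF \<delta>] assms in \<open>meson of_int_le_iff order_trans\<close>)
  then have "mon e \<in> Wt (\<delta> + \<alpha>) (int j) p" unfolding Wt_def by (intro Msp_mon) simp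
  moreover have "jet \<delta> j (graph_incl (mon e)) = (if j = 0 then mon e else (\<lambda>_. 0))"
    by (auto simp: jet_incl fun_eq_iff)
  ultimately show "jet \<delta> j (graph_incl (mon e)) \<in> Wt (\<delta> + \<alpha>) (int j) p"
    using Wt_zero by (cases "j = 0") auto
qed

lemma sact_incl:
  assumes "g \<in> mero_module f p"
  shows "sact q (graph_incl g) \<in> graph_module f p"
    and "germ_eq f p (jet 0 j (sact q (graph_incl g))) (\<lambda>x. coeff q j * g x)"
    and "germ_eq f p (Pol (sact q (graph_incl g))) (\<lambda>x. smult (g x) q)"
proof -
  show "sact q (graph_incl g) \<in> graph_module f p" by (intro graph_sact graph_incl_graph assms)
  show 1: "germ_eq f p (Pol (sact q (graph_incl g))) (\<lambda>x. smult (g x) q)"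
    using Pol_sact_germ[OF graph_incl_graph[OF assms], of q] by (simp add: Pol_incl mult.commute)
  show "germ_eq f p (jet 0 j (sact q (graph_incl g))) (\<lambda>x. coeff q j * g x)"
  proof -
    have "jet 0 j (sact q (graph_incl g)) = (\<lambda>x. coeff (Pol (sact q (graph_incl g)) x) j)"
      by (rule ext) (rule jet_0)
    then show ?thesis
      using germ_eq_lift1[where F="\<lambda>_ P. coeff P j", OF 1] by (simp add: mult.commute)
  qed
qed

lemma span_scale:
  "u \<in> span_by (germ_eq f p) (V0_ops f \<alpha> p) G \<Longrightarrow> holo_germ p h \<Longrightarrow> (\<lambda>x j. h x * u x j) \<in> span_by (germ_eq f p) (V0_ops f \<alpha> p) G"
  by (rule span_by.act[where T="\<lambda>u x j. h x * u x j"]) (auto simp: V0_ops_def)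

lemma span_sum:
  fixes u :: "'k \<Rightarrow> 'n graph_section"
  shows "(\<And>k. k \<in> K \<Longrightarrow> u k \<in> span_by (germ_eq f p) (V0_ops f \<alpha> p) G) \<Longrightarrow>
    (\<lambda>x j. \<Sum>k\<in>K. u k x j) \<in> span_by (germ_eq f p) (V0_ops f \<alpha> p) G"
proof (induction K rule: infinite_finite_induct)
  case (insert k K)
  then have "u k + (\<lambda>x j. \<Sum>k\<in>K. u k x j) \<in> span_by (germ_eq f p) (V0_ops f \<alpha> p) G"
    by (intro span_by.add) auto
  then show ?case using insert(1,2) by (simp add: plus_fun_def)
qed (simp_all add: span_by.zero flip: zero_fun_def)

lemma span_sact:
  assumes "u \<in> span_by (germ_eq f p) (V0_ops f \<alpha> p) G"
  shows "sact q u \<in> span_by (germ_eq f p) (V0_ops f \<alpha> p) G"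
proof -
  have "Sop v \<in> span_by (germ_eq f p) (V0_ops f \<alpha> p) G" if "v \<in> span_by (germ_eq f p) (V0_ops f \<alpha> p) G" for v
  proof -
    have "dt_act \<circ> t_act f \<in> V0_ops f \<alpha> p" unfolding V0_ops_def by blast
    from span_by.act[OF this that] have "dt_act (t_act f v) \<in> span_by (germ_eq f p) (V0_ops f \<alpha> p) G"
      by (simp only: o_apply)
    from span_scale[OF this holo_germ_const, of "-1"] show ?thesis by (simp add: Sop_def)
  qed
  then have "(Sop ^^ i) u \<in> span_by (germ_eq f p) (V0_ops f \<alpha> p) G" for i
    by (induction i) (auto simp: assms)
  then show ?thesis unfolding sact_def by (intro span_sum span_scale holo_germ_const)
qed

text \<open>
  A derivative that lowers the exponent of x_i from c to c - 1 multiplies the polynomial by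
  s + c / a_i - \<alpha>, up to a constant; \<open>gpoly B e\<close> collects these factors on the way from B to e.
\<close>

definition below :: "('n \<Rightarrow> int) \<Rightarrow> ('n \<Rightarrow> int) \<Rightarrow> ('n \<times> int) set" where
  "below B e = Sigma I (\<lambda>i. {e i<..B i})"

definition root_of :: "'n \<times> int \<Rightarrow> rat" where
  "root_of = (\<lambda>(i, c). of_int c / of_nat (a i) - \<alpha>)"

definition gpoly :: "('n \<Rightarrow> int) \<Rightarrow> ('n \<Rightarrow> int) \<Rightarrow> complex poly" where
  "gpoly B e = (\<Prod>t\<in>below B e. [:of_rat (root_of t), 1:])"

lemma finite_below [simp]: "finite (below B e)"
  by (simp add: below_def)

lemma root_of_eq_iff: "i \<in> I \<Longrightarrow> root_of (i, c) = \<delta> \<longleftrightarrow> of_int c = (\<delta> + \<alpha>) * of_nat (a i)"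
  by (auto simp: root_of_def I_def field_simps)

text \<open>Each i contributes at most one c with root delta, namely c = (delta + alpha) a_i, and
  since c > e_i this i is a pole of e.\<close>

lemma card_roots_le_poles: "card {t \<in> below B e. root_of t = \<delta>} \<le> poles (\<delta> + \<alpha>) e"
  unfolding poles_def
proof (rule card_inj_on_le[where f=fst])
  show "inj_on fst {t \<in> below B e. root_of t = \<delta>}"
  proof (rule inj_onI, clarsimp simp: below_def)
    fix i c c' assume "root_of (i, c') = root_of (i, c)" "i \<in> I"
    then show "c = c'" by (simp add: root_of_def I_def)
  qed
  show "fst ` {t \<in> below B e. root_of t = \<delta>} \<subseteq> {i \<in> I. (\<delta> + \<alpha>) * of_nat (a i) \<in> \<int> \<and> of_int (e i) < (\<delta> + \<alpha>) * of_nat (a i)}"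
  proof (clarsimp simp: below_def)
    fix i c assume *: "i \<in> I" "e i < c" "\<delta> = root_of (i, c)"
    then have "(\<delta> + \<alpha>) * of_nat (a i) = of_int c" using root_of_eq_iff[of i c \<delta>] by simp
    then show "(root_of (i, c) + \<alpha>) * of_nat (a i) \<in> \<int> \<and> of_int (e i) < (root_of (i, c) + \<alpha>) * of_nat (a i)"
      using * by simp
  qed
qed simp

text \<open>Grouping the factors by their roots reduces the claim to powers of distinct linear
  polynomials, whose multiplicities are bounded by the pole counts.\<close>

lemma gpoly_dvd:
  assumes "\<And>t. t \<in> below B e \<Longrightarrow> [:of_rat (root_of t), 1:] ^ poles (root_of t + \<alpha>) e dvd q"
  shows "gpoly B e dvd q"
proof -
  let ?A = "root_of ` below B e"
  let ?n = "\<lambda>\<delta>. card {t \<in> below B e. root_of t = \<delta>}"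
  have "gpoly B e = (\<Prod>\<delta>\<in>?A. \<Prod>t\<in>{t \<in> below B e. root_of t = \<delta>}. [:of_rat (root_of t), 1:])"
    unfolding gpoly_def by (rule prod.image_gen) simp
  also have "\<dots> = (\<Prod>\<delta>\<in>?A. [:of_rat \<delta>, 1:] ^ ?n \<delta>)"
    by (intro prod.cong refl) simp
  also have "\<dots> dvd q"
  proof (rule prod_linear_powers_dvd)
    show "inj_on of_rat ?A" by (simp add: inj_on_def)
    show "[:of_rat \<delta>, 1:] ^ ?n \<delta> dvd q" if "\<delta> \<in> ?A" for \<delta>
      using that assms dvd_trans[OF le_imp_power_dvd[OF card_roots_le_poles]] by blast
  qed simp
  finally show ?thesis .
qed

lemma gpoly_step:
  assumes "i \<in> I" "e i < B i"
  shows "gpoly B e = [:of_rat (root_of (i, e i + 1)), 1:] * gpoly B (e(i := e i + 1))"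
proof -
  have "below B e = insert (i, e i + 1) (below B (e(i := e i + 1)))"
    using assms by (auto simp: below_def split: if_splits)
  moreover have "(i, e i + 1) \<notin> below B (e(i := e i + 1))" by (simp add: below_def)
  ultimately show ?thesis
    unfolding gpoly_def
    using prod.insert[OF finite_below, of "(i, e i + 1)" B "e(i := e i + 1)" "\<lambda>t. [:of_rat (root_of t), 1::complex:]"]
    by presburger
qed

text \<open>As h does not involve x_i, the derivative only meets the monomial: it multiplies by e_i
  / x_i + (s - alpha) a_i / x_i, which is a_i / x_i times the factor s + e_i / a_i - alpha.\<close>

lemma dx_sact_incl:
  assumes h: "holo_germ p h" "indep i h" and i: "i \<in> I"
  shows "germ_eq f p (dx_act f \<alpha> i (sact q (graph_incl (\<lambda>x. h x * mon e x))))
    (sact (smult (of_nat (a i)) ([:of_rat (root_of (i, e i)), 1:] * q)) (graph_incl (\<lambda>x. h x * mon (e(i := e i - 1)) x)))"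
proof (rule graph_eqI_coeff)
  let ?g = "\<lambda>x. h x * mon e x" and ?g' = "\<lambda>x. h x * mon (e(i := e i - 1)) x"
  have g: "?g \<in> mero_module f p" "?g' \<in> mero_module f p"
    unfolding mero_eq by (intro Msp_mon_mult h(1) UNIV_I)+
  show "dx_act f \<alpha> i (sact q (graph_incl ?g)) \<in> graph_module f p"
    by (intro graph_dx sact_incl g)
  show "sact (smult (of_nat (a i)) ([:of_rat (root_of (i, e i)), 1:] * q)) (graph_incl ?g') \<in> graph_module f p"
    by (intro sact_incl g)
  fix j
  let ?c = "\<lambda>j. coeff q j"
  have ph: "partial i h x = 0" for x
  proof -
    have "h (x + axis i z) = h x" for z
      using h(2) upd_plus_axis[of i "x $ i + z" x] by (simp add: indep_def) metis
    then show ?thesis by (simp add: partial_def)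
  qed
  have 1: "germ_eq f p (tw \<alpha> i (jet 0 j (sact q (graph_incl ?g)))) (tw \<alpha> i (\<lambda>x. (?c j * h x) * mon e x))"
    using germ_eq_tw[OF sact_incl(2)[OF g(1), where q=q and j=j], of \<alpha> i] by (simp add: mult.assoc)
  have "partial i (\<lambda>x. ?c j * h x) x = 0" for x
  proof -
    have "?c j * h (x + axis i z) = ?c j * h x" for z
      using h(2) upd_plus_axis[of i "x $ i + z" x] by (simp add: indep_def) metis
    then show ?thesis unfolding partial_def by (simp only: deriv_const)
  qed
  then have 2: "germ_eq f p (tw \<alpha> i (\<lambda>x. (?c j * h x) * mon e x))
      (\<lambda>x. ((of_int (e i) - of_rat \<alpha> * of_nat (a i)) * (?c j * h x)) * mon (e(i := e i - 1)) x)"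
    using tw_holo_mon[OF holo_germ_mult[OF holo_germ_const h(1)], of \<alpha> i "?c j" e] i by simp
  have 3: "germ_eq f p (\<lambda>x. of_nat (a i) / x $ i * (if j = 0 then 0 else jet 0 (j - 1) (sact q (graph_incl ?g)) x))
      (\<lambda>x. (if j = 0 then 0 else of_nat (a i) * ?c (j - 1) * ?g' x))"
  proof (cases "j = 0")
    case False
    have "germ_eq f p (\<lambda>x. of_nat (a i) / x $ i * jet 0 (j - 1) (sact q (graph_incl ?g)) x)
        (\<lambda>x. of_nat (a i) / x $ i * (?c (j - 1) * ?g x))"
      by (rule germ_eq_lift1[where F="\<lambda>x y. of_nat (a i) / x $ i * y", OF sact_incl(2)[OF g(1)]])
    moreover have "germ_eq f p (\<lambda>x. of_nat (a i) / x $ i * (?c (j - 1) * ?g x)) (\<lambda>x. of_nat (a i) * ?c (j - 1) * ?g' x)"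
      using i by (intro germ_eqI) (simp add: f_nonzero_iff mon_lower)
    ultimately show ?thesis using False germ_eq_trans by auto
  qed simp
  have "germ_eq f p (jet 0 j (dx_act f \<alpha> i (sact q (graph_incl ?g))))
     (\<lambda>x. ((of_int (e i) - of_rat \<alpha> * of_nat (a i)) * (?c j * h x)) * mon (e(i := e i - 1)) x +
        (if j = 0 then 0 else of_nat (a i) * ?c (j - 1) * ?g' x))"
    using germ_eq_trans[OF jet_dx_germ[OF sact_incl(1)[OF g(1)], of 0 j i q, unfolded add_0]
       germ_eq_lift2[where F="\<lambda>_. (+)", OF germ_eq_trans[OF 1 2] 3]] by simp
  moreover have "(\<lambda>x. ((of_int (e i) - of_rat \<alpha> * of_nat (a i)) * (?c j * h x)) * mon (e(i := e i - 1)) x +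
        (if j = 0 then 0 else of_nat (a i) * ?c (j - 1) * ?g' x)) =
      (\<lambda>x. coeff (smult (of_nat (a i)) ([:of_rat (root_of (i, e i)), 1:] * q)) j * ?g' x)"
  proof -
    have "of_int (e i) - of_rat \<alpha> * of_nat (a i) = of_nat (a i) * (of_rat (root_of (i, e i)) :: complex)"
      using i by (simp add: root_of_def of_rat_diff of_rat_divide of_rat_mult I_def right_diff_distrib)
    then show ?thesis
      by (auto simp: fun_eq_iff coeff_pCons algebra_simps split: nat.split)
  qed
  ultimately show "germ_eq f p (jet 0 j (dx_act f \<alpha> i (sact q (graph_incl ?g))))
     (jet 0 j (sact (smult (of_nat (a i)) ([:of_rat (root_of (i, e i)), 1:] * q)) (graph_incl ?g')))"
    using germ_eq_trans[OF _ germ_eq_sym[OF sact_incl(2)[OF g(2)]]] by simp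
qed

text \<open>Induction on the distance from e to B. If e_i < B_i, then h is independent of x_i, so
  the term for e is up to the constant a_i the derivative of the term for e with e_i raised by one;
  the new factor is the one in \<open>gpoly_step\<close>.\<close>

lemma generated_term:
  assumes "e \<in> clipped B p" "h \<in> coeffs_at B p e"
  shows "sact (gpoly B e * q) (graph_incl (\<lambda>x. h x * mon e x)) \<in> span_by (germ_eq f p) (V0_ops f \<alpha> p) {graph_incl (mon B)}"
  using assms
proof (induction "\<Sum>i\<in>UNIV. nat (B i - e i)" arbitrary: e rule: less_induct)
  case less
  let ?S = "span_by (germ_eq f p) (V0_ops f \<alpha> p) {graph_incl (mon B)}"
  show ?case
  proof (cases "e = B")
    case True
    have "(\<lambda>x j. h x * graph_incl (mon B) x j) \<in> ?S"
      using less(3) by (intro span_scale span_by.base) (auto simp: coeffs_at_def)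
    moreover have "(\<lambda>x j. h x * graph_incl (mon B) x j) = graph_incl (\<lambda>x. h x * mon e x)"
      unfolding True graph_incl_def by (auto simp: fun_eq_iff)
    ultimately show ?thesis using span_sact by (simp only:)
  next
    case False
    then obtain i where "e i \<noteq> B i" by (auto simp: fun_eq_iff)
    moreover have "e i \<le> B i" using less(2) by (simp add: clipped_def)
    ultimately have i: "e i < B i" by simp
    then have pi: "i \<in> I" "p $ i = 0" using less(2) by (force simp: clipped_def)+
    let ?e = "e(i := e i + 1)"
    let ?w = "sact (gpoly B ?e * q) (graph_incl (\<lambda>x. h x * mon ?e x))"
    have h: "holo_germ p h" "indep i h" using less(3) i by (auto simp: coeffs_at_def)
    have "?w \<in> ?S"
    proof (rule less(1))
      show "(\<Sum>j\<in>UNIV. nat (B j - ?e j)) < (\<Sum>j\<in>UNIV. nat (B j - e j))"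
        using i by (intro sum_strict_mono_ex1) auto
      show "?e \<in> clipped B p" using less(2) i pi by (auto simp: clipped_def)
      show "h \<in> coeffs_at B p ?e" using less(3) by (auto simp: coeffs_at_def split: if_splits)
    qed
    then have "dx_act f \<alpha> i ?w \<in> ?S"
      by (rule span_by.act[rotated]) (simp add: V0_ops_def)
    from span_by.cong[where E="germ_eq f p", OF this dx_sact_incl[OF h pi(1), where e="?e" and q="gpoly B ?e * q"]]
    have "sact (smult (of_nat (a i)) ([:of_rat (root_of (i, ?e i)), 1:] * (gpoly B ?e * q)))
        (graph_incl (\<lambda>x. h x * mon (?e(i := ?e i - 1)) x)) \<in> ?S" .
    moreover have "?e(i := ?e i - 1) = e" "?e i = e i + 1" by auto
    ultimately have "sact (smult (of_nat (a i)) ([:of_rat (root_of (i, e i + 1)), 1:] * (gpoly B ?e * q)))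
        (graph_incl (\<lambda>x. h x * mon e x)) \<in> ?S"
      by (simp only:)
    moreover have "[:of_rat (root_of (i, e i + 1)), 1:] * (gpoly B ?e * q) = gpoly B e * q"
      using gpoly_step[of i e B, OF pi(1) i] by (simp only: mult.assoc)
    ultimately have *: "sact (smult (of_nat (a i)) (gpoly B e * q)) (graph_incl (\<lambda>x. h x * mon e x)) \<in> ?S"
      by (simp only:)
    have "(\<lambda>x j. (1 / of_nat (a i)) * sact (smult (of_nat (a i)) (gpoly B e * q)) (graph_incl (\<lambda>x. h x * mon e x)) x j)
        = sact (gpoly B e * q) (graph_incl (\<lambda>x. h x * mon e x))"
      using pi(1) by (auto simp: sact_def sum_distrib_left I_def fun_eq_iff)
    with span_scale[OF * holo_germ_const, of "1 / of_nat (a i)"] show ?thesis by simp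
  qed
qed

end

section \<open>Uniqueness of the V-filtration\<close>

lemma dt_act_linear:
  "dt_act (\<lambda>x j. u x j + v x j) = (\<lambda>x j. dt_act u x j + dt_act v x j)"
  "dt_act (\<lambda>x j. c * u x j) = (\<lambda>x j. c * dt_act u x j)"
  by (auto simp: dt_act_def fun_eq_iff)

lemma t_act_linear:
  "t_act f (\<lambda>x j. u x j + v x j) = (\<lambda>x j. t_act f u x j + t_act f v x j)"
  "t_act f (\<lambda>x j. c * u x j) = (\<lambda>x j. c * t_act f u x j)"
  by (auto simp: t_act_def fun_eq_iff algebra_simps)

lemma dtt_minus_linear:
  "dtt_minus f \<gamma> (\<lambda>x j. u x j + v x j) = (\<lambda>x j. dtt_minus f \<gamma> u x j + dtt_minus f \<gamma> v x j)"
  "dtt_minus f \<gamma> (\<lambda>x j. c * u x j) = (\<lambda>x j. c * dtt_minus f \<gamma> u x j)"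
  by (simp_all add: dtt_minus_def t_act_linear dt_act_linear algebra_simps)

lemma dtt_minus_diff: "dtt_minus f \<gamma> u x j - dtt_minus f \<gamma>' u x j = of_rat (\<gamma>' - \<gamma>) * u x j"
  by (simp add: dtt_minus_def of_rat_diff algebra_simps)

lemma dtt_minus_commute: "dtt_minus f \<gamma> (dtt_minus f \<gamma>' u) = dtt_minus f \<gamma>' (dtt_minus f \<gamma> u)"
proof -
  have *: "dtt_minus f c u = (\<lambda>x j. dt_act (t_act f u) x j + (- of_rat c) * u x j)" for c u
    by (simp add: dtt_minus_def fun_eq_iff)
  show ?thesis
    unfolding * t_act_linear dt_act_linear by (simp add: algebra_simps)
qed

definition dtt_submodule :: "(complex ^ 'n::finite \<Rightarrow> complex) \<Rightarrow> 'n graph_section set \<Rightarrow> bool" where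
  "dtt_submodule f S \<longleftrightarrow> (\<forall>u\<in>S. \<forall>v\<in>S. (\<lambda>x j. u x j + v x j) \<in> S) \<and> (\<forall>c. \<forall>u\<in>S. (\<lambda>x j. c * u x j) \<in> S) \<and>
     (\<forall>\<gamma>. \<forall>u\<in>S. dtt_minus f \<gamma> u \<in> S)"

lemma dtt_submodule_add: "dtt_submodule f S \<Longrightarrow> u \<in> S \<Longrightarrow> v \<in> S \<Longrightarrow> (\<lambda>x j. u x j + v x j) \<in> S"
  by (simp add: dtt_submodule_def)

lemma dtt_submodule_scale: "dtt_submodule f S \<Longrightarrow> u \<in> S \<Longrightarrow> (\<lambda>x j. c * u x j) \<in> S"
  by (simp add: dtt_submodule_def)

lemma dtt_submodule_dtt: "dtt_submodule f S \<Longrightarrow> u \<in> S \<Longrightarrow> dtt_minus f \<gamma> u \<in> S"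
  by (simp add: dtt_submodule_def)

text \<open>Coprimality of (\<theta> - c)^M and (\<theta> - d)^N for \<theta> = (d/dt) t.\<close>

lemma dtt_coprime:
  assumes S: "dtt_submodule f S" and cd: "c \<noteq> d"
    and "(dtt_minus f c ^^ M) w \<in> S" "(dtt_minus f d ^^ N) w \<in> S"
  shows "w \<in> S"
  using assms(3,4)
proof (induction M arbitrary: w)
  case (Suc M)
  have inner: "w \<in> S" if "dtt_minus f c w \<in> S" "(dtt_minus f d ^^ N) w \<in> S" for w N
    using that
  proof (induction N arbitrary: w)
    case (Suc N)
    have dw: "dtt_minus f d w \<in> S"
    proof (rule Suc.IH)
      show "dtt_minus f c (dtt_minus f d w) \<in> S"
        unfolding dtt_minus_commute[of f c d] by (rule dtt_submodule_dtt[OF S Suc.prems(1)])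
      show "(dtt_minus f d ^^ N) (dtt_minus f d w) \<in> S"
        using Suc.prems(2) by (simp only: funpow_Suc_right o_apply)
    qed
    have "(\<lambda>x j. dtt_minus f c w x j + (-1) * dtt_minus f d w x j) \<in> S"
      by (rule dtt_submodule_add[OF S Suc.prems(1) dtt_submodule_scale[OF S dw]])
    moreover have "(\<lambda>x j. dtt_minus f c w x j + (-1) * dtt_minus f d w x j) = (\<lambda>x j. of_rat (d - c) * w x j)"
      using dtt_minus_diff[of f c w _ _ d] by (simp add: fun_eq_iff)
    ultimately have "(\<lambda>x j. of_rat (d - c) * w x j) \<in> S" by (simp only:)
    from dtt_submodule_scale[OF S this, of "1 / of_rat (d - c)"]
    show ?case using cd by simp
  qed simp
  have "(dtt_minus f c ^^ M) w \<in> S"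
  proof (rule inner)
    show "dtt_minus f c ((dtt_minus f c ^^ M) w) \<in> S" using Suc.prems(1) by simp
    have comm: "(dtt_minus f d ^^ k) (dtt_minus f c v) = dtt_minus f c ((dtt_minus f d ^^ k) v)" for k v
      by (induction k) (simp_all add: dtt_minus_commute[of f c d])
    have "(dtt_minus f d ^^ N) ((dtt_minus f c ^^ k) w) = (dtt_minus f c ^^ k) ((dtt_minus f d ^^ N) w)" for k
      by (induction k) (simp_all add: comm)
    moreover have "(dtt_minus f c ^^ k) v \<in> S" if "v \<in> S" for k v
      using that by (induction k) (auto intro: dtt_submodule_dtt[OF S])
    ultimately show "(dtt_minus f d ^^ N) ((dtt_minus f c ^^ M) w) \<in> S" using Suc.prems(2) by simp
  qed
  then show ?case using Suc by blast
qed simp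

lemma V0_ops_intros:
  "holo_germ p h \<Longrightarrow> (\<lambda>u x j. h x * u x j) \<in> V0_ops f \<alpha> p"
  "dx_act f \<alpha> i \<in> V0_ops f \<alpha> p"
  "t_act f \<in> V0_ops f \<alpha> p"
  "dt_act \<circ> t_act f \<in> V0_ops f \<alpha> p"
  unfolding V0_ops_def
  by (rule UnI1, rule UnI1, rule CollectI, rule exI, rule conjI, rule refl, assumption)
     (rule UnI1, rule UnI2, rule rangeI, rule UnI2, rule insertI1, rule UnI2, rule insertI2, rule singletonI)

context
  fixes f :: "complex ^ 'n::finite \<Rightarrow> complex" and \<alpha> :: rat
    and V :: "rat \<Rightarrow> complex ^ 'n \<Rightarrow> 'n graph_section set"
  assumes V: "is_V_filtration f \<alpha> V"
begin

lemma V_parts: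
  "\<And>\<gamma>. subsheaf_module f (graph_module f) (V0_ops f \<alpha>) (V \<gamma>)"
  "\<And>\<gamma>. locally_fin_gen f (V0_ops f \<alpha>) (V \<gamma>)"
  "\<And>\<gamma> \<delta> p. \<gamma> \<le> \<delta> \<Longrightarrow> V \<delta> p \<subseteq> V \<gamma> p"
  "\<And>p. (\<Union>\<gamma>. V \<gamma> p) = graph_module f p"
  "\<And>p. \<exists>r::nat. r > 0 \<and>
        (\<forall>\<^sub>F q in nhds p. \<forall>\<gamma>. V \<gamma> q = V (of_int \<lceil>of_nat r * \<gamma>\<rceil> / of_nat r) q)"
  "\<And>\<gamma> p. t_act f ` V \<gamma> p \<subseteq> V (\<gamma> + 1) p"
  "\<And>p. \<exists>c. \<forall>\<^sub>F q in nhds p. \<forall>\<gamma>\<ge>c. \<forall>u \<in> V (\<gamma> + 1) q. \<exists>v \<in> V \<gamma> q. germ_eq f q u (t_act f v)"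
  "\<And>\<gamma> p. \<exists>N. \<forall>u \<in> V \<gamma> p. (dtt_minus f \<gamma> ^^ N) u \<in> (\<Union>\<delta>\<in>{\<gamma><..}. V \<delta> p)"
  by (insert V, unfold is_V_filtration_def, (elim conjE allE, (assumption | erule (1) mp))+)

lemma V_span: "span_by (germ_eq f p) (V0_ops f \<alpha> p) (V \<gamma> p) \<subseteq> V \<gamma> p"
  using V_parts(1)[of \<gamma>] unfolding subsheaf_module_def by (elim allE[of _ p] conjE)

lemmas V_antimono = V_parts(3) and V_Union = V_parts(4) and V_nilp = V_parts(8)

lemma V_grid: "\<exists>r::nat. r > 0 \<and> (\<forall>\<gamma>. V \<gamma> p = V (of_int \<lceil>of_nat r * \<gamma>\<rceil> / of_nat r) p)"
  using V_parts(5)[of p] by (elim exE conjE, drule_tac eventually_nhds_x_imp_x) (intro exI conjI)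

lemma V_t: "u \<in> V \<gamma> p \<Longrightarrow> t_act f u \<in> V (\<gamma> + 1) p"
  using V_parts(6)[of \<gamma> p] by (rule subsetD) (rule imageI)

lemma V_t_surj: "\<exists>c. \<forall>\<gamma>\<ge>c. \<forall>u \<in> V (\<gamma> + 1) p. \<exists>v \<in> V \<gamma> p. germ_eq f p u (t_act f v)"
  using V_parts(7)[of p] by (elim exE, drule_tac eventually_nhds_x_imp_x) (rule exI)

lemma V_gen: "\<exists>G. finite G \<and> V \<gamma> p = span_by (germ_eq f p) (V0_ops f \<alpha> p) G"
  using V_parts(2)[of \<gamma>] unfolding locally_fin_gen_def
  by (elim allE[of _ p] exE conjE, drule_tac eventually_nhds_x_imp_x) (intro exI conjI)

lemma V_cong: "u \<in> V \<gamma> p \<Longrightarrow> germ_eq f p u v \<Longrightarrow> v \<in> V \<gamma> p"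
  by (rule subsetD[OF V_span]) (rule span_by.cong[where E="germ_eq f p", OF span_by.base])

lemma V_submodule: "dtt_submodule f (V \<gamma> p)"
proof -
  have add: "(\<lambda>x j. u x j + v x j) \<in> V \<gamma> p" if "u \<in> V \<gamma> p" "v \<in> V \<gamma> p" for u v
  proof -
    have "u + v \<in> span_by (germ_eq f p) (V0_ops f \<alpha> p) (V \<gamma> p)"
      using that by (intro span_by.add span_by.base)
    from subsetD[OF V_span this] show ?thesis by (simp add: plus_fun_def)
  qed
  have scale: "(\<lambda>x j. c * u x j) \<in> V \<gamma> p" if "u \<in> V \<gamma> p" for u c
  proof -
    have "(\<lambda>u x j. c * u x j) \<in> V0_ops f \<alpha> p"
      by (rule V0_ops_intros(1)[OF holo_germ_const])
    then have "(\<lambda>u x j. c * u x j) u \<in> span_by (germ_eq f p) (V0_ops f \<alpha> p) (V \<gamma> p)"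
      using that by (rule span_by.act[OF _ span_by.base])
    from subsetD[OF V_span this] show ?thesis .
  qed
  have "dtt_minus f \<gamma>' u \<in> V \<gamma> p" if "u \<in> V \<gamma> p" for u \<gamma>'
  proof -
    have "dt_act \<circ> t_act f \<in> V0_ops f \<alpha> p" by (rule V0_ops_intros(4))
    then have "(dt_act \<circ> t_act f) u \<in> span_by (germ_eq f p) (V0_ops f \<alpha> p) (V \<gamma> p)"
      using that by (rule span_by.act[OF _ span_by.base])
    from subsetD[OF V_span this] have "dt_act (t_act f u) \<in> V \<gamma> p" by (simp only: o_apply)
    from add[OF this scale[OF that, of "- of_rat \<gamma>'"]] show ?thesis by (simp add: dtt_minus_def)
  qed
  with add scale show ?thesis unfolding dtt_submodule_def by (intro conjI ballI allI)
qed

text \<open>The filtration jumps only in (1/r) Z, so finitely many downward steps lead from c to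
  gamma0, and each may use all larger indices.\<close>

lemma V_descend:
  assumes base: "P c" and step: "\<And>\<gamma>. \<gamma>0 \<le> \<gamma> \<Longrightarrow> (\<And>\<delta>. \<delta> > \<gamma> \<Longrightarrow> P \<delta>) \<Longrightarrow> P \<gamma>"
    and cong: "\<And>\<gamma> \<delta>. V \<gamma> p = V \<delta> p \<Longrightarrow> P \<gamma> \<Longrightarrow> P \<delta>" and mono: "\<And>\<gamma> \<delta>. \<gamma> \<le> \<delta> \<Longrightarrow> P \<gamma> \<Longrightarrow> P \<delta>"
  shows "P \<gamma>0"
proof -
  obtain r :: nat where r: "r > 0" "\<And>\<gamma>. V \<gamma> p = V (of_int \<lceil>of_nat r * \<gamma>\<rceil> / of_nat r) p"
    using V_grid by blast
  have *: "P (of_int k / of_nat r)" if "\<lceil>of_nat r * \<gamma>0\<rceil> \<le> k" "k \<le> max \<lceil>of_nat r * \<gamma>0\<rceil> \<lceil>of_nat r * c\<rceil>" for k :: int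
    using that(2,1)
  proof (induction k rule: int_le_induct)
    case base
    have "P (of_int \<lceil>of_nat r * c\<rceil> / of_nat r)" using assms(1) cong r(2) by blast
    then show ?case by (rule mono[rotated]) (simp add: divide_right_mono)
  next
    case (step i)
    show ?case
    proof (cases "\<lceil>of_nat r * \<gamma>0\<rceil> \<le> i - 1")
      case False
      then show ?thesis using step by simp
    next
      case True
      show ?thesis
      proof (rule assms(2))
        have "of_nat r * \<gamma>0 \<le> of_int (i - 1)" using True by (simp only: ceiling_le_iff)
        then show "\<gamma>0 \<le> of_int (i - 1) / of_nat r" using r(1) by (simp add: pos_le_divide_eq mult.commute)
        fix \<delta> :: rat assume "of_int (i - 1) / of_nat r < \<delta>"
        then have "of_int (i - 1) < of_nat r * \<delta>" using r(1) by (simp add: pos_divide_less_eq mult.commute)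
        then have "i \<le> \<lceil>of_nat r * \<delta>\<rceil>" by linarith
        then have "of_int i / of_nat r \<le> (of_int \<lceil>of_nat r * \<delta>\<rceil> / of_nat r :: rat)"
          by (simp add: divide_right_mono)
        moreover have "P (of_int i / of_nat r)" using step True by simp
        ultimately have "P (of_int \<lceil>of_nat r * \<delta>\<rceil> / of_nat r)" by (rule mono)
        then show "P \<delta>" using cong[OF r(2)[symmetric]] by blast
      qed
    qed
  qed
  have "P (of_int \<lceil>of_nat r * \<gamma>0\<rceil> / of_nat r)" by (rule *) auto
  then show ?thesis using cong[OF r(2)[symmetric]] by blast
qed

end

text \<open>Once V^c is contained in V'^gamma0 for some large c, the inclusion descends to gamma0:
  on an element of V^gamma a power of (d/dt) t - gamma lands in what is already known, and
  coprimality with the operators (d/dt) t - delta, delta < gamma0, lifts it through the steps of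
  V'.\<close>

lemma V_filtration_le:
  assumes V: "is_V_filtration f \<alpha> V" and V': "is_V_filtration f \<alpha> V'"
  shows "V \<gamma>0 p \<subseteq> V' \<gamma>0 p"
proof -
  \<comment> \<open>Finitely many generators lie in a common step of V', and so does all they
    generate.\<close>
  have bounded: "\<exists>\<delta>. V \<gamma> p \<subseteq> V' \<delta> p" for \<gamma>
  proof -
    obtain G where G: "finite G" "V \<gamma> p = span_by (germ_eq f p) (V0_ops f \<alpha> p) G"
      using V_gen[OF V] by blast
    have "G \<subseteq> graph_module f p" using G(2) span_by.base V_Union[OF V, of p] by blast
    with G(1) have "\<exists>\<delta>. G \<subseteq> V' \<delta> p"
    proof (induction G)
      case (insert g G)
      then obtain \<delta> where "G \<subseteq> V' \<delta> p" by auto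
      moreover obtain \<delta>' where "g \<in> V' \<delta>' p" using insert(4) V_Union[OF V', of p] by auto
      ultimately have "insert g G \<subseteq> V' (min \<delta> \<delta>') p"
        using V_antimono[OF V', of "min \<delta> \<delta>'" \<delta> p] V_antimono[OF V', of "min \<delta> \<delta>'" \<delta>' p] by auto
      then show ?case by blast
    qed simp
    then obtain \<delta> where "G \<subseteq> V' \<delta> p" by blast
    moreover have "u \<in> V' \<delta> p" if "u \<in> span_by (germ_eq f p) (V0_ops f \<alpha> p) G" "G \<subseteq> V' \<delta> p" for u
    proof -
      have "u \<in> span_by (germ_eq f p) (V0_ops f \<alpha> p) (V' \<delta> p)"
        using that by induction (auto intro: span_by.intros)
      then show ?thesis using V_span[OF V'] by blast
    qed
    ultimately show ?thesis unfolding G(2) by blast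
  qed
  \<comment> \<open>From some index on V^(gamma+1) = t V^gamma, so the shift between the two
    filtrations stays constant and V' is reached at any prescribed index.\<close>
  have high: "\<exists>c. V c p \<subseteq> V' \<gamma> p" for \<gamma>
  proof -
    obtain c where c: "\<And>\<gamma> u. c \<le> \<gamma> \<Longrightarrow> u \<in> V (\<gamma> + 1) p \<Longrightarrow> \<exists>v \<in> V \<gamma> p. germ_eq f p u (t_act f v)"
      using V_t_surj[OF V] by blast
    obtain \<delta> where \<delta>: "V c p \<subseteq> V' \<delta> p" using bounded by blast
    have "V (c + of_nat k) p \<subseteq> V' (\<delta> + of_nat k) p" for k
    proof (induction k)
      case (Suc k)
      show ?case
      proof
        fix u assume "u \<in> V (c + of_nat (Suc k)) p"
        then obtain v where v: "v \<in> V (c + of_nat k) p" "germ_eq f p u (t_act f v)"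
          using c[of "c + of_nat k" u] by (auto simp: add_ac)
        then have "t_act f v \<in> V' (\<delta> + of_nat k + 1) p" using Suc V_t[OF V'] by blast
        then have "u \<in> V' (\<delta> + of_nat k + 1) p" by (rule V_cong[OF V']) (rule germ_eq_sym[OF v(2)])
        then show "u \<in> V' (\<delta> + of_nat (Suc k)) p" by (simp add: add_ac)
      qed
    qed (simp add: \<delta>)
    moreover obtain k :: nat where "\<gamma> - \<delta> \<le> of_nat k" using reals_Archimedean2 less_imp_le by blast
    then have "\<gamma> \<le> \<delta> + of_nat k" by simp
    ultimately show ?thesis using V_antimono[OF V', of \<gamma> "\<delta> + of_nat k" p] by blast
  qed
  have sub': "dtt_submodule f (V' \<gamma> p)" for \<gamma> by (rule V_submodule[OF V'])
  obtain c where c: "V c p \<subseteq> V' \<gamma>0 p" using high by blast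
  show ?thesis
  proof (rule V_descend[OF V, where P="\<lambda>\<gamma>. V \<gamma> p \<subseteq> V' \<gamma>0 p" and p=p and c=c])
    fix \<gamma> assume \<gamma>: "\<gamma>0 \<le> \<gamma>" and IH: "\<And>\<delta>. \<gamma> < \<delta> \<Longrightarrow> V \<delta> p \<subseteq> V' \<gamma>0 p"
    show "V \<gamma> p \<subseteq> V' \<gamma>0 p"
    proof
      fix u assume u: "u \<in> V \<gamma> p"
      obtain N where "(dtt_minus f \<gamma> ^^ N) u \<in> (\<Union>\<delta>\<in>{\<gamma><..}. V \<delta> p)" using V_nilp[OF V, of \<gamma> p] u by blast
      then have N: "(dtt_minus f \<gamma> ^^ N) u \<in> V' \<gamma>0 p" using IH by auto
      obtain \<delta>0 where \<delta>0: "u \<in> V' \<delta>0 p" using u V_Union[OF V, of p] V_Union[OF V', of p] by blast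
      obtain r :: nat where r: "r > 0" "\<And>\<gamma>. V' \<gamma> p = V' (of_int \<lceil>of_nat r * \<gamma>\<rceil> / of_nat r) p"
        using V_grid[OF V'] by blast
      \<comment> \<open>As long as u is known only in V'^delta with delta < gamma0 <= gamma,
        \<open>dtt_coprime\<close> moves it to a larger index; the bound in terms of k records
        progress of 1/r per round.\<close>
      have climb: "u \<in> V' (min \<gamma>0 (\<delta>0 + of_nat k / of_nat r)) p" for k
      proof (induction k)
        case 0
        then show ?case using \<delta>0 V_antimono[OF V', of "min \<gamma>0 (\<delta>0 + of_nat 0 / of_nat r)" \<delta>0 p] by auto
      next
        case (Suc k)
        define \<delta> where "\<delta> = of_int \<lceil>of_nat r * (\<delta>0 + of_nat k / of_nat r)\<rceil> / (of_nat r :: rat)"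
        show ?case
        proof (cases "\<gamma>0 \<le> \<delta>0 + of_nat k / of_nat r")
          case True
          moreover have "\<delta>0 + of_nat k / of_nat r \<le> \<delta>0 + of_nat (Suc k) / (of_nat r :: rat)"
            by (simp add: divide_right_mono)
          ultimately show ?thesis using Suc by (simp add: min_absorb1)
        next
          case False
          then have u\<delta>: "u \<in> V' \<delta> p" unfolding \<delta>_def using Suc r(2)[of "\<delta>0 + of_nat k / of_nat r"] by simp
          show ?thesis
          proof (cases "\<gamma>0 \<le> \<delta>")
            case True
            then have "min \<gamma>0 (\<delta>0 + of_nat (Suc k) / of_nat r) \<le> \<delta>" by (simp only: min_le_iff_disj simp_thms)
            then show ?thesis using u\<delta> V_antimono[OF V'] by blast
          next
            case False
            obtain M where M: "(dtt_minus f \<delta> ^^ M) u \<in> (\<Union>\<delta>'\<in>{\<delta><..}. V' \<delta>' p)" using V_nilp[OF V', of \<delta> p] u\<delta> by blast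
            then obtain \<delta>1 where \<delta>1: "\<delta> < \<delta>1" "(dtt_minus f \<delta> ^^ M) u \<in> V' \<delta>1 p" by auto
            define m where "m = min \<gamma>0 \<delta>1"
            have m: "m \<le> \<gamma>0" "m \<le> \<delta>1" "\<delta> < m" using False \<delta>1(1) by (auto simp: m_def)
            have "u \<in> V' m p"
              by (rule dtt_coprime[OF sub', where c=\<gamma> and d=\<delta> and M=N and w=u and N=M])
                 (use \<gamma> False N \<delta>1(2) V_antimono[OF V' m(1)] V_antimono[OF V' m(2)] in auto)
            then have "u \<in> V' (of_int \<lceil>of_nat r * m\<rceil> / of_nat r) p" using r(2) by blast
            \<comment> \<open>Here m exceeds the grid point delta strictly, so after rounding up it
              exceeds it by at least 1/r.\<close>
            moreover have "min \<gamma>0 (\<delta>0 + of_nat (Suc k) / of_nat r) \<le> of_int \<lceil>of_nat r * m\<rceil> / of_nat r"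
            proof -
              have "of_int \<lceil>of_nat r * (\<delta>0 + of_nat k / of_nat r)\<rceil> < of_nat r * m"
                using r(1) m(3) by (simp add: \<delta>_def pos_divide_less_eq mult.commute)
              then have "\<lceil>of_nat r * (\<delta>0 + of_nat k / of_nat r)\<rceil> + 1 \<le> \<lceil>of_nat r * m\<rceil>"
                by linarith
              then have "of_int (\<lceil>of_nat r * (\<delta>0 + of_nat k / of_nat r)\<rceil> + 1) \<le> (of_int \<lceil>of_nat r * m\<rceil> :: rat)"
                by (simp only: of_int_le_iff)
              moreover have "of_nat r * (\<delta>0 + of_nat k / of_nat r) \<le> of_int \<lceil>of_nat r * (\<delta>0 + of_nat k / of_nat r)\<rceil>"
                by (rule le_of_int_ceiling)
              ultimately have "of_nat r * (\<delta>0 + of_nat k / of_nat r) + 1 \<le> (of_int \<lceil>of_nat r * m\<rceil> :: rat)"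
                by (simp only: of_int_add of_int_1)
              moreover have "of_nat r * (\<delta>0 + of_nat k / of_nat r) + 1 = of_nat r * (\<delta>0 + of_nat (Suc k) / (of_nat r :: rat))"
                using r(1) by (simp add: field_simps)
              ultimately have "\<delta>0 + of_nat (Suc k) / of_nat r \<le> of_int \<lceil>of_nat r * m\<rceil> / of_nat r"
                using r(1) by (simp add: pos_le_divide_eq mult.commute)
              then show ?thesis by simp
            qed
            ultimately show ?thesis using V_antimono[OF V'] by blast
          qed
        qed
      qed
      obtain k :: nat where "of_nat r * (\<gamma>0 - \<delta>0) \<le> of_nat k" using reals_Archimedean2 less_imp_le by blast
      then have "\<gamma>0 \<le> \<delta>0 + of_nat k / of_nat r" using r(1) by (simp add: field_simps)
      then show "u \<in> V' \<gamma>0 p" using climb[of k] by (simp add: min_absorb1)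
    qed
  qed (use c V_antimono[OF V] in blast)+
qed

lemma V_filtration_unique: "is_V_filtration f \<alpha> V \<Longrightarrow> is_V_filtration f \<alpha> V' \<Longrightarrow> V = V'"
  by (intro ext equalityI V_filtration_le)

lemma V_filtration_eqI: "is_V_filtration f \<alpha> V \<Longrightarrow> V_filtration f \<alpha> = V"
  unfolding V_filtration_def by (rule the_equality) (auto intro: V_filtration_unique)

section \<open>Identification of the V-filtration\<close>

context normal_crossing
begin

text \<open>The part of u belonging to x^e is a polynomial in s. By \<open>decomp_support\<close>
  its Taylor coefficients at -delta of index below the pole count vanish for every delta < gamma,
  and these vanishing orders combine to divisibility by \<open>gpoly\<close>. B may exceed
  \<open>bexp\<close>, which the Hodge filtration exploits.\<close>

lemma Vf_coeffs_dvd: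
  assumes u: "u \<in> Vf \<gamma> p" and B: "\<And>i. bexp \<gamma> i \<le> B i"
    and Pol: "\<forall>\<^sub>F x in nhds p. f x \<noteq> 0 \<longrightarrow> Pol u x = (\<Sum>k\<le>d. smult (jet 0 k u x) (monom 1 k))"
    and S: "finite S" "S \<subseteq> clipped B p" and H: "\<And>k. k \<in> {..d} \<Longrightarrow> decomp B p S (H k) (jet 0 k u)"
  shows "\<forall>\<^sub>F x in nhds p. f x \<noteq> 0 \<longrightarrow> gpoly (bexp \<gamma>) e dvd (\<Sum>k\<le>d. smult (H k e x) (monom 1 k))"
proof -
  let ?B = "bexp \<gamma>" and ?Q = "\<lambda>e x. \<Sum>k\<le>d. smult (H k e x) (monom 1 k)"
  \<comment> \<open>Constants that turn coefficients at s = 0 into Taylor coefficients at -delta;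
    normal forms are linear, so the same constants act on the coefficients \<open>H\<close>.\<close>
  define \<kappa> where "\<kappa> \<delta> j k = coeff (pcompose (monom 1 k) [:- of_rat \<delta> :: complex, 1:]) j" for \<delta> :: rat and j k
  have jetQ: "coeff (pcompose (?Q e x) [:- of_rat \<delta>, 1:]) j = (\<Sum>k\<le>d. \<kappa> \<delta> j k * H k e x)" for e x \<delta> j
    by (simp add: \<kappa>_def pcompose_sum pcompose_smult coeff_sum mult.commute)
  have dec: "decomp B p S (\<lambda>e x. \<Sum>k\<le>d. \<kappa> \<delta> j k * H k e x) (jet \<delta> j u)" for \<delta> j
  proof (rule decomp_cong)
    show "decomp B p S (\<lambda>e x. \<Sum>k\<le>d. \<kappa> \<delta> j k * H k e x) (\<lambda>x. \<Sum>k\<le>d. \<kappa> \<delta> j k * jet 0 k u x)"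
      using decomp_lincomb[OF finite_atMost, of d B p S H "\<lambda>k. jet 0 k u" "\<kappa> \<delta> j"] H S by blast
    show "germ_eq f p (\<lambda>x. \<Sum>k\<le>d. \<kappa> \<delta> j k * jet 0 k u x) (jet \<delta> j u)"
      unfolding germ_eq_def using Pol
      by (rule eventually_mono) (simp add: jet_def[of \<delta>] \<kappa>_def pcompose_sum pcompose_smult coeff_sum mult.commute)
  qed
  have zero: "germ_eq f p (\<lambda>x. \<Sum>k\<le>d. \<kappa> \<delta> j k * H k e x) (\<lambda>_. 0)"
    if "\<delta> < \<gamma>" "j < poles (\<delta> + \<alpha>) e" for \<delta> j e
  proof (rule decomp_support[OF dec])
    show "jet \<delta> j u \<in> Msp {e. int (poles (\<delta> + \<alpha>) e) \<le> int j} p"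
      using Vf_jet[OF u that(1)] by (simp add: Wt_def)
    show "clip_closed B {e. int (poles (\<delta> + \<alpha>) e) \<le> int j}"
      using below_bexp[OF that(1)] B by (intro clip_closed_poles) (meson of_int_le_iff order_trans)
    show "e \<notin> {e. int (poles (\<delta> + \<alpha>) e) \<le> int j}" using that(2) by simp
  qed
  \<comment> \<open>Only the finitely many roots of \<open>gpoly\<close>, all below gamma, matter,
    so one neighbourhood is enough.\<close>
  have "\<forall>\<^sub>F x in nhds p. \<forall>t\<in>below ?B e. \<forall>j\<in>{..<poles (root_of t + \<alpha>) e}.
      f x \<noteq> 0 \<longrightarrow> (\<Sum>k\<le>d. \<kappa> (root_of t) j k * H k e x) = 0"
  proof (intro eventually_ball_finite ballI finite_below finite_lessThan)
    fix t j assume t: "t \<in> below ?B e" and j: "j \<in> {..<poles (root_of t + \<alpha>) e}"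
    obtain i c where ic: "t = (i, c)" "i \<in> I" "c \<le> ?B i" using t by (auto simp: below_def)
    have "(root_of t + \<alpha>) * of_nat (a i) = of_int c"
      using root_of_eq_iff[OF ic(2), of c "root_of t"] ic(1) by simp
    also have "\<dots> \<le> of_int (?B i)" using ic(3) by simp
    also have "\<dots> < (\<gamma> + \<alpha>) * of_nat (a i)" by (rule bexp_less)
    finally have "root_of t < \<gamma>" using ic(2) by (simp add: I_iff mult_less_cancel_right)
    from zero[OF this, of j e] j
    show "\<forall>\<^sub>F x in nhds p. f x \<noteq> 0 \<longrightarrow> (\<Sum>k\<le>d. \<kappa> (root_of t) j k * H k e x) = 0"
      by (simp add: germ_eq_def)
  qed
  then show ?thesis
  proof (rule eventually_mono, intro impI)
    fix x assume *: "\<forall>t\<in>below ?B e. \<forall>j\<in>{..<poles (root_of t + \<alpha>) e}.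
      f x \<noteq> 0 \<longrightarrow> (\<Sum>k\<le>d. \<kappa> (root_of t) j k * H k e x) = 0" "f x \<noteq> 0"
    show "gpoly ?B e dvd ?Q e x"
      by (rule gpoly_dvd, rule linear_power_dvd) (use * in \<open>auto simp: jetQ\<close>)
  qed
qed

text \<open>Expand the coefficients of u in s over a common set of monomials. The polynomial at x^e
  is a multiple of \<open>gpoly\<close>, so \<open>generated_term\<close> produces it, and equality
  of polynomials gives equality of sections.\<close>

lemma Vf_generated: "Vf \<gamma> p = span_by (germ_eq f p) (V0_ops f \<alpha> p) {graph_incl (mon (bexp \<gamma>))}"
proof
  show "span_by (germ_eq f p) (V0_ops f \<alpha> p) {graph_incl (mon (bexp \<gamma>))} \<subseteq> Vf \<gamma> p"
    by (rule Vf_span) (simp add: incl_mon_Vf)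
  let ?B = "bexp \<gamma>"
  show "Vf \<gamma> p \<subseteq> span_by (germ_eq f p) (V0_ops f \<alpha> p) {graph_incl (mon (bexp \<gamma>))}"
  proof
    fix u assume u: "u \<in> Vf \<gamma> p"
    note gu = Vf_graph[OF u]
    obtain d where d: "\<forall>\<^sub>F x in nhds p. f x \<noteq> 0 \<longrightarrow> (\<forall>k>d. u x k = 0) \<and>
      (\<forall>\<delta> j. jet \<delta> j u x = (\<Sum>k\<le>d. rjet \<delta> k j * (u x k / f x ^ k)))"
      using graph_jet_expansion[OF gu] by blast
    have Pol: "\<forall>\<^sub>F x in nhds p. f x \<noteq> 0 \<longrightarrow> Pol u x = (\<Sum>k\<le>d. smult (jet 0 k u x) (monom 1 k))"
      using d
    proof (rule eventually_mono, intro impI)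
      fix x assume x: "f x \<noteq> 0 \<longrightarrow> (\<forall>k>d. u x k = 0) \<and>
        (\<forall>\<delta> j. jet \<delta> j u x = (\<Sum>k\<le>d. rjet \<delta> k j * (u x k / f x ^ k)))" "f x \<noteq> 0"
      have "coeff (Pol u x) k = 0" if "k > d" for k
        using x that by (auto simp: jet_0[symmetric] rjet_zero intro!: sum.neutral)
      then have "degree (Pol u x) \<le> d" by (intro degree_le) auto
      from poly_as_sum_of_monoms'[OF this] show "Pol u x = (\<Sum>k\<le>d. smult (jet 0 k u x) (monom 1 k))"
        by (simp add: jet_0 smult_monom)
    qed
    obtain S H where S: "finite S" "S \<subseteq> clipped ?B p" and H: "\<And>k. k \<in> {..d} \<Longrightarrow> decomp ?B p S (H k) (jet 0 k u)"
      using decomp_exists_family[of "{..d}" "\<lambda>k. jet 0 k u" p ?B] jet_mero[OF gu] by blast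
    define Q where "Q e x = (\<Sum>k\<le>d. smult (H k e x) (monom 1 k))" for e x
    have dvd: "\<forall>\<^sub>F x in nhds p. f x \<noteq> 0 \<longrightarrow> gpoly ?B e dvd Q e x" for e
      unfolding Q_def by (rule Vf_coeffs_dvd[OF u order_refl Pol S H])
    \<comment> \<open>Each power of s is divided separately, although only the combination over k is
      divisible without remainder: in this way the quotients are constant and the coefficients H k e
      stay holomorphic in x.\<close>
    define q where "q e k = monom 1 k div gpoly ?B e" for e k
    define w where "w = (\<lambda>x j. \<Sum>e\<in>S. \<Sum>k\<le>d. sact (gpoly ?B e * q e k) (graph_incl (\<lambda>x. H k e x * mon e x)) x j)"
    have Hc: "H k e \<in> coeffs_at ?B p e" if "k \<le> d" for k e
      using H[of k] that by (simp add: decomp_def)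
    have "w \<in> span_by (germ_eq f p) (V0_ops f \<alpha> p) {graph_incl (mon ?B)}"
      unfolding w_def using S Hc by (intro span_sum generated_term) auto
    moreover have gw: "sact (gpoly ?B e * q e k) (graph_incl (\<lambda>x. H k e x * mon e x)) \<in> graph_module f p" if "k \<le> d" for e k
      using Hc[OF that] by (intro sact_incl) (auto simp: mero_eq coeffs_at_def intro: Msp_mon_mult)
    then have "w \<in> graph_module f p"
      unfolding w_def by (intro graph_sum) auto
    moreover have "germ_eq f p (Pol w) (Pol u)"
    proof -
      have Polsum: "supp_fin (\<lambda>x j. \<Sum>k\<in>K. v k x j) x \<and> Pol (\<lambda>x j. \<Sum>k\<in>K. v k x j) x = (\<Sum>k\<in>K. Pol (v k) x)"
        if "\<And>k. k \<in> K \<Longrightarrow> supp_fin (v k) x" for K :: "'z set" and v x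
        using that
      proof (induction K rule: infinite_finite_induct)
        case (insert k K)
        then show ?case by (simp add: Pol_add supp_fin_add)
      qed (simp_all add: supp_fin_def Pol_def)
      have Polw: "Pol w x = (\<Sum>e\<in>S. \<Sum>k\<le>d. smult (H k e x * mon e x) (gpoly ?B e * q e k))" if "f x \<noteq> 0" for x
      proof -
        let ?v = "\<lambda>e k. sact (gpoly ?B e * q e k) (graph_incl (\<lambda>x. H k e x * mon e x))"
        have v: "supp_fin (?v e k) x" "Pol (?v e k) x = smult (H k e x * mon e x) (gpoly ?B e * q e k)" for e k
          using Pol_sact[OF that supp_fin_incl] by (simp_all add: Pol_incl)
        have "supp_fin (\<lambda>x j. \<Sum>k\<le>d. ?v e k x j) x \<and> Pol (\<lambda>x j. \<Sum>k\<le>d. ?v e k x j) x = (\<Sum>k\<le>d. Pol (?v e k) x)" for e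
          by (rule Polsum) (rule v(1))
        then have "Pol w x = (\<Sum>e\<in>S. \<Sum>k\<le>d. Pol (?v e k) x)"
          unfolding w_def using Polsum[of S "\<lambda>e x j. \<Sum>k\<le>d. ?v e k x j" x] by simp
        then show ?thesis by (simp only: v(2))
      qed
      have "\<forall>\<^sub>F x in nhds p. \<forall>e\<in>S. f x \<noteq> 0 \<longrightarrow> gpoly ?B e dvd Q e x"
        using dvd S(1) by (intro eventually_ball_finite) auto
      moreover have "\<forall>\<^sub>F x in nhds p. \<forall>k\<in>{..d}. f x \<noteq> 0 \<longrightarrow> jet 0 k u x = (\<Sum>e\<in>S. H k e x * mon e x)"
        using H by (intro eventually_ball_finite) (auto simp: decomp_def germ_eq_def)
      ultimately show ?thesis
        unfolding germ_eq_def using Pol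
      proof (eventually_elim, intro impI)
        fix x assume x1: "\<forall>e\<in>S. f x \<noteq> 0 \<longrightarrow> gpoly ?B e dvd Q e x"
          and x2: "\<forall>k\<in>{..d}. f x \<noteq> 0 \<longrightarrow> jet 0 k u x = (\<Sum>e\<in>S. H k e x * mon e x)"
          and x3: "f x \<noteq> 0 \<longrightarrow> Pol u x = (\<Sum>k\<le>d. smult (jet 0 k u x) (monom 1 k))" and fx: "f x \<noteq> 0"
        have "Q e x = gpoly ?B e * (\<Sum>k\<le>d. smult (H k e x) (q e k))" if "e \<in> S" for e
        proof -
          have "Q e x div gpoly ?B e = (\<Sum>k\<le>d. smult (H k e x) (q e k))"
            unfolding Q_def q_def by (rule div_sum_smult)
          then show ?thesis using x1 that fx by (metis dvd_mult_div_cancel)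
        qed
        then have "(\<Sum>k\<le>d. smult (H k e x * mon e x) (gpoly ?B e * q e k)) = smult (mon e x) (Q e x)" if "e \<in> S" for e
          using that by (simp add: smult_sum_right' sum_distrib_left mult.commute)
        then have "Pol w x = (\<Sum>e\<in>S. smult (mon e x) (Q e x))" unfolding Polw[OF fx] by (rule sum.cong[OF refl])
        also have "\<dots> = (\<Sum>e\<in>S. \<Sum>k\<le>d. smult (H k e x * mon e x) (monom 1 k))"
          by (simp add: Q_def smult_sum_right' mult.commute)
        also have "\<dots> = (\<Sum>k\<le>d. \<Sum>e\<in>S. smult (H k e x * mon e x) (monom 1 k))"
          by (rule sum.swap)
        also have "\<dots> = Pol u x"
          using x2 x3 fx by (simp add: smult_sum)
        finally show "Pol w x = Pol u x" .
      qed
    qed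
    ultimately show "u \<in> span_by (germ_eq f p) (V0_ops f \<alpha> p) {graph_incl (mon ?B)}"
      using span_by.cong[where E="germ_eq f p"] graph_eqI[of w p u] gu by blast
  qed
qed

lemma is_V_filtration_Vf: "is_V_filtration f \<alpha> Vf"
  unfolding is_V_filtration_def
proof (intro conjI allI impI)
  fix \<gamma> \<delta> :: rat and p :: "complex ^ 'n"
  show "subsheaf_module f (graph_module f) (V0_ops f \<alpha>) (Vf \<gamma>)"
    unfolding subsheaf_module_def
  proof (intro allI conjI ballI)
    show "Vf \<gamma> p \<subseteq> graph_module f p" for p using Vf_graph by blast
    show "span_by (germ_eq f p) (V0_ops f \<alpha> p) (Vf \<gamma> p) \<subseteq> Vf \<gamma> p" for p
      by (rule Vf_span) simp
    show "\<forall>\<^sub>F q in nhds p. u \<in> Vf \<gamma> q" if "u \<in> Vf \<gamma> p" for u p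
      using that unfolding Vf_generated by (rule span_by_eventually) (rule V0_ops_eventually)
  qed
  show "locally_fin_gen f (V0_ops f \<alpha>) (Vf \<gamma>)"
    unfolding locally_fin_gen_def Vf_generated
    by (intro allI exI[of _ "{graph_incl (mon (bexp \<gamma>))}"]) simp
  show "Vf \<delta> p \<subseteq> Vf \<gamma> p" if "\<gamma> \<le> \<delta>" by (rule Vf_antimono[OF that])
  show "(\<Union>\<gamma>. Vf \<gamma> p) = graph_module f p"
    by (intro equalityI subsetI) (auto intro: Vf_graph dest: graph_in_Vf)
  show "\<exists>r::nat. r > 0 \<and> (\<forall>\<^sub>F q in nhds p. \<forall>\<gamma>. Vf \<gamma> q = Vf (of_int \<lceil>of_nat r * \<gamma>\<rceil> / of_nat r) q)"
    using grid_pos Vf_round_up by (intro exI[of _ grid] conjI always_eventually allI)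
  show "t_act f ` Vf \<gamma> p \<subseteq> Vf (\<gamma> + 1) p" by (intro image_subsetI Vf_t)
  show "dt_act ` Vf \<gamma> p \<subseteq> Vf (\<gamma> - 1) p" by (intro image_subsetI Vf_dt)
  show "\<exists>c. \<forall>\<^sub>F q in nhds p. \<forall>\<gamma>\<ge>c. \<forall>u \<in> Vf (\<gamma> + 1) q. \<exists>v \<in> Vf \<gamma> q. germ_eq f q u (t_act f v)"
    by (intro exI[of _ 0] always_eventually allI impI ballI Vf_t_inverse)
  show "\<exists>N. \<forall>u \<in> Vf \<gamma> p. (dtt_minus f \<gamma> ^^ N) u \<in> (\<Union>\<delta>\<in>{\<gamma><..}. Vf \<delta> p)"
    by (intro exI ballI) (rule Vf_nilpotent[unfolded Va_eq_Union])
qed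

lemma V_filtration_eq: "V_filtration f \<alpha> = Vf"
  by (rule V_filtration_eqI[OF is_V_filtration_Vf])

lemma V_above_eq: "V_above f \<alpha> \<gamma> p = Va \<gamma> p"
  by (simp add: V_above_def V_filtration_eq Va_eq_Union)

end

section \<open>Monodromy filtrations\<close>

text \<open>What \<open>relative_monodromy_filtration\<close> becomes when L has its only jump at c,
  without the auxiliary graded pieces.\<close>

definition monodromy_filtration ::
  "('a::ab_group_add \<Rightarrow> 'a) \<Rightarrow> 'a set \<Rightarrow> 'a set \<Rightarrow> int \<Rightarrow> (int \<Rightarrow> 'a set) \<Rightarrow> bool" where
  "monodromy_filtration N A B c R \<longleftrightarrow>
     (\<forall>k. B \<subseteq> R k \<and> R k \<subseteq> A \<and> (\<forall>u\<in>R k. \<forall>v\<in>R k. u - v \<in> R k)) \<and>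
     (\<forall>k l. k \<le> l \<longrightarrow> R k \<subseteq> R l) \<and> (\<exists>k l. R k = B \<and> R l = A) \<and> (\<forall>k. N ` R k \<subseteq> R (k - 2)) \<and>
     (\<forall>i::nat. (\<forall>u \<in> R (c + int i). (N ^^ i) u \<in> R (c - int i - 1) \<longrightarrow> u \<in> R (c + int i - 1)) \<and>
          (\<forall>v \<in> R (c - int i). \<exists>u \<in> R (c + int i). v - (N ^^ i) u \<in> R (c - int i - 1)))"

lemma subgroup_add:
  fixes S :: "'a::ab_group_add set"
  assumes "\<forall>u\<in>S. \<forall>v\<in>S. u - v \<in> S" "u \<in> S" "v \<in> S"
  shows "u + v \<in> S"
proof -
  have "v - v \<in> S" using assms by blast
  then have "(v - v) - v \<in> S" using assms by blast
  then have "u - ((v - v) - v) \<in> S" using assms by blast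
  then show ?thesis by simp
qed

lemma subgroup_zero:
  fixes S :: "'a::ab_group_add set"
  assumes "\<forall>u\<in>S. \<forall>v\<in>S. u - v \<in> S" "u \<in> S"
  shows "0 \<in> S"
  using assms by (metis diff_self)

definition rel_gr :: "(int \<Rightarrow> 'a::ab_group_add set) \<Rightarrow> (int \<Rightarrow> 'a set) \<Rightarrow> int \<Rightarrow> int \<Rightarrow> 'a set" where
  "rel_gr L R m k = {u + v |u v. u \<in> R m \<inter> L k \<and> v \<in> L (k - 1)}"

lemma relative_monodromy_iff:
  "relative_monodromy_filtration N A B L R \<longleftrightarrow>
    (\<forall>k. B \<subseteq> R k \<and> R k \<subseteq> A \<and> (\<forall>u\<in>R k. \<forall>v\<in>R k. u - v \<in> R k)) \<and>
    (\<forall>k l. k \<le> l \<longrightarrow> R k \<subseteq> R l) \<and> (\<exists>k l. R k = B \<and> R l = A) \<and> (\<forall>k. N ` R k \<subseteq> R (k - 2)) \<and>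
    (\<forall>k (i::nat).
      (\<forall>u \<in> rel_gr L R (k + int i) k. (N ^^ i) u \<in> rel_gr L R (k - int i - 1) k \<longrightarrow> u \<in> rel_gr L R (k + int i - 1) k) \<and>
      (\<forall>v \<in> rel_gr L R (k - int i) k. \<exists>u \<in> rel_gr L R (k + int i) k. v - (N ^^ i) u \<in> rel_gr L R (k - int i - 1) k))"
  unfolding relative_monodromy_filtration_def Let_def rel_gr_def ..

lemma relative_monodromy_facts:
  assumes "relative_monodromy_filtration N A B L R"
  shows "\<forall>k. B \<subseteq> R k \<and> R k \<subseteq> A \<and> (\<forall>u\<in>R k. \<forall>v\<in>R k. u - v \<in> R k)"
    and "\<forall>k l. k \<le> l \<longrightarrow> R k \<subseteq> R l" and "\<exists>k l. R k = B \<and> R l = A" and "\<forall>k. N ` R k \<subseteq> R (k - 2)"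
    and "\<forall>k (i::nat).
      (\<forall>u \<in> rel_gr L R (k + int i) k. (N ^^ i) u \<in> rel_gr L R (k - int i - 1) k \<longrightarrow> u \<in> rel_gr L R (k + int i - 1) k) \<and>
      (\<forall>v \<in> rel_gr L R (k - int i) k. \<exists>u \<in> rel_gr L R (k + int i) k. v - (N ^^ i) u \<in> rel_gr L R (k - int i - 1) k)"
  by (insert assms, unfold relative_monodromy_iff, (elim conjE, assumption)+)

lemma relative_monodromy_pure:
  fixes A B :: "'a::ab_group_add set"
  assumes R: "relative_monodromy_filtration N A B (\<lambda>k. if c \<le> k then A else B) R" and "0 \<in> B"
  shows "monodromy_filtration N A B c R"
proof -
  let ?L = "\<lambda>k. if c \<le> k then A else B"
  let ?G = "rel_gr ?L R"
  note F = relative_monodromy_facts[OF R]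
  have R1: "B \<subseteq> R k" "R k \<subseteq> A" "\<forall>u\<in>R k. \<forall>v\<in>R k. u - v \<in> R k" for k
    by (insert F(1)[THEN spec, of k], (elim conjE, assumption)+)
  have G: "?G m c = R m" for m
  proof
    show "?G m c \<subseteq> R m"
      unfolding rel_gr_def using R1(1)[of m] subgroup_add[OF R1(3)[of m]] by auto
    show "R m \<subseteq> ?G m c"
      unfolding rel_gr_def using R1(2) assms(2) by force
  qed
  have "\<forall>i::nat. (\<forall>u \<in> R (c + int i). (N ^^ i) u \<in> R (c - int i - 1) \<longrightarrow> u \<in> R (c + int i - 1)) \<and>
          (\<forall>v \<in> R (c - int i). \<exists>u \<in> R (c + int i). v - (N ^^ i) u \<in> R (c - int i - 1))"
    using F(5)[THEN spec, of c] unfolding G .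
  with F(1-4) show ?thesis unfolding monodromy_filtration_def by (intro conjI)
qed

lemma monodromy_filtration_facts:
  assumes "monodromy_filtration N A B c R"
  shows "\<And>k. B \<subseteq> R k" "\<And>k. R k \<subseteq> A" "\<And>k. \<forall>u\<in>R k. \<forall>v\<in>R k. u - v \<in> R k"
    and "\<And>k l. k \<le> l \<Longrightarrow> R k \<subseteq> R l" "\<exists>k l. R k = B \<and> R l = A" "\<And>k u. u \<in> R k \<Longrightarrow> N u \<in> R (k - 2)"
    and "\<And>i u. u \<in> R (c + int i) \<Longrightarrow> (N ^^ i) u \<in> R (c - int i - 1) \<Longrightarrow> u \<in> R (c + int i - 1)"
    and "\<And>i v. v \<in> R (c - int i) \<Longrightarrow> \<exists>u \<in> R (c + int i). v - (N ^^ i) u \<in> R (c - int i - 1)"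
proof -
  have c: "\<forall>k. B \<subseteq> R k \<and> R k \<subseteq> A \<and> (\<forall>u\<in>R k. \<forall>v\<in>R k. u - v \<in> R k)"
     "\<forall>k l. k \<le> l \<longrightarrow> R k \<subseteq> R l" "\<exists>k l. R k = B \<and> R l = A" "\<forall>k. N ` R k \<subseteq> R (k - 2)"
     "\<forall>i::nat. (\<forall>u \<in> R (c + int i). (N ^^ i) u \<in> R (c - int i - 1) \<longrightarrow> u \<in> R (c + int i - 1)) \<and>
          (\<forall>v \<in> R (c - int i). \<exists>u \<in> R (c + int i). v - (N ^^ i) u \<in> R (c - int i - 1))"
    by (insert assms, unfold monodromy_filtration_def, (elim conjE, assumption)+)
  show "B \<subseteq> R k" "R k \<subseteq> A" "\<forall>u\<in>R k. \<forall>v\<in>R k. u - v \<in> R k" for k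
    by (insert c(1)[THEN spec, of k], (elim conjE, assumption)+)
  show "k \<le> l \<Longrightarrow> R k \<subseteq> R l" for k l using c(2) by (elim allE) (rule mp)
  show "\<exists>k l. R k = B \<and> R l = A" by (rule c(3))
  show "u \<in> R k \<Longrightarrow> N u \<in> R (k - 2)" for k u using c(4)[rule_format, of k] by (rule subsetD) (rule imageI)
  show "u \<in> R (c + int i) \<Longrightarrow> (N ^^ i) u \<in> R (c - int i - 1) \<Longrightarrow> u \<in> R (c + int i - 1)" for i u
    using c(5)[rule_format, of i] by (elim conjE) (drule (1) bspec, erule (1) mp)
  show "v \<in> R (c - int i) \<Longrightarrow> \<exists>u \<in> R (c + int i). v - (N ^^ i) u \<in> R (c - int i - 1)" for i v
    using c(5)[rule_format, of i] by (elim conjE) (erule (1) bspec)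
qed

text \<open>In degrees other than c the graded piece of L is zero and both isomorphism conditions
  hold trivially; in degree c it is all of A/B.\<close>

lemma pure_relative_monodromy:
  fixes A B :: "'a::ab_group_add set"
  assumes R: "monodromy_filtration N A B c R" and "0 \<in> B" and BA: "B \<subseteq> A"
    and A: "\<forall>u\<in>A. \<forall>v\<in>A. u - v \<in> A" and B: "\<forall>u\<in>B. \<forall>v\<in>B. u - v \<in> B"
    and N: "\<And>u. u \<in> A \<Longrightarrow> N u \<in> A" "\<And>u. u \<in> B \<Longrightarrow> N u \<in> B"
  shows "relative_monodromy_filtration N A B (\<lambda>k. if c \<le> k then A else B) R"
proof -
  let ?L = "\<lambda>k. if c \<le> k then A else B"
  let ?G = "rel_gr ?L R"
  note R1 = monodromy_filtration_facts(1-3)[OF R]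
  have Gc: "?G m c = R m" for m
  proof
    show "?G m c \<subseteq> R m"
      unfolding rel_gr_def using R1(1)[of m] subgroup_add[OF R1(3)[of m]] by auto
    show "R m \<subseteq> ?G m c"
      unfolding rel_gr_def using R1(2) assms(2) by force
  qed
  have Ggt: "?G m k = A" if "k > c" for m k
  proof
    show "?G m k \<subseteq> A" unfolding rel_gr_def using that R1(2)[of m] subgroup_add[OF A] by auto
    show "A \<subseteq> ?G m k" unfolding rel_gr_def using that R1(1)[of m] assms(2) BA by force
  qed
  have Glt: "?G m k = B" if "k < c" for m k
  proof
    show "?G m k \<subseteq> B" unfolding rel_gr_def using that subgroup_add[OF B] by auto
    show "B \<subseteq> ?G m k" unfolding rel_gr_def using that R1(1)[of m] assms(2) by force
  qed
  have NA: "(N ^^ i) u \<in> A" if "u \<in> A" for i u using that by (induction i) (auto intro: N)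
  have NB: "(N ^^ i) u \<in> B" if "u \<in> B" for i u using that by (induction i) (auto intro: N)
  have "(\<forall>u \<in> ?G (k + int i) k. (N ^^ i) u \<in> ?G (k - int i - 1) k \<longrightarrow> u \<in> ?G (k + int i - 1) k) \<and>
          (\<forall>v \<in> ?G (k - int i) k. \<exists>u \<in> ?G (k + int i) k. v - (N ^^ i) u \<in> ?G (k - int i - 1) k)" for k i
  proof (cases k c rule: linorder_cases)
    case less
    have "v - (N ^^ i) 0 \<in> B" if "v \<in> B" for v using that B NB[OF assms(2)] by blast
    then show ?thesis using assms(2) by (auto simp: Glt[OF less])
  next
    case equal
    show ?thesis unfolding equal Gc using monodromy_filtration_facts(7,8)[OF R] by blast
  next
    case greater
    have "v - (N ^^ i) 0 \<in> A" if "v \<in> A" for v using that A NA assms(2) BA by blast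
    then show ?thesis using assms(2) BA by (auto simp: Ggt[OF greater])
  qed
  then show ?thesis
    using R unfolding monodromy_filtration_def relative_monodromy_iff by (intro conjI allI; elim conjE; assumption?) simp_all
qed

lemma monodromy_filtration_power:
  assumes "monodromy_filtration N A B c R" "u \<in> R k"
  shows "(N ^^ i) u \<in> R (k - 2 * int i)"
proof (induction i)
  case (Suc i)
  from monodromy_filtration_facts(6)[OF assms(1) Suc] show ?case by (simp add: algebra_simps)
qed (simp add: assms(2))

text \<open>Every u lies in some high step. If N^(i+1) u is deep enough, injectivity on the graded
  pieces lowers that step one at a time down to c + i.\<close>

lemma monodromy_filtration_upper:
  assumes R: "monodromy_filtration N A B c R"
  shows "R (c + int i) = {u \<in> A. (N ^^ Suc i) u \<in> R (c - int i - 2)}"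
proof (intro equalityI subsetI CollectI conjI)
  note F = monodromy_filtration_facts[OF R]
  fix u assume u: "u \<in> R (c + int i)"
  then show "u \<in> A" using F(2) by blast
  show "(N ^^ Suc i) u \<in> R (c - int i - 2)"
    using monodromy_filtration_power[OF R u, of "Suc i"] by (simp add: algebra_simps)
next
  note F = monodromy_filtration_facts[OF R]
  fix u assume u: "u \<in> {u \<in> A. (N ^^ Suc i) u \<in> R (c - int i - 2)}"
  obtain l where l: "R l = A" using F(5) by blast
  have desc: "u \<in> R (c + int i + int k) \<Longrightarrow> u \<in> R (c + int i)" for k
  proof (induction k)
    case (Suc k)
    have "(N ^^ (i + Suc k)) u = (N ^^ k) ((N ^^ Suc i) u)"
      by (simp only: funpow_add[symmetric, THEN fun_cong, unfolded o_apply] add.commute add_Suc_right add_Suc)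
    moreover have "(N ^^ k) ((N ^^ Suc i) u) \<in> R (c - int i - 2 - 2 * int k)"
      using u by (intro monodromy_filtration_power[OF R]) simp
    then have "(N ^^ k) ((N ^^ Suc i) u) \<in> R (c - int (i + Suc k) - 1)"
      by (rule subsetD[OF F(4), rotated]) simp
    ultimately have "u \<in> R (c + int (i + Suc k) - 1)"
      using F(7)[of u "i + Suc k"] Suc.prems by (simp add: add_ac)
    then show ?case by (intro Suc.IH) (simp add: algebra_simps)
  qed simp
  have "u \<in> R (c + int i + int (nat (l - c - int i)))"
    using u F(4)[of l "c + int i + int (nat (l - c - int i))"] l by auto
  then show "u \<in> R (c + int i)" by (rule desc)
qed

text \<open>Surjectivity on the graded pieces writes v as a power of N applied to a higher step, up
  to an error in a smaller step; the error is absorbed by induction until it lies in B.\<close>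

lemma monodromy_filtration_lower:
  assumes R: "monodromy_filtration N A B c R" and N: "\<And>u v. N (u + v) = N u + N v"
  shows "R (c - int i) = {v. \<exists>u \<in> R (c + int i). v - (N ^^ i) u \<in> B}"
proof (intro equalityI subsetI CollectI)
  note F = monodromy_filtration_facts[OF R]
  have Ni: "(N ^^ i) (u + v) = (N ^^ i) u + (N ^^ i) v" for i u v
    by (induction i) (simp_all add: N)
  obtain l where l: "R l = B" using F(5) by blast
  have *: "\<exists>u \<in> R (c + int i). v - (N ^^ i) u \<in> B" if "v \<in> R k" "l \<le> k" "k \<le> c - int i" for k v
    using that(2,1,3)
  proof (induction k arbitrary: v rule: int_ge_induct)
    case base
    have "v \<in> R (c + int i)" by (rule subsetD[OF F(4) base(1)]) (use base(2) in simp)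
    then have "0 \<in> R (c + int i)" by (rule subgroup_zero[OF F(3)])
    have z: "(N ^^ i) 0 = 0" using Ni[of i 0 0] by simp
    with \<open>0 \<in> R (c + int i)\<close> base l show ?case by (intro bexI[of _ 0]) simp_all
  next
    case (step k)
    define j where "j = nat (c - (k + 1))"
    have j: "k + 1 = c - int j" "i \<le> j" using step(4) by (auto simp: j_def)
    obtain u' where u': "u' \<in> R (c + int j)" "v - (N ^^ j) u' \<in> R (c - int j - 1)"
      using F(8)[of v j] step(3) j(1) by auto
    moreover have "c - int j - 1 = k" using j(1) by simp
    ultimately have "v - (N ^^ j) u' \<in> R k" by (simp only:)
    then obtain u'' where u'': "u'' \<in> R (c + int i)" "v - (N ^^ j) u' - (N ^^ i) u'' \<in> B"
      using step.IH[of "v - (N ^^ j) u'"] step(4) by auto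
    have "(N ^^ (j - i)) u' \<in> R (c + int j - 2 * int (j - i))"
      by (rule monodromy_filtration_power[OF R u'(1)])
    then have "(N ^^ (j - i)) u' \<in> R (c + int i)"
      by (rule subsetD[OF F(4), rotated]) (use j(2) in simp)
    then have "(N ^^ (j - i)) u' + u'' \<in> R (c + int i)" using u''(1) subgroup_add[OF F(3)] by blast
    moreover have "(N ^^ i) ((N ^^ (j - i)) u' + u'') = (N ^^ j) u' + (N ^^ i) u''"
      using j(2) by (simp only: Ni) (simp add: funpow_add[symmetric, THEN fun_cong, unfolded o_apply])
    ultimately show ?case using u''(2) by (intro bexI[of _ "(N ^^ (j - i)) u' + u''"]) (simp_all add: algebra_simps)
  qed
  fix v assume v: "v \<in> R (c - int i)"
  show "\<exists>u \<in> R (c + int i). v - (N ^^ i) u \<in> B"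
  proof (cases "l \<le> c - int i")
    case True
    show ?thesis by (rule *[OF v True]) simp
  next
    case False
    then have "v \<in> R l" by (intro subsetD[OF F(4) v]) simp
    have "v \<in> R (c + int i)" by (rule subsetD[OF F(4) v]) simp
    then have "0 \<in> R (c + int i)" by (rule subgroup_zero[OF F(3)])
    moreover have "(N ^^ i) 0 = 0" using Ni[of i 0 0] by simp
    ultimately show ?thesis using \<open>v \<in> R l\<close> l by (intro bexI[of _ 0]) simp_all
  qed
next
  note F = monodromy_filtration_facts[OF R]
  fix v assume "v \<in> {v. \<exists>u \<in> R (c + int i). v - (N ^^ i) u \<in> B}"
  then obtain u where u: "u \<in> R (c + int i)" "v - (N ^^ i) u \<in> B" by blast
  have "(N ^^ i) u \<in> R (c + int i - 2 * int i)" by (rule monodromy_filtration_power[OF R u(1)])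
  then have "(N ^^ i) u \<in> R (c - int i)" by (simp add: algebra_simps)
  from subgroup_add[OF F(3) subsetD[OF F(1) u(2)] this] show "v \<in> R (c - int i)" by simp
qed

text \<open>The two descriptions feed each other from the outside inwards: R (c + i) is determined
  by R (c - i - 2), and R (c - i - 1) by R (c + i + 1).\<close>

lemma monodromy_filtration_unique:
  assumes R: "monodromy_filtration N A B c R" and R': "monodromy_filtration N A B c R'"
    and N: "\<And>u v. N (u + v) = N u + N v"
  shows "R = R'"
proof -
  note F = monodromy_filtration_facts[OF R] and F' = monodromy_filtration_facts[OF R']
  obtain k l k' l' where kl: "R k = B" "R l = A" "R' k' = B" "R' l' = A" using F(5) F'(5) by blast
  \<comment> \<open>From distance M on, both filtrations have reached A upwards and B
    downwards.\<close>
  define M where "M = nat (max (max (l - c) (l' - c)) (max (c - k) (c - k')))"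
  have top: "R (c + int i) = A" "R' (c + int i) = A" "R (c - int i - 1) = B" "R' (c - int i - 1) = B" if "M \<le> i" for i
  proof -
    have i: "l \<le> c + int i" "l' \<le> c + int i" "c - int i - 1 \<le> k" "c - int i - 1 \<le> k'"
      using that unfolding M_def by linarith+
    show "R (c + int i) = A" using F(2) F(4)[OF i(1)] kl(2) by blast
    show "R' (c + int i) = A" using F'(2) F'(4)[OF i(2)] kl(4) by blast
    show "R (c - int i - 1) = B" using F(1) F(4)[OF i(3)] kl(1) by blast
    show "R' (c - int i - 1) = B" using F'(1) F'(4)[OF i(4)] kl(3) by blast
  qed
  have P: "R (c + int i) = R' (c + int i) \<and> R (c - int i - 1) = R' (c - int i - 1)" for i
  proof (cases "i \<le> M")
    case True
    then show ?thesis
    proof (induction i rule: inc_induct)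
      case base
      then show ?case using top by simp
    next
      case (step i)
      have 1: "R (c - int i - 2) = R' (c - int i - 2)" using step.IH by (simp add: algebra_simps)
      have 2: "R (c + int (Suc i)) = R' (c + int (Suc i))" using step.IH by simp
      have "R (c + int i) = R' (c + int i)"
        unfolding monodromy_filtration_upper[OF R] monodromy_filtration_upper[OF R'] 1 ..
      moreover have "R (c - int (Suc i)) = R' (c - int (Suc i))"
        unfolding monodromy_filtration_lower[OF R N] monodromy_filtration_lower[OF R' N] 2 ..
      ultimately show ?case by (simp add: algebra_simps)
    qed
  next
    case False
    then show ?thesis using top by simp
  qed
  show ?thesis
  proof
    fix k show "R k = R' k"
    proof (cases "c \<le> k")
      case True
      then show ?thesis using P[of "nat (k - c)"] by simp
    next
      case False
      then show ?thesis using P[of "nat (c - k - 1)"] by simp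
    qed
  qed
qed

section \<open>Monodromy filtrations expressed by Taylor coefficients\<close>

definition alternate :: "nat \<Rightarrow> 'a::ab_group_add \<Rightarrow> 'a" where
  "alternate i x = (if even i then x else - x)"

text \<open>
  A models V^\<gamma>, B models its next step, J j is the j-th Taylor coefficient at s = -\<gamma>, and N is
  minus the shift of Taylor coefficients; equations for J need to hold only modulo all the C k.
\<close>

locale jet_module =
  fixes A B :: "'a::ab_group_add set" and J :: "nat \<Rightarrow> 'a \<Rightarrow> 'b::ab_group_add"
    and C :: "int \<Rightarrow> 'b set" and N :: "'a \<Rightarrow> 'a" and n :: nat
  assumes A_zero: "0 \<in> A" and A_diff: "u \<in> A \<Longrightarrow> v \<in> A \<Longrightarrow> u - v \<in> A"
    and C_zero: "0 \<in> C k" and C_diff: "x \<in> C k \<Longrightarrow> y \<in> C k \<Longrightarrow> x - y \<in> C k"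
    and C_mono: "k \<le> l \<Longrightarrow> C k \<subseteq> C l"
    and J_diff: "u \<in> A \<Longrightarrow> v \<in> A \<Longrightarrow> J j (u - v) - (J j u - J j v) \<in> C k"
    and N_A: "u \<in> A \<Longrightarrow> N u \<in> A" and N_add: "N (u + v) = N u + N v"
    and J_N_0: "u \<in> A \<Longrightarrow> J 0 (N u) \<in> C k"
    and J_N_Suc: "u \<in> A \<Longrightarrow> J (Suc j) (N u) + J j u \<in> C k"
    and J_top: "u \<in> A \<Longrightarrow> int n \<le> k \<Longrightarrow> J j u \<in> C k"
    and J_surj: "(\<And>j. g j \<in> C (int n)) \<Longrightarrow> \<exists>u\<in>A. \<forall>j<n. \<forall>k. J j u - g j \<in> C k"
    and B_def: "B = {u \<in> A. \<forall>j. J j u \<in> C (int j)}" and n_pos: "0 < n"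
begin

lemma C_minus: "x \<in> C k \<Longrightarrow> - x \<in> C k"
  using C_diff[OF C_zero, of x k] by simp

lemma C_minus_iff: "- x \<in> C k \<longleftrightarrow> x \<in> C k"
  using C_minus[of x k] C_minus[of "- x" k] by auto

lemma C_add: "x \<in> C k \<Longrightarrow> y \<in> C k \<Longrightarrow> x + y \<in> C k"
  using C_diff[OF _ C_minus, of x k y] by simp

lemma C_cong: "x - y \<in> C k \<Longrightarrow> x \<in> C k \<longleftrightarrow> y \<in> C k"
  using C_add[of "x - y" k y] C_diff[of x k "x - y"] by auto

lemma J_diff_C: "u \<in> A \<Longrightarrow> v \<in> A \<Longrightarrow> J j u \<in> C k \<Longrightarrow> J j v \<in> C k \<Longrightarrow> J j (u - v) \<in> C k"
  using C_cong[OF J_diff] C_diff by blast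

lemma J_Suc_N_iff: "u \<in> A \<Longrightarrow> J (Suc j) (N u) \<in> C k \<longleftrightarrow> J j u \<in> C k"
  using C_cong[of "J (Suc j) (N u)" "- J j u" k] J_N_Suc[of u j k] by (simp add: C_minus_iff)

lemma N_power_A: "u \<in> A \<Longrightarrow> (N ^^ i) u \<in> A"
  by (induction i) (auto intro: N_A)

lemma J_N_power_low: "u \<in> A \<Longrightarrow> j < i \<Longrightarrow> J j ((N ^^ i) u) \<in> C k"
proof (induction i arbitrary: j)
  case (Suc i)
  show ?case
  proof (cases j)
    case 0
    then show ?thesis using J_N_0[OF N_power_A[OF Suc.prems(1)]] by simp
  next
    case (Suc j')
    then show ?thesis using J_Suc_N_iff[OF N_power_A[OF Suc.prems(1)], of j' i k] Suc.IH[of j'] Suc.prems \<open>u \<in> A\<close>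
      using Suc.IH by auto
  qed
qed simp

lemma J_N_power_iff: "u \<in> A \<Longrightarrow> J (j + i) ((N ^^ i) u) \<in> C k \<longleftrightarrow> J j u \<in> C k"
  by (induction i) (simp_all add: J_Suc_N_iff N_power_A)

lemma J_N_power_diff: "u \<in> A \<Longrightarrow> J (j + i) ((N ^^ i) u) - alternate i (J j u) \<in> C k"
proof (induction i)
  case 0
  then show ?case by (simp add: alternate_def C_zero)
next
  case (Suc i)
  have 1: "J (Suc (j + i)) (N ((N ^^ i) u)) + J (j + i) ((N ^^ i) u) \<in> C k"
    by (rule J_N_Suc[OF N_power_A[OF Suc.prems]])
  from C_diff[OF 1 Suc.IH[OF Suc.prems]]
  show ?case by (simp add: alternate_def add.commute split: if_splits)
qed

lemma B_subset: "B \<subseteq> A"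
  by (auto simp: B_def)

lemma B_zero: "0 \<in> B"
proof -
  have "J j 0 \<in> C (int j)" for j
    using J_diff[OF A_zero A_zero, of j "int j"] by (simp add: C_minus_iff)
  then show ?thesis by (simp add: B_def A_zero)
qed

lemma B_diff: "u \<in> B \<Longrightarrow> v \<in> B \<Longrightarrow> u - v \<in> B"
  by (auto simp: B_def intro: A_diff J_diff_C)

lemma N_B: "u \<in> B \<Longrightarrow> N u \<in> B"
proof -
  assume u: "u \<in> B"
  then have uA: "u \<in> A" "\<And>j. J j u \<in> C (int j)" by (auto simp: B_def)
  have "J j (N u) \<in> C (int j)" for j
  proof (cases j)
    case (Suc i)
    then show ?thesis using J_Suc_N_iff[OF uA(1)] uA(2)[of i] C_mono[of "int i" "int j"] by auto
  qed (simp add: J_N_0[OF uA(1)])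
  then show ?thesis by (simp add: B_def N_A[OF uA(1)])
qed

text \<open>A/B is the sum over j of T / C j, where T = C n. For l > 0 a class of C l modulo C (l -
  1) occurs in T / C j for each j < l, and N moves it from j to j + 1: a Jordan block of length l.
  Centred at c, its vector in position j has weight c + l - 1 - 2j, which is at most k exactly when
  l <= 2j + k - c + 1. The maximum with j accounts for C j being zero in the quotient.\<close>

definition Rf :: "int \<Rightarrow> int \<Rightarrow> 'a set" where
  "Rf c k = {u \<in> A. \<forall>j. J j u \<in> C (max (int j) (2 * int j + k - c + 1))}"

lemma Rf_A: "Rf c k \<subseteq> A"
  by (auto simp: Rf_def)

lemma Rf_jet: "u \<in> Rf c k \<Longrightarrow> J j u \<in> C (max (int j) (2 * int j + k - c + 1))"
  by (simp add: Rf_def)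

lemma Rf_diff: "u \<in> Rf c k \<Longrightarrow> v \<in> Rf c k \<Longrightarrow> u - v \<in> Rf c k"
  by (auto simp: Rf_def intro: A_diff J_diff_C)

lemma Rf_mono: "k \<le> l \<Longrightarrow> Rf c k \<subseteq> Rf c l"
proof -
  assume "k \<le> l"
  then have "max (int j) (2 * int j + k - c + 1) \<le> max (int j) (2 * int j + l - c + 1)" for j
    by (intro max.mono) auto
  from C_mono[OF this] show ?thesis unfolding Rf_def by blast
qed

lemma B_Rf: "B \<subseteq> Rf c k"
  unfolding Rf_def B_def using C_mono[of "int j" "max (int j) (2 * int j + k - c + 1)" for j] by auto

lemma Rf_extremes: "Rf c (c - 2 * int n - 1) = B" "Rf c (c + int n) = A"
proof -
  show "Rf c (c + int n) = A"
    unfolding Rf_def using J_top by force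
  show "Rf c (c - 2 * int n - 1) = B"
  proof
    show "Rf c (c - 2 * int n - 1) \<subseteq> B"
    proof
      fix u assume u: "u \<in> Rf c (c - 2 * int n - 1)"
      then have uA: "u \<in> A" using Rf_A by blast
      have "J j u \<in> C (int j)" for j
      proof (cases "j < n")
        case True
        then have "max (int j) (2 * int j + (c - 2 * int n - 1) - c + 1) = int j" by simp
        then show ?thesis using Rf_jet[OF u, of j] by (simp only:)
      next
        case False
        then show ?thesis using J_top[OF uA] by simp
      qed
      then show "u \<in> B" using uA by (simp add: B_def)
    qed
  qed (rule B_Rf)
qed

lemma Rf_N: "u \<in> Rf c k \<Longrightarrow> N u \<in> Rf c (k - 2)"
proof -
  assume u: "u \<in> Rf c k"
  then have uA: "u \<in> A" using Rf_A by blast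
  have "J j (N u) \<in> C (max (int j) (2 * int j + (k - 2) - c + 1))" for j
  proof (cases j)
    case 0
    then show ?thesis using J_N_0[OF uA] by simp
  next
    case (Suc i)
    then have "max (int i) (2 * int i + k - c + 1) \<le> max (int j) (2 * int j + (k - 2) - c + 1)" by simp
    then have "J i u \<in> C (max (int j) (2 * int j + (k - 2) - c + 1))" using Rf_jet[OF u, of i] C_mono by blast
    then show ?thesis using J_Suc_N_iff[OF uA] Suc by simp
  qed
  then show ?thesis by (simp add: Rf_def N_A[OF uA])
qed

text \<open>The bound at position j + i for the level c - i - 1 equals the bound at position j for
  the level c + i - 1.\<close>

lemma Rf_inj:
  assumes "u \<in> Rf c (c + int i)" "(N ^^ i) u \<in> Rf c (c - int i - 1)"
  shows "u \<in> Rf c (c + int i - 1)"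
proof -
  have uA: "u \<in> A" using assms(1) Rf_A by blast
  have "J j u \<in> C (max (int j) (2 * int j + (c + int i - 1) - c + 1))" for j
  proof -
    have "J (j + i) ((N ^^ i) u) \<in> C (max (int (j + i)) (2 * int (j + i) + (c - int i - 1) - c + 1))"
      by (rule Rf_jet[OF assms(2)])
    moreover have "max (int (j + i)) (2 * int (j + i) + (c - int i - 1) - c + 1) = max (int j) (2 * int j + (c + int i - 1) - c + 1)"
      by simp
    ultimately show ?thesis using J_N_power_iff[OF uA] by (simp only:)
  qed
  then show ?thesis using uA by (simp add: Rf_def)
qed

lemma alternate_alternate [simp]: "alternate i (alternate i x) = x"
  by (simp add: alternate_def)

lemma alternate_C: "alternate i x \<in> C k \<longleftrightarrow> x \<in> C k"
  by (simp add: alternate_def C_minus_iff)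

text \<open>The preimage is found by prescribing its Taylor coefficients: shift those of v back by i
  and correct the sign. Coefficients of index n and beyond cannot obstruct, as C k is everything for
  k >= n.\<close>

lemma N_power_lift:
  assumes v: "v \<in> A" and low: "\<And>j. j < i \<Longrightarrow> J j v \<in> C (int j)"
  shows "\<exists>u\<in>A. v - (N ^^ i) u \<in> B \<and> (\<forall>j<n. \<forall>k. J j u - alternate i (J (j + i) v) \<in> C k)"
proof -
  have "\<exists>u\<in>A. \<forall>j<n. \<forall>k. J j u - alternate i (J (j + i) v) \<in> C k"
    by (rule J_surj) (simp add: alternate_C J_top[OF v])
  then obtain u where u: "u \<in> A" "\<And>j k. j < n \<Longrightarrow> J j u - alternate i (J (j + i) v) \<in> C k" by blast
  have "J j (v - (N ^^ i) u) \<in> C (int j)" for j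
  proof (cases "j < i")
    case True
    then show ?thesis using low J_N_power_low[OF u(1)] by (intro J_diff_C[OF v N_power_A[OF u(1)]])
  next
    case False
    then obtain l where l: "j = l + i" using less_eqE[of i j] by (metis add.commute not_less)
    show ?thesis
    proof (cases "l < n")
      case True
      have "J j ((N ^^ i) u) - alternate i (J l u) \<in> C (int j)" unfolding l by (rule J_N_power_diff[OF u(1)])
      moreover have "alternate i (J l u - alternate i (J j v)) \<in> C (int j)"
        unfolding alternate_C l by (rule u(2)[OF True])
      then have "alternate i (J l u) - J j v \<in> C (int j)"
        by (auto simp: alternate_def split: if_splits)
      ultimately have "(J j ((N ^^ i) u) - alternate i (J l u)) + (alternate i (J l u) - J j v) \<in> C (int j)" by (rule C_add)
      then have "J j v - J j ((N ^^ i) u) \<in> C (int j)" using C_minus by fastforce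
      then show ?thesis using C_cong[OF J_diff[OF v N_power_A[OF u(1)]]] by blast
    next
      case False
      then show ?thesis using J_top[OF A_diff[OF v N_power_A[OF u(1)]]] l by simp
    qed
  qed
  then have "v - (N ^^ i) u \<in> B" using A_diff[OF v N_power_A[OF u(1)]] by (simp add: B_def)
  with u show ?thesis by blast
qed

lemma Rf_surj:
  assumes "v \<in> Rf c (c - int i)"
  shows "\<exists>u\<in>Rf c (c + int i). v - (N ^^ i) u \<in> B \<and> (\<forall>j<n. \<forall>k. J j u - alternate i (J (j + i) v) \<in> C k)"
proof -
  have vA: "v \<in> A" using assms Rf_A by blast
  have "J j v \<in> C (int j)" if "j < i" for j
  proof -
    have "max (int j) (2 * int j + (c - int i) - c + 1) = int j" using that by simp
    then show ?thesis using Rf_jet[OF assms, of j] by (simp only:)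
  qed
  then obtain u where u: "u \<in> A" "v - (N ^^ i) u \<in> B" "\<And>j k. j < n \<Longrightarrow> J j u - alternate i (J (j + i) v) \<in> C k"
    using N_power_lift[OF vA] by blast
  have "J j u \<in> C (max (int j) (2 * int j + (c + int i) - c + 1))" for j
  proof (cases "j < n")
    case True
    have "J (j + i) v \<in> C (max (int (j + i)) (2 * int (j + i) + (c - int i) - c + 1))"
      by (rule Rf_jet[OF assms])
    moreover have "max (int (j + i)) (2 * int (j + i) + (c - int i) - c + 1) = max (int j) (2 * int j + (c + int i) - c + 1)"
      by simp
    ultimately have "alternate i (J (j + i) v) \<in> C (max (int j) (2 * int j + (c + int i) - c + 1))"
      by (simp only: alternate_C)
    then show ?thesis using C_cong[OF u(3)[OF True]] by blast
  next
    case False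
    then show ?thesis using J_top[OF u(1)] by simp
  qed
  then have "u \<in> Rf c (c + int i)" using u(1) by (simp add: Rf_def)
  with u(2,3) show ?thesis by blast
qed

lemma Rf_monodromy: "monodromy_filtration N A B c (Rf c)"
  unfolding monodromy_filtration_def
proof (intro conjI allI impI ballI)
  fix k l :: int and i :: nat
  show "B \<subseteq> Rf c k" "Rf c k \<subseteq> A" by (rule B_Rf, rule Rf_A)
  show "u - v \<in> Rf c k" if "u \<in> Rf c k" "v \<in> Rf c k" for u v using that by (rule Rf_diff)
  show "k \<le> l \<Longrightarrow> Rf c k \<subseteq> Rf c l" by (rule Rf_mono)
  show "\<exists>k l. Rf c k = B \<and> Rf c l = A" using Rf_extremes by blast
  show "N ` Rf c k \<subseteq> Rf c (k - 2)" by (intro image_subsetI Rf_N)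
  show "u \<in> Rf c (c + int i - 1)" if "u \<in> Rf c (c + int i)" "(N ^^ i) u \<in> Rf c (c - int i - 1)" for u
    using that by (rule Rf_inj)
  show "\<exists>u\<in>Rf c (c + int i). v - (N ^^ i) u \<in> Rf c (c - int i - 1)" if "v \<in> Rf c (c - int i)" for v
    using Rf_surj[OF that] B_Rf by blast
qed

lemma Rf_relative_pure: "relative_monodromy_filtration N A B (\<lambda>k. if c \<le> k then A else B) (Rf c)"
  by (rule pure_relative_monodromy[OF Rf_monodromy B_zero B_subset])
     (auto intro: A_diff B_diff N_A N_B)

lemma Rf_unique:
  assumes "relative_monodromy_filtration N A B (\<lambda>k. if c \<le> k then A else B) R"
  shows "R = Rf c"
  by (rule monodromy_filtration_unique[OF relative_monodromy_pure[OF assms B_zero] Rf_monodromy N_add])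

text \<open>
  The filtration L on the unipotent vanishing cycles: its lowest step is the image of N, and
  relative to it the monodromy filtration of N centred at w + 1 has trivial N on the higher steps.
\<close>

definition Lf :: "int \<Rightarrow> int \<Rightarrow> 'a set" where
  "Lf w k = (if w \<le> k then {u \<in> A. J 0 u \<in> C (k - w)} else B)"

lemma B_Lf: "B \<subseteq> Lf w k"
proof
  fix u assume u: "u \<in> B"
  have "J 0 u \<in> C 0" using u by (auto simp: B_def dest: spec[of _ 0])
  then show "u \<in> Lf w k" using u C_mono[of 0 "k - w"] B_subset by (auto simp: Lf_def)
qed

lemma Lf_diff: "u \<in> Lf w k \<Longrightarrow> v \<in> Lf w k \<Longrightarrow> u - v \<in> Lf w k"
  by (auto simp: Lf_def intro: A_diff B_diff J_diff_C split: if_splits)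

lemma Lf_mono: "k \<le> l \<Longrightarrow> Lf w k \<subseteq> Lf w l"
proof (cases "w \<le> k")
  case True
  assume "k \<le> l"
  then show ?thesis using True C_mono[of "k - w" "l - w"] by (auto simp: Lf_def)
next
  case False
  then show ?thesis using B_Lf by (simp add: Lf_def[of w k])
qed

section \<open>The relative filtration on the unipotent vanishing cycles\<close>

lemma Lf_0_iff: "u \<in> A \<Longrightarrow> J 0 u \<in> C 0 \<Longrightarrow> \<exists>z\<in>A. u - N z \<in> B"
  using N_power_lift[of u 1] by auto

text \<open>Together with \<open>rel_gr_high\<close>: for k > w the filtration induced on the graded
  piece of degree k has its only jump at k, so the isomorphism conditions there are trivial.\<close>

lemma rel_gr_low:
  assumes "w < k" "m < k"
  shows "rel_gr (Lf w) (Rf (w + 1)) m k = Lf w (k - 1)"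
proof
  show "rel_gr (Lf w) (Rf (w + 1)) m k \<subseteq> Lf w (k - 1)"
  proof
    fix x assume "x \<in> rel_gr (Lf w) (Rf (w + 1)) m k"
    then obtain u v where uv: "x = u + v" "u \<in> Rf (w + 1) m" "u \<in> Lf w k" "v \<in> Lf w (k - 1)"
      unfolding rel_gr_def by blast
    have "J 0 u \<in> C (max (int 0) (2 * int 0 + m - (w + 1) + 1))" by (rule Rf_jet[OF uv(2)])
    then have "J 0 u \<in> C (k - 1 - w)"
      using C_mono[of "max (int 0) (2 * int 0 + m - (w + 1) + 1)" "k - 1 - w"] assms by auto
    then have "u \<in> Lf w (k - 1)" using uv(2) Rf_A assms by (auto simp: Lf_def)
    then show "x \<in> Lf w (k - 1)" unfolding uv(1) using uv(4) Lf_diff subgroup_add[of "Lf w (k - 1)"] by blast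
  qed
  show "Lf w (k - 1) \<subseteq> rel_gr (Lf w) (Rf (w + 1)) m k"
    unfolding rel_gr_def using B_Rf B_zero B_Lf by force
qed

lemma rel_gr_high:
  assumes "w < k" "k \<le> m"
  shows "rel_gr (Lf w) (Rf (w + 1)) m k = Lf w k"
proof
  show "rel_gr (Lf w) (Rf (w + 1)) m k \<subseteq> Lf w k"
    unfolding rel_gr_def using Lf_mono[of "k - 1" k w] Lf_diff subgroup_add[of "Lf w k"] by fastforce
  show "Lf w k \<subseteq> rel_gr (Lf w) (Rf (w + 1)) m k"
  proof
    fix u assume u: "u \<in> Lf w k"
    then have uA: "u \<in> A" and J0: "J 0 u \<in> C (k - w)" using assms(1) by (auto simp: Lf_def)
    \<comment> \<open>The representative x keeps the zeroth Taylor coefficient of u and has all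
      others cleared; u - x has no zeroth coefficient and lies in the next lower step.\<close>
    have "\<exists>x\<in>A. \<forall>j<n. \<forall>k. J j x - (if j = 0 then J 0 u else 0) \<in> C k"
      by (rule J_surj) (simp add: J_top[OF uA] C_zero)
    then obtain x where x: "x \<in> A" "\<And>j k. j < n \<Longrightarrow> J j x - (if j = 0 then J 0 u else 0) \<in> C k" by blast
    have "J j x \<in> C (max (int j) (2 * int j + m - (w + 1) + 1))" for j
    proof (cases "j < n")
      case True
      have "J 0 u \<in> C (max (int j) (2 * int j + m - (w + 1) + 1))"
      proof (rule subsetD[OF C_mono J0])
        show "k - w \<le> max (int j) (2 * int j + m - (w + 1) + 1)"
          using assms(2) by (intro max.coboundedI2) simp
      qed
      then have "(if j = 0 then J 0 u else 0) \<in> C (max (int j) (2 * int j + m - (w + 1) + 1))"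
        using C_zero by (cases "j = 0") (simp_all only: if_True if_False simp_thms)
      then show ?thesis using C_cong[OF x(2)[OF True]] by blast
    next
      case False
      then show ?thesis using J_top[OF x(1)] by simp
    qed
    then have "x \<in> Rf (w + 1) m" using x(1) by (simp add: Rf_def)
    moreover have J0x: "J 0 x \<in> C k' \<longleftrightarrow> J 0 u \<in> C k'" for k' using C_cong[OF x(2)[OF n_pos]] by simp
    then have "x \<in> Lf w k" using x(1) J0 assms(1) by (simp add: Lf_def)
    moreover have "J 0 (u - x) \<in> C (k - 1 - w)"
    proof -
      have "J 0 u - J 0 x \<in> C (k - 1 - w)" using C_minus[OF x(2)[OF n_pos, of "k - 1 - w"]] by simp
      then show ?thesis using C_cong[OF J_diff[OF uA x(1)]] by blast
    qed
    then have "u - x \<in> Lf w (k - 1)" using A_diff[OF uA x(1)] assms(1) by (simp add: Lf_def)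
    ultimately show "u \<in> rel_gr (Lf w) (Rf (w + 1)) m k"
      unfolding rel_gr_def by (intro CollectI exI[of _ x] exI[of _ "u - x"]) simp
  qed
qed

lemma rel_gr_below: "k < w \<Longrightarrow> rel_gr (Lf w) (Rf (w + 1)) m k = B"
  unfolding rel_gr_def Lf_def using B_Rf[of "w + 1" m] B_zero subgroup_add[of B] B_diff by force

lemma rel_gr_centre: "rel_gr (Lf w) (Rf (w + 1)) m w = Rf (w + 1) m \<inter> Lf w w"
proof
  have "u + v \<in> Rf (w + 1) m \<inter> Lf w w" if "u \<in> Rf (w + 1) m" "u \<in> Lf w w" "v \<in> B" for u v
    using that subgroup_add[of "Rf (w + 1) m" u v] subgroup_add[of "Lf w w" u v] Rf_diff Lf_diff B_Rf B_Lf by blast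
  then show "rel_gr (Lf w) (Rf (w + 1)) m w \<subseteq> Rf (w + 1) m \<inter> Lf w w"
    unfolding rel_gr_def by (auto simp: Lf_def[of w "w - 1"])
  show "Rf (w + 1) m \<inter> Lf w w \<subseteq> rel_gr (Lf w) (Rf (w + 1)) m w"
    unfolding rel_gr_def using B_zero by (force simp: Lf_def[of w "w - 1"])
qed

lemma centre_inj:
  assumes "u \<in> Rf (w + 1) (w + int i) \<inter> Lf w w" "(N ^^ i) u \<in> Rf (w + 1) (w - int i - 1) \<inter> Lf w w"
  shows "u \<in> Rf (w + 1) (w + int i - 1) \<inter> Lf w w"
proof -
  have uA: "u \<in> A" using assms(1) Rf_A by blast
  have J0: "J 0 u \<in> C 0" using assms(1) by (simp add: Lf_def)
  have "J j u \<in> C (max (int j) (2 * int j + (w + int i - 1) - (w + 1) + 1))" for j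
  proof (cases "j = 0")
    case True
    then show ?thesis using J0 C_mono[of 0 "max (int j) (2 * int j + (w + int i - 1) - (w + 1) + 1)"] by auto
  next
    case False
    have "J (j + i) ((N ^^ i) u) \<in> C (max (int (j + i)) (2 * int (j + i) + (w - int i - 1) - (w + 1) + 1))"
      by (rule Rf_jet) (use assms(2) in blast)
    moreover have "max (int (j + i)) (2 * int (j + i) + (w - int i - 1) - (w + 1) + 1) = max (int j) (2 * int j + (w + int i - 1) - (w + 1) + 1)"
      using False by (auto simp: max_def)
    ultimately show ?thesis using J_N_power_iff[OF uA] by (simp only:)
  qed
  then show ?thesis using uA assms(1) by (simp add: Rf_def)
qed

lemma centre_surj:
  assumes "v \<in> Rf (w + 1) (w - int i) \<inter> Lf w w"
  shows "\<exists>u \<in> Rf (w + 1) (w + int i) \<inter> Lf w w. v - (N ^^ i) u \<in> B"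
proof (cases "i = 0")
  case True
  then show ?thesis using assms B_zero by (intro bexI[of _ v]) auto
next
  case False
  have vA: "v \<in> A" using assms Rf_A by blast
  have J0: "J 0 v \<in> C 0" using assms by (simp add: Lf_def)
  \<comment> \<open>One index more than \<open>N_power_lift\<close> needs: the case j = i controls
    the zeroth coefficient of the preimage.\<close>
  have low: "J j v \<in> C (int j)" if "j \<le> i" for j
  proof -
    have "max (int j) (2 * int j + (w - int i) - (w + 1) + 1) = int j" using that by simp
    then show ?thesis using Rf_jet[of v "w + 1" "w - int i" j] assms by (simp only: Int_iff)
  qed
  obtain u where u: "u \<in> A" "v - (N ^^ i) u \<in> B" "\<And>j k. j < n \<Longrightarrow> J j u - alternate i (J (j + i) v) \<in> C k"
    using N_power_lift[OF vA, of i] low by auto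
  \<comment> \<open>Clearing the zeroth coefficient puts the preimage into the lowest step of
    \<open>Lf\<close>; the change is invisible after N^i, because the removed coefficient lies in C
    i.\<close>
  have "\<exists>u'\<in>A. \<forall>j<n. \<forall>k. J j u' - (if j = 0 then 0 else J j u) \<in> C k"
    by (rule J_surj) (simp add: J_top[OF u(1)] C_zero)
  then obtain u' where u': "u' \<in> A" "\<And>j k. j < n \<Longrightarrow> J j u' - (if j = 0 then 0 else J j u) \<in> C k"
    by blast
  have J0u': "J 0 u' \<in> C k" for k using u'(2)[OF n_pos] by simp
  have "J j (u - u') \<in> C (int j + int i)" for j
  proof -
    have "J j u - J j u' \<in> C (int j + int i)"
    proof (cases "j < n")
      case True
      show ?thesis
      proof (cases "j = 0")
        case True
        have "alternate i (J i v) \<in> C (int i)" unfolding alternate_C by (rule low) simp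
        then have "J 0 u \<in> C (int i)" using C_cong[OF u(3)[OF n_pos]] by simp
        then show ?thesis using True J0u' by (simp add: C_diff)
      next
        case False
        then show ?thesis using C_minus[OF u'(2)[OF True, of "int j + int i"]] by simp
      qed
    next
      case False
      then show ?thesis using J_top[OF u(1)] J_top[OF u'(1)] by (intro C_diff) auto
    qed
    then show ?thesis using C_cong[OF J_diff[OF u(1) u'(1)]] by blast
  qed
  then have "J (j + i) ((N ^^ i) (u - u')) \<in> C (int (j + i))" for j
    using J_N_power_iff[OF A_diff[OF u(1) u'(1)]] by simp
  then have "J j ((N ^^ i) (u - u')) \<in> C (int j)" for j
    using J_N_power_low[OF A_diff[OF u(1) u'(1)], of j i] by (cases "j < i") (auto simp: not_less le_iff_add add.commute)
  then have d: "(N ^^ i) (u - u') \<in> B" using N_power_A[OF A_diff[OF u(1) u'(1)]] by (simp add: B_def)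
  have Ni: "(N ^^ i) (x + y) = (N ^^ i) x + (N ^^ i) y" for x y
    by (induction i) (simp_all add: N_add)
  have "(N ^^ i) u = (N ^^ i) (u - u') + (N ^^ i) u'" using Ni[of "u - u'" u'] by simp
  then have "v - (N ^^ i) u' = (v - (N ^^ i) u) + (N ^^ i) (u - u')" by simp
  moreover have "(v - (N ^^ i) u) + (N ^^ i) (u - u') \<in> B" by (rule subgroup_add) (use B_diff u(2) d in auto)
  ultimately have B': "v - (N ^^ i) u' \<in> B" by (simp only:)
  have "J j u' \<in> C (max (int j) (2 * int j + (w + int i) - (w + 1) + 1))" for j
  proof (cases "j = 0 \<or> \<not> j < n")
    case True
    then show ?thesis using J0u' J_top[OF u'(1)] by auto
  next
    case False
    have "J (j + i) v \<in> C (max (int (j + i)) (2 * int (j + i) + (w - int i) - (w + 1) + 1))"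
      by (rule Rf_jet) (use assms in blast)
    moreover have "max (int (j + i)) (2 * int (j + i) + (w - int i) - (w + 1) + 1) = max (int j) (2 * int j + (w + int i) - (w + 1) + 1)"
      using False \<open>i \<noteq> 0\<close> by (auto simp: max_def)
    ultimately have "alternate i (J (j + i) v) \<in> C (max (int j) (2 * int j + (w + int i) - (w + 1) + 1))"
      by (simp only: alternate_C)
    then have "J j u \<in> C (max (int j) (2 * int j + (w + int i) - (w + 1) + 1))" using C_cong[OF u(3)] False by blast
    then show ?thesis using C_cong[OF u'(2)[of j]] False by auto
  qed
  then have "u' \<in> Rf (w + 1) (w + int i) \<inter> Lf w w" using u'(1) J0u' by (simp add: Rf_def Lf_def)
  with B' show ?thesis by blast
qed

text \<open>In terms of the Jordan blocks at \<open>Rf\<close>, with centre w + 1: the lowest step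
  of \<open>Lf\<close>, the image of N, drops the first vector of each block and leaves a block of
  length l - 1 centred at w. The first vector has weight w + l and enters \<open>Lf\<close> in
  degree w + l, where N induces zero.\<close>

lemma Rf_relative_Lf: "relative_monodromy_filtration N A B (Lf w) (Rf (w + 1))"
  unfolding relative_monodromy_iff
proof (intro conjI)
  show "\<forall>k. B \<subseteq> Rf (w + 1) k \<and> Rf (w + 1) k \<subseteq> A \<and> (\<forall>u\<in>Rf (w + 1) k. \<forall>v\<in>Rf (w + 1) k. u - v \<in> Rf (w + 1) k)"
    by (intro allI conjI ballI B_Rf Rf_A Rf_diff)
  show "\<forall>k l. k \<le> l \<longrightarrow> Rf (w + 1) k \<subseteq> Rf (w + 1) l" by (intro allI impI Rf_mono)
  show "\<exists>k l. Rf (w + 1) k = B \<and> Rf (w + 1) l = A" using Rf_extremes[of "w + 1"] by blast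
  show "\<forall>k. N ` Rf (w + 1) k \<subseteq> Rf (w + 1) (k - 2)" by (intro allI image_subsetI Rf_N)
  let ?G = "rel_gr (Lf w) (Rf (w + 1))"
  show "\<forall>k (i::nat). (\<forall>u \<in> ?G (k + int i) k. (N ^^ i) u \<in> ?G (k - int i - 1) k \<longrightarrow> u \<in> ?G (k + int i - 1) k) \<and>
      (\<forall>v \<in> ?G (k - int i) k. \<exists>u \<in> ?G (k + int i) k. v - (N ^^ i) u \<in> ?G (k - int i - 1) k)"
  proof (intro allI)
    fix k :: int and i :: nat
    show "(\<forall>u \<in> ?G (k + int i) k. (N ^^ i) u \<in> ?G (k - int i - 1) k \<longrightarrow> u \<in> ?G (k + int i - 1) k) \<and>
      (\<forall>v \<in> ?G (k - int i) k. \<exists>u \<in> ?G (k + int i) k. v - (N ^^ i) u \<in> ?G (k - int i - 1) k)"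
    proof (cases k w rule: linorder_cases)
      case less
      have "(N ^^ i) 0 \<in> B" using B_zero by (induction i) (auto intro: N_B)
      then show ?thesis using B_zero B_diff unfolding rel_gr_below[OF less] by blast
    next
      case equal
      have "v - (N ^^ i) u \<in> Rf (w + 1) (w - int i - 1) \<inter> Lf w w" if "v - (N ^^ i) u \<in> B" for u v
        using that B_Rf B_Lf by blast
      then show ?thesis unfolding equal rel_gr_centre using centre_inj centre_surj by meson
    next
      case greater
      show ?thesis
      proof (cases "i = 0")
        case True
        have "v - v \<in> Lf w (k - 1)" for v using B_zero B_Lf by auto
        then show ?thesis using rel_gr_high[OF greater, of k] rel_gr_low[OF greater, of "k - 1"] True by auto
      next
        case False
        have h: "?G (k + int i) k = Lf w k" "?G (k + int i - 1) k = Lf w k"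
          by (rule rel_gr_high[OF greater]; use False in simp)+
        have l: "?G (k - int i) k = Lf w (k - 1)" "?G (k - int i - 1) k = Lf w (k - 1)"
          by (rule rel_gr_low[OF greater]; use False in simp)+
        have "(N ^^ i) 0 \<in> B" using B_zero by (induction i) (auto intro: N_B)
        then have "0 \<in> Lf w k" "v - (N ^^ i) 0 \<in> Lf w (k - 1)" if "v \<in> Lf w (k - 1)" for v
          using B_Lf B_zero Lf_diff that by blast+
        then show ?thesis unfolding h l by blast
      qed
    qed
  qed
qed

text \<open>N maps A into L w, hence induces zero on the graded pieces of degree k > w. There the
  weight filtration can jump only at k, which ties L to \<open>Rf\<close>; in degree w the
  isomorphism condition excludes the first vectors of Jordan blocks.\<close>

lemma Lf_unique:
  fixes L :: "int \<Rightarrow> 'a set" and ktop :: int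
  assumes R: "relative_monodromy_filtration N A B L (Rf (w + 1))"
    and L_diff: "\<And>k. \<forall>u\<in>L k. \<forall>v\<in>L k. u - v \<in> L k" and L_mono: "\<And>k l. k \<le> l \<Longrightarrow> L k \<subseteq> L l"
    and L_low: "\<And>k. k < w \<Longrightarrow> L k = B" and B_L: "\<And>k. B \<subseteq> L k" and L_A: "\<And>k. L k \<subseteq> A"
    and L_top: "L ktop = A" and N_L: "\<And>u k. u \<in> A \<Longrightarrow> w \<le> k \<Longrightarrow> N u \<in> L k"
  shows "L = Lf w"
proof -
  let ?R = "Rf (w + 1)" and ?G = "rel_gr L (Rf (w + 1))"
  note F = relative_monodromy_facts(5)[OF R, rule_format]
  have inj: "u \<in> ?G (k + int i - 1) k" if "u \<in> ?G (k + int i) k" "(N ^^ i) u \<in> ?G (k - int i - 1) k" for u k i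
    using conjunct1[OF F] that by blast
  have surj: "\<exists>u \<in> ?G (k + int i) k. v - (N ^^ i) u \<in> ?G (k - int i - 1) k" if "v \<in> ?G (k - int i) k" for v k i
    using conjunct2[OF F] that by blast
  have zero: "0 \<in> L k" "0 \<in> ?R k" for k using B_zero B_L B_Rf by blast+
  have GI: "v \<in> ?G m k" if "v \<in> L (k - 1)" for v m k
    unfolding rel_gr_def using zero that by force
  have GA: "?G m k \<subseteq> L k" for m k
  proof
    fix x assume "x \<in> ?G m k"
    then obtain u v where "x = u + v" "u \<in> L k" "v \<in> L (k - 1)" unfolding rel_gr_def by blast
    then show "x \<in> L k" using subgroup_add[OF L_diff, of u k v] L_mono[of "k - 1" k] by auto
  qed
  have Gadd: "x + v \<in> ?G m k" if xG: "x \<in> ?G m k" and vL: "v \<in> L (k - 1)" for x v m k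
  proof -
    obtain u u' where u: "x = u + u'" "u \<in> ?R m \<inter> L k" "u' \<in> L (k - 1)" using xG unfolding rel_gr_def by blast
    have "u' + v \<in> L (k - 1)" using subgroup_add[OF L_diff] u(3) vL by blast
    then show ?thesis unfolding rel_gr_def using u by (intro CollectI exI[of _ u] exI[of _ "u' + v"]) (simp add: add.assoc)
  qed
  have NiL: "(N ^^ i) u \<in> L (k - 1)" if uk: "u \<in> A" "w < k" "0 < i" for u k i
  proof -
    obtain i' where "i = Suc i'" using uk(3) gr0_implies_Suc by blast
    then show ?thesis using N_L[OF N_power_A[OF uk(1), of i'], of "k - 1"] uk(2) by simp
  qed
  \<comment> \<open>Positive powers of N vanish on the graded piece, so injectivity brings the
    weight of any element down to k.\<close>
  have high: "L k \<subseteq> {u + v |u v. u \<in> ?R k \<and> v \<in> L (k - 1)}" if k: "w < k" for k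
  proof
    fix u assume u: "u \<in> L k"
    then have uA: "u \<in> A" using L_A by blast
    have "u \<in> ?G (k + int i) k \<Longrightarrow> u \<in> ?G k k" for i
    proof (induction i)
      case (Suc i)
      have "u \<in> ?G (k + int (Suc i) - 1) k"
        by (rule inj[OF Suc.prems]) (rule GI, rule NiL[OF uA k], simp)
      then show ?case using Suc.IH by simp
    qed simp
    moreover have "u \<in> ?G (k + int (nat (w + 1 + int n - k))) k"
    proof -
      have "u \<in> ?R (k + int (nat (w + 1 + int n - k)))"
        using uA Rf_extremes(2)[of "w + 1"] Rf_mono[of "w + 1 + int n" "k + int (nat (w + 1 + int n - k))" "w + 1"] by auto
      then show ?thesis unfolding rel_gr_def using u zero by force
    qed
    ultimately have "u \<in> ?G k k" by blast
    then show "u \<in> {u + v |u v. u \<in> ?R k \<and> v \<in> L (k - 1)}" unfolding rel_gr_def by blast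
  qed
  \<comment> \<open>Positive powers of N vanish on the graded piece, so surjectivity pushes an
    element of weight below k down through all weights, until only B is left.\<close>
  have low: "?R m \<inter> L k \<subseteq> L (k - 1)" if k: "w < k" "m < k" for k m
  proof
    fix v assume v: "v \<in> ?R m \<inter> L k"
    have *: "v \<in> ?G (k - 1 - int i) k" for i
    proof (induction i)
      case 0
      have "v \<in> ?R (k - 1) \<inter> L k" using v Rf_mono[of m "k - 1" "w + 1"] k(2) by auto
      then show ?case unfolding rel_gr_def using zero by force
    next
      case (Suc i)
      have "v \<in> ?G (k - int (Suc i)) k" using Suc by (simp add: algebra_simps)
      from surj[OF this] obtain u where u: "u \<in> ?G (k + int (Suc i)) k" "v - (N ^^ Suc i) u \<in> ?G (k - int (Suc i) - 1) k"
        by blast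
      have "u \<in> A" using u(1) GA L_A by blast
      from Gadd[OF u(2) NiL[OF this k(1), of "Suc i"]] show ?case by (simp add: algebra_simps)
    qed
    define i where "i = nat (k + int n + int n - w)"
    have "?R (k - 1 - int i) \<subseteq> B"
      using Rf_extremes(1)[of "w + 1"] Rf_mono[of "k - 1 - int i" "w + 1 - 2 * int n - 1" "w + 1"] k(1)
      by (auto simp: i_def)
    then have "?G (k - 1 - int i) k \<subseteq> L (k - 1)"
      unfolding rel_gr_def using B_L[of "k - 1"] subgroup_add[OF L_diff, of _ "k - 1"] by blast
    then show "v \<in> L (k - 1)" using *[of i] by blast
  qed
  \<comment> \<open>An element of weight at most k is zero in every graded piece of L of degree
    above k, and so descends from the top step to L k.\<close>
  have R_L: "?R k \<subseteq> L k" if "w \<le> k" for k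
  proof
    fix u assume u: "u \<in> ?R k"
    have "u \<in> L (k + int i) \<Longrightarrow> u \<in> L k" for i
    proof (induction i)
      case (Suc i)
      have "u \<in> L (k + int (Suc i) - 1)"
        by (rule subsetD[OF low[of "k + int (Suc i)" k]]) (use that u Suc.prems in auto)
      then show ?case using Suc.IH by simp
    qed simp
    moreover have "u \<in> L (k + int (nat (ktop - k)))"
    proof (rule subsetD[OF L_mono])
      show "ktop \<le> k + int (nat (ktop - k))" by simp
      show "u \<in> L ktop" using u Rf_A L_top by blast
    qed
    ultimately show "u \<in> L k" by blast
  qed
  have J0_zero: "u \<in> L k" if uk: "u \<in> A" "J 0 u \<in> C 0" "w \<le> k" for u k
  proof -
    obtain z where z: "z \<in> A" "u - N z \<in> B" using Lf_0_iff uk by blast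
    have "(u - N z) + N z \<in> L k" using subgroup_add[OF L_diff] z B_L N_L[OF z(1) uk(3)] by blast
    then show ?thesis by simp
  qed
  have lift: "\<exists>x\<in>A. (\<forall>j k. j \<noteq> 0 \<longrightarrow> int j \<le> k \<longrightarrow> J j x \<in> C k) \<and> (\<forall>k. J 0 x \<in> C k \<longleftrightarrow> J 0 u \<in> C k) \<and> (\<forall>k. J 0 (u - x) \<in> C k)"
    if "u \<in> A" for u
  proof -
    have "\<exists>x\<in>A. \<forall>j<n. \<forall>k. J j x - (if j = 0 then J 0 u else 0) \<in> C k"
      by (rule J_surj) (simp add: J_top[OF that] C_zero)
    then obtain x where x: "x \<in> A" "\<And>j k. j < n \<Longrightarrow> J j x - (if j = 0 then J 0 u else 0) \<in> C k" by blast
    have "J j x \<in> C k" if "j \<noteq> 0" "int j \<le> k" for j k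
      using x(2)[of j k] J_top[OF x(1), of k j] that by (cases "j < n") auto
    moreover have "J 0 x \<in> C k \<longleftrightarrow> J 0 u \<in> C k" for k using C_cong[OF x(2)[OF n_pos]] by simp
    moreover have "J 0 (u - x) \<in> C k" for k
    proof -
      have "J 0 u - J 0 x \<in> C k" using C_minus[OF x(2)[OF n_pos, of k]] by simp
      then show ?thesis using C_cong[OF J_diff[OF that x(1)]] by blast
    qed
    ultimately show ?thesis using x(1) by blast
  qed
  \<comment> \<open>The section x with only the zeroth coefficient of u has weight at most w + i and
    satisfies N^i x = 0 modulo B. Injectivity of N^i in degree w lowers its weight by one, which is
    a statement about its zeroth coefficient.\<close>
  have step: "J 0 u \<in> C (int i - 1)" if u: "u \<in> L w" "J 0 u \<in> C (int i)" and i: "0 < i" for u i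
  proof -
    have uA: "u \<in> A" using u L_A by blast
    obtain x where x: "x \<in> A" "\<And>j k. j \<noteq> 0 \<Longrightarrow> int j \<le> k \<Longrightarrow> J j x \<in> C k" "\<And>k. J 0 x \<in> C k \<longleftrightarrow> J 0 u \<in> C k"
      "\<And>k. J 0 (u - x) \<in> C k" using lift[OF uA] by blast
    have "u - x \<in> L w" by (rule J0_zero) (use A_diff[OF uA x(1)] x(4) in auto)
    then have "u - (u - x) \<in> L w" using L_diff u(1) by blast
    then have xL: "x \<in> L w" by simp
    have "J j x \<in> C (max (int j) (2 * int j + (w + int i) - (w + 1) + 1))" for j
    proof (cases "j = 0")
      case True
      have "J 0 x \<in> C (int i)" using x(3) u(2) by blast
      then show ?thesis using True by simp
    next
      case False
      then show ?thesis using x(2) by simp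
    qed
    then have "x \<in> ?R (w + int i)" using x(1) by (simp add: Rf_def)
    then have xG: "x \<in> ?G (w + int i) w" unfolding rel_gr_def using xL zero by force
    have "J j ((N ^^ i) x) \<in> C (int j)" for j
    proof (cases "j < i")
      case True
      then show ?thesis using J_N_power_low[OF x(1)] by blast
    next
      case False
      then obtain l where l: "j = l + i" by (metis add.commute le_iff_add not_less)
      have "J l x \<in> C (int j)"
      proof (cases "l = 0")
        case True
        have "J 0 x \<in> C (int i)" using x(3) u(2) by blast
        then show ?thesis using True l by simp
      next
        case False
        then show ?thesis using x(2) l by simp
      qed
      then show ?thesis unfolding l using J_N_power_iff[OF x(1)] by simp
    qed
    then have "(N ^^ i) x \<in> B" using N_power_A[OF x(1)] by (simp add: B_def)
    then have "(N ^^ i) x \<in> ?G (w - int i - 1) w" by (intro GI) (use B_L in blast)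
    from inj[OF xG this] obtain y y' where y: "x = y + y'" "y \<in> ?R (w + int i - 1)" "y' \<in> L (w - 1)"
      unfolding rel_gr_def by blast
    have "y' \<in> ?R (w + int i - 1)" using y(3) L_low[of "w - 1"] B_Rf by auto
    then have "x \<in> ?R (w + int i - 1)"
      unfolding y(1) using y(2) Rf_diff subgroup_add[of "?R (w + int i - 1)"] by blast
    from Rf_jet[OF this, of 0] have "J 0 x \<in> C (int i - 1)" using i by simp
    then show ?thesis using x(3) by blast
  qed
  have J0_low: "J 0 u \<in> C 0" if u: "u \<in> L w" for u
  proof -
    have "J 0 u \<in> C (int i) \<Longrightarrow> J 0 u \<in> C 0" for i
    proof (induction i)
      case (Suc i)
      have "J 0 u \<in> C (int (Suc i) - 1)" by (rule step[OF u Suc.prems]) simp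
      moreover have "int (Suc i) - 1 = int i" by simp
      ultimately show ?case using Suc.IH by (simp only:)
    qed simp
    moreover have "J 0 u \<in> C (int n)" using u L_A J_top by blast
    ultimately show ?thesis by blast
  qed
  have sub: "L (w + int i) \<subseteq> {u \<in> A. J 0 u \<in> C (int i)}" for i
  proof (induction i)
    case 0
    then show ?case using J0_low L_A by auto
  next
    case (Suc i)
    show ?case
    proof
      fix x assume x: "x \<in> L (w + int (Suc i))"
      obtain u v where uv: "x = u + v" "u \<in> ?R (w + int (Suc i))" "v \<in> L (w + int i)"
        using high[of "w + int (Suc i)"] x by auto
      have "max (int 0) (2 * int 0 + (w + int (Suc i)) - (w + 1) + 1) = int (Suc i)" by simp
      then have "J 0 u \<in> C (int (Suc i))" using Rf_jet[OF uv(2), of 0] by (simp only:)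
      moreover have "J 0 v \<in> C (int (Suc i))" using Suc uv(3) C_mono[of "int i" "int (Suc i)"] by auto
      moreover have "u \<in> A" "v \<in> A" "x \<in> A" using uv L_A Rf_A x by blast+
      ultimately have "J 0 (x - v) \<in> C (int (Suc i))" "J 0 v \<in> C (int (Suc i))" using uv(1) by auto
      then have "J 0 x - J 0 v \<in> C (int (Suc i))" using C_cong[OF J_diff[OF \<open>x \<in> A\<close> \<open>v \<in> A\<close>]] by blast
      then have "J 0 x \<in> C (int (Suc i))" using C_add[of "J 0 x - J 0 v" _ "J 0 v"] \<open>J 0 v \<in> C (int (Suc i))\<close> by simp
      then show "x \<in> {u \<in> A. J 0 u \<in> C (int (Suc i))}" using \<open>x \<in> A\<close> by blast
    qed
  qed
  \<comment> \<open>Split u into a part with only a zeroth coefficient, which has weight at most k,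
    and a part without one, which lies in the image of N modulo B.\<close>
  have sup: "{u \<in> A. J 0 u \<in> C (k - w)} \<subseteq> L k" if k: "w \<le> k" for k
  proof
    fix u assume "u \<in> {u \<in> A. J 0 u \<in> C (k - w)}"
    then have uA: "u \<in> A" and J0: "J 0 u \<in> C (k - w)" by auto
    obtain x where x: "x \<in> A" "\<And>j k. j \<noteq> 0 \<Longrightarrow> int j \<le> k \<Longrightarrow> J j x \<in> C k" "\<And>k. J 0 x \<in> C k \<longleftrightarrow> J 0 u \<in> C k"
      "\<And>k. J 0 (u - x) \<in> C k" using lift[OF uA] by blast
    have "J j x \<in> C (max (int j) (2 * int j + k - (w + 1) + 1))" for j
    proof (cases "j = 0")
      case True
      have "J 0 x \<in> C (k - w)" using x(3) J0 by blast
      then show ?thesis using True k by simp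
    next
      case False
      then show ?thesis using x(2) by simp
    qed
    then have "x \<in> ?R k" using x(1) by (simp add: Rf_def)
    then have "x \<in> L k" using R_L[OF k] by blast
    moreover have "u - x \<in> L k" by (rule J0_zero[OF _ _ k]) (use A_diff[OF uA x(1)] x(4) in auto)
    ultimately have "(u - x) + x \<in> L k" using subgroup_add[OF L_diff] by blast
    then show "u \<in> L k" by simp
  qed
  show ?thesis
  proof
    fix k show "L k = Lf w k"
    proof (cases "w \<le> k")
      case True
      then have "w + int (nat (k - w)) = k" "int (nat (k - w)) = k - w" by auto
      with sub[of "nat (k - w)"] sup[OF True] show ?thesis unfolding Lf_def using True by auto
    next
      case False
      then show ?thesis using L_low by (simp add: Lf_def)
    qed
  qed
qed

end

context normal_crossing
begin

section \<open>The weight filtration\<close>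

lemma pcompose_linear_power: "pcompose ([:c, 1:] ^ j) [:- c, 1:] = monom (1::complex) j"
proof -
  have "pcompose ([:c, 1:] ^ j) [:- c, 1:] = pcompose [:c, 1:] [:- c, 1:] ^ j"
    by (induction j) (simp_all add: pcompose_1 pcompose_mult del: mult_pCons_left)
  also have "pcompose [:c, 1:] [:- c, 1:] = [:0, 1:]" by (simp add: pcompose_pCons)
  finally show ?thesis by (simp add: monom_altdef)
qed

lemma jet_sact_incl:
  assumes "g \<in> mero_module f p"
  shows "germ_eq f p (jet \<delta> j (sact q (graph_incl g))) (\<lambda>x. coeff (pcompose q [:- of_rat \<delta>, 1:]) j * g x)"
proof -
  have "germ_eq f p (\<lambda>x. coeff (pcompose (Pol (sact q (graph_incl g)) x) [:- of_rat \<delta>, 1:]) j)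
      (\<lambda>x. coeff (pcompose (smult (g x) q) [:- of_rat \<delta>, 1:]) j)"
    by (rule germ_eq_lift1[where F="\<lambda>_ P. coeff (pcompose P [:- of_rat \<delta>, 1:]) j", OF sact_incl(3)[OF assms]])
  moreover have "jet \<delta> j (sact q (graph_incl g)) = (\<lambda>x. coeff (pcompose (Pol (sact q (graph_incl g)) x) [:- of_rat \<delta>, 1:]) j)"
    by (rule ext) (rule jet_def)
  ultimately show ?thesis by (simp add: pcompose_smult mult.commute)
qed

text \<open>
  Hermite interpolation: with psi vanishing to high order at the other relevant points and
  normalised to 1 at -gamma, the polynomial 1 - (1 - psi)^R is 1 to order R at -gamma and vanishes
  to high order where psi does.
\<close>

lemma interpolation:
  fixes g :: "nat \<Rightarrow> complex ^ 'n \<Rightarrow> complex"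
  assumes g: "\<And>j. j < R \<Longrightarrow> g j \<in> mero_module f p" and R: "CARD('n) \<le> R"
  shows "\<exists>q. \<forall>j<R. sact (q * [:of_rat \<gamma>, 1:] ^ j) (graph_incl (g j)) \<in> Vf \<gamma> p \<and>
     (\<forall>i<R. germ_eq f p (jet \<gamma> i (sact (q * [:of_rat \<gamma>, 1:] ^ j) (graph_incl (g j)))) (\<lambda>x. if i = j then g j x else 0))"
proof -
  have "\<forall>j. \<exists>N::int. j < R \<longrightarrow> (\<forall>\<beta> k. (\<forall>i\<in>I. \<beta> * of_nat (a i) \<in> \<int> \<longrightarrow> \<beta> * of_nat (a i) \<le> of_int N) \<longrightarrow> 0 \<le> k \<longrightarrow> g j \<in> Wt \<beta> k p)"
    using mero_bounded[OF g] by blast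
  then obtain N :: "nat \<Rightarrow> int" where N: "\<And>j \<beta> k. j < R \<Longrightarrow>
      \<forall>i\<in>I. \<beta> * of_nat (a i) \<in> \<int> \<longrightarrow> \<beta> * of_nat (a i) \<le> of_int (N j) \<Longrightarrow> 0 \<le> k \<Longrightarrow> g j \<in> Wt \<beta> k p"
    by metis
  define M where "M = Min (insert 0 (N ` {..<R}))"
  have M: "M \<le> N j" if "j < R" for j unfolding M_def using that by (intro Min_le) auto
  \<comment> \<open>At a delta < gamma outside this finite set all critical values are at most M, so
    every g j satisfies the pole condition already and the polynomial factor is
    unconstrained.\<close>
  define \<Delta> where "\<Delta> = root_of ` below (bexp \<gamma>) (\<lambda>_. M)"
  have fin: "finite \<Delta>" by (simp add: \<Delta>_def)
  have less: "\<delta> < \<gamma>" if \<delta>: "\<delta> \<in> \<Delta>" for \<delta>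
  proof -
    obtain t where t: "\<delta> = root_of t" "t \<in> below (bexp \<gamma>) (\<lambda>_. M)" using \<delta> by (auto simp: \<Delta>_def)
    obtain i c where ic: "\<delta> = root_of (i, c)" "i \<in> I" "c \<le> bexp \<gamma> i"
      using t by (cases t) (auto simp: below_def)
    have "(\<delta> + \<alpha>) * of_nat (a i) = of_int c" using root_of_eq_iff[OF ic(2), of c \<delta>] ic(1) by simp
    also have "\<dots> \<le> of_int (bexp \<gamma> i)" using ic(3) by simp
    also have "\<dots> < (\<gamma> + \<alpha>) * of_nat (a i)" by (rule bexp_less)
    finally show ?thesis using ic(2) by (simp add: I_iff mult_less_cancel_right)
  qed
  have good: "g j \<in> Wt (\<delta> + \<alpha>) k p" if "\<delta> < \<gamma>" "\<delta> \<notin> \<Delta>" "j < R" "0 \<le> k" for \<delta> j k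
  proof (rule N[OF that(3) _ that(4)], intro ballI impI)
    fix i assume i: "i \<in> I" "(\<delta> + \<alpha>) * of_nat (a i) \<in> \<int>"
    then obtain c where c: "(\<delta> + \<alpha>) * of_nat (a i) = of_int c" by (elim Ints_cases)
    have "of_int c \<le> (of_int (bexp \<gamma> i) :: rat)" using below_bexp[OF that(1) i] c by simp
    then have "c \<le> bexp \<gamma> i" by simp
    moreover have "root_of (i, c) = \<delta>" using root_of_eq_iff[OF i(1)] c by simp
    ultimately have "c \<le> M" using that(2) i(1) by (force simp: \<Delta>_def below_def)
    also have "\<dots> \<le> N j" by (rule M[OF that(3)])
    finally show "(\<delta> + \<alpha>) * of_nat (a i) \<le> of_int (N j)" using c by simp
  qed
  define \<psi> :: "complex poly" where "\<psi> = (\<Prod>\<delta>\<in>\<Delta>. [:of_rat \<delta>, 1:] ^ R)"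
  have "poly \<psi> (- of_rat \<gamma>) \<noteq> 0"
    unfolding \<psi>_def poly_prod using fin less by force
  define \<psi>' where "\<psi>' = smult (1 / poly \<psi> (- of_rat \<gamma>)) \<psi>"
  define q where "q = 1 - (1 - \<psi>') ^ R"
  have "poly (1 - \<psi>') (- of_rat \<gamma>) = 0" using \<open>poly \<psi> (- of_rat \<gamma>) \<noteq> 0\<close> by (simp add: \<psi>'_def)
  then have "[:of_rat \<gamma>, 1:] dvd 1 - \<psi>'" using poly_eq_0_iff_dvd[of "1 - \<psi>'" "- of_rat \<gamma>"] by simp
  then have d1: "[:of_rat \<gamma>, 1:] ^ R dvd (1 - \<psi>') ^ R" by (rule dvd_power_same)
  have "\<psi>' dvd q" using one_diff_power_eq[of "1 - \<psi>'" R] by (simp add: q_def)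
  then have "\<psi> dvd q" unfolding \<psi>'_def using \<open>poly \<psi> (- of_rat \<gamma>) \<noteq> 0\<close> by (simp add: smult_dvd_iff)
  have d2: "[:of_rat \<delta>, 1:] ^ R dvd q" if "\<delta> \<in> \<Delta>" for \<delta>
  proof -
    have "[:of_rat \<delta>, 1:] ^ R dvd \<psi>" unfolding \<psi>_def using fin that by (rule dvd_prodI)
    then show ?thesis using \<open>\<psi> dvd q\<close> by (rule dvd_trans)
  qed
  have low: "coeff (pcompose P [:- c, 1:]) i = 0" if dvd: "[:c, 1:] ^ R dvd P" and i: "i < R" for P :: "complex poly" and c i
  proof -
    obtain P' where "P = [:c, 1:] ^ R * P'" using dvd by (elim dvdE)
    then show ?thesis using i by (simp add: pcompose_mult pcompose_linear_power coeff_monom_mult)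
  qed
  have "sact (q * [:of_rat \<gamma>, 1:] ^ j) (graph_incl (g j)) \<in> Vf \<gamma> p \<and>
     (\<forall>i<R. germ_eq f p (jet \<gamma> i (sact (q * [:of_rat \<gamma>, 1:] ^ j) (graph_incl (g j)))) (\<lambda>x. if i = j then g j x else 0))"
    if j: "j < R" for j
  proof
    let ?Q = "q * [:of_rat \<gamma>, 1:] ^ j"
    show "sact ?Q (graph_incl (g j)) \<in> Vf \<gamma> p"
    proof (rule VfI)
      show gr: "sact ?Q (graph_incl (g j)) \<in> graph_module f p" by (rule sact_incl(1)[OF g[OF j]])
      fix \<delta> i assume \<delta>: "\<delta> < \<gamma>"
      show "jet \<delta> i (sact ?Q (graph_incl (g j))) \<in> Wt (\<delta> + \<alpha>) (int i) p"
      proof (cases "R \<le> i")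
        case True
        then show ?thesis using jet_mero[OF gr] R by (simp add: Wt_top)
      next
        case False
        have "(\<lambda>x. coeff (pcompose ?Q [:- of_rat \<delta>, 1:]) i * g j x) \<in> Wt (\<delta> + \<alpha>) (int i) p"
        proof (cases "\<delta> \<in> \<Delta>")
          case True
          have "coeff (pcompose ?Q [:- of_rat \<delta>, 1:]) i = 0"
            by (rule low) (use d2[OF True] False in auto)
          then show ?thesis by (simp add: Wt_zero)
        next
          case False
          then show ?thesis by (intro Wt_const_mult good[OF \<delta> _ j]) auto
        qed
        then show ?thesis by (rule Wt_cong) (rule germ_eq_sym[OF jet_sact_incl[OF g[OF j]]])
      qed
    qed
    show "\<forall>i<R. germ_eq f p (jet \<gamma> i (sact ?Q (graph_incl (g j)))) (\<lambda>x. if i = j then g j x else 0)"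
    proof (intro allI impI)
      fix i assume i: "i < R"
      have "?Q = [:of_rat \<gamma>, 1:] ^ j - (1 - \<psi>') ^ R * [:of_rat \<gamma>, 1:] ^ j"
        by (simp add: q_def left_diff_distrib)
      then have "coeff (pcompose ?Q [:- of_rat \<gamma>, 1:]) i =
          coeff (pcompose ([:of_rat \<gamma>, 1:] ^ j) [:- of_rat \<gamma>, 1:]) i
          - coeff (pcompose ((1 - \<psi>') ^ R * [:of_rat \<gamma>, 1:] ^ j) [:- of_rat \<gamma>, 1:]) i"
        by (simp only: pcompose_diff coeff_diff)
      also have "\<dots> = (if i = j then 1 else 0)"
        using low[of "of_rat \<gamma>" "(1 - \<psi>') ^ R * [:of_rat \<gamma>, 1:] ^ j" i] d1 i
        by (simp add: pcompose_linear_power)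
      finally have "coeff (pcompose ?Q [:- of_rat \<gamma>, 1:]) i = (if i = j then 1 else 0)" .
      then show "germ_eq f p (jet \<gamma> i (sact ?Q (graph_incl (g j)))) (\<lambda>x. if i = j then g j x else 0)"
        using jet_sact_incl[OF g[OF j], of \<gamma> i ?Q] by (simp split: if_splits)
    qed
  qed
  then show ?thesis by blast
qed

lemma jet_sum_germ:
  "finite K \<Longrightarrow> (\<And>k. k \<in> K \<Longrightarrow> u k \<in> graph_module f p) \<Longrightarrow>
    germ_eq f p (jet \<delta> j (\<lambda>x i. \<Sum>k\<in>K. u k x i)) (\<lambda>x. \<Sum>k\<in>K. jet \<delta> j (u k) x)"
proof (induction K rule: finite_induct)
  case empty
  have "jet \<delta> j (\<lambda>_ _. 0) = (\<lambda>_. 0)" by (simp add: fun_eq_iff jet_def Pol_def)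
  then show ?case by simp
next
  case (insert k K)
  have "germ_eq f p (jet \<delta> j (\<lambda>x i. u k x i + (\<Sum>k\<in>K. u k x i))) (\<lambda>x. jet \<delta> j (u k) x + jet \<delta> j (\<lambda>x i. \<Sum>k\<in>K. u k x i) x)"
    using insert by (intro jet_add_germ graph_sum) auto
  moreover have "germ_eq f p (\<lambda>x. jet \<delta> j (u k) x + jet \<delta> j (\<lambda>x i. \<Sum>k\<in>K. u k x i) x)
      (\<lambda>x. jet \<delta> j (u k) x + (\<Sum>k\<in>K. jet \<delta> j (u k) x))"
    using insert by (intro germ_eq_lift1[where F="\<lambda>x y. jet \<delta> j (u k) x + y"]) auto
  ultimately show ?case using insert(1,2) germ_eq_trans by auto
qed

lemma jets_surjective:
  assumes "\<And>j. g j \<in> mero_module f p"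
  shows "\<exists>u\<in>Vf \<gamma> p. \<forall>j<CARD('n). germ_eq f p (jet \<gamma> j u) (g j)"
proof -
  obtain q where q: "\<And>j. j < CARD('n) \<Longrightarrow> sact (q * [:of_rat \<gamma>, 1:] ^ j) (graph_incl (g j)) \<in> Vf \<gamma> p"
     "\<And>i j. j < CARD('n) \<Longrightarrow> i < CARD('n) \<Longrightarrow>
        germ_eq f p (jet \<gamma> i (sact (q * [:of_rat \<gamma>, 1:] ^ j) (graph_incl (g j)))) (\<lambda>x. if i = j then g j x else 0)"
    using interpolation[of "CARD('n)" g p \<gamma>] assms by blast
  define v where "v j = sact (q * [:of_rat \<gamma>, 1:] ^ j) (graph_incl (g j))" for j
  define u where "u = (\<lambda>x i. \<Sum>j<CARD('n). v j x i)"
  have "(\<lambda>x i. \<Sum>j\<in>K. v j x i) \<in> Vf \<gamma> p" if "K \<subseteq> {..<CARD('n)}" for K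
    using finite_subset[OF that finite_lessThan] that q(1)
    by (induction K rule: finite_induct) (auto simp: Vf_zero v_def Vf_add)
  then have "u \<in> Vf \<gamma> p" unfolding u_def by blast
  moreover have "germ_eq f p (jet \<gamma> i u) (g i)" if i: "i < CARD('n)" for i
  proof -
    have 1: "germ_eq f p (jet \<gamma> i u) (\<lambda>x. \<Sum>j<CARD('n). jet \<gamma> i (v j) x)"
      unfolding u_def using q(1) Vf_graph by (intro jet_sum_germ) (auto simp: v_def)
    have "\<forall>\<^sub>F x in nhds p. \<forall>j\<in>{..<CARD('n)}. f x \<noteq> 0 \<longrightarrow> jet \<gamma> i (v j) x = (if i = j then g j x else 0)"
      using q(2)[OF _ i] by (intro eventually_ball_finite) (auto simp: germ_eq_def v_def)
    then have 2: "germ_eq f p (\<lambda>x. \<Sum>j<CARD('n). jet \<gamma> i (v j) x) (g i)"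
      unfolding germ_eq_def by (rule eventually_mono) (use i in \<open>simp add: sum.delta\<close>)
    show ?thesis by (rule germ_eq_trans[OF 1 2])
  qed
  ultimately show ?thesis by blast
qed

lemma germ_eq_diff_Wt: "germ_eq f p u v \<Longrightarrow> u - v \<in> Wt \<beta> k p"
  by (rule Wt_of_zero_germ) (use germ_eq_lift2[where F="\<lambda>_. (-)", of f p u v v v] in \<open>simp add: fun_diff_def\<close>)

text \<open>The parameter n is CARD('n) because no exponent has more poles than there are
  coordinates, so \<open>Wt\<close> is everything from that index on.\<close>

lemma jet_module_Vf:
  "jet_module (Vf \<gamma> p) (Va \<gamma> p) (jet \<gamma>) (\<lambda>k. Wt (\<gamma> + \<alpha>) k p) (dtt_minus f \<gamma>) CARD('n)"
proof
  fix u v :: "'n graph_section" and j :: nat and k l :: int and x y :: "complex ^ 'n \<Rightarrow> complex"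
  show "0 \<in> Vf \<gamma> p" using Vf_zero by (simp add: zero_fun_def)
  show "u - v \<in> Vf \<gamma> p" if "u \<in> Vf \<gamma> p" "v \<in> Vf \<gamma> p"
    using Vf_diff[OF that] by (simp add: fun_diff_def)
  show "0 \<in> Wt (\<gamma> + \<alpha>) k p" using Wt_zero by (simp add: zero_fun_def)
  show "x - y \<in> Wt (\<gamma> + \<alpha>) k p" if "x \<in> Wt (\<gamma> + \<alpha>) k p" "y \<in> Wt (\<gamma> + \<alpha>) k p"
    using Wt_diff[OF that] by (simp add: fun_diff_def)
  show "k \<le> l \<Longrightarrow> Wt (\<gamma> + \<alpha>) k p \<subseteq> Wt (\<gamma> + \<alpha>) l p" by (rule Wt_mono)
  show "jet \<gamma> j (u - v) - (jet \<gamma> j u - jet \<gamma> j v) \<in> Wt (\<gamma> + \<alpha>) k p" if "u \<in> Vf \<gamma> p" "v \<in> Vf \<gamma> p"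
  proof (rule germ_eq_diff_Wt)
    have g: "u \<in> graph_module f p" "v \<in> graph_module f p" using that Vf_graph by auto
    have "germ_eq f p (jet \<gamma> j (\<lambda>x j. u x j + (-1) * v x j)) (\<lambda>x. jet \<gamma> j u x + jet \<gamma> j (\<lambda>x j. (-1) * v x j) x)"
      by (rule jet_add_germ[OF g(1) graph_scale[OF g(2)]])
    moreover have "germ_eq f p (\<lambda>x. jet \<gamma> j u x + jet \<gamma> j (\<lambda>x j. (-1) * v x j) x) (\<lambda>x. jet \<gamma> j u x + (-1) * jet \<gamma> j v x)"
      by (rule germ_eq_lift1[where F="\<lambda>x y. jet \<gamma> j u x + y", OF jet_scale_germ[OF g(2)]])
    ultimately show "germ_eq f p (jet \<gamma> j (u - v)) (jet \<gamma> j u - jet \<gamma> j v)"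
      using germ_eq_trans by (fastforce simp: fun_diff_def)
  qed
  show "dtt_minus f \<gamma> u \<in> Vf \<gamma> p" if "u \<in> Vf \<gamma> p" by (rule Vf_dtt_minus[OF that])
  show "dtt_minus f \<gamma> (u + v) = dtt_minus f \<gamma> u + dtt_minus f \<gamma> v"
    unfolding plus_fun_def by (rule dtt_minus_linear(1))
  show "jet \<gamma> 0 (dtt_minus f \<gamma> u) \<in> Wt (\<gamma> + \<alpha>) k p" if "u \<in> Vf \<gamma> p"
    using jet_dtt_minus_germ[OF Vf_graph[OF that], of \<gamma> 0 \<gamma>] by (intro Wt_of_zero_germ) simp
  show "jet \<gamma> (Suc j) (dtt_minus f \<gamma> u) + jet \<gamma> j u \<in> Wt (\<gamma> + \<alpha>) k p" if "u \<in> Vf \<gamma> p"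
  proof (rule Wt_of_zero_germ)
    have "germ_eq f p (jet \<gamma> (Suc j) (dtt_minus f \<gamma> u)) (\<lambda>x. - jet \<gamma> j u x)"
      using jet_dtt_minus_germ[OF Vf_graph[OF that], of \<gamma> "Suc j" \<gamma>] by simp
    from germ_eq_lift1[where F="\<lambda>x y. y + jet \<gamma> j u x", OF this]
    show "germ_eq f p (jet \<gamma> (Suc j) (dtt_minus f \<gamma> u) + jet \<gamma> j u) (\<lambda>_. 0)"
      by (simp add: plus_fun_def)
  qed
  show "jet \<gamma> j u \<in> Wt (\<gamma> + \<alpha>) k p" if "u \<in> Vf \<gamma> p" "int CARD('n) \<le> k"
    using jet_mero[OF Vf_graph[OF that(1)]] that(2) by (simp add: Wt_top)
  show "\<exists>u\<in>Vf \<gamma> p. \<forall>j<CARD('n). \<forall>k. jet \<gamma> j u - g j \<in> Wt (\<gamma> + \<alpha>) k p"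
    if "\<And>j. g j \<in> Wt (\<gamma> + \<alpha>) (int CARD('n)) p" for g
  proof -
    have "g j \<in> mero_module f p" for j using that[of j] by (simp add: Wt_top)
    then obtain u where "u \<in> Vf \<gamma> p" "\<forall>j<CARD('n). germ_eq f p (jet \<gamma> j u) (g j)"
      using jets_surjective[of g p \<gamma>] by blast
    then show ?thesis using germ_eq_diff_Wt by (intro bexI[of _ u]) auto
  qed
  show "Va \<gamma> p = {u \<in> Vf \<gamma> p. \<forall>j. jet \<gamma> j u \<in> Wt (\<gamma> + \<alpha>) (int j) p}"
    using Va_iff by blast
  show "0 < CARD('n)" by simp
qed

definition weight :: "int \<Rightarrow> complex ^ 'n \<Rightarrow> (complex ^ 'n \<Rightarrow> complex) set" where
  "weight k = Wt \<alpha> (k - int CARD('n))"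

lemma jet_nat_eq: "supp_fin u x \<Longrightarrow> jet (- of_nat d) 0 u x = (\<Sum>k\<le>d. u x k / f x ^ k * poly (rising k) (of_nat d))"
proof -
  assume "supp_fin u x"
  moreover have "jet (- of_nat d) 0 u x = poly (Pol u x) (of_nat d)"
    by (simp add: jet_def of_rat_minus poly_pcompose flip: poly_0_coeff_0)
  ultimately show ?thesis by (simp add: poly_Pol_nat)
qed

text \<open>The values at s = 0, 1, 2, ... and the components u_k / f^k determine each other by a
  triangular system with constant coefficients. Dividing by f^k replaces alpha by alpha - k, and
  \<open>Wt_subset_shift_down\<close> moves this on to alpha - d.\<close>

lemma graph_comp_Wt_iff:
  assumes u: "u \<in> graph_module f p" and l: "0 \<le> l"
  shows "(\<forall>j. (\<lambda>x. u x j) \<in> Wt \<alpha> l p) \<longleftrightarrow> (\<forall>d::nat. jet (- of_nat d) 0 u \<in> Wt (- of_nat d + \<alpha>) l p)"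
proof -
  let ?c = "\<lambda>d k. poly (rising k) (of_nat d) :: complex"
  have germ: "germ_eq f p (jet (- of_nat d) 0 u) (\<lambda>x. \<Sum>k\<le>d. ?c d k * (u x k / f x ^ k))" for d
    unfolding germ_eq_def using graph_supp_fin[OF u]
    by (rule eventually_mono) (simp add: jet_nat_eq mult.commute)
  have div: "(\<lambda>x. u x k / f x ^ k) \<in> Wt (- of_nat d + \<alpha>) l p" if "(\<lambda>x. u x k) \<in> Wt \<alpha> l p" "k \<le> d" for k d
  proof -
    have "- of_nat d + \<alpha> + of_nat (d - k) = \<alpha> - of_nat k" using that(2) by (simp add: of_nat_diff)
    then show ?thesis
      using Wt_div_f_power[OF that(1), of k] Wt_subset_shift_down[OF l, of "- of_nat d + \<alpha>" "d - k" p] by auto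
  qed
  show ?thesis
  proof
    assume *: "\<forall>j. (\<lambda>x. u x j) \<in> Wt \<alpha> l p"
    show "\<forall>d. jet (- of_nat d) 0 u \<in> Wt (- of_nat d + \<alpha>) l p"
    proof
      fix d
      have "(\<lambda>x. \<Sum>k\<le>d. ?c d k * (u x k / f x ^ k)) \<in> Wt (- of_nat d + \<alpha>) l p"
        using div * unfolding Wt_def by (intro Msp_sum Msp_const_mult) auto
      then show "jet (- of_nat d) 0 u \<in> Wt (- of_nat d + \<alpha>) l p"
        by (rule Wt_cong) (rule germ_eq_sym[OF germ])
    qed
  next
    assume *: "\<forall>d. jet (- of_nat d) 0 u \<in> Wt (- of_nat d + \<alpha>) l p"
    show "\<forall>j. (\<lambda>x. u x j) \<in> Wt \<alpha> l p"
    proof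
      fix d show "(\<lambda>x. u x d) \<in> Wt \<alpha> l p"
      proof (induction d rule: less_induct)
        case (less d)
        have 1: "(\<lambda>x. \<Sum>k<d. ?c d k * (u x k / f x ^ k)) \<in> Wt (- of_nat d + \<alpha>) l p"
          using div less unfolding Wt_def by (intro Msp_sum Msp_const_mult) auto
        have 2: "(\<lambda>x. \<Sum>k\<le>d. ?c d k * (u x k / f x ^ k)) \<in> Wt (- of_nat d + \<alpha>) l p"
          using * by (intro Wt_cong[OF _ germ]) blast
        have "(\<lambda>x. f x ^ d * ((1 / ?c d d) * ((\<Sum>k\<le>d. ?c d k * (u x k / f x ^ k)) - (\<Sum>k<d. ?c d k * (u x k / f x ^ k)))))
            \<in> Wt (- of_nat d + \<alpha> + of_nat d) l p"
          by (intro Wt_mult_f_power Wt_const_mult Wt_diff 1 2)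
        then have "(\<lambda>x. f x ^ d * ((1 / ?c d d) * ((\<Sum>k\<le>d. ?c d k * (u x k / f x ^ k)) - (\<Sum>k<d. ?c d k * (u x k / f x ^ k)))))
            \<in> Wt \<alpha> l p" by simp
        then show ?case
          by (rule Wt_cong, intro germ_eqI)
             (simp add: poly_rising_nat_nonzero lessThan_Suc_atMost[symmetric])
      qed
    qed
  qed
qed

end

lemma set_sum_absorb_right:
  fixes S T :: "'a::monoid_add set"
  assumes "0 \<in> T" "\<And>u v. u \<in> S \<Longrightarrow> v \<in> T \<Longrightarrow> u + v \<in> S"
  shows "{u + v |u v. u \<in> S \<and> v \<in> T} = S"
proof (intro equalityI subsetI)
  fix x assume "x \<in> S"
  then show "x \<in> {u + v |u v. u \<in> S \<and> v \<in> T}"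
    using assms(1) by (intro CollectI exI[of _ x] exI[of _ 0]) simp
qed (use assms(2) in blast)

lemma set_sum_absorb_left:
  fixes S T :: "'a::monoid_add set"
  assumes "0 \<in> S" "\<And>u v. u \<in> S \<Longrightarrow> v \<in> T \<Longrightarrow> u + v \<in> T"
  shows "{u + v |u v. u \<in> S \<and> v \<in> T} = T"
proof (intro equalityI subsetI)
  fix x assume "x \<in> T"
  then show "x \<in> {u + v |u v. u \<in> S \<and> v \<in> T}"
    using assms(1) by (intro CollectI exI[of _ 0] exI[of _ x]) simp
qed (use assms(2) in blast)

section \<open>Generators of the weight filtration\<close>

context normal_crossing
begin

text \<open>The index set I_alpha of the theorem.\<close>

definition critical :: "'n set" where
  "critical = {i \<in> I. \<alpha> * of_nat (a i) \<in> \<int>}"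

lemma bexp_0_critical: "i \<in> critical \<Longrightarrow> of_int (bexp 0 i) + 1 = \<alpha> * of_nat (a i)"
  by (auto simp: critical_def bexp_def elim!: Ints_cases)

lemma bexp_0_nonneg: "i \<in> I \<Longrightarrow> 0 \<le> bexp 0 i"
proof -
  assume "i \<in> I"
  then have "0 < \<alpha> * of_nat (a i)" using \<alpha>_pos by (simp add: I_iff)
  then have "0 < \<lceil>\<alpha> * of_nat (a i)\<rceil>" by simp
  then show ?thesis by (simp add: bexp_def)
qed

lemma poles_\<alpha>: "poles \<alpha> e = card {i \<in> critical. e i \<le> bexp 0 i}"
proof -
  have "of_int (e i) < \<alpha> * of_nat (a i) \<longleftrightarrow> e i \<le> bexp 0 i" if "i \<in> critical" for i
  proof -
    have "of_int (e i) < \<alpha> * of_nat (a i) \<longleftrightarrow> of_int (e i) < (of_int (bexp 0 i + 1) :: rat)"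
      using bexp_0_critical[OF that] by simp
    then show ?thesis by (simp only: of_int_less_iff) linarith
  qed
  then have "{i \<in> I. \<alpha> * of_nat (a i) \<in> \<int> \<and> of_int (e i) < \<alpha> * of_nat (a i)} = {i \<in> critical. e i \<le> bexp 0 i}"
    by (auto simp: critical_def)
  then show ?thesis by (simp add: poles_def)
qed

lemma poles_max_bexp: "poles \<alpha> (\<lambda>i. max (e i) (bexp 0 i)) = poles \<alpha> e"
  by (simp add: poles_\<alpha>)

lemma nabla_indep:
  assumes "holo_germ p h" "indep i h" "i \<in> I"
  shows "germ_eq f p (nabla f \<alpha> i (\<lambda>x. h x * mon e x))
    (\<lambda>x. (of_int (e i) - of_rat \<alpha> * of_nat (a i)) * (h x * mon (e(i := e i - 1)) x))"
proof -
  have "partial i h x = 0" for x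
  proof -
    have "h (x + axis i z) = h x" for z
      using assms(2) upd_plus_axis[of i "x $ i + z" x] by (simp add: indep_def) metis
    then show ?thesis by (simp add: partial_def)
  qed
  then show ?thesis
    using germ_eq_trans[OF germ_eq_nabla_tw tw_holo_mon[OF assms(1), of \<alpha> i e]] assms(3) by (simp add: mult.assoc)
qed

lemma of_rat_integer_mult_neq:
  "of_int k \<noteq> \<beta> * of_nat m \<Longrightarrow> of_int k - of_rat \<beta> * of_nat m \<noteq> (0::complex)"
proof
  assume "of_int k \<noteq> \<beta> * of_nat m" "of_int k - of_rat \<beta> * of_nat m = (0::complex)"
  then have "of_rat (of_int k) = (of_rat (\<beta> * of_nat m) :: complex)" by (simp add: of_rat_mult)
  then show False using \<open>of_int k \<noteq> \<beta> * of_nat m\<close> by (simp only: of_rat_eq_iff)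
qed

text \<open>Each derivative lowers one exponent by one, with factor e_i + 1 - alpha a_i; this is
  nonzero since e_i + 1 is at most \<open>bexp 0 i\<close>, which is less than alpha a_i.
  Independence of h from x_i keeps the derivative from meeting h.\<close>

lemma lowering:
  assumes "holo_germ p h" "\<And>i. e i < bexp 0 i \<Longrightarrow> i \<in> I \<and> indep i h"
  shows "\<exists>ks c. c \<noteq> 0 \<and> length ks = (\<Sum>i\<in>UNIV. nat (bexp 0 i - e i)) \<and>
    germ_eq f p (foldr (nabla f \<alpha>) ks (\<lambda>x. h x * mon (\<lambda>i. max (e i) (bexp 0 i)) x)) (\<lambda>x. c * (h x * mon e x))"
  using assms(2)
proof (induction "\<Sum>i\<in>UNIV. nat (bexp 0 i - e i)" arbitrary: e)
  case 0
  then have "\<forall>i. nat (bexp 0 i - e i) = 0" by simp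
  then have "(\<lambda>i. max (e i) (bexp 0 i)) = e" by (auto simp: fun_eq_iff)
  then show ?case using 0 by (intro exI[of _ "[]"] exI[of _ 1]) simp
next
  case (Suc N)
  have "\<exists>i. nat (bexp 0 i - e i) \<noteq> 0"
  proof (rule ccontr)
    assume "\<not> ?thesis"
    then have "(\<Sum>i\<in>UNIV. nat (bexp 0 i - e i)) = 0" by simp
    then show False using Suc.hyps(2) by linarith
  qed
  then obtain i where "nat (bexp 0 i - e i) \<noteq> 0" by blast
  then have i: "e i < bexp 0 i" by simp
  let ?e = "e(i := e i + 1)"
  have N: "(\<Sum>k\<in>UNIV. nat (bexp 0 k - ?e k)) = N"
  proof -
    have "(\<Sum>k\<in>UNIV. nat (bexp 0 k - e k)) = nat (bexp 0 i - e i) + (\<Sum>k\<in>UNIV - {i}. nat (bexp 0 k - e k))"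
      by (rule sum.remove) simp_all
    moreover have "(\<Sum>k\<in>UNIV. nat (bexp 0 k - ?e k)) = nat (bexp 0 i - ?e i) + (\<Sum>k\<in>UNIV - {i}. nat (bexp 0 k - ?e k))"
      by (rule sum.remove) simp_all
    moreover have "(\<Sum>k\<in>UNIV - {i}. nat (bexp 0 k - ?e k)) = (\<Sum>k\<in>UNIV - {i}. nat (bexp 0 k - e k))"
      by (rule sum.cong) auto
    ultimately show ?thesis using i Suc.hyps(2) by simp
  qed
  have "k \<in> I \<and> indep k h" if "?e k < bexp 0 k" for k
    using that Suc.prems[of k] i Suc.prems[of i] by (auto split: if_splits)
  from Suc.hyps(1)[OF N[symmetric] this] obtain ks c where ks: "c \<noteq> 0" "length ks = N"
    "germ_eq f p (foldr (nabla f \<alpha>) ks (\<lambda>x. h x * mon (\<lambda>k. max (?e k) (bexp 0 k)) x)) (\<lambda>x. c * (h x * mon ?e x))"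
    unfolding N by blast
  have max: "(\<lambda>k. max (?e k) (bexp 0 k)) = (\<lambda>k. max (e k) (bexp 0 k))"
    using i by (auto simp: fun_eq_iff)
  define c' where "c' = of_int (e i + 1) - of_rat \<alpha> * (of_nat (a i) :: complex)"
  have iI: "i \<in> I" "indep i h" using Suc.prems[OF i] by auto
  have "of_int (e i + 1) < \<alpha> * of_nat (a i)"
  proof (rule le_less_trans)
    show "of_int (e i + 1) \<le> (of_int (bexp 0 i) :: rat)" using i by (simp only: of_int_le_iff)
    show "of_int (bexp 0 i) < \<alpha> * of_nat (a i)" using bexp_less[of 0 i] by (simp only: add_0)
  qed
  then have c': "c' \<noteq> 0" unfolding c'_def by (intro of_rat_integer_mult_neq less_imp_neq)
  have "indep i (\<lambda>x. c * h x)" using iI(2) by (simp add: indep_def)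
  from nabla_indep[OF holo_germ_mult[OF holo_germ_const assms(1)] this iI(1), of ?e]
  have "germ_eq f p (nabla f \<alpha> i (\<lambda>x. c * (h x * mon ?e x))) (\<lambda>x. (c' * c) * (h x * mon e x))"
    by (simp add: c'_def mult.assoc)
  from germ_eq_trans[OF germ_eq_nabla[OF ks(3)] this]
  show ?case using ks(1,2) c' Suc.hyps(2) unfolding max
    by (intro exI[of _ "i # ks"] exI[of _ "c' * c"]) simp
qed

text \<open>The exponents of the generator indexed by J in the theorem.\<close>

definition gen_exp :: "'n set \<Rightarrow> 'n \<Rightarrow> int" where
  "gen_exp J i = (if i \<in> critical - J then bexp 0 i + 1 else bexp 0 i)"

definition gens :: "int \<Rightarrow> (complex ^ 'n \<Rightarrow> complex) set" where
  "gens l = {mon (gen_exp J) |J. J \<subseteq> critical \<and> int (card J) \<le> l}"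

lemma finite_gens: "finite (gens l)"
proof -
  have "gens l \<subseteq> (\<lambda>J. mon (gen_exp J)) ` UNIV" by (auto simp: gens_def)
  then show ?thesis by (rule finite_subset) simp
qed

lemma bexp_le_gen_exp: "bexp 0 i \<le> gen_exp J i"
  by (simp add: gen_exp_def)

lemma poles_gen_exp: "J \<subseteq> critical \<Longrightarrow> poles \<alpha> (gen_exp J) = card J"
proof -
  assume "J \<subseteq> critical"
  then have "{i \<in> critical. gen_exp J i \<le> bexp 0 i} = J" by (auto simp: gen_exp_def)
  then show ?thesis by (simp add: poles_\<alpha>)
qed

lemma Msp_eq_span: "Msp E p = span_by (germ_eq f p) (O_ops p) (mon ` E)"
proof
  show "Msp E p \<subseteq> span_by (germ_eq f p) (O_ops p) (mon ` E)"
  proof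
    fix g assume "g \<in> Msp E p"
    then show "g \<in> span_by (germ_eq f p) (O_ops p) (mon ` E)"
    proof (induction rule: Msp_induct)
      case (mon e h)
      show ?case
        by (rule span_by.act[where T="\<lambda>u x. h x * u x"])
           (use mon in \<open>auto simp: O_ops_def intro: span_by.base\<close>)
    next
      case zero
      show ?case using span_by.zero[where E="germ_eq f p" and Ops="O_ops p" and G="mon ` E"] by (simp add: zero_fun_def)
    next
      case (add u v)
      from span_by.add[OF this] show ?case by (simp add: plus_fun_def)
    next
      case (cong u v)
      then show ?case by (rule span_by.cong[where E="germ_eq f p"])
    qed
  qed
  show "span_by (germ_eq f p) (O_ops p) (mon ` E) \<subseteq> Msp E p"
  proof
    fix g assume "g \<in> span_by (germ_eq f p) (O_ops p) (mon ` E)"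
    then show "g \<in> Msp E p"
    proof (rule span_by_least)
      show "mon ` E \<subseteq> Msp E p" using Msp_mon by blast
      show "0 \<in> Msp E p" using Msp_zero by (simp add: zero_fun_def)
      show "u + v \<in> Msp E p" if "u \<in> Msp E p" "v \<in> Msp E p" for u v
        using Msp_add[OF that] by (simp add: plus_fun_def)
      show "T u \<in> Msp E p" if "T \<in> O_ops p" "u \<in> Msp E p" for T u
        using that Msp_holo_mult by (auto simp: O_ops_def)
      show "v \<in> Msp E p" if "u \<in> Msp E p" "germ_eq f p u v" for u v
        using that by (rule Msp_cong)
    qed
  qed
qed

text \<open>The exponents that describe the zeroth Hodge piece of a weight step, see
  \<open>hodge_weight_0\<close>.\<close>

definition top_exps :: "int \<Rightarrow> ('n \<Rightarrow> int) set" where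
  "top_exps l = {e. (\<forall>i\<in>I. bexp 0 i \<le> e i) \<and> int (poles \<alpha> e) \<le> l}"

lemma Msp_top_exps:
  assumes "l \<le> card critical"
  shows "Msp (top_exps (int l)) p = span_by (germ_eq f p) (O_ops p) {mon (gen_exp J) |J. J \<subseteq> critical \<and> card J = l}"
proof -
  let ?E = "{gen_exp J |J. J \<subseteq> critical \<and> card J = l}"
  have "Msp (top_exps (int l)) p = Msp ?E p"
  proof
    show "Msp (top_exps (int l)) p \<subseteq> Msp ?E p"
    proof
      fix g assume "g \<in> Msp (top_exps (int l)) p"
      then show "g \<in> Msp ?E p"
      proof (rule Msp_subset)
        fix e assume e: "e \<in> top_exps (int l)"
        let ?P = "{i \<in> critical. e i \<le> bexp 0 i}"
        have "card ?P \<le> l" using e by (simp add: top_exps_def poles_\<alpha>)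
        moreover have "?P \<subseteq> critical" by blast
        \<comment> \<open>The set of poles is enlarged to exactly l elements. A larger J only lowers
          the exponents of the generator, so the generator still divides x^e.\<close>
        ultimately obtain J where J: "?P \<subseteq> J" "J \<subseteq> critical" "card J = l"
          using exists_subset_between[of ?P l critical] assms by auto
        have "gen_exp J i \<le> e i" if "i \<in> I" for i
          using that e J(1) by (auto simp: gen_exp_def top_exps_def)
        then show "\<exists>e'\<in>?E. \<forall>i\<in>I. p $ i = 0 \<longrightarrow> e' i \<le> e i"
          using J by (intro bexI[of _ "gen_exp J"]) auto
      qed
    qed
    show "Msp ?E p \<subseteq> Msp (top_exps (int l)) p"
      by (rule Msp_mono) (auto simp: top_exps_def bexp_le_gen_exp poles_gen_exp)
  qed
  moreover have "mon ` ?E = {mon (gen_exp J) |J. J \<subseteq> critical \<and> card J = l}" by blast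
  ultimately show ?thesis by (simp only: Msp_eq_span)
qed

lemma Msp_top_exps_gens:
  "g \<in> Msp (top_exps l) p \<Longrightarrow> g \<in> span_by (germ_eq f p) (O_ops p) (gens l)"
proof -
  assume "g \<in> Msp (top_exps l) p"
  then have "g \<in> Msp {gen_exp J |J. J \<subseteq> critical \<and> int (card J) \<le> l} p"
  proof (rule Msp_subset)
    fix e assume e: "e \<in> top_exps l"
    let ?P = "{i \<in> critical. e i \<le> bexp 0 i}"
    have "gen_exp ?P i \<le> e i" if "i \<in> I" for i
      using that e by (auto simp: gen_exp_def top_exps_def)
    then show "\<exists>e'\<in>{gen_exp J |J. J \<subseteq> critical \<and> int (card J) \<le> l}. \<forall>i\<in>I. p $ i = 0 \<longrightarrow> e' i \<le> e i"
      using e by (intro bexI[of _ "gen_exp ?P"]) (auto simp: top_exps_def poles_\<alpha>)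
  qed
  moreover have "mon ` {gen_exp J |J. J \<subseteq> critical \<and> int (card J) \<le> l} = gens l" by (auto simp: gens_def)
  ultimately show ?thesis by (simp only: Msp_eq_span)
qed

lemma span_by_mono_ops: "u \<in> span_by E Ops G \<Longrightarrow> Ops \<subseteq> Ops' \<Longrightarrow> u \<in> span_by E Ops' G"
  by (induction rule: span_by.induct) (blast intro: span_by.intros)+

lemma O_ops_D_ops: "O_ops p \<subseteq> D_ops f \<alpha> p"
  by (simp add: D_ops_def)

lemma Wt_D_ops: "T \<in> D_ops f \<alpha> p \<Longrightarrow> u \<in> Wt \<alpha> l p \<Longrightarrow> T u \<in> Wt \<alpha> l p"
  unfolding D_ops_def
proof (elim UnE rangeE)
  assume u: "u \<in> Wt \<alpha> l p"
  show "T \<in> O_ops p \<Longrightarrow> T u \<in> Wt \<alpha> l p" using Wt_holo_mult[OF u] by (auto simp: O_ops_def)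
  show "T = nabla f \<alpha> i \<Longrightarrow> T u \<in> Wt \<alpha> l p" for i
    using Wt_cong[OF Wt_tw[OF u] germ_eq_sym[OF germ_eq_nabla_tw]] by simp
qed

lemma Wt_span: "G \<subseteq> Wt \<alpha> l p \<Longrightarrow> span_by (germ_eq f p) (D_ops f \<alpha> p) G \<subseteq> Wt \<alpha> l p"
proof
  fix u assume G: "G \<subseteq> Wt \<alpha> l p" and u: "u \<in> span_by (germ_eq f p) (D_ops f \<alpha> p) G"
  show "u \<in> Wt \<alpha> l p"
    using u G
  proof (rule span_by_least)
    show "0 \<in> Wt \<alpha> l p" using Wt_zero by (simp add: zero_fun_def)
    show "u + v \<in> Wt \<alpha> l p" if "u \<in> Wt \<alpha> l p" "v \<in> Wt \<alpha> l p" for u v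
      using Wt_add[OF that] by (simp add: plus_fun_def)
  qed (fact Wt_D_ops, fact Wt_cong)
qed

lemma gens_Wt: "gens l \<subseteq> Wt \<alpha> l p"
  by (auto simp: gens_def Wt_def poles_gen_exp intro!: Msp_mon)

lemma clip_bexp:
  assumes "e \<in> clipped (\<lambda>i. bexp 0 i + 1) p" "h \<in> coeffs_at (\<lambda>i. bexp 0 i + 1) p e"
  shows "holo_germ p h" and "\<And>i. e i < bexp 0 i \<Longrightarrow> i \<in> I \<and> indep i h"
  using assms by (force simp: clipped_def coeffs_at_def)+

text \<open>The bound is \<open>bexp 0\<close> plus 1 because at a critical index alpha a_i equals
  this number; with a smaller bound, clipping could turn a non-pole into a pole.\<close>

lemma clip_closed_bexp: "clip_closed (\<lambda>i. bexp 0 i + 1) {e. int (poles \<alpha> e) \<le> l}"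
  using bexp_0_critical by (intro clip_closed_poles) (auto simp: critical_def)

lemma span_foldr_nabla:
  "u \<in> span_by (germ_eq f p) (D_ops f \<alpha> p) G \<Longrightarrow> foldr (nabla f \<alpha>) ks u \<in> span_by (germ_eq f p) (D_ops f \<alpha> p) G"
  by (induction ks) (auto simp: D_ops_def intro: span_by.act)

lemma span_D_scale:
  "u \<in> span_by (germ_eq f p) (D_ops f \<alpha> p) G \<Longrightarrow> holo_germ p h \<Longrightarrow>
    (\<lambda>x. h x * u x) \<in> span_by (germ_eq f p) (D_ops f \<alpha> p) G"
  by (rule span_by.act[where T="\<lambda>u x. h x * u x"]) (auto simp: D_ops_def O_ops_def)

lemma span_by_sum:
  fixes u :: "'k \<Rightarrow> complex ^ 'n \<Rightarrow> complex"
  shows "(\<And>k. k \<in> K \<Longrightarrow> u k \<in> span_by E Ops G) \<Longrightarrow> (\<lambda>x. \<Sum>k\<in>K. u k x) \<in> span_by E Ops G"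
proof (induction K rule: infinite_finite_induct)
  case (insert k K)
  then have "u k + (\<lambda>x. \<Sum>k\<in>K. u k x) \<in> span_by E Ops G"
    by (intro span_by.add) auto
  then show ?case using insert(1,2) by (simp add: plus_fun_def)
qed (simp_all add: span_by.zero flip: zero_fun_def)

text \<open>Each term of the normal form is a nonzero multiple of iterated derivatives of the term
  with exponents raised to at least \<open>bexp 0\<close>. Raising keeps the pole count, so the
  raised term is generated by \<open>gens l\<close>.\<close>

lemma Wt_generated: "Wt \<alpha> l p = span_by (germ_eq f p) (D_ops f \<alpha> p) (gens l)"
proof
  show "span_by (germ_eq f p) (D_ops f \<alpha> p) (gens l) \<subseteq> Wt \<alpha> l p"
    by (rule Wt_span[OF gens_Wt])
  let ?S = "span_by (germ_eq f p) (D_ops f \<alpha> p) (gens l)"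
  show "Wt \<alpha> l p \<subseteq> ?S"
  proof
    fix g assume "g \<in> Wt \<alpha> l p"
    then obtain S H where dec: "decomp (\<lambda>i. bexp 0 i + 1) p S H g" and S: "S \<subseteq> {e. int (poles \<alpha> e) \<le> l}"
      using decomp_exists[OF _ clip_closed_bexp] unfolding Wt_def by blast
    have "(\<lambda>x. H e x * mon e x) \<in> ?S" if e: "e \<in> S" for e
    proof -
      have eH: "e \<in> clipped (\<lambda>i. bexp 0 i + 1) p" "H e \<in> coeffs_at (\<lambda>i. bexp 0 i + 1) p e"
        using dec e by (auto simp: decomp_def)
      obtain ks c where ks: "c \<noteq> 0"
        "germ_eq f p (foldr (nabla f \<alpha>) ks (\<lambda>x. H e x * mon (\<lambda>i. max (e i) (bexp 0 i)) x)) (\<lambda>x. c * (H e x * mon e x))"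
        using lowering[OF clip_bexp[OF eH]] by blast
      have "(\<lambda>i. max (e i) (bexp 0 i)) \<in> top_exps l"
        using S e by (auto simp: top_exps_def poles_max_bexp)
      then have "(\<lambda>x. H e x * mon (\<lambda>i. max (e i) (bexp 0 i)) x) \<in> ?S"
        by (intro span_by_mono_ops[OF Msp_top_exps_gens O_ops_D_ops] Msp_mon_mult clip_bexp(1)[OF eH])
      from span_by.cong[where E="germ_eq f p", OF span_foldr_nabla[OF this] ks(2)]
      have "(\<lambda>x. c * (H e x * mon e x)) \<in> ?S" .
      from span_D_scale[OF this holo_germ_const, of "1 / c"] show ?thesis using ks(1) by simp
    qed
    then have "(\<lambda>x. \<Sum>e\<in>S. H e x * mon e x) \<in> ?S" by (rule span_by_sum)
    moreover have "germ_eq f p (\<lambda>x. \<Sum>e\<in>S. H e x * mon e x) g"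
      using dec germ_eq_sym by (auto simp: decomp_def)
    ultimately show "g \<in> ?S" by (rule span_by.cong[where E="germ_eq f p"])
  qed
qed

lemma poles_le_critical: "poles \<alpha> e \<le> card critical"
  unfolding poles_\<alpha> by (rule card_mono) auto

lemma Wt_off: "f p \<noteq> 0 \<Longrightarrow> 0 \<le> l \<Longrightarrow> Wt \<alpha> l p = mero_module f p"
proof
  assume p: "f p \<noteq> 0" and l: "0 \<le> l"
  show "Wt \<alpha> l p \<subseteq> mero_module f p" by (rule Wt_subset_mero)
  have "gen_exp {} \<in> {e. int (poles \<alpha> e) \<le> l}" using poles_gen_exp[of "{}"] l by simp
  then have "g \<in> Msp {e. int (poles \<alpha> e) \<le> l} p" if "g \<in> Msp UNIV p" for g
    using p by (intro Msp_subset[OF that] bexI[of _ "gen_exp {}"]) (auto simp: f_nonzero_iff)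
  then show "mero_module f p \<subseteq> Wt \<alpha> l p" unfolding Wt_def mero_eq by blast
qed

text \<open>For gamma > 0 all points delta = 0, -1, -2, ... lie below gamma, so the V-condition
  controls the values at s = 0, 1, 2, ... and with them the components.\<close>

lemma Vf_W_graph: "0 < \<gamma> \<Longrightarrow> u \<in> Vf \<gamma> p \<Longrightarrow> 0 \<le> l \<Longrightarrow> (\<lambda>x. u x j) \<in> Wt \<alpha> l p"
proof -
  assume *: "0 < \<gamma>" "u \<in> Vf \<gamma> p" "0 \<le> l"
  have "jet (- of_nat d) 0 u \<in> Wt (- of_nat d + \<alpha>) l p" for d
  proof -
    have "- of_nat d < \<gamma>" using *(1) by (rule le_less_trans[rotated]) simp
    from Vf_jet[OF *(2) this, of 0] show ?thesis using Wt_mono[of 0 l] *(3) by auto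
  qed
  then show ?thesis using graph_comp_Wt_iff[OF Vf_graph[OF *(2)] *(3)] by blast
qed

section \<open>Filtrations induced on the graded pieces of V\<close>

lemma W_gr_V_eq:
  "W_gr_V f \<alpha> W p \<gamma> k = {u + v |u v. u \<in> Vf \<gamma> p \<inter> W_graph f W k p \<and> v \<in> Va \<gamma> p}"
  unfolding W_gr_V_def V_filtration_eq V_above_eq ..

lemma Va_zero: "0 \<in> Va \<gamma> p"
  by (rule jet_module.B_zero[OF jet_module_Vf])

lemma Vf_add_Va: "u \<in> Vf \<gamma> p \<Longrightarrow> v \<in> Va \<gamma> p \<Longrightarrow> u + v \<in> Vf \<gamma> p"
  using Vf_add[of u \<gamma> p v] by (simp add: Va_iff plus_fun_def)

lemma W_gr_V_full:
  assumes "Vf \<gamma> p \<subseteq> W_graph f W k p"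
  shows "W_gr_V f \<alpha> W p \<gamma> k = Vf \<gamma> p"
proof -
  have "Vf \<gamma> p \<inter> W_graph f W k p = Vf \<gamma> p" using assms by blast
  then show ?thesis
    unfolding W_gr_V_eq by (simp only: set_sum_absorb_right[OF Va_zero Vf_add_Va])
qed

lemma W_gr_V_zero:
  assumes "W k p = zero_stalk f p"
  shows "W_gr_V f \<alpha> W p \<gamma> k = Va \<gamma> p"
  unfolding W_gr_V_eq
proof (rule set_sum_absorb_left)
  have "(\<lambda>_. 0) \<in> W k p" unfolding assms by (simp add: zero_stalk_def)
  then show "0 \<in> Vf \<gamma> p \<inter> W_graph f W k p"
    using Vf_zero graph_zero by (simp add: W_graph_def zero_fun_def)
  fix u v assume u: "u \<in> Vf \<gamma> p \<inter> W_graph f W k p" and v: "v \<in> Va \<gamma> p"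
  then have "germ_eq f p (\<lambda>x. u x j) (\<lambda>_. 0)" for j
    by (simp add: W_graph_def assms zero_stalk_def)
  then have "germ_eq f p u (\<lambda>_ _. 0)"
    using u by (intro graph_eqI_comp graph_zero) (simp_all add: W_graph_def)
  then have "germ_eq f p v (u + v)"
    unfolding germ_eq_def by (rule eventually_mono) (simp add: fun_eq_iff)
  then show "u + v \<in> Va \<gamma> p" using Vf_cong[of v "next_jump \<gamma>" p] v unfolding Va_eq_Vf by blast
qed

lemma weight_neg: "k < int CARD('n) \<Longrightarrow> weight k = zero_stalk f"
  unfolding weight_def by (rule Wt_neg) simp

lemma W_gr_V_weight_pos:
  assumes "0 < \<gamma>"
  shows "W_gr_V f \<alpha> weight p \<gamma> k = (if int CARD('n) \<le> k then Vf \<gamma> p else Va \<gamma> p)"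
proof (cases "int CARD('n) \<le> k")
  case True
  have "Vf \<gamma> p \<subseteq> W_graph f weight k p"
    using Vf_W_graph[OF assms] True by (auto simp: W_graph_def weight_def Vf_graph)
  then show ?thesis using True W_gr_V_full by simp
next
  case False
  then show ?thesis using W_gr_V_zero[of weight k p \<gamma>] weight_neg[of k] by simp
qed

definition grL :: "complex ^ 'n \<Rightarrow> int \<Rightarrow> 'n graph_section set" where
  "grL p = jet_module.Lf (Vf 0 p) (Va 0 p) (jet 0) (\<lambda>k. Wt (0 + \<alpha>) k p) (int CARD('n))"

definition grR :: "complex ^ 'n \<Rightarrow> rat \<Rightarrow> int \<Rightarrow> int \<Rightarrow> 'n graph_section set" where
  "grR p \<gamma> = jet_module.Rf (Vf \<gamma> p) (jet \<gamma>) (\<lambda>k. Wt (\<gamma> + \<alpha>) k p)"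

lemma grL_eq: "grL p k = (if int CARD('n) \<le> k then {u \<in> Vf 0 p. jet 0 0 u \<in> Wt \<alpha> (k - int CARD('n)) p} else Va 0 p)"
  unfolding grL_def jet_module.Lf_def[OF jet_module_Vf] by simp

lemma grR_iff: "u \<in> grR p \<gamma> c k \<longleftrightarrow> u \<in> Vf \<gamma> p \<and> (\<forall>j. jet \<gamma> j u \<in> Wt (\<gamma> + \<alpha>) (max (int j) (2 * int j + k - c + 1)) p)"
  unfolding grR_def jet_module.Rf_def[OF jet_module_Vf] by simp

text \<open>In V^0 the conditions at s = d > 0 hold automatically, and only the value at s = 0
  remains.\<close>

lemma graph_comp_Wt_iff_0:
  assumes u: "u \<in> Vf 0 p" and l: "0 \<le> l"
  shows "(\<forall>j. (\<lambda>x. u x j) \<in> Wt \<alpha> l p) \<longleftrightarrow> jet 0 0 u \<in> Wt \<alpha> l p"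
  unfolding graph_comp_Wt_iff[OF Vf_graph[OF u] l]
proof
  assume "\<forall>d. jet (- of_nat d) 0 u \<in> Wt (- of_nat d + \<alpha>) l p"
  then show "jet 0 0 u \<in> Wt \<alpha> l p" by (auto dest: spec[of _ 0])
next
  assume 0: "jet 0 0 u \<in> Wt \<alpha> l p"
  show "\<forall>d. jet (- of_nat d) 0 u \<in> Wt (- of_nat d + \<alpha>) l p"
  proof
    fix d show "jet (- of_nat d) 0 u \<in> Wt (- of_nat d + \<alpha>) l p"
    proof (cases "d = 0")
      case False
      then have "- of_nat d < (0::rat)" by simp
      from Vf_jet[OF u this, of 0] show ?thesis using Wt_mono[of 0 l] l by auto
    qed (simp add: 0)
  qed
qed

lemma W_gr_V_weight_0: "W_gr_V f \<alpha> weight p 0 k = grL p k"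
proof (cases "int CARD('n) \<le> k")
  case True
  then have l: "0 \<le> k - int CARD('n)" by simp
  have S: "Vf 0 p \<inter> W_graph f weight k p = grL p k"
    unfolding grL_eq using True graph_comp_Wt_iff_0[OF _ l] Vf_graph by (auto simp: W_graph_def weight_def)
  have "u + v \<in> grL p k" if "u \<in> grL p k" "v \<in> Va 0 p" for u v
  proof -
    have "v \<in> grL p k" using that(2) jet_module.B_Lf[OF jet_module_Vf] unfolding grL_def by blast
    then show ?thesis using that(1) jet_module.Lf_diff[OF jet_module_Vf] subgroup_add[of "grL p k"] unfolding grL_def by blast
  qed
  then show ?thesis unfolding W_gr_V_eq S by (rule set_sum_absorb_right[OF Va_zero])
next
  case False
  then show ?thesis using W_gr_V_zero[of weight k p 0] weight_neg[of k] by (simp add: grL_eq)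
qed

text \<open>Multiplication by t moves the Taylor coefficients from s = 0 to s = -1 and multiplies
  them by f; the centres differ by 2, just as the two levels do.\<close>

lemma grR_var:
  assumes u: "u \<in> Vf 0 p"
  shows "u \<in> grR p 0 (int CARD('n) + 1) k \<longleftrightarrow> t_act f u \<in> grR p 1 (int CARD('n) - 1) (k - 2)"
proof -
  have "jet 0 j u \<in> Wt \<alpha> l p \<longleftrightarrow> jet 1 j (t_act f u) \<in> Wt (1 + \<alpha>) l p" for j l
  proof
    assume "jet 0 j u \<in> Wt \<alpha> l p"
    from Wt_mult_f[OF this] have "(\<lambda>x. f x * jet (1 - 1) j u x) \<in> Wt (1 + \<alpha>) l p" by (simp add: add.commute)
    then show "jet 1 j (t_act f u) \<in> Wt (1 + \<alpha>) l p"
      by (rule Wt_cong) (rule germ_eq_sym[OF jet_t_germ[OF Vf_graph[OF u]]])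
  next
    assume "jet 1 j (t_act f u) \<in> Wt (1 + \<alpha>) l p"
    from Wt_div_f_power[OF Wt_cong[OF this jet_t_germ[OF Vf_graph[OF u]]], of 1]
    have "(\<lambda>x. f x * jet 0 j u x / f x) \<in> Wt \<alpha> l p" by simp
    then show "jet 0 j u \<in> Wt \<alpha> l p" by (rule Wt_cong) (auto intro: germ_eqI)
  qed
  moreover have "2 * int j + (k - 2) - (int CARD('n) - 1) + 1 = 2 * int j + k - (int CARD('n) + 1) + 1" for j
    by simp
  ultimately show ?thesis using u Vf_t[OF u] unfolding grR_iff by (simp only: add_0 simp_thms)
qed

lemma is_weight_filtration_weight: "is_weight_filtration f \<alpha> weight"
  unfolding is_weight_filtration_def V_filtration_eq V_above_eq
proof (intro conjI allI impI)
  fix k l :: int and p :: "complex ^ 'n"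
  show "subsheaf_module f (mero_module f) (D_ops f \<alpha>) (weight k)"
    unfolding subsheaf_module_def weight_def
    by (intro allI conjI ballI Wt_subset_mero Wt_span order_refl) (simp add: Wt_def Msp_eventually)
  show "locally_fin_gen f (D_ops f \<alpha>) (weight k)"
    unfolding locally_fin_gen_def weight_def Wt_generated
    by (intro allI exI[of _ "gens (k - int CARD('n))"] conjI finite_gens always_eventually refl)
  show "weight k p \<subseteq> weight l p" if "k \<le> l" unfolding weight_def using that by (intro Wt_mono) simp
  show "\<exists>k l. weight k = zero_stalk f \<and> weight l = mero_module f"
    using weight_neg[of "int CARD('n) - 1"] Wt_top[of "int CARD('n)" \<alpha>]
    by (intro exI[of _ "int CARD('n) - 1"] exI[of _ "2 * int CARD('n)"]) (simp add: weight_def)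
  show "weight k p = (if int CARD('n) \<le> k then mero_module f p else zero_stalk f p)" if "f p \<noteq> 0"
    using that weight_neg[of k] by (simp add: weight_def Wt_off)
  show "\<exists>R. (\<forall>\<gamma>. 0 < \<gamma> \<and> \<gamma> \<le> 1 \<longrightarrow>
           relative_monodromy_filtration (dtt_minus f \<gamma>) (Vf \<gamma> p) (Va \<gamma> p) (\<lambda>k. W_gr_V f \<alpha> weight p \<gamma> (k + 1)) (R \<gamma>)) \<and>
        relative_monodromy_filtration (dtt_minus f 0) (Vf 0 p) (Va 0 p) (W_gr_V f \<alpha> weight p 0) (R 0) \<and>
        (\<forall>k. \<forall>u\<in>Vf 0 p. u \<in> R 0 k \<longleftrightarrow> t_act f u \<in> R 1 (k - 2))"
  \<comment> \<open>The centres: for gamma > 0 the induced filtration jumps at CARD('n), and the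
    shift by one moves this to CARD('n) - 1. For gamma = 0 the centre is CARD('n) + 1, as in
    \<open>Rf_relative_Lf\<close> with w = CARD('n).\<close>
  proof (rule exI[of _ "\<lambda>\<gamma>. if \<gamma> = 0 then grR p 0 (int CARD('n) + 1) else grR p \<gamma> (int CARD('n) - 1)"], intro conjI allI impI ballI)
    fix \<gamma> :: rat assume \<gamma>: "0 < \<gamma> \<and> \<gamma> \<le> 1"
    have "(\<lambda>k. W_gr_V f \<alpha> weight p \<gamma> (k + 1)) = (\<lambda>k. if int CARD('n) - 1 \<le> k then Vf \<gamma> p else Va \<gamma> p)"
    proof
      fix k
      have "int CARD('n) \<le> k + 1 \<longleftrightarrow> int CARD('n) - 1 \<le> k" by linarith
      then show "W_gr_V f \<alpha> weight p \<gamma> (k + 1) = (if int CARD('n) - 1 \<le> k then Vf \<gamma> p else Va \<gamma> p)"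
        using \<gamma> by (simp only: W_gr_V_weight_pos)
    qed
    then show "relative_monodromy_filtration (dtt_minus f \<gamma>) (Vf \<gamma> p) (Va \<gamma> p) (\<lambda>k. W_gr_V f \<alpha> weight p \<gamma> (k + 1))
        (if \<gamma> = 0 then grR p 0 (int CARD('n) + 1) else grR p \<gamma> (int CARD('n) - 1))"
      using jet_module.Rf_relative_pure[OF jet_module_Vf, of \<gamma> p "int CARD('n) - 1"] \<gamma> by (simp add: grR_def)
  next
    have "W_gr_V f \<alpha> weight p 0 = grL p" by (rule ext) (rule W_gr_V_weight_0)
    then show "relative_monodromy_filtration (dtt_minus f 0) (Vf 0 p) (Va 0 p) (W_gr_V f \<alpha> weight p 0)
        (if (0::rat) = 0 then grR p 0 (int CARD('n) + 1) else grR p 0 (int CARD('n) - 1))"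
      using jet_module.Rf_relative_Lf[OF jet_module_Vf, of 0 p "int CARD('n)"] by (simp only: grL_def grR_def if_True simp_thms)
  next
    fix k u assume "u \<in> Vf 0 p"
    from grR_var[OF this, of k]
    show "(u \<in> (if (0::rat) = 0 then grR p 0 (int CARD('n) + 1) else grR p 0 (int CARD('n) - 1)) k) =
        (t_act f u \<in> (if (1::rat) = 0 then grR p 0 (int CARD('n) + 1) else grR p 1 (int CARD('n) - 1)) (k - 2))"
      by simp
  qed
qed

section \<open>D-submodules and uniqueness of the weight filtration\<close>

definition D_closed :: "complex ^ 'n \<Rightarrow> (complex ^ 'n \<Rightarrow> complex) set \<Rightarrow> bool" where
  "D_closed p S \<longleftrightarrow> span_by (germ_eq f p) (D_ops f \<alpha> p) S \<subseteq> S"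

lemma D_closedD:
  assumes "D_closed p S"
  shows "(\<lambda>_. 0) \<in> S" and "u \<in> S \<Longrightarrow> v \<in> S \<Longrightarrow> (\<lambda>x. u x + v x) \<in> S"
    and "u \<in> S \<Longrightarrow> holo_germ p h \<Longrightarrow> (\<lambda>x. h x * u x) \<in> S"
    and "u \<in> S \<Longrightarrow> nabla f \<alpha> i u \<in> S" and "u \<in> S \<Longrightarrow> germ_eq f p u v \<Longrightarrow> v \<in> S"
proof -
  let ?T = "span_by (germ_eq f p) (D_ops f \<alpha> p) S"
  have sub: "w \<in> ?T \<Longrightarrow> w \<in> S" for w using assms unfolding D_closed_def by blast
  have base: "w \<in> S \<Longrightarrow> w \<in> ?T" for w by (rule span_by.base)
  show "(\<lambda>_. 0) \<in> S" using sub[OF span_by.zero] by (simp add: zero_fun_def)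
  show "(\<lambda>x. u x + v x) \<in> S" if "u \<in> S" "v \<in> S"
    using sub[OF span_by.add[OF base[OF that(1)] base[OF that(2)]]] by (simp add: plus_fun_def)
  show "(\<lambda>x. h x * u x) \<in> S" if "u \<in> S" "holo_germ p h"
    by (rule sub[OF span_D_scale[OF base[OF that(1)] that(2)]])
  show "nabla f \<alpha> i u \<in> S" if "u \<in> S"
    by (rule sub[OF span_by.act[OF _ base[OF that]]]) (simp add: D_ops_def)
  show "v \<in> S" if "u \<in> S" "germ_eq f p u v"
    by (rule sub[OF span_by.cong[where E="germ_eq f p", OF base[OF that(1)] that(2)]])
qed

text \<open>Up to (K - alpha) (d f / d x_i) f^K v, which already lies in S, the product of f with
  the twisted derivative of f^K v is f^(K+1) times the ordinary derivative of v.\<close>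

lemma D_closed_partial:
  assumes S: "D_closed p S" and v: "holo_germ p v" and u: "(\<lambda>x. f x ^ K * v x) \<in> S"
  shows "(\<lambda>x. f x ^ Suc K * partial i v x) \<in> S"
proof -
  let ?u = "\<lambda>x. f x ^ K * v x" and ?e = "\<lambda>i. int K * int (a i)"
  have "germ_eq f p ?u (\<lambda>x. v x * mon ?e x)" by (rule germ_eqI) (simp add: f_power_eq_mon)
  from germ_eq_trans[OF germ_eq_nabla[OF this] germ_eq_trans[OF germ_eq_nabla_tw tw_holo_mon[OF v]]]
  have nab: "germ_eq f p (nabla f \<alpha> i ?u) (\<lambda>x. partial i v x * mon ?e x +
      (if i \<in> I then ((of_int (?e i) - of_rat \<alpha> * of_nat (a i)) * v x) * mon (?e(i := ?e i - 1)) x else 0))"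
    (is "germ_eq f p _ ?R") .
  let ?w = "\<lambda>x. f x * nabla f \<alpha> i ?u x + ((of_rat \<alpha> - of_nat K) * partial i f x) * ?u x"
  have "germ_eq f p ?w (\<lambda>x. f x * ?R x + ((of_rat \<alpha> - of_nat K) * partial i f x) * ?u x)"
    by (rule germ_eq_lift1[where F="\<lambda>x y. f x * y + ((of_rat \<alpha> - of_nat K) * partial i f x) * ?u x", OF nab])
  moreover have "germ_eq f p (\<lambda>x. f x * ?R x + ((of_rat \<alpha> - of_nat K) * partial i f x) * ?u x)
      (\<lambda>x. f x ^ Suc K * partial i v x)"
  proof (rule germ_eqI)
    fix x assume fx: "f x \<noteq> 0"
    show "f x * ?R x + ((of_rat \<alpha> - of_nat K) * partial i f x) * ?u x = f x ^ Suc K * partial i v x"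
    proof (cases "i \<in> I")
      case True
      then have xi: "x $ i \<noteq> 0" using fx by (simp add: f_nonzero_iff)
      have "mon (?e(i := ?e i - 1)) x = f x ^ K / x $ i"
        using mon_lower[OF True xi, of ?e] by (simp add: f_power_eq_mon[OF fx])
      then show ?thesis
        using True xi by (simp add: partial_f[OF fx] f_power_eq_mon[OF fx, symmetric]) (simp add: field_simps)
    next
      case False
      then have "a i = 0" by (simp add: I_def)
      then show ?thesis using False by (simp add: partial_f[OF fx] f_power_eq_mon[OF fx, symmetric])
    qed
  qed
  ultimately have "germ_eq f p ?w (\<lambda>x. f x ^ Suc K * partial i v x)" by (rule germ_eq_trans)
  moreover have "?w \<in> S"
    by (intro D_closedD(2)[OF S] D_closedD(3)[OF S] D_closedD(4)[OF S] u holo_germ_f holo_germ_mult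
        holo_germ_const holo_germ_partial)
  ultimately show ?thesis using D_closedD(5)[OF S] by blast
qed

lemma D_closed_foldr_partial:
  assumes S: "D_closed p S" and h: "holo_germ p h" "h \<in> S"
  shows "holo_germ p (foldr partial ks h) \<and> (\<exists>K. (\<lambda>x. f x ^ K * foldr partial ks h x) \<in> S)"
proof (induction ks)
  case Nil
  have "(\<lambda>x. f x ^ 0 * foldr partial [] h x) \<in> S" using h(2) by simp
  then show ?case using h(1) by (auto simp del: power_0)
next
  case (Cons i ks)
  then obtain K where K: "holo_germ p (foldr partial ks h)" "(\<lambda>x. f x ^ K * foldr partial ks h x) \<in> S" by blast
  have "(\<lambda>x. f x ^ Suc K * foldr partial (i # ks) h x) \<in> S"
    using D_closed_partial[OF S K, of i] by (simp only: foldr_Cons o_apply)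
  moreover have "holo_germ p (foldr partial (i # ks) h)"
    using holo_germ_partial[OF K(1)] by (simp only: foldr_Cons o_apply)
  ultimately show ?case by blast
qed

text \<open>Exponents are lowered by derivatives. The factor e'_i - alpha a_i is nonzero, because
  e'_i >= e_i + 1 > alpha a_i as long as e'_i is above its target.\<close>

lemma D_closed_lower_mon:
  assumes S: "D_closed p S" and e: "\<And>i. i \<in> I \<Longrightarrow> \<alpha> * of_nat (a i) - 1 < of_int (e i)"
    and "mon e' \<in> S" "\<And>i. i \<in> I \<Longrightarrow> e i \<le> e' i"
  shows "mon e \<in> S"
  using assms(3,4)
proof (induction "\<Sum>i\<in>I. nat (e' i - e i)" arbitrary: e' rule: less_induct)
  case less
  show ?case
  proof (cases "\<exists>i\<in>I. e i < e' i")
    case False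
    then have "mon e = mon e'" using less.prems(2) by (intro ext mon_cong) force
    then show ?thesis using less.prems(1) by simp
  next
    case True
    then obtain i where i: "i \<in> I" "e i < e' i" by blast
    let ?e = "e'(i := e' i - 1)"
    define c where "c = of_int (e' i) - of_rat \<alpha> * (of_nat (a i) :: complex)"
    have "\<alpha> * of_nat (a i) < of_int (e i + 1)" using e[OF i(1)] by simp
    also have "\<dots> \<le> of_int (e' i)" using i(2) by (simp only: of_int_le_iff)
    finally have c: "c \<noteq> 0" unfolding c_def by (intro of_rat_integer_mult_neq) simp
    have "indep i (\<lambda>_. 1)" by (simp add: indep_def)
    from nabla_indep[OF holo_germ_const this i(1), of p e']
    have "germ_eq f p (nabla f \<alpha> i (mon e')) (\<lambda>x. c * mon ?e x)" by (simp add: c_def)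
    from D_closedD(5)[OF S D_closedD(4)[OF S less.prems(1)] this] have "(\<lambda>x. c * mon ?e x) \<in> S" .
    from D_closedD(3)[OF S this holo_germ_const, of "1 / c"] have "mon ?e \<in> S" using c by simp
    moreover have "(\<Sum>k\<in>I. nat (?e k - e k)) < (\<Sum>k\<in>I. nat (e' k - e k))"
      using i by (intro sum_strict_mono_ex1) auto
    moreover have "e k \<le> ?e k" if "k \<in> I" for k using less.prems(2)[OF that] i(2) by auto
    ultimately show ?thesis by (intro less.hyps[of ?e])
  qed
qed

text \<open>
  A D-submodule with a nonzero holomorphic section h contains f^K times some iterated derivative of h
  that is a unit, hence a power of f, hence all monomials that can be reached without meeting an
  exponent annihilated by a derivative.
\<close>

lemma D_closed_contains_mon:
  assumes S: "D_closed p S" and h: "holo_germ p h" "h \<in> S" "\<not> germ_eq f p h (\<lambda>_. 0)"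
    and e: "\<And>i. i \<in> I \<Longrightarrow> \<alpha> * of_nat (a i) - 1 < of_int (e i)"
  shows "mon e \<in> S"
proof -
  obtain \<epsilon> where \<epsilon>: "\<epsilon> > 0" "\<And>y. y \<in> ball p \<epsilon> \<Longrightarrow> holo_at h y" using h(1) unfolding holo_germ_iff_ball by blast
  have "\<exists>ks. foldr partial ks h p \<noteq> 0"
  proof (rule ccontr)
    assume "\<nexists>ks. foldr partial ks h p \<noteq> 0"
    then have none: "foldr partial ks h p = 0" for ks by simp
    have "h x = 0" if x: "x \<in> ball p \<epsilon>" for x
      using holo_zero_if_partials_zero[where h=h, OF \<epsilon>(2) none x] .
    then have "germ_eq f p h (\<lambda>_. 0)"
      unfolding germ_eq_def eventually_nhds_metric using \<epsilon>(1) by (auto simp: dist_commute)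
    then show False using h(3) by contradiction
  qed
  then obtain ks where ks: "foldr partial ks h p \<noteq> 0" by blast
  define v where "v = foldr partial ks h"
  obtain K where v: "holo_germ p v" "(\<lambda>x. f x ^ K * v x) \<in> S"
    using D_closed_foldr_partial[OF S h(1,2), of ks] unfolding v_def by blast
  have "v p \<noteq> 0" using ks by (simp add: v_def)
  \<comment> \<open>So large that every exponent of f^M is at least e_i, whence x^e is reached from
    f^M by lowering.\<close>
  define M where "M = K + nat (\<Sum>i\<in>UNIV. \<bar>e i\<bar>)"
  have "(\<lambda>x. (f x ^ (M - K) * inverse (v x)) * (f x ^ K * v x)) \<in> S"
    by (intro D_closedD(3)[OF S] v holo_germ_mult holo_germ_power holo_germ_f holo_germ_inverse \<open>v p \<noteq> 0\<close>)
  moreover have "germ_eq f p (\<lambda>x. (f x ^ (M - K) * inverse (v x)) * (f x ^ K * v x)) (mon (\<lambda>i. int M * int (a i)))"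
    unfolding germ_eq_def
    using isCont_eventually_nonzero[OF holo_germ_isCont[OF v(1)] \<open>v p \<noteq> 0\<close>]
  proof (rule eventually_mono, intro impI)
    fix x assume x: "v x \<noteq> 0" "f x \<noteq> 0"
    have "f x ^ (M - K) * f x ^ K = f x ^ M" by (simp add: M_def power_add)
    then show "(f x ^ (M - K) * inverse (v x)) * (f x ^ K * v x) = mon (\<lambda>i. int M * int (a i)) x"
      using x(1) f_power_eq_mon[OF x(2), of M] by (simp add: mult_ac)
  qed
  ultimately have M: "mon (\<lambda>i. int M * int (a i)) \<in> S" by (rule D_closedD(5)[OF S])
  show ?thesis
  proof (rule D_closed_lower_mon[OF S _ M])
    fix i assume i: "i \<in> I"
    then show "\<alpha> * of_nat (a i) - 1 < of_int (e i)" by (rule e)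
    have "e i \<le> \<bar>e i\<bar>" by simp
    also have "\<dots> \<le> (\<Sum>i\<in>UNIV. \<bar>e i\<bar>)" by (rule member_le_sum) auto
    also have "\<dots> \<le> int M" by (simp add: M_def sum_nonneg)
    also have "\<dots> \<le> int M * int (a i)" using i by (simp add: I_iff mult_le_cancel_left1)
    finally show "e i \<le> int M * int (a i)" .
  qed
qed

text \<open>If all generators vanished near p, the module would be zero at nearby points off the
  divisor, where it is everything. A nonzero generator becomes holomorphic after multiplication by a
  power of f.\<close>

lemma fin_gen_nonzero:
  assumes fg: "locally_fin_gen f (D_ops f \<alpha>) W" and mero: "\<And>p. W p \<subseteq> mero_module f p"
    and cl: "\<And>p. D_closed p (W p)" and off: "\<And>q. f q \<noteq> 0 \<Longrightarrow> W q = mero_module f q"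
  shows "\<exists>h\<in>W p. holo_germ p h \<and> \<not> germ_eq f p h (\<lambda>_. 0)"
proof -
  obtain G where G: "finite G" "\<forall>\<^sub>F q in nhds p. W q = span_by (germ_eq f q) (D_ops f \<alpha> q) G"
    using fg unfolding locally_fin_gen_def by blast
  have "\<exists>g\<in>G. \<not> germ_eq f p g (\<lambda>_. 0)"
  proof (rule ccontr)
    assume "\<not> ?thesis"
    then have "\<forall>\<^sub>F q in nhds p. \<forall>g\<in>G. germ_eq f q g (\<lambda>_. 0)"
      using G(1) by (intro eventually_ball_finite) (auto intro: germ_eq_eventually)
    from exists_off[OF eventually_conj[OF this G(2)]] obtain q where q: "f q \<noteq> 0"
      "\<forall>g\<in>G. germ_eq f q g (\<lambda>_. 0)" "W q = span_by (germ_eq f q) (D_ops f \<alpha> q) G" by blast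
    have zs: "Wt \<alpha> (-1) q = zero_stalk f q" by (simp add: Wt_neg)
    have "span_by (germ_eq f q) (D_ops f \<alpha> q) G \<subseteq> Wt \<alpha> (-1) q"
      by (rule Wt_span) (use q(2) in \<open>simp add: zs zero_stalk_def subset_iff\<close>)
    moreover have "mon (\<lambda>_. 0) \<in> mero_module f q" unfolding mero_eq by (rule Msp_mon) simp
    ultimately have "germ_eq f q (mon (\<lambda>_. 0)) (\<lambda>_. 0)" using off[OF q(1)] q(3) zs by (auto simp: zero_stalk_def)
    from eventually_nhds_x_imp_x[OF germ_eq_off[OF this q(1)]] show False by simp
  qed
  then obtain g where g: "g \<in> G" "\<not> germ_eq f p g (\<lambda>_. 0)" by blast
  have "g \<in> span_by (germ_eq f p) (D_ops f \<alpha> p) G" using g(1) by (rule span_by.base)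
  then have gW: "g \<in> W p" using eventually_nhds_x_imp_x[OF G(2)] by simp
  then obtain h N where h: "holo_germ p h" "germ_eq f p g (\<lambda>x. h x / f x ^ N)"
    using mero unfolding mero_module_def by blast
  have "germ_eq f p (\<lambda>x. f x ^ N * g x) (\<lambda>x. f x ^ N * (h x / f x ^ N))"
    by (rule germ_eq_lift1[where F="\<lambda>x y. f x ^ N * y", OF h(2)])
  moreover have "germ_eq f p (\<lambda>x. f x ^ N * (h x / f x ^ N)) h" by (rule germ_eqI) simp
  ultimately have "germ_eq f p (\<lambda>x. f x ^ N * g x) h" by (rule germ_eq_trans)
  moreover have "(\<lambda>x. f x ^ N * g x) \<in> W p"
    by (intro D_closedD(3)[OF cl gW] holo_germ_power holo_germ_f)
  ultimately have "h \<in> W p" by (rule D_closedD(5)[OF cl, rotated])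
  moreover have "\<not> germ_eq f p h (\<lambda>_. 0)"
  proof
    assume "germ_eq f p h (\<lambda>_. 0)"
    from germ_eq_lift1[where F="\<lambda>x y. y / f x ^ N", OF this]
    have "germ_eq f p (\<lambda>x. h x / f x ^ N) (\<lambda>_. 0)" by simp
    with germ_eq_trans[OF h(2) this] g(2) show False by blast
  qed
  ultimately show ?thesis using h(1) by blast
qed

lemma W_graph_span:
  assumes W: "D_closed p (W k p)" and G: "G \<subseteq> W_graph f W k p"
    and u: "u \<in> span_by (germ_eq f p) (V0_ops f \<alpha> p) G"
  shows "u \<in> W_graph f W k p"
  using u G
proof (rule span_by_least)
  note cl = D_closedD[OF W]
  show "0 \<in> W_graph f W k p"
    using graph_zero cl(1) by (simp add: W_graph_def zero_fun_def)
  show "u + v \<in> W_graph f W k p" if "u \<in> W_graph f W k p" "v \<in> W_graph f W k p" for u v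
    using that graph_add cl(2) by (simp add: W_graph_def plus_fun_def)
  show "v \<in> W_graph f W k p" if "u \<in> W_graph f W k p" "germ_eq f p u v" for u v
    using that(1) graph_cong[OF _ that(2)] cl(5)[OF _ germ_eq_comp[OF that(2)]] by (simp add: W_graph_def)
  have scale: "(\<lambda>x j. h x * u x j) \<in> W_graph f W k p" if "u \<in> W_graph f W k p" "holo_germ p h" for u h
    using that graph_holo_mult cl(3) by (simp add: W_graph_def)
  have dt: "dt_act u \<in> W_graph f W k p" if "u \<in> W_graph f W k p" for u
  proof -
    have "(\<lambda>x. dt_act u x j) \<in> W k p" for j
      using that cl(1) by (cases "j = 0") (simp_all add: W_graph_def dt_act_def)
    then show ?thesis using that graph_dt by (simp add: W_graph_def)
  qed
  have t: "t_act f u \<in> W_graph f W k p" if "u \<in> W_graph f W k p" for u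
  proof -
    have "(\<lambda>x. f x * u x j + (- of_nat (Suc j)) * u x (Suc j)) \<in> W k p" for j
      using that by (intro cl(2,3) holo_germ_f holo_germ_const) (auto simp: W_graph_def)
    moreover have "(\<lambda>x. f x * u x j + (- of_nat (Suc j)) * u x (Suc j)) = (\<lambda>x. t_act f u x j)" for j
      by (simp add: t_act_def fun_eq_iff del: of_nat_Suc)
    ultimately show ?thesis using that graph_t by (simp add: W_graph_def)
  qed
  have dx: "dx_act f \<alpha> i u \<in> W_graph f W k p" if "u \<in> W_graph f W k p" for u i
  proof -
    have "(\<lambda>x. nabla f \<alpha> i (\<lambda>y. u y j) x + (- partial i f x) * dt_act u x j) \<in> W k p" for j
      using that dt[OF that] by (intro cl(2,3,4) holo_germ_minus holo_germ_partial holo_germ_f) (auto simp: W_graph_def)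
    then show ?thesis using that graph_dx by (simp add: W_graph_def dx_act_eq)
  qed
  show "T u \<in> W_graph f W k p" if "T \<in> V0_ops f \<alpha> p" "u \<in> W_graph f W k p" for T u
    using that(1) scale[OF that(2)] dx[OF that(2)] t[OF that(2)] dt[OF t[OF that(2)]]
    by (auto simp: V0_ops_def)
qed

lemma W_graph_incl:
  assumes "D_closed p (W k p)" "m \<in> W k p" "m \<in> mero_module f p"
  shows "graph_incl m \<in> W_graph f W k p"
proof -
  have "(\<lambda>x. graph_incl m x j) \<in> W k p" for j
    using D_closedD(1)[OF assms(1)] assms(2) by (cases "j = 0") (simp_all add: graph_incl_def)
  then show ?thesis using graph_incl_graph[OF assms(3)] by (simp add: W_graph_def)
qed

lemma W_graph_sact:
  assumes "D_closed p (W k p)" "m \<in> W k p" "m \<in> mero_module f p"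
  shows "sact q (graph_incl m) \<in> W_graph f W k p"
proof (rule W_graph_span[where G="{graph_incl m}" and W=W and k=k])
  show "{graph_incl m} \<subseteq> W_graph f W k p" using W_graph_incl[of p W k, OF assms] by simp
  show "sact q (graph_incl m) \<in> span_by (germ_eq f p) (V0_ops f \<alpha> p) {graph_incl m}"
    by (intro span_sact span_by.base) simp
qed (rule assms(1))

text \<open>For gamma > 0 the exponents of the generator of V^gamma exceed alpha a_i - 1, so
  \<open>D_closed_contains_mon\<close> applies. At gamma = 0 the strict inequality fails exactly at
  the critical indices.\<close>

lemma Vf_W_graph_pos:
  assumes W: "D_closed p (W k p)" and h: "h \<in> W k p" "holo_germ p h" "\<not> germ_eq f p h (\<lambda>_. 0)"
    and \<gamma>: "0 < \<gamma>"
  shows "Vf \<gamma> p \<subseteq> W_graph f W k p"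
proof
  fix u assume u: "u \<in> Vf \<gamma> p"
  have "mon (bexp \<gamma>) \<in> W k p"
  proof (rule D_closed_contains_mon[OF W h(2,1,3)])
    fix i assume i: "i \<in> I"
    have "\<alpha> * of_nat (a i) < (\<gamma> + \<alpha>) * of_nat (a i)" using \<gamma> i by (simp add: I_iff)
    also have "\<dots> \<le> of_int \<lceil>(\<gamma> + \<alpha>) * of_nat (a i)\<rceil>" by (rule le_of_int_ceiling)
    finally show "\<alpha> * of_nat (a i) - 1 < of_int (bexp \<gamma> i)" by (simp add: bexp_def)
  qed
  moreover have "mon (bexp \<gamma>) \<in> mero_module f p" unfolding mero_eq by (rule Msp_mon) simp
  ultimately have "{graph_incl (mon (bexp \<gamma>))} \<subseteq> W_graph f W k p"
    using W_graph_incl[of p W k, OF W] by simp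
  then show "u \<in> W_graph f W k p"
    using W_graph_span[of p W k, OF W] u unfolding Vf_generated by blast
qed

lemma relative_monodromy_subset: "relative_monodromy_filtration N A B L R \<Longrightarrow> R k \<subseteq> A"
  using relative_monodromy_facts(1) by blast

context
  fixes W assumes W: "is_weight_filtration f \<alpha> W"
begin

lemma W_conjuncts:
  "\<forall>k. subsheaf_module f (mero_module f) (D_ops f \<alpha>) (W k) \<and> locally_fin_gen f (D_ops f \<alpha>) (W k)"
  "\<forall>k l p. k \<le> l \<longrightarrow> W k p \<subseteq> W l p" "\<exists>k l. W k = zero_stalk f \<and> W l = mero_module f"
  "\<forall>k p. f p \<noteq> 0 \<longrightarrow> W k p = (if k \<ge> int CARD('n) then mero_module f p else zero_stalk f p)"
  "\<forall>p. \<exists>R.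
        (\<forall>\<gamma>. 0 < \<gamma> \<and> \<gamma> \<le> 1 \<longrightarrow>
           relative_monodromy_filtration (dtt_minus f \<gamma>) (Vf \<gamma> p) (Va \<gamma> p) (\<lambda>k. W_gr_V f \<alpha> W p \<gamma> (k + 1)) (R \<gamma>)) \<and>
        relative_monodromy_filtration (dtt_minus f 0) (Vf 0 p) (Va 0 p) (W_gr_V f \<alpha> W p 0) (R 0) \<and>
        (\<forall>k. \<forall>u \<in> Vf 0 p. u \<in> R 0 k \<longleftrightarrow> t_act f u \<in> R 1 (k - 2))"
  by (insert W, unfold is_weight_filtration_def V_filtration_eq V_above_eq, (elim conjE, assumption)+)

lemma W_fin_gen: "locally_fin_gen f (D_ops f \<alpha>) (W k)"
  using W_conjuncts(1)[THEN spec, of k] by (rule conjunct2)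

lemma W_subsheaf:
  "W k p \<subseteq> mero_module f p \<and> span_by (germ_eq f p) (D_ops f \<alpha> p) (W k p) \<subseteq> W k p \<and>
    (\<forall>u\<in>W k p. \<forall>\<^sub>F q in nhds p. u \<in> W k q)"
  using W_conjuncts(1)[THEN spec, of k, THEN conjunct1] unfolding subsheaf_module_def by (rule spec)

lemma W_off: "f p \<noteq> 0 \<Longrightarrow> W k p = (if k \<ge> int CARD('n) then mero_module f p else zero_stalk f p)"
  using W_conjuncts(4)[rule_format, of p k] by simp

lemma W_mero: "W k p \<subseteq> mero_module f p"
  using W_subsheaf by (rule conjunct1)

lemma W_closed: "D_closed p (W k p)"
  unfolding D_closed_def by (rule W_subsheaf[THEN conjunct2, THEN conjunct1])

lemma W_eventually: "u \<in> W k p \<Longrightarrow> \<forall>\<^sub>F q in nhds p. u \<in> W k q"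
  by (rule W_subsheaf[THEN conjunct2, THEN conjunct2, THEN bspec])

text \<open>A section that vanishes at the points off the divisor is already a zero germ, since
  \<open>germ_eq\<close> compares values only there.\<close>

lemma W_low: "k < int CARD('n) \<Longrightarrow> W k = zero_stalk f"
proof (intro ext equalityI subsetI)
  fix p u assume k: "k < int CARD('n)" and u: "u \<in> W k p"
  have "\<forall>\<^sub>F q in nhds p. f q \<noteq> 0 \<longrightarrow> u q = 0"
    using W_eventually[OF u]
  proof (rule eventually_mono, intro impI)
    fix q assume "u \<in> W k q" and q: "f q \<noteq> 0"
    then have "u \<in> zero_stalk f q" using W_off[OF q, of k] k by simp
    then have "germ_eq f q u (\<lambda>_. 0)" by (simp add: zero_stalk_def)
    from eventually_nhds_x_imp_x[OF germ_eq_off[OF this q]] show "u q = 0" .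
  qed
  then show "u \<in> zero_stalk f p" by (simp add: zero_stalk_def germ_eq_def)
next
  fix p and u :: "complex ^ 'n \<Rightarrow> complex" assume "u \<in> zero_stalk f p"
  then have "germ_eq f p (\<lambda>_. 0) u" by (simp add: zero_stalk_def germ_eq_sym)
  from D_closedD(5)[OF W_closed D_closedD(1)[OF W_closed] this] show "u \<in> W k p" .
qed

lemma Vf_pos_W:
  assumes "int CARD('n) \<le> k" "0 < \<gamma>"
  shows "Vf \<gamma> p \<subseteq> W_graph f W k p"
proof -
  have "\<exists>h\<in>W k p. holo_germ p h \<and> \<not> germ_eq f p h (\<lambda>_. 0)"
    by (rule fin_gen_nonzero[OF W_fin_gen W_mero W_closed]) (use W_off assms(1) in simp)
  then obtain h where "h \<in> W k p" "holo_germ p h" "\<not> germ_eq f p h (\<lambda>_. 0)" by blast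
  from Vf_W_graph_pos[of p W k, OF W_closed this assms(2)] show ?thesis .
qed

lemma W_gr_V_0_full: "\<exists>k. W_gr_V f \<alpha> W p 0 k = Vf 0 p"
proof -
  obtain l where "W l = mero_module f" using W_conjuncts(3) by blast
  then have "Vf 0 p \<subseteq> W_graph f W l p" using Vf_graph graph_mero by (auto simp: W_graph_def)
  from W_gr_V_full[OF this] show ?thesis by blast
qed

lemma W_graph_mono: "k \<le> l \<Longrightarrow> W_graph f W k p \<subseteq> W_graph f W l p"
  using W_conjuncts(2)[rule_format, of k l p] by (auto simp: W_graph_def)

lemma W_graph_diff: "u \<in> W_graph f W k p \<Longrightarrow> v \<in> W_graph f W k p \<Longrightarrow> u - v \<in> W_graph f W k p"
proof -
  assume *: "u \<in> W_graph f W k p" "v \<in> W_graph f W k p"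
  have "(\<lambda>x. u x j + (- 1) * v x j) \<in> W k p" for j
    using * by (intro D_closedD(2,3)[OF W_closed] holo_germ_const) (auto simp: W_graph_def)
  moreover have "(\<lambda>x j. u x j + (- 1) * v x j) \<in> graph_module f p"
    using * by (intro graph_add graph_scale) (auto simp: W_graph_def)
  ultimately show ?thesis by (simp add: W_graph_def fun_diff_def)
qed

text \<open>On Gr_V^1 the induced filtration has its only jump at CARD('n), as V^1 lies in the graph
  module of that step and W is zero below; this determines R 1. The var condition carries it over to
  R 0, and \<open>Lf_unique\<close> recovers the filtration on Gr_V^0.\<close>

lemma W_gr_V_0: "W_gr_V f \<alpha> W p 0 = grL p"
proof -
  obtain R where R1: "\<And>\<gamma>. 0 < \<gamma> \<and> \<gamma> \<le> 1 \<Longrightarrow>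
      relative_monodromy_filtration (dtt_minus f \<gamma>) (Vf \<gamma> p) (Va \<gamma> p) (\<lambda>k. W_gr_V f \<alpha> W p \<gamma> (k + 1)) (R \<gamma>)"
    and R0: "relative_monodromy_filtration (dtt_minus f 0) (Vf 0 p) (Va 0 p) (W_gr_V f \<alpha> W p 0) (R 0)"
    and var: "\<And>k u. u \<in> Vf 0 p \<Longrightarrow> u \<in> R 0 k \<longleftrightarrow> t_act f u \<in> R 1 (k - 2)"
    by (rule exE[OF W_conjuncts(5)[THEN spec, of p]], elim conjE) blast
  have "(\<lambda>k. W_gr_V f \<alpha> W p 1 (k + 1)) = (\<lambda>k. if int CARD('n) - 1 \<le> k then Vf 1 p else Va 1 p)"
  proof
    fix k show "W_gr_V f \<alpha> W p 1 (k + 1) = (if int CARD('n) - 1 \<le> k then Vf 1 p else Va 1 p)"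
      using W_gr_V_full[OF Vf_pos_W[of "k + 1" 1 p]] W_gr_V_zero[of W "k + 1" p 1] W_low[of "k + 1"] by simp
  qed
  with R1[of 1] have "R 1 = grR p 1 (int CARD('n) - 1)"
    unfolding grR_def by (intro jet_module.Rf_unique[OF jet_module_Vf]) simp
  have "R 0 = grR p 0 (int CARD('n) + 1)"
  proof (rule ext, intro equalityI subsetI)
    fix k u assume u: "u \<in> R 0 k"
    then have "u \<in> Vf 0 p" using relative_monodromy_subset[OF R0] by blast
    then show "u \<in> grR p 0 (int CARD('n) + 1) k"
      using u var[of u k] grR_var[of u p k] \<open>R 1 = _\<close> by simp
  next
    fix k u assume u: "u \<in> grR p 0 (int CARD('n) + 1) k"
    then have "u \<in> Vf 0 p" by (simp add: grR_iff)
    then show "u \<in> R 0 k"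
      using u var[of u k] grR_var[of u p k] \<open>R 1 = _\<close> by simp
  qed
  then have R: "relative_monodromy_filtration (dtt_minus f 0) (Vf 0 p) (Va 0 p) (W_gr_V f \<alpha> W p 0)
      (jet_module.Rf (Vf 0 p) (jet 0) (\<lambda>k. Wt (0 + \<alpha>) k p) (int CARD('n) + 1))"
    using R0 by (simp add: grR_def)
  have split: "x \<in> W_gr_V f \<alpha> W p 0 k \<longleftrightarrow> (\<exists>u v. x = u + v \<and> u \<in> Vf 0 p \<inter> W_graph f W k p \<and> v \<in> Va 0 p)" for x k
    unfolding W_gr_V_eq by blast
  obtain ktop where ktop: "W_gr_V f \<alpha> W p 0 ktop = Vf 0 p" using W_gr_V_0_full by blast
  have W0: "0 \<in> W_graph f W k p" for k
    using graph_zero D_closedD(1)[OF W_closed] by (simp add: W_graph_def zero_fun_def)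
  have V0: "0 \<in> Vf 0 p" using Vf_zero by (simp add: zero_fun_def)
  show ?thesis
    unfolding grL_def
  proof (rule jet_module.Lf_unique[OF jet_module_Vf R, where ktop=ktop])
    fix k l :: int
    show "\<forall>u\<in>W_gr_V f \<alpha> W p 0 k. \<forall>v\<in>W_gr_V f \<alpha> W p 0 k. u - v \<in> W_gr_V f \<alpha> W p 0 k"
    proof (intro ballI)
      fix x y assume "x \<in> W_gr_V f \<alpha> W p 0 k" "y \<in> W_gr_V f \<alpha> W p 0 k"
      then obtain u v u' v' where *: "x = u + v" "u \<in> Vf 0 p" "u \<in> W_graph f W k p" "v \<in> Va 0 p"
        "y = u' + v'" "u' \<in> Vf 0 p" "u' \<in> W_graph f W k p" "v' \<in> Va 0 p" unfolding split by blast
      have "u - u' \<in> Vf 0 p \<inter> W_graph f W k p"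
        using Vf_diff[OF *(2,6)] W_graph_diff[OF *(3,7)] by (simp add: fun_diff_def)
      moreover have "v - v' \<in> Va 0 p" by (rule jet_module.B_diff[OF jet_module_Vf *(4,8)])
      moreover have "x - y = (u - u') + (v - v')" using *(1,5) by simp
      ultimately show "x - y \<in> W_gr_V f \<alpha> W p 0 k" unfolding split by blast
    qed
    show "W_gr_V f \<alpha> W p 0 k \<subseteq> W_gr_V f \<alpha> W p 0 l" if "k \<le> l"
      using W_graph_mono[OF that, of p] unfolding W_gr_V_eq by blast
    show "W_gr_V f \<alpha> W p 0 k = Va 0 p" if "k < int CARD('n)"
      by (rule W_gr_V_zero) (simp add: W_low[OF that])
    show "Va 0 p \<subseteq> W_gr_V f \<alpha> W p 0 k"
    proof
      fix x assume "x \<in> Va 0 p"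
      then show "x \<in> W_gr_V f \<alpha> W p 0 k"
        unfolding split using W0 V0 by (intro exI[of _ 0] exI[of _ x]) simp
    qed
    show "W_gr_V f \<alpha> W p 0 k \<subseteq> Vf 0 p"
      unfolding W_gr_V_eq using Vf_add_Va by blast
    show "W_gr_V f \<alpha> W p 0 ktop = Vf 0 p" by (rule ktop)
    fix u assume u: "u \<in> Vf 0 p" and k: "int CARD('n) \<le> k"
    \<comment> \<open>The image of (d/dt) t lies in W k: t maps V^0 into V^1, which is contained
      there, and d/dt only moves components.\<close>
    have "t_act f u \<in> W_graph f W k p"
      using Vf_pos_W[OF k, of 1 p] Vf_t[OF u] by auto
    moreover have "(\<lambda>x. dt_act v x j) \<in> W k p" if "v \<in> W_graph f W k p" for v j
      using that D_closedD(1)[OF W_closed, of k p] by (cases "j = 0") (simp_all add: W_graph_def dt_act_def)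
    ultimately have "dtt_minus f 0 u \<in> W_graph f W k p"
      using graph_dtt_minus[OF Vf_graph[OF u], of 0] by (simp add: W_graph_def flip: dt_t_eq_dtt_minus)
    then show "dtt_minus f 0 u \<in> W_gr_V f \<alpha> W p 0 k"
      unfolding split using Vf_dtt_minus[OF u] Va_zero by (intro exI[of _ "dtt_minus f 0 u"] exI[of _ 0]) simp
  qed
qed

text \<open>A generator of \<open>weight\<close> defines a class on Gr_V^0 that W shares. It
  therefore agrees with a section of W up to an element of V^gamma with gamma > 0, which W contains
  too.\<close>

lemma weight_le_W: "weight k p \<subseteq> W k p"
proof (cases "int CARD('n) \<le> k")
  case False
  then show ?thesis using weight_neg[of k] W_low[of k] by simp
next
  case True
  have "gens (k - int CARD('n)) \<subseteq> W k p"
  proof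
    fix g assume "g \<in> gens (k - int CARD('n))"
    then obtain J where J: "g = mon (gen_exp J)" "J \<subseteq> critical" "int (card J) \<le> k - int CARD('n)"
      by (auto simp: gens_def)
    have V: "graph_incl g \<in> Vf 0 p" unfolding J(1) by (rule incl_mon_Vf) (rule bexp_le_gen_exp)
    have "jet 0 0 (graph_incl g) = g" by (simp add: fun_eq_iff jet_incl)
    moreover have "g \<in> Wt \<alpha> (k - int CARD('n)) p"
      unfolding J(1) Wt_def using J(2,3) by (intro Msp_mon) (simp add: poles_gen_exp)
    ultimately have "graph_incl g \<in> grL p k" using V True by (simp add: grL_eq)
    then obtain u v where uv: "graph_incl g = u + v" "u \<in> W_graph f W k p" "v \<in> Va 0 p"
      unfolding W_gr_V_0[symmetric] W_gr_V_eq by blast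
    obtain \<gamma> where "0 < \<gamma>" "v \<in> Vf \<gamma> p" using uv(3) unfolding Va_eq_Union by auto
    then have "v \<in> W_graph f W k p" using Vf_pos_W[OF True] by blast
    then have "(\<lambda>x. u x 0 + v x 0) \<in> W k p"
      using uv(2) by (intro D_closedD(2)[OF W_closed]) (auto simp: W_graph_def)
    moreover have "(\<lambda>x. u x 0 + v x 0) = g"
    proof
      fix x show "u x 0 + v x 0 = g x"
        using fun_cong[OF fun_cong[OF uv(1), of x], of 0] by (simp add: graph_incl_def)
    qed
    ultimately show "g \<in> W k p" by simp
  qed
  then have gens: "gens (k - int CARD('n)) \<subseteq> W k p" .
  have "u \<in> W k p" if u: "u \<in> span_by (germ_eq f p) (D_ops f \<alpha> p) (gens (k - int CARD('n)))" for u
  proof -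
    have "u \<in> span_by (germ_eq f p) (D_ops f \<alpha> p) (W k p)"
      using u gens by (induction rule: span_by.induct) (blast intro: span_by.intros)+
    then show "u \<in> W k p" using W_closed[of p k] unfolding D_closed_def by blast
  qed
  then show ?thesis unfolding weight_def Wt_generated by blast
qed

text \<open>Interpolation multiplies \<open>graph_incl m\<close> by a polynomial in s so that the
  result lies in V^0 and has value m at s = 0. It stays in the graph module of W k, and the known
  filtration on Gr_V^0 bounds the poles of m.\<close>

lemma W_le_weight: "W k p \<subseteq> weight k p"
proof (cases "int CARD('n) \<le> k")
  case False
  then show ?thesis using weight_neg[of k] W_low[of k] by simp
next
  case True
  show ?thesis
  proof
    fix m assume m: "m \<in> W k p"
    then have mm: "m \<in> mero_module f p" using W_mero by blast
    obtain q where q: "\<And>j. j < CARD('n) \<Longrightarrow> sact (q * [:of_rat 0, 1:] ^ j) (graph_incl m) \<in> Vf 0 p"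
      "\<And>i j. j < CARD('n) \<Longrightarrow> i < CARD('n) \<Longrightarrow>
         germ_eq f p (jet 0 i (sact (q * [:of_rat 0, 1:] ^ j) (graph_incl m))) (\<lambda>x. if i = j then m x else 0)"
      using interpolation[of "CARD('n)" "\<lambda>_. m" p 0, OF mm order_refl] by blast
    define u where "u = sact (q * [:of_rat 0, 1:] ^ 0) (graph_incl m)"
    have u: "u \<in> Vf 0 p" "germ_eq f p (jet 0 0 u) m" using q(1)[of 0] q(2)[of 0 0] by (simp_all add: u_def)
    have "u \<in> W_graph f W k p" unfolding u_def by (rule W_graph_sact[of p W k, OF W_closed m mm])
    then have "u \<in> W_gr_V f \<alpha> W p 0 k"
      unfolding W_gr_V_eq using u(1) Va_zero by (intro CollectI exI[of _ u] exI[of _ 0]) simp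
    then have "jet 0 0 u \<in> Wt \<alpha> (k - int CARD('n)) p" unfolding W_gr_V_0 grL_eq using True by simp
    then show "m \<in> weight k p" unfolding weight_def by (rule Wt_cong) (rule u(2))
  qed
qed

lemma W_eq_weight: "W = weight"
  using W_le_weight weight_le_W by (intro ext equalityI)

end

lemma weight_filtration_eq: "weight_filtration f \<alpha> = weight"
  unfolding weight_filtration_def
  by (rule the_equality) (fact is_weight_filtration_weight, rule W_eq_weight)

section \<open>The Hodge filtration\<close>

definition dt_degree_le :: "int \<Rightarrow> 'n graph_section \<Rightarrow> complex ^ 'n \<Rightarrow> bool" where
  "dt_degree_le K u p \<longleftrightarrow> (\<forall>\<^sub>F x in nhds p. f x \<noteq> 0 \<longrightarrow> (\<forall>j. K < int j \<longrightarrow> u x j = 0))"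

text \<open>Off the divisor every component is holomorphic, so only the vanishing of the components
  with index above K remains of the condition.\<close>

lemma hodge_U_graph_iff:
  assumes u: "u \<in> graph_module f p"
  shows "(\<forall>\<^sub>F q in nhds p. f q \<noteq> 0 \<longrightarrow> u \<in> hodge_U_graph f K q) \<longleftrightarrow> dt_degree_le K u p"
proof
  assume "\<forall>\<^sub>F q in nhds p. f q \<noteq> 0 \<longrightarrow> u \<in> hodge_U_graph f K q"
  then show "dt_degree_le K u p"
    unfolding dt_degree_le_def
  proof (rule eventually_mono, intro impI allI)
    fix q j assume *: "f q \<noteq> 0 \<longrightarrow> u \<in> hodge_U_graph f K q" "f q \<noteq> 0" "K < int j"
    then have "(\<lambda>x. u x j) \<in> hodge_U f (K - int j) q" by (simp add: hodge_U_graph_def)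
    then have "germ_eq f q (\<lambda>x. u x j) (\<lambda>_. 0)" using *(3) by (simp add: hodge_U_def zero_stalk_def)
    from eventually_nhds_x_imp_x[OF germ_eq_off[OF this *(2)]] show "u q j = 0" .
  qed
next
  assume "dt_degree_le K u p"
  then have K: "\<forall>\<^sub>F q in nhds p. \<forall>\<^sub>F x in nhds q. f x \<noteq> 0 \<longrightarrow> (\<forall>j. K < int j \<longrightarrow> u x j = 0)"
    unfolding dt_degree_le_def by (simp add: eventually_eventually)
  obtain d where "\<forall>\<^sub>F x in nhds p. f x \<noteq> 0 \<longrightarrow> (\<forall>k>d. u x k = 0)" using graph_bound[OF u] by blast
  then have d: "\<forall>\<^sub>F q in nhds p. \<forall>\<^sub>F x in nhds q. f x \<noteq> 0 \<longrightarrow> (\<forall>k>d. u x k = 0)"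
    by (simp add: eventually_eventually)
  have "\<forall>\<^sub>F q in nhds p. \<forall>j\<in>{..d}. f q \<noteq> 0 \<longrightarrow> holo_germ q (\<lambda>x. u x j)"
    using graph_mero[OF u] unfolding mero_eq by (intro eventually_ball_finite ballI Msp_holo_at) auto
  then show "\<forall>\<^sub>F q in nhds p. f q \<noteq> 0 \<longrightarrow> u \<in> hodge_U_graph f K q"
    using K d
  proof (eventually_elim, intro impI)
    fix q assume q: "\<forall>j\<in>{..d}. f q \<noteq> 0 \<longrightarrow> holo_germ q (\<lambda>x. u x j)"
      "\<forall>\<^sub>F x in nhds q. f x \<noteq> 0 \<longrightarrow> (\<forall>j. K < int j \<longrightarrow> u x j = 0)"
      "\<forall>\<^sub>F x in nhds q. f x \<noteq> 0 \<longrightarrow> (\<forall>k>d. u x k = 0)" "f q \<noteq> 0"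
    have "(\<lambda>x. u x j) \<in> hodge_U f (K - int j) q" for j
    proof (cases "K < int j")
      case True
      have "germ_eq f q (\<lambda>x. u x j) (\<lambda>_. 0)"
        unfolding germ_eq_def using q(2) by (rule eventually_mono) (use True in simp)
      then show ?thesis using True by (simp add: hodge_U_def zero_stalk_def)
    next
      case False
      have "holo_germ q (\<lambda>x. u x j)"
      proof (cases "j \<le> d")
        case True
        then show ?thesis using q(1,4) by simp
      next
        case False
        have "\<forall>\<^sub>F x in nhds q. 0 = u x j"
          using q(3) eventually_f_nonzero[OF q(4)] by (rule eventually_elim2) (use False in simp)
        then show ?thesis by (rule holo_germ_cong_ev) simp
      qed
      then show ?thesis using False by (simp add: hodge_U_def)
    qed
    then show "u \<in> hodge_U_graph f K q" by (simp add: hodge_U_graph_def)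
  qed
qed

definition hodge_gens :: "int \<Rightarrow> complex ^ 'n \<Rightarrow> 'n graph_section set" where
  "hodge_gens k p = (\<Union>i::nat. (dt_act ^^ i) ` {u \<in> Vf 0 p. dt_degree_le (k - int i) u p})"

lemma hodge_graph_eq: "hodge_graph f \<alpha> k p = span_by (germ_eq f p) {} (hodge_gens k p)"
proof -
  have "{u \<in> Vf 0 p. \<forall>\<^sub>F q in nhds p. f q \<noteq> 0 \<longrightarrow> u \<in> hodge_U_graph f (k - int i) q} =
      {u \<in> Vf 0 p. dt_degree_le (k - int i) u p}" for i :: nat
    using hodge_U_graph_iff[OF Vf_graph] by blast
  then show ?thesis unfolding hodge_graph_def V_filtration_eq hodge_gens_def by simp
qed

lemma hodge_gens_graph: "u \<in> hodge_gens k p \<Longrightarrow> u \<in> graph_module f p"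
proof -
  assume "u \<in> hodge_gens k p"
  then obtain i v where "u = (dt_act ^^ i) v" "v \<in> graph_module f p" unfolding hodge_gens_def using Vf_graph by blast
  moreover have "(dt_act ^^ i) v \<in> graph_module f p" if "v \<in> graph_module f p" for v
    using that by (induction i) (auto intro: graph_dt)
  ultimately show ?thesis by blast
qed

lemma graph_plus: "u \<in> graph_module f p \<Longrightarrow> v \<in> graph_module f p \<Longrightarrow> u + v \<in> graph_module f p"
  using graph_add[of u p v] by (simp add: plus_fun_def)

lemma hodge_graph_graph: "u \<in> hodge_graph f \<alpha> k p \<Longrightarrow> u \<in> graph_module f p"
  unfolding hodge_graph_eq
  by (erule span_by_least)
     (use hodge_gens_graph graph_zero graph_plus graph_cong in \<open>auto simp: zero_fun_def\<close>)

text \<open>The value at s = 0 is blind to every term with a positive power of d/dt, so the summands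
  with i = 0 account for it alone.\<close>

lemma hodge_graph_top:
  assumes "w \<in> hodge_graph f \<alpha> (int k) p"
  shows "\<exists>v\<in>Vf 0 p. dt_degree_le (int k) v p \<and> germ_eq f p (jet 0 0 w) (jet 0 0 v)"
  using assms unfolding hodge_graph_eq
proof (induction rule: span_by.induct)
  case zero
  have "dt_degree_le (int k) 0 p" by (simp add: dt_degree_le_def)
  moreover have "0 \<in> Vf 0 p" using Vf_zero by (simp add: zero_fun_def)
  ultimately show ?case by (intro bexI[of _ 0] conjI germ_eq_refl)
next
  case (base w)
  then obtain i u where u: "w = (dt_act ^^ i) u" "u \<in> Vf 0 p" "dt_degree_le (int k - int i) u p"
    unfolding hodge_gens_def by blast
  show ?case
  proof (cases i)
    case 0
    then show ?thesis using u by (intro bexI[of _ u]) simp_all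
  next
    case (Suc i')
    have g: "(dt_act ^^ i') u \<in> graph_module f p" using Vf_graph[OF u(2)] by (induction i') (auto intro: graph_dt)
    have "germ_eq f p (jet 0 0 w) (\<lambda>_. 0)"
      unfolding germ_eq_def u(1) Suc using graph_supp_fin[OF g] by (rule eventually_mono) (simp add: jet_dt_zero)
    moreover have "dt_degree_le (int k) 0 p" by (simp add: dt_degree_le_def)
    moreover have "0 \<in> Vf 0 p" using Vf_zero by (simp add: zero_fun_def)
    moreover have "jet 0 0 0 = (\<lambda>_. 0)" by (simp add: fun_eq_iff jet_def Pol_def)
    ultimately show ?thesis by (intro bexI[of _ 0] conjI) (simp_all only:)
  qed
next
  case (add w w')
  then obtain v v' where v: "v \<in> Vf 0 p" "dt_degree_le (int k) v p" "germ_eq f p (jet 0 0 w) (jet 0 0 v)"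
    "v' \<in> Vf 0 p" "dt_degree_le (int k) v' p" "germ_eq f p (jet 0 0 w') (jet 0 0 v')" by blast
  have g: "w \<in> graph_module f p" "w' \<in> graph_module f p"
    using add(1,2) hodge_graph_graph unfolding hodge_graph_eq by blast+
  have "germ_eq f p (jet 0 0 (w + w')) (\<lambda>x. jet 0 0 w x + jet 0 0 w' x)"
    using jet_add_germ[OF g] by (simp add: plus_fun_def)
  moreover have "germ_eq f p (\<lambda>x. jet 0 0 w x + jet 0 0 w' x) (\<lambda>x. jet 0 0 v x + jet 0 0 v' x)"
    by (rule germ_eq_lift2[where F="\<lambda>_. (+)", OF v(3,6)])
  moreover have "germ_eq f p (\<lambda>x. jet 0 0 v x + jet 0 0 v' x) (jet 0 0 (v + v'))"
    using germ_eq_sym[OF jet_add_germ[OF Vf_graph[OF v(1)] Vf_graph[OF v(4)]]] by (simp add: plus_fun_def)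
  ultimately have "germ_eq f p (jet 0 0 (w + w')) (jet 0 0 (v + v'))"
    using germ_eq_trans by blast
  moreover have "dt_degree_le (int k) (v + v') p"
    using v(2,5) unfolding dt_degree_le_def by (rule eventually_elim2) simp
  moreover have "v + v' \<in> Vf 0 p" using Vf_add[OF v(1,4)] by (simp add: plus_fun_def)
  ultimately show ?case by blast
next
  case (act T u)
  then show ?case by simp
next
  case (cong w w')
  then obtain v where v: "v \<in> Vf 0 p" "dt_degree_le (int k) v p" "germ_eq f p (jet 0 0 w) (jet 0 0 v)" by blast
  have "germ_eq f p (jet 0 0 w') (jet 0 0 v)"
    by (rule germ_eq_trans'[OF jet_cong[OF cong(2)] v(3)])
  with v(1,2) show ?case by blast
qed

lemma degree_gpoly: "degree (gpoly B e) = card (below B e)"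
  unfolding gpoly_def by (subst degree_prod_sum_eq) auto

lemma card_below: "card (below B e) = (\<Sum>i\<in>I. nat (B i - e i))"
  unfolding below_def by (subst card_SigmaI) auto

text \<open>The sum is the degree of \<open>gpoly (bexp 0) e\<close> and also the number of
  derivatives that \<open>lowering\<close> uses to reach e; the first gives one inclusion, the
  second the other.\<close>

definition hodge_exps :: "nat \<Rightarrow> int \<Rightarrow> ('n \<Rightarrow> int) set" where
  "hodge_exps k l = {e. (\<Sum>i\<in>I. nat (bexp 0 i - e i)) \<le> k \<and> int (poles \<alpha> e) \<le> l}"

text \<open>The section \<open>graph_incl m\<close> itself need not lie in V^0;
  \<open>hodge_graph_top\<close> replaces it by some v in V^0 of degree at most k with value m at s
  = 0. A coefficient polynomial of v that is divisible by a polynomial of degree above k is zero,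
  and with it its constant term. The bound \<open>bexp 0\<close> plus 1 lets the same expansion show
  the pole counts.\<close>

lemma hodge_weight_decomp:
  assumes m: "graph_incl m \<in> hodge_graph f \<alpha> (int k) p" and W: "m \<in> Wt \<alpha> l p"
  shows "\<exists>S H. finite S \<and> S \<subseteq> clipped (\<lambda>i. bexp 0 i + 1) p \<inter> hodge_exps k l \<and>
    (\<forall>e\<in>S. H e \<in> coeffs_at (\<lambda>i. bexp 0 i + 1) p e) \<and> germ_eq f p m (\<lambda>x. \<Sum>e\<in>S. H e x * mon e x)"
proof -
  let ?B = "\<lambda>i. bexp 0 i + 1"
  obtain v where v: "v \<in> Vf 0 p" "dt_degree_le (int k) v p" "germ_eq f p (jet 0 0 (graph_incl m)) (jet 0 0 v)"
    using hodge_graph_top[OF m] by blast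
  have "jet 0 0 (graph_incl m) = m" by (simp add: fun_eq_iff jet_incl)
  with v(3) have mv: "germ_eq f p m (jet 0 0 v)" by simp
  have Pol: "\<forall>\<^sub>F x in nhds p. f x \<noteq> 0 \<longrightarrow> Pol v x = (\<Sum>j\<le>k. smult (jet 0 j v x) (monom 1 j))"
    using v(2) unfolding dt_degree_le_def
  proof (rule eventually_mono, intro impI)
    fix x assume "f x \<noteq> 0 \<longrightarrow> (\<forall>j. int k < int j \<longrightarrow> v x j = 0)" "f x \<noteq> 0"
    then have "v x j = 0" if "k < j" for j using that by simp
    then have "Pol v x = (\<Sum>j\<le>k. smult (v x j / f x ^ j) (rising j))" by (rule Pol_bound)
    moreover have "degree (smult (v x j / f x ^ j) (rising j)) \<le> k" if "j \<le> k" for j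
      using degree_rising_le[of j] that by simp
    ultimately have "degree (Pol v x) \<le> k"
      using degree_sum_le[of "{..k}" "\<lambda>j. smult (v x j / f x ^ j) (rising j)" k] by (simp only: finite_atMost atMost_iff)
    from poly_as_sum_of_monoms'[OF this] show "Pol v x = (\<Sum>j\<le>k. smult (jet 0 j v x) (monom 1 j))"
      by (simp add: jet_0 smult_monom)
  qed
  obtain S H where S: "finite S" "S \<subseteq> clipped ?B p" and H: "\<And>j. j \<in> {..k} \<Longrightarrow> decomp ?B p S (H j) (jet 0 j v)"
    using decomp_exists_family[of "{..k}" "\<lambda>j. jet 0 j v" p ?B] jet_mero[OF Vf_graph[OF v(1)]] by blast
  have dec: "decomp ?B p S (H 0) m" using decomp_cong[OF H[of 0] germ_eq_sym[OF mv]] by simp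
  have low: "germ_eq f p (H 0 e) (\<lambda>_. 0)" if "e \<notin> hodge_exps k l" for e
  proof (cases "int (poles \<alpha> e) \<le> l")
    case True
    then have deg: "k < degree (gpoly (bexp 0) e)"
      using that by (simp add: hodge_exps_def degree_gpoly card_below)
    have "\<forall>\<^sub>F x in nhds p. f x \<noteq> 0 \<longrightarrow> gpoly (bexp 0) e dvd (\<Sum>j\<le>k. smult (H j e x) (monom 1 j))"
      by (rule Vf_coeffs_dvd[OF v(1) _ Pol S H]) simp_all
    then show ?thesis
      unfolding germ_eq_def
    proof (rule eventually_mono, intro impI)
      fix x assume "f x \<noteq> 0 \<longrightarrow> gpoly (bexp 0) e dvd (\<Sum>j\<le>k. smult (H j e x) (monom 1 j))" "f x \<noteq> 0"
      then have dvd: "gpoly (bexp 0) e dvd (\<Sum>j\<le>k. smult (H j e x) (monom 1 j))" by blast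
      have "degree (\<Sum>j\<le>k. smult (H j e x) (monom 1 j)) \<le> k"
        by (rule degree_sum_le) (auto intro: order_trans[OF degree_smult_le] order_trans[OF degree_monom_le])
      then have "(\<Sum>j\<le>k. smult (H j e x) (monom 1 j)) = 0"
        using dvd_imp_degree_le[OF dvd] deg by (meson not_le order_trans)
      then have "coeff (\<Sum>j\<le>k. smult (H j e x) (monom 1 j)) 0 = 0" by simp
      then show "H 0 e x = 0" by (simp add: coeff_sum if_distrib sum.delta cong: if_cong)
    qed
  next
    case False
    show ?thesis
      using W False unfolding Wt_def
      by (intro decomp_support[OF dec _ clip_closed_bexp]) auto
  qed
  let ?S = "S \<inter> hodge_exps k l"
  have "\<forall>\<^sub>F x in nhds p. \<forall>e\<in>S - ?S. f x \<noteq> 0 \<longrightarrow> H 0 e x = 0"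
    using low S(1) by (intro eventually_ball_finite) (auto simp: germ_eq_def)
  then have "germ_eq f p (\<lambda>x. \<Sum>e\<in>S. H 0 e x * mon e x) (\<lambda>x. \<Sum>e\<in>?S. H 0 e x * mon e x)"
    unfolding germ_eq_def
    by (rule eventually_mono) (use S(1) in \<open>auto intro!: sum.mono_neutral_right\<close>)
  moreover have "germ_eq f p m (\<lambda>x. \<Sum>e\<in>S. H 0 e x * mon e x)" using dec by (simp add: decomp_def)
  ultimately have "germ_eq f p m (\<lambda>x. \<Sum>e\<in>?S. H 0 e x * mon e x)" using germ_eq_trans by blast
  moreover have "\<forall>e\<in>?S. H 0 e \<in> coeffs_at ?B p e" using dec by (simp add: decomp_def)
  ultimately show ?thesis using S by (intro exI[of _ ?S] exI[of _ "H 0"]) blast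
qed

section \<open>Stability of the Hodge filtration under differentiation\<close>

lemma nabla_add:
  assumes "u \<in> mero_module f p" "v \<in> mero_module f p"
  shows "germ_eq f p (nabla f \<alpha> i (\<lambda>x. u x + v x)) (\<lambda>x. nabla f \<alpha> i u x + nabla f \<alpha> i v x)"
proof -
  have "\<forall>\<^sub>F q in nhds p. f q \<noteq> 0 \<longrightarrow> holo_at u q" "\<forall>\<^sub>F q in nhds p. f q \<noteq> 0 \<longrightarrow> holo_at v q"
    using assms Msp_holo_at' unfolding mero_eq by blast+
  then show ?thesis
    unfolding germ_eq_def by eventually_elim (simp add: nabla_def holo_at_add algebra_simps add_divide_distrib)
qed

lemma dx_add:
  assumes "u \<in> graph_module f p" "v \<in> graph_module f p"
  shows "germ_eq f p (dx_act f \<alpha> i (u + v)) (dx_act f \<alpha> i u + dx_act f \<alpha> i v)"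
proof (rule graph_eqI_comp)
  show "dx_act f \<alpha> i (u + v) \<in> graph_module f p" by (intro graph_dx graph_plus assms)
  show "dx_act f \<alpha> i u + dx_act f \<alpha> i v \<in> graph_module f p" by (intro graph_plus graph_dx assms)
  fix j
  let ?r = "\<lambda>x. - partial i f x * dt_act (u + v) x j"
  have "germ_eq f p (\<lambda>x. nabla f \<alpha> i (\<lambda>y. u y j + v y j) x + ?r x)
      (\<lambda>x. (nabla f \<alpha> i (\<lambda>y. u y j) x + nabla f \<alpha> i (\<lambda>y. v y j) x) + ?r x)"
    by (rule germ_eq_lift1[where F="\<lambda>x y. y + ?r x", OF nabla_add[OF graph_mero[OF assms(1)] graph_mero[OF assms(2)]]])
  moreover have "dx_act f \<alpha> i (u + v) x j = nabla f \<alpha> i (\<lambda>y. u y j + v y j) x + ?r x" for x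
    by (simp add: dx_act_def)
  moreover have "(dx_act f \<alpha> i u + dx_act f \<alpha> i v) x j =
      (nabla f \<alpha> i (\<lambda>y. u y j) x + nabla f \<alpha> i (\<lambda>y. v y j) x) + ?r x" for x
    by (cases j) (simp_all add: dx_act_def dt_act_def algebra_simps)
  ultimately show "germ_eq f p (\<lambda>x. dx_act f \<alpha> i (u + v) x j) (\<lambda>x. (dx_act f \<alpha> i u + dx_act f \<alpha> i v) x j)"
    by (simp only:)
qed

lemma dx_cong:
  assumes "u \<in> graph_module f p" "germ_eq f p u v"
  shows "germ_eq f p (dx_act f \<alpha> i u) (dx_act f \<alpha> i v)"
proof (rule graph_eqI_comp)
  show "dx_act f \<alpha> i u \<in> graph_module f p" "dx_act f \<alpha> i v \<in> graph_module f p"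
    using graph_dx assms(1) graph_cong[OF assms] by blast+
  fix j
  have "germ_eq f p (\<lambda>x. nabla f \<alpha> i (\<lambda>y. u y j) x + - partial i f x * dt_act u x j)
      (\<lambda>x. nabla f \<alpha> i (\<lambda>y. v y j) x + - partial i f x * dt_act v x j)"
    by (rule germ_eq_lift2[where F="\<lambda>x y z. y + - partial i f x * z",
        OF germ_eq_nabla[OF germ_eq_comp[OF assms(2)]] germ_eq_comp[OF dt_cong[OF assms(2)]]])
  then show "germ_eq f p (\<lambda>x. dx_act f \<alpha> i u x j) (\<lambda>x. dx_act f \<alpha> i v x j)"
    by (simp add: dx_act_eq)
qed

lemma dx_dt_commute: "dx_act f \<alpha> i (dt_act u) = dt_act (dx_act f \<alpha> i u)"
proof (intro ext)
  fix x j show "dx_act f \<alpha> i (dt_act u) x j = dt_act (dx_act f \<alpha> i u) x j"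
    by (cases j) (simp_all add: dx_act_def dt_act_def nabla_zero)
qed

lemma dx_dt_power: "dx_act f \<alpha> i ((dt_act ^^ k) u) = (dt_act ^^ k) (dx_act f \<alpha> i u)"
  by (induction k) (simp_all add: dx_dt_commute)

lemma scale_dt_power:
  fixes u :: "'n graph_section"
  shows "(\<lambda>x j. h x * (dt_act ^^ k) u x j) = (dt_act ^^ k) (\<lambda>x j. h x * u x j)"
proof (induction k)
  case (Suc k)
  have "(\<lambda>x j. h x * dt_act v x j) = dt_act (\<lambda>x j. h x * v x j)" for v :: "'n graph_section"
    by (simp add: dt_act_def fun_eq_iff)
  then show ?case by (simp add: Suc[symmetric])
qed simp

lemma dt_degree_le_mono: "K \<le> L \<Longrightarrow> dt_degree_le K u p \<Longrightarrow> dt_degree_le L u p"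
  unfolding dt_degree_le_def by (erule eventually_mono) auto

lemma dt_degree_le_dx:
  assumes "u \<in> graph_module f p" "dt_degree_le K u p"
  shows "dt_degree_le (K + 1) (dx_act f \<alpha> i u) p"
proof -
  obtain d where d: "\<forall>\<^sub>F x in nhds p. f x \<noteq> 0 \<longrightarrow> (\<forall>k>d. dx_act f \<alpha> i u x k = 0)"
    using graph_bound[OF graph_dx[OF assms(1)]] by blast
  have "\<forall>\<^sub>F x in nhds p. \<forall>j\<in>{j \<in> {..d}. K + 1 < int j}. f x \<noteq> 0 \<longrightarrow> dx_act f \<alpha> i u x j = 0"
  proof (intro eventually_ball_finite ballI)
    fix j assume j: "j \<in> {j \<in> {..d}. K + 1 < int j}"
    have "germ_eq f p (\<lambda>x. u x j) (\<lambda>_. 0)"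
      using assms(2) unfolding dt_degree_le_def germ_eq_def by (rule eventually_mono) (use j in simp)
    from germ_eq_nabla[OF this, of i] have "germ_eq f p (nabla f \<alpha> i (\<lambda>x. u x j)) (\<lambda>_. 0)"
      by (simp add: germ_eq_def nabla_zero)
    then show "\<forall>\<^sub>F x in nhds p. f x \<noteq> 0 \<longrightarrow> dx_act f \<alpha> i u x j = 0"
      using assms(2) unfolding germ_eq_def dt_degree_le_def
    proof (rule eventually_elim2, intro impI)
      fix x assume *: "f x \<noteq> 0 \<longrightarrow> nabla f \<alpha> i (\<lambda>x. u x j) x = 0" "f x \<noteq> 0 \<longrightarrow> (\<forall>j. K < int j \<longrightarrow> u x j = 0)" "f x \<noteq> 0"
      have "dt_act u x j = 0" using * j by (auto simp: dt_act_def)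
      then show "dx_act f \<alpha> i u x j = 0" using * by (simp add: dx_act_def)
    qed
  qed simp
  then show ?thesis
    unfolding dt_degree_le_def using d
  proof (rule eventually_elim2, intro impI allI)
    fix x j assume "\<forall>j\<in>{j \<in> {..d}. K + 1 < int j}. f x \<noteq> 0 \<longrightarrow> dx_act f \<alpha> i u x j = 0"
      "f x \<noteq> 0 \<longrightarrow> (\<forall>k>d. dx_act f \<alpha> i u x k = 0)" "f x \<noteq> 0" "K + 1 < int j"
    then show "dx_act f \<alpha> i u x j = 0" by (cases "j \<le> d") auto
  qed
qed

text \<open>Derivatives are additive only up to \<open>germ_eq\<close>, and only on graph sections;
  the induction over the span is done once for all operators of this kind.\<close>

lemma hodge_graph_map:
  assumes w: "w \<in> hodge_graph f \<alpha> k p"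
    and gens: "\<And>u. u \<in> hodge_gens k p \<Longrightarrow> T u \<in> hodge_graph f \<alpha> k' p" and zero: "T 0 = 0"
    and add: "\<And>u v. u \<in> graph_module f p \<Longrightarrow> v \<in> graph_module f p \<Longrightarrow> germ_eq f p (T (u + v)) (T u + T v)"
    and cong: "\<And>u v. u \<in> graph_module f p \<Longrightarrow> germ_eq f p u v \<Longrightarrow> germ_eq f p (T u) (T v)"
  shows "T w \<in> hodge_graph f \<alpha> k' p"
  using w unfolding hodge_graph_eq
proof (induction rule: span_by.induct)
  case zero
  show ?case unfolding assms(3) by (rule span_by.zero)
next
  case (base g)
  then show ?case using gens unfolding hodge_graph_eq by blast
next
  case (add u v)
  have "u \<in> graph_module f p" "v \<in> graph_module f p"
    using add(1,2) hodge_graph_graph unfolding hodge_graph_eq by blast+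
  from span_by.cong[where E="germ_eq f p", OF span_by.add[OF add(3,4)] germ_eq_sym[OF assms(4)[OF this]]]
  show ?case .
next
  case (act S u)
  then show ?case by simp
next
  case (cong u v)
  have "u \<in> graph_module f p" using cong(1) hodge_graph_graph unfolding hodge_graph_eq by blast
  from span_by.cong[where E="germ_eq f p", OF cong(3) assms(5)[OF this cong(2)]] show ?case .
qed

lemma hodge_graph_base: "u \<in> Vf 0 p \<Longrightarrow> dt_degree_le (k - int i) u p \<Longrightarrow> (dt_act ^^ i) u \<in> hodge_graph f \<alpha> k p"
  unfolding hodge_graph_eq hodge_gens_def by (intro span_by.base) blast

lemma hodge_graph_dx: "w \<in> hodge_graph f \<alpha> k p \<Longrightarrow> dx_act f \<alpha> i w \<in> hodge_graph f \<alpha> (k + 1) p"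
proof (erule hodge_graph_map)
  fix u assume "u \<in> hodge_gens k p"
  then obtain j v where v: "u = (dt_act ^^ j) v" "v \<in> Vf 0 p" "dt_degree_le (k - int j) v p"
    unfolding hodge_gens_def by blast
  have "dt_degree_le (k + 1 - int j) (dx_act f \<alpha> i v) p"
    using dt_degree_le_dx[OF Vf_graph[OF v(2)] v(3), of i] by (simp add: algebra_simps)
  from hodge_graph_base[OF Vf_dx[OF v(2)] this] show "dx_act f \<alpha> i u \<in> hodge_graph f \<alpha> (k + 1) p"
    by (simp add: v(1) dx_dt_power)
next
  show "dx_act f \<alpha> i 0 = 0" by (simp add: fun_eq_iff dx_act_def dt_act_def nabla_zero)
qed (fact dx_add, fact dx_cong)

lemma hodge_graph_dt: "w \<in> hodge_graph f \<alpha> k p \<Longrightarrow> dt_act w \<in> hodge_graph f \<alpha> (k + 1) p"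
proof (erule hodge_graph_map)
  fix u assume "u \<in> hodge_gens k p"
  then obtain j v where v: "u = (dt_act ^^ j) v" "v \<in> Vf 0 p" "dt_degree_le (k - int j) v p"
    unfolding hodge_gens_def by blast
  have "dt_degree_le (k + 1 - int (Suc j)) v p" using v(3) by (simp add: algebra_simps)
  from hodge_graph_base[OF v(2) this] show "dt_act u \<in> hodge_graph f \<alpha> (k + 1) p" by (simp add: v(1))
next
  show "dt_act 0 = 0" by (simp add: fun_eq_iff dt_act_def)
  fix u v :: "'n graph_section"
  have "dt_act (u + v) = dt_act u + dt_act v" by (simp add: fun_eq_iff dt_act_def)
  then show "germ_eq f p (dt_act (u + v)) (dt_act u + dt_act v)" by simp
qed (rule dt_cong)

lemma hodge_graph_scale:
  assumes h: "holo_germ p h" and w: "w \<in> hodge_graph f \<alpha> k p"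
  shows "(\<lambda>x j. h x * w x j) \<in> hodge_graph f \<alpha> k p"
  using w
proof (rule hodge_graph_map)
  fix u assume "u \<in> hodge_gens k p"
  then obtain j v where v: "u = (dt_act ^^ j) v" "v \<in> Vf 0 p" "dt_degree_le (k - int j) v p"
    unfolding hodge_gens_def by blast
  have "dt_degree_le (k - int j) (\<lambda>x j. h x * v x j) p"
    using v(3) unfolding dt_degree_le_def by (rule eventually_mono) simp
  from hodge_graph_base[OF Vf_holo_mult[OF v(2) h] this] show "(\<lambda>x j. h x * u x j) \<in> hodge_graph f \<alpha> k p"
    by (simp add: v(1) scale_dt_power)
next
  show "(\<lambda>x j. h x * (0 :: 'n graph_section) x j) = 0" by (simp add: fun_eq_iff)
  fix u v :: "'n graph_section"
  have "(\<lambda>x j. h x * (u + v) x j) = (\<lambda>x j. h x * u x j) + (\<lambda>x j. h x * v x j)"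
    by (simp add: fun_eq_iff distrib_left)
  then show "germ_eq f p (\<lambda>x j. h x * (u + v) x j) ((\<lambda>x j. h x * u x j) + (\<lambda>x j. h x * v x j))" by simp
  assume "germ_eq f p u v"
  then show "germ_eq f p (\<lambda>x j. h x * u x j) (\<lambda>x j. h x * v x j)"
    by (rule germ_eq_lift1[where F="\<lambda>x y. \<lambda>j. h x * y j"])
qed

lemma hodge_graph_mono: "k \<le> k' \<Longrightarrow> hodge_graph f \<alpha> k p \<subseteq> hodge_graph f \<alpha> k' p"
proof
  fix w assume k: "k \<le> k'" and w: "w \<in> hodge_graph f \<alpha> k p"
  show "w \<in> hodge_graph f \<alpha> k' p"
    using w
  proof (rule hodge_graph_map[where T="\<lambda>u. u"])
    fix u assume "u \<in> hodge_gens k p"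
    then obtain j v where v: "u = (dt_act ^^ j) v" "v \<in> Vf 0 p" "dt_degree_le (k - int j) v p"
      unfolding hodge_gens_def by blast
    from hodge_graph_base[OF v(2) dt_degree_le_mono[OF _ v(3), of "k' - int j"]] k
    show "u \<in> hodge_graph f \<alpha> k' p" by (simp add: v(1))
  qed simp_all
qed

lemma hodge_filtration_iff: "m \<in> hodge_filtration f \<alpha> k p \<longleftrightarrow> m \<in> mero_module f p \<and> graph_incl m \<in> hodge_graph f \<alpha> k p"
  by (simp add: hodge_filtration_def)

text \<open>With delta for the graph inclusion, (nabla m) delta = d/dx_i (m delta) + (d f / d x_i)
  d/dt (m delta), and both terms raise the Hodge degree by one.\<close>

lemma hodge_filtration_nabla:
  assumes "m \<in> hodge_filtration f \<alpha> k p"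
  shows "nabla f \<alpha> i m \<in> hodge_filtration f \<alpha> (k + 1) p"
proof -
  have m: "m \<in> mero_module f p" "graph_incl m \<in> hodge_graph f \<alpha> k p"
    using assms by (auto simp: hodge_filtration_iff)
  have "graph_incl (nabla f \<alpha> i m) = dx_act f \<alpha> i (graph_incl m) + (\<lambda>x j. partial i f x * dt_act (graph_incl m) x j)"
  proof (intro ext)
    fix x j
    show "graph_incl (nabla f \<alpha> i m) x j = (dx_act f \<alpha> i (graph_incl m) + (\<lambda>x j. partial i f x * dt_act (graph_incl m) x j)) x j"
      by (cases "j = 0") (simp_all add: graph_incl_def dx_act_def dt_act_def nabla_zero)
  qed
  moreover have "dx_act f \<alpha> i (graph_incl m) + (\<lambda>x j. partial i f x * dt_act (graph_incl m) x j) \<in> hodge_graph f \<alpha> (k + 1) p"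
    using hodge_graph_dx[OF m(2)] hodge_graph_scale[OF holo_germ_partial[OF holo_germ_f] hodge_graph_dt[OF m(2)]]
    unfolding hodge_graph_eq by (rule span_by.add)
  ultimately show ?thesis using mero_nabla[OF m(1)] by (simp add: hodge_filtration_iff)
qed

lemma hodge_filtration_foldr:
  "m \<in> hodge_filtration f \<alpha> 0 p \<Longrightarrow> foldr (nabla f \<alpha>) ks m \<in> hodge_filtration f \<alpha> (int (length ks)) p"
proof (induction ks)
  case (Cons i ks)
  from hodge_filtration_nabla[OF Cons.IH[OF Cons.prems], of i] show ?case by (simp add: add.commute)
qed simp

lemma hodge_filtration_mono: "k \<le> k' \<Longrightarrow> hodge_filtration f \<alpha> k p \<subseteq> hodge_filtration f \<alpha> k' p"
  using hodge_graph_mono[of k k' p] by (auto simp: hodge_filtration_iff)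

lemma hodge_filtration_span:
  assumes "G \<subseteq> hodge_filtration f \<alpha> k p"
  shows "span_by (germ_eq f p) (O_ops p) G \<subseteq> hodge_filtration f \<alpha> k p"
proof
  fix m assume "m \<in> span_by (germ_eq f p) (O_ops p) G"
  then show "m \<in> hodge_filtration f \<alpha> k p"
    using assms
  proof (rule span_by_least)
    have "graph_incl (\<lambda>_. 0) = (0 :: 'n graph_section)" by (simp add: fun_eq_iff graph_incl_def)
    then show "0 \<in> hodge_filtration f \<alpha> k p"
      using mero_zero span_by.zero[of "germ_eq f p" "{}" "hodge_gens k p"]
      by (simp add: hodge_filtration_iff hodge_graph_eq zero_fun_def)
  next
    fix u v assume *: "u \<in> hodge_filtration f \<alpha> k p" "v \<in> hodge_filtration f \<alpha> k p"
    have "graph_incl (u + v) = graph_incl u + graph_incl v" by (simp add: fun_eq_iff graph_incl_def)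
    moreover have "graph_incl u + graph_incl v \<in> hodge_graph f \<alpha> k p"
      using * unfolding hodge_filtration_iff hodge_graph_eq by (intro span_by.add) auto
    moreover have "u + v \<in> mero_module f p"
      using * mero_add[of u p v] by (simp add: hodge_filtration_iff plus_fun_def)
    ultimately show "u + v \<in> hodge_filtration f \<alpha> k p" by (simp add: hodge_filtration_iff)
  next
    fix T u assume "T \<in> O_ops p" and u: "u \<in> hodge_filtration f \<alpha> k p"
    then obtain h where h: "T = (\<lambda>u x. h x * u x)" "holo_germ p h" by (auto simp: O_ops_def)
    have "graph_incl (\<lambda>x. h x * u x) = (\<lambda>x j. h x * graph_incl u x j)" by (simp add: fun_eq_iff graph_incl_def)
    then show "T u \<in> hodge_filtration f \<alpha> k p"
      using u hodge_graph_scale[OF h(2)] mero_mult_holo[OF _ h(2)] by (simp add: hodge_filtration_iff h(1))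
  next
    fix u v assume u: "u \<in> hodge_filtration f \<alpha> k p" and uv: "germ_eq f p u v"
    have eq: "germ_eq f p (graph_incl u) (graph_incl v)"
      using uv unfolding germ_eq_def by (rule eventually_mono) (simp add: graph_incl_def fun_eq_iff)
    have "graph_incl u \<in> span_by (germ_eq f p) {} (hodge_gens k p)"
      using u by (simp add: hodge_filtration_iff hodge_graph_eq)
    from span_by.cong[where E="germ_eq f p", OF this eq] show "v \<in> hodge_filtration f \<alpha> k p"
      using u mero_cong[OF _ uv] by (simp add: hodge_filtration_iff hodge_graph_eq)
  qed
qed

section \<open>The Hodge filtration on the weight steps\<close>

lemma hodge_weight_eq: "hodge_weight f \<alpha> k (int CARD('n) + l) p = hodge_filtration f \<alpha> k p \<inter> Wt \<alpha> l p"
  by (simp add: hodge_weight_def weight_filtration_eq weight_def)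

lemma hodge_exps_0: "hodge_exps 0 l = top_exps l"
  by (auto simp: hodge_exps_def top_exps_def)

lemma hodge_weight_subset:
  assumes "m \<in> hodge_weight f \<alpha> (int k) (int CARD('n) + l) p"
  shows "m \<in> Msp (hodge_exps k l) p"
proof -
  have "graph_incl m \<in> hodge_graph f \<alpha> (int k) p" "m \<in> Wt \<alpha> l p"
    using assms by (simp_all add: hodge_weight_eq hodge_filtration_iff)
  from hodge_weight_decomp[OF this] obtain S H where S: "finite S" "S \<subseteq> clipped (\<lambda>i. bexp 0 i + 1) p \<inter> hodge_exps k l"
    "\<forall>e\<in>S. H e \<in> coeffs_at (\<lambda>i. bexp 0 i + 1) p e" and m: "germ_eq f p m (\<lambda>x. \<Sum>e\<in>S. H e x * mon e x)"
    by (elim exE conjE) (rule that)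
  have "\<forall>e\<in>S. holo_germ p (H e)" "S \<subseteq> hodge_exps k l" using S(2,3) by (auto simp: coeffs_at_def)
  with S(1) m show ?thesis
    unfolding Msp_def by (intro CollectI exI[of _ S] exI[of _ H] conjI)
qed

lemma hodge_filtration_mon:
  assumes "e \<in> top_exps l"
  shows "mon e \<in> hodge_weight f \<alpha> 0 (int CARD('n) + l) p"
proof -
  have "graph_incl (mon e) \<in> Vf 0 p"
    using assms by (intro incl_mon_Vf) (simp add: top_exps_def)
  moreover have "dt_degree_le (0 - int 0) (graph_incl (mon e)) p"
    unfolding dt_degree_le_def by (rule always_eventually) (auto simp: graph_incl_def)
  ultimately have "graph_incl (mon e) \<in> hodge_graph f \<alpha> 0 p"
    using hodge_graph_base[of "graph_incl (mon e)" p 0 0] by simp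
  moreover have "mon e \<in> mero_module f p" unfolding mero_eq by (rule Msp_mon) simp
  moreover have "mon e \<in> Wt \<alpha> l p" using assms unfolding Wt_def by (intro Msp_mon) (simp add: top_exps_def)
  ultimately show ?thesis by (simp add: hodge_weight_eq hodge_filtration_iff)
qed

lemma hodge_weight_0: "hodge_weight f \<alpha> 0 (int CARD('n) + l) p = Msp (top_exps l) p"
proof
  show "hodge_weight f \<alpha> 0 (int CARD('n) + l) p \<subseteq> Msp (top_exps l) p"
    using hodge_weight_subset[of _ 0 l p] by (auto simp: hodge_exps_0)
  have "Msp (top_exps l) p \<subseteq> hodge_filtration f \<alpha> 0 p"
    unfolding Msp_eq_span
    by (rule hodge_filtration_span) (use hodge_filtration_mon[of _ l p] in \<open>auto simp: hodge_weight_eq\<close>)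
  moreover have "Msp (top_exps l) p \<subseteq> Wt \<alpha> l p"
    unfolding Wt_def by (rule Msp_mono) (auto simp: top_exps_def)
  ultimately show "Msp (top_exps l) p \<subseteq> hodge_weight f \<alpha> 0 (int CARD('n) + l) p"
    by (simp add: hodge_weight_eq)
qed

text \<open>Derivatives raise the Hodge degree by one and preserve the weight. Conversely,
  \<open>hodge_exps\<close> says that at most k derivatives lead to each term of the normal form
  from a term in Hodge degree 0, and by \<open>poles_max_bexp\<close> that term has the same
  weight.\<close>

lemma hodge_weight_order_act:
  "hodge_weight f \<alpha> (int k) (int CARD('n) + l) = order_act f \<alpha> k (hodge_weight f \<alpha> 0 (int CARD('n) + l))"
proof (rule ext, rule equalityI)
  fix p
  let ?w = "int CARD('n) + l"
  let ?G = "{foldr (nabla f \<alpha>) ks u |ks u. length ks \<le> k \<and> u \<in> hodge_weight f \<alpha> 0 ?w p}"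
  let ?T = "span_by (germ_eq f p) (O_ops p) ?G"
  show "order_act f \<alpha> k (hodge_weight f \<alpha> 0 ?w) p \<subseteq> hodge_weight f \<alpha> (int k) ?w p"
  proof -
    have "?T \<subseteq> hodge_filtration f \<alpha> (int k) p"
    proof (rule hodge_filtration_span, clarify)
      fix ks :: "'n list" and u assume "length ks \<le> k" "u \<in> hodge_weight f \<alpha> 0 ?w p"
      then show "foldr (nabla f \<alpha>) ks u \<in> hodge_filtration f \<alpha> (int k) p"
        using hodge_filtration_foldr[of u p ks] hodge_filtration_mono[of "int (length ks)" "int k" p]
        by (auto simp: hodge_weight_eq)
    qed
    moreover have "?T \<subseteq> Wt \<alpha> l p"
    proof
      fix m assume "m \<in> ?T"
      then show "m \<in> Wt \<alpha> l p"
      proof (rule span_by_least)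
        show "?G \<subseteq> Wt \<alpha> l p"
        proof clarify
          fix ks :: "'n list" and u assume "u \<in> hodge_weight f \<alpha> 0 ?w p"
          then have "u \<in> Wt \<alpha> l p" by (simp add: hodge_weight_eq)
          then show "foldr (nabla f \<alpha>) ks u \<in> Wt \<alpha> l p"
            by (induction ks) (auto simp: D_ops_def intro: Wt_D_ops)
        qed
        show "0 \<in> Wt \<alpha> l p" using Wt_zero by (simp add: zero_fun_def)
        show "u + v \<in> Wt \<alpha> l p" if "u \<in> Wt \<alpha> l p" "v \<in> Wt \<alpha> l p" for u v
          using Wt_add[OF that] by (simp add: plus_fun_def)
        show "T u \<in> Wt \<alpha> l p" if "T \<in> O_ops p" "u \<in> Wt \<alpha> l p" for T u
          using Wt_D_ops that O_ops_D_ops by blast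
      qed (fact Wt_cong)
    qed
    ultimately show ?thesis unfolding order_act_def hodge_weight_eq by blast
  qed
  show "hodge_weight f \<alpha> (int k) ?w p \<subseteq> order_act f \<alpha> k (hodge_weight f \<alpha> 0 ?w) p"
  proof
    fix m assume "m \<in> hodge_weight f \<alpha> (int k) ?w p"
    then have "graph_incl m \<in> hodge_graph f \<alpha> (int k) p" "m \<in> Wt \<alpha> l p"
      by (simp_all add: hodge_weight_eq hodge_filtration_iff)
    from hodge_weight_decomp[OF this] obtain S H where S: "finite S" "S \<subseteq> clipped (\<lambda>i. bexp 0 i + 1) p \<inter> hodge_exps k l"
      "\<forall>e\<in>S. H e \<in> coeffs_at (\<lambda>i. bexp 0 i + 1) p e" and m: "germ_eq f p m (\<lambda>x. \<Sum>e\<in>S. H e x * mon e x)"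
      by (elim exE conjE) (rule that)
    have "(\<lambda>x. H e x * mon e x) \<in> ?T" if e: "e \<in> S" for e
    proof -
      have eH: "e \<in> clipped (\<lambda>i. bexp 0 i + 1) p" "H e \<in> coeffs_at (\<lambda>i. bexp 0 i + 1) p e" "e \<in> hodge_exps k l"
        using S e by auto
      obtain ks c where ks: "c \<noteq> 0" "length ks = (\<Sum>i\<in>UNIV. nat (bexp 0 i - e i))"
        "germ_eq f p (foldr (nabla f \<alpha>) ks (\<lambda>x. H e x * mon (\<lambda>i. max (e i) (bexp 0 i)) x)) (\<lambda>x. c * (H e x * mon e x))"
        using lowering[OF clip_bexp[OF eH(1,2)]] by blast
      \<comment> \<open>Outside I no exponent lies below \<open>bexp 0\<close>, so no derivatives in
        those directions are used.\<close>
      have "(\<Sum>i\<in>UNIV. nat (bexp 0 i - e i)) = (\<Sum>i\<in>I. nat (bexp 0 i - e i))"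
        by (rule sum.mono_neutral_right) (use clip_bexp(2)[OF eH(1,2)] in force)+
      then have len: "length ks \<le> k" using ks(2) eH(3) by (simp add: hodge_exps_def)
      have "(\<lambda>x. H e x * mon (\<lambda>i. max (e i) (bexp 0 i)) x) \<in> hodge_weight f \<alpha> 0 ?w p"
        unfolding hodge_weight_0
        by (rule Msp_mon_mult[OF _ clip_bexp(1)[OF eH(1,2)]])
           (use eH(3) in \<open>simp add: hodge_exps_def top_exps_def poles_max_bexp\<close>)
      then have "foldr (nabla f \<alpha>) ks (\<lambda>x. H e x * mon (\<lambda>i. max (e i) (bexp 0 i)) x) \<in> ?T"
        using len by (intro span_by.base) blast
      from span_by.cong[where E="germ_eq f p", OF this ks(3)] have "(\<lambda>x. c * (H e x * mon e x)) \<in> ?T" .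
      then have "(\<lambda>x. (1 / c) * (c * (H e x * mon e x))) \<in> ?T"
        by (rule span_by.act[where T="\<lambda>u x. (1 / c) * u x", rotated])
           (auto simp: O_ops_def intro!: exI[of _ "\<lambda>_. 1 / c"])
      then show ?thesis using ks(1) by simp
    qed
    then have "(\<lambda>x. \<Sum>e\<in>S. H e x * mon e x) \<in> ?T" by (rule span_by_sum)
    from span_by.cong[where E="germ_eq f p", OF this germ_eq_sym[OF m]]
    show "m \<in> order_act f \<alpha> k (hodge_weight f \<alpha> 0 ?w) p" unfolding order_act_def .
  qed
qed

lemma mon_gen_exp:
  assumes "J \<subseteq> critical"
  shows "mon (gen_exp J) x = (\<Prod>i\<in>critical - J. (x $ i) ^ nat \<lceil>\<alpha> * of_nat (a i)\<rceil>) *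
    (\<Prod>i\<in>(I - critical) \<union> J. (x $ i) ^ nat (\<lceil>\<alpha> * of_nat (a i)\<rceil> - 1))"
proof -
  have I: "I = (critical - J) \<union> ((I - critical) \<union> J)"
    using assms by (auto simp: critical_def)
  have "mon (gen_exp J) x = (\<Prod>i\<in>critical - J. (x $ i) powi gen_exp J i) * (\<Prod>i\<in>(I - critical) \<union> J. (x $ i) powi gen_exp J i)"
    unfolding mon_def by (subst I, rule prod.union_disjoint) auto
  moreover have "(\<Prod>i\<in>critical - J. (x $ i) powi gen_exp J i) = (\<Prod>i\<in>critical - J. (x $ i) ^ nat \<lceil>\<alpha> * of_nat (a i)\<rceil>)"
  proof (rule prod.cong[OF refl])
    fix i assume i: "i \<in> critical - J"
    then have "0 \<le> bexp 0 i" by (intro bexp_0_nonneg) (simp add: critical_def)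
    then show "(x $ i) powi gen_exp J i = (x $ i) ^ nat \<lceil>\<alpha> * of_nat (a i)\<rceil>"
      using i by (simp add: gen_exp_def bexp_def power_int_def)
  qed
  moreover have "(\<Prod>i\<in>(I - critical) \<union> J. (x $ i) powi gen_exp J i) =
      (\<Prod>i\<in>(I - critical) \<union> J. (x $ i) ^ nat (\<lceil>\<alpha> * of_nat (a i)\<rceil> - 1))"
  proof (rule prod.cong[OF refl])
    fix i assume i: "i \<in> (I - critical) \<union> J"
    then have "0 \<le> bexp 0 i" using assms by (intro bexp_0_nonneg) (auto simp: critical_def)
    moreover have "gen_exp J i = bexp 0 i" using i by (auto simp: gen_exp_def)
    ultimately show "(x $ i) powi gen_exp J i = (x $ i) ^ nat (\<lceil>\<alpha> * of_nat (a i)\<rceil> - 1)"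
      by (simp add: bexp_def power_int_def)
  qed
  ultimately show ?thesis by simp
qed

lemma Wt_card_critical: "Wt \<alpha> (int (card critical)) = mero_module f"
  using poles_le_critical by (simp add: Wt_def mero_eq)

end

theorem theorem3p24:
  fixes a :: "'n::finite \<Rightarrow> nat" and \<alpha> :: rat
    and f :: "complex ^ 'n \<Rightarrow> complex" and I I\<^sub>\<alpha> :: "'n set" and m n :: nat
  assumes "\<exists>i. a i \<noteq> 0" and "\<alpha> > 0"
  defines "f \<equiv> (\<lambda>x. \<Prod>i\<in>UNIV. (x $ i) ^ a i)"
    and "n \<equiv> CARD('n)"
    and "I \<equiv> {i. a i \<noteq> 0}"
    and "I\<^sub>\<alpha> \<equiv> {i \<in> I. \<alpha> * of_nat (a i) \<in> \<int>}"
    and "m \<equiv> card I\<^sub>\<alpha>"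
  shows "weight_filtration f \<alpha> (int (n + m)) = mero_module f
    \<and> (\<forall>l\<le>m.
        (\<forall>p. hodge_weight f \<alpha> 0 (int (n + l)) p =
           span_by (germ_eq f p) (O_ops p)
             {(\<lambda>x. (\<Prod>i\<in>I\<^sub>\<alpha> - J. (x $ i) ^ nat \<lceil>\<alpha> * of_nat (a i)\<rceil>) *
                   (\<Prod>i\<in>(I - I\<^sub>\<alpha>) \<union> J. (x $ i) ^ nat (\<lceil>\<alpha> * of_nat (a i)\<rceil> - 1)))
              |J. J \<subseteq> I\<^sub>\<alpha> \<and> card J = l}) \<and>
        (\<forall>k::nat. hodge_weight f \<alpha> (int k) (int (n + l)) =
           order_act f \<alpha> k (hodge_weight f \<alpha> 0 (int (n + l)))))"
proof -
  interpret nc: normal_crossing a \<alpha>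
    by unfold_locales (use assms(1,2) in auto)
  have f: "f = nc.f" unfolding f_def by (rule ext) (simp add: nc.f_def)
  have I: "I = nc.I" unfolding I_def nc.I_def ..
  have I\<^sub>\<alpha>: "I\<^sub>\<alpha> = nc.critical" unfolding I\<^sub>\<alpha>_def nc.critical_def I ..
  have w: "int (n + l) = int CARD('n) + int l" for l by (simp add: n_def)
  have gens: "{(\<lambda>x. (\<Prod>i\<in>I\<^sub>\<alpha> - J. (x $ i) ^ nat \<lceil>\<alpha> * of_nat (a i)\<rceil>) *
        (\<Prod>i\<in>(I - I\<^sub>\<alpha>) \<union> J. (x $ i) ^ nat (\<lceil>\<alpha> * of_nat (a i)\<rceil> - 1))) |J. J \<subseteq> I\<^sub>\<alpha> \<and> card J = l}
      = {nc.mon (nc.gen_exp J) |J. J \<subseteq> nc.critical \<and> card J = l}" for l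
    unfolding I I\<^sub>\<alpha> using nc.mon_gen_exp[symmetric] by (intro Collect_cong ex_cong1) auto
  show ?thesis
  proof (intro conjI allI impI)
    show "weight_filtration f \<alpha> (int (n + m)) = mero_module f"
      unfolding w f nc.weight_filtration_eq nc.weight_def m_def I\<^sub>\<alpha> using nc.Wt_card_critical by simp
  next
    fix l p assume "l \<le> m"
    then show "hodge_weight f \<alpha> 0 (int (n + l)) p =
           span_by (germ_eq f p) (O_ops p)
             {(\<lambda>x. (\<Prod>i\<in>I\<^sub>\<alpha> - J. (x $ i) ^ nat \<lceil>\<alpha> * of_nat (a i)\<rceil>) *
                   (\<Prod>i\<in>(I - I\<^sub>\<alpha>) \<union> J. (x $ i) ^ nat (\<lceil>\<alpha> * of_nat (a i)\<rceil> - 1)))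
              |J. J \<subseteq> I\<^sub>\<alpha> \<and> card J = l}"
      unfolding w gens unfolding f nc.hodge_weight_0 by (intro nc.Msp_top_exps) (simp add: m_def I\<^sub>\<alpha>)
  next
    fix l k
    show "hodge_weight f \<alpha> (int k) (int (n + l)) = order_act f \<alpha> k (hodge_weight f \<alpha> 0 (int (n + l)))"
      unfolding w f by (rule nc.hodge_weight_order_act)
  qed
qed

end
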